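(* Let $G=G_1\ast_A G_2$ be an amalgam of finite groups, let $g_1,\dots,g_n$ be words in the generators of $G$, let $H=\langle g_1,\dots,g_n\rangle$, and let $m$ be the sum of the lengths of the words $g_1,\dots,g_n$. Then the generalized Stallings' folding algorithm computes $(\Gamma(H),v_0)$ in time $O(m^2)$.
   Context: Amalgam. $G_1=gp\langle X_1|R_1\rangle$, $G_2=gp\langle X_2|R_2\rangle$ are finite groups given by fixed finite presentations with $X_1^{\pm}\cap X_2^{\pm}=\emptyset$; $A$ is a (finite) group with monomorphisms $\phi_i:A\to G_i$; $G=G_1\ast_A G_2=gp\langle X_1,X_2\mid R_1,R_2,\phi_1(A)=\phi_2(A)\rangle$, $X=X_1\cup X_2$. $A$ is identified with its images in $G_1,G_2,G$. These data, together with the Cayley graphs and all relative Cayley graphs of $G_1,G_2$, are given and are not part of the input, so they do not affect the complexity (constants may depend on them). Graphs. Graphs have directed edges $e$ with inverse edges $\overline e\ne e$, initial vertex $\iota(e)$, terminal vertex $\tau(e)=\iota(\overline e)$; labels satisfy $lab(\overline e)=lab(e)^{-1}\in X^{\pm}$. The label of a path is the word read along it. $Cayley(G_i,S)$, $S\le G_i$, has vertices the right cosets $Sg$ and an edge labelled $x$ from $Sg$ to $Sgx$ for each $x\in X_i^{\pm}$; $Cayley(G_i)$ is the Cayley graph of $G_i$. An $X_i$-monochromatic component is a maximal connected subgraph labelled with $X_i^{\pm}$ having at least one edge. $VB(\Gamma)$ is the set of bichromatic vertices (those at which both $X_1^{\pm}$-labelled and $X_2^{\pm}$-labelled edges start),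 $VM_i(\Gamma)$ the set of vertices at which only $X_i^{\pm}$-labelled edges start; $VB(C)$, $VM_i(C)$ are the vertices of $C$ in these sets. A folding identifies two distinct edges with the same initial vertex and the same label; cutting hairs removes edges whose terminal vertex has degree 1. Generalized Stallings' folding algorithm. Input: $\{g_1,\dots,g_n\}\subseteq G$ (words in $X^{\pm}$), $H=\langle g_1,\dots,g_n\rangle$. $\Gamma_k$ denotes the graph after step $k$. Step 1: construct $n$ loops around a common basepoint $v_0$, each labelled by one of the $g_k$. Step 2: iteratively fold edges and cut hairs. Step 3: for each $X_i$-monochromatic component $C$ of $\Gamma_2$ ($i=1,2$), pick $e\in E(C)$ and glue a copy of $Cayley(G_i)$ on $e$ by identifying $1_{G_i}$ with $\iota(e)$ and identifying the two copies of $e$ in $Cayley(G_i)$ and $\Gamma_2$; if necessary, iteratively fold edges. Step 4: for each $v\in VB(\Gamma_3)$, if there are paths $p_1,p_2$ with $\iota(p_1)=\iota(p_2)=v$, $\tau(p_1)\neq\tau(p_2)$, $lab(p_i)\in G_i\cap A$ ($i=1,2$) and $lab(p_1)=_Glab(p_2)$, then identify $\tau(p_1)$ with $\tau(p_2)$; if necessary, iteratively fold edges. Step 5: iteratively remove from $\Gamma_4$ all $X_i$-monochromatic components $C$ such that: $(C,\vartheta)\cong(Cayley(G_i,K),K\cdot1)$ with $K\le A$, $\vartheta\in VB(C)$; $|VB(C)|=[A:K]$; and either $K=\{1\}$ and $v_0\notin VM_i(C)$, or $K\ne\{1\}$ and $v_0\notin V(C)$. (Removing $C$ means deleting all edges and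 all monochromatic vertices of $C$, keeping its bichromatic vertices.) Let $\Gamma$ be the result. If $VB(\Gamma)=\emptyset$ and $(\Gamma,v_0)$ is isomorphic to $(Cayley(G_i),1_{G_i})$, set $V(\Gamma_5)=\{v_0\}$, $E(\Gamma_5)=\emptyset$; else $\Gamma_5=\Gamma$. Step 6: if $v_0\in VM_i(\Gamma_5)$ and $(C,v_0)\cong(Cayley(G_i,K),K\cdot1)$ with $L=K\cap A\ne\{1\}$, where $C$ is the $X_i$-monochromatic component of $\Gamma_5$ with $v_0\in V(C)$, then glue to $\Gamma_5$ a copy of $Cayley(G_j,L)$ ($1\le i\ne j\le2$) by identifying $L\cdot1$ with $v_0$ and identifying the vertices $L\cdot a$ with the vertices $v_0\cdot a$ of $C$ for all $a\in A\setminus L$ (where $v_0\cdot a$ is the endpoint of the path in $C$ from $v_0$ labelled by a word representing $a$). Output: $\Gamma(H)=\Gamma_6$ with basepoint $v_0$. *)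

theory Defs
  imports
    "HOL-Algebra.Coset"
    "HOL-Library.Landau_Symbols"
    "Graph_Theory.Graph_Theory"
begin

section \<open>Words and group presentations\<close>

text \<open>The letter \<open>(x, True)\<close> stands for the generator \<open>x\<close> and \<open>(x, False)\<close> for its formal inverse.\<close>

type_synonym 'x letter = "'x \<times> bool"
type_synonym 'x word = "'x letter list"

definition letters :: "'x set \<Rightarrow> 'x letter set" where
  "letters X = X \<times> UNIV"

abbreviation words :: "'x set \<Rightarrow> 'x word set" where
  "words X \<equiv> lists (letters X)"

fun inv_letter :: "'x letter \<Rightarrow> 'x letter" where
  "inv_letter (x, b) = (x, \<not> b)"

definition inv_word :: "'x word \<Rightarrow> 'x word" where
  "inv_word w = rev (map inv_letter w)"

inductive_set pres_rel :: "'x set \<Rightarrow> 'x word set \<Rightarrow> ('x word \<times> 'x word) set"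
  for X :: "'x set" and R :: "'x word set" where
  refl: "w \<in> words X \<Longrightarrow> (w, w) \<in> pres_rel X R"
| sym: "(u, w) \<in> pres_rel X R \<Longrightarrow> (w, u) \<in> pres_rel X R"
| trans: "(u, v) \<in> pres_rel X R \<Longrightarrow> (v, w) \<in> pres_rel X R \<Longrightarrow> (u, w) \<in> pres_rel X R"
| cancel: "u \<in> words X \<Longrightarrow> w \<in> words X \<Longrightarrow> a \<in> letters X
    \<Longrightarrow> (u @ [a, inv_letter a] @ w, u @ w) \<in> pres_rel X R"
| relator: "u \<in> words X \<Longrightarrow> w \<in> words X \<Longrightarrow> r \<in> R
    \<Longrightarrow> (u @ r @ w, u @ w) \<in> pres_rel X R"

definition word_class :: "'x set \<Rightarrow> 'x word set \<Rightarrow> 'x word \<Rightarrow> 'x word set" where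
  "word_class X R w = pres_rel X R `` {w}"

text \<open>The group \<open>gp\<langle>X | R\<rangle>\<close>; its elements are the classes of words that it identifies.\<close>

definition gp :: "'x set \<Rightarrow> 'x word set \<Rightarrow> 'x word set monoid" where
  "gp X R = \<lparr>carrier = words X // pres_rel X R,
             monoid.mult = (\<lambda>P Q. \<Union>p\<in>P. \<Union>q\<in>Q. word_class X R (p @ q)),
             one = word_class X R []\<rparr>"


section \<open>Labelled graphs with inverse edges\<close>

text \<open>\<open>tail\<close> and \<open>head\<close> are the maps \<open>\<iota>\<close> and \<open>\<tau>\<close>, and \<open>bar\<close> is the edge inversion. Parallel edges
  with equal labels are allowed.\<close>

record ('v, 'e, 'x) lgraph =
  dig :: "('v, 'e) pre_digraph"
  bar :: "'e \<Rightarrow> 'e"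
  lab :: "'e \<Rightarrow> 'x letter"

abbreviation "lverts \<Gamma> \<equiv> verts (dig \<Gamma>)"
abbreviation "larcs \<Gamma> \<equiv> arcs (dig \<Gamma>)"
abbreviation "ltail \<Gamma> \<equiv> tail (dig \<Gamma>)"
abbreviation "lhead \<Gamma> \<equiv> head (dig \<Gamma>)"

type_synonym ('v, 'e, 'x) pgraph = "('v, 'e, 'x) lgraph \<times> 'v"

definition lgraph_wf :: "('v, 'e, 'x) lgraph \<Rightarrow> bool" where
  "lgraph_wf \<Gamma> \<longleftrightarrow> bidirected_digraph (dig \<Gamma>) (bar \<Gamma>)
     \<and> (\<forall>e\<in>larcs \<Gamma>. lab \<Gamma> (bar \<Gamma> e) = inv_letter (lab \<Gamma> e))"

definition lgraph_hom ::
  "('v, 'e, 'x) lgraph \<Rightarrow> ('w, 'f, 'x) lgraph \<Rightarrow> ('v \<Rightarrow> 'w) \<Rightarrow> ('e \<Rightarrow> 'f) \<Rightarrow> bool" where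
  "lgraph_hom \<Gamma> \<Delta> f g \<longleftrightarrow> f ` lverts \<Gamma> \<subseteq> lverts \<Delta> \<and> g ` larcs \<Gamma> \<subseteq> larcs \<Delta>
     \<and> (\<forall>e\<in>larcs \<Gamma>. ltail \<Delta> (g e) = f (ltail \<Gamma> e) \<and> lhead \<Delta> (g e) = f (lhead \<Gamma> e)
            \<and> bar \<Delta> (g e) = g (bar \<Gamma> e) \<and> lab \<Delta> (g e) = lab \<Gamma> e)"

fun pgraph_iso :: "('v, 'e, 'x) pgraph \<Rightarrow> ('w, 'f, 'x) pgraph \<Rightarrow> bool" where
  "pgraph_iso (\<Gamma>, v) (\<Delta>, w) \<longleftrightarrow>
     (\<exists>f g. lgraph_hom \<Gamma> \<Delta> f g \<and> bij_betw f (lverts \<Gamma>) (lverts \<Delta>)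
          \<and> bij_betw g (larcs \<Gamma>) (larcs \<Delta>) \<and> v \<in> lverts \<Gamma> \<and> f v = w)"

definition subgr :: "('v, 'e, 'x) lgraph \<Rightarrow> 'v set \<Rightarrow> 'e set \<Rightarrow> ('v, 'e, 'x) lgraph" where
  "subgr \<Gamma> V E = \<lparr>dig = (dig \<Gamma>)\<lparr>verts := V, arcs := E\<rparr>,
                  bar = (\<lambda>e. if e \<in> E then bar \<Gamma> e else e), lab = lab \<Gamma>\<rparr>"

definition djunion ::
  "('v, 'e, 'x) lgraph \<Rightarrow> 'p set \<Rightarrow> ('p \<Rightarrow> ('w, 'f, 'x) lgraph) \<Rightarrow> ('v + 'p \<times> 'w, 'e + 'p \<times> 'f, 'x) lgraph"
where
  "djunion \<Gamma> P F =
     \<lparr>dig = \<lparr>verts = lverts \<Gamma> <+> (SIGMA p:P. lverts (F p)),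
             arcs = larcs \<Gamma> <+> (SIGMA p:P. larcs (F p)),
             tail = case_sum (\<lambda>e. Inl (ltail \<Gamma> e)) (\<lambda>(p, e). Inr (p, ltail (F p) e)),
             head = case_sum (\<lambda>e. Inl (lhead \<Gamma> e)) (\<lambda>(p, e). Inr (p, lhead (F p) e))\<rparr>,
      bar = case_sum (\<lambda>e. Inl (bar \<Gamma> e)) (\<lambda>(p, e). Inr (p, if p \<in> P then bar (F p) e else e)),
      lab = case_sum (lab \<Gamma>) (\<lambda>(p, e). lab (F p) e)\<rparr>"

text \<open>\<open>identify \<Gamma> RV RE \<Delta> f\<close>: identifying exactly the pairs of vertices in \<open>RV\<close> and the pairs of edges
  in \<open>RE\<close> (and what follows by equivalence) turns \<open>\<Gamma>\<close> into \<open>\<Delta>\<close>, with projection \<open>f\<close> on the vertices.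
  The vertices and edges of \<open>\<Delta>\<close> may be named arbitrarily, so \<open>\<Delta>\<close> is determined up to isomorphism.\<close>

definition identify ::
  "('v, 'e, 'x) lgraph \<Rightarrow> ('v \<times> 'v) set \<Rightarrow> ('e \<times> 'e) set \<Rightarrow> ('w, 'f, 'x) lgraph \<Rightarrow> ('v \<Rightarrow> 'w) \<Rightarrow> bool"
where
  "identify \<Gamma> RV RE \<Delta> f \<longleftrightarrow> lgraph_wf \<Delta> \<and>
     (\<exists>g. lgraph_hom \<Gamma> \<Delta> f g \<and> f ` lverts \<Gamma> = lverts \<Delta> \<and> g ` larcs \<Gamma> = larcs \<Delta>
        \<and> (\<forall>u\<in>lverts \<Gamma>. \<forall>v\<in>lverts \<Gamma>. f u = f v \<longleftrightarrow> (u, v) \<in> (RV \<union> RV\<inverse>)\<^sup>*)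
        \<and> (\<forall>d\<in>larcs \<Gamma>. \<forall>e\<in>larcs \<Gamma>. g d = g e \<longleftrightarrow> (d, e) \<in> (RE \<union> RE\<inverse>)\<^sup>*))"


section \<open>Foldings, hairs, and the first two steps\<close>

inductive fold_step :: "('v, 'e, 'x) pgraph \<Rightarrow> ('v, 'e, 'x) pgraph \<Rightarrow> bool" where
  "d \<in> larcs \<Gamma> \<Longrightarrow> e \<in> larcs \<Gamma> \<Longrightarrow> d \<noteq> e \<Longrightarrow> ltail \<Gamma> d = ltail \<Gamma> e \<Longrightarrow> lab \<Gamma> d = lab \<Gamma> e
   \<Longrightarrow> identify \<Gamma> {(lhead \<Gamma> d, lhead \<Gamma> e)} {(d, e), (bar \<Gamma> d, bar \<Gamma> e)} \<Delta> f
   \<Longrightarrow> fold_step (\<Gamma>, v) (\<Delta>, f v)"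

text \<open>A hair is removed together with its inverse edge and its end vertex of degree 1. The basepoint
  is never removed. Every edge has its inverse in the edge set, so the degree of a vertex is its
  out-degree.\<close>

inductive cut_hair :: "('v, 'e, 'x) pgraph \<Rightarrow> ('v, 'e, 'x) pgraph \<Rightarrow> bool" where
  "e \<in> larcs \<Gamma> \<Longrightarrow> lhead \<Gamma> e \<noteq> v \<Longrightarrow> out_degree (dig \<Gamma>) (lhead \<Gamma> e) = 1
   \<Longrightarrow> cut_hair (\<Gamma>, v) (subgr \<Gamma> (lverts \<Gamma> - {lhead \<Gamma> e}) (larcs \<Gamma> - {e, bar \<Gamma> e}), v)"

definition exhaust :: "('g \<Rightarrow> 'g \<Rightarrow> bool) \<Rightarrow> 'g \<Rightarrow> 'g \<Rightarrow> bool" where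
  "exhaust r \<Gamma> \<Delta> \<longleftrightarrow> r\<^sup>*\<^sup>* \<Gamma> \<Delta> \<and> \<not> (\<exists>\<Delta>'. r \<Delta> \<Delta>')"

text \<open>The vertices of loop number \<open>k\<close> are \<open>(k, j)\<close> with \<open>0 < j < length (gs ! k)\<close>, plus the basepoint
  \<open>(0, 0)\<close>. The edge \<open>(k, j, True)\<close> carries the \<open>j\<close>-th letter of \<open>gs ! k\<close>, and \<open>(k, j, False)\<close> is its
  inverse.\<close>

definition loop_vertex :: "'x word list \<Rightarrow> nat \<Rightarrow> nat \<Rightarrow> nat \<times> nat" where
  "loop_vertex gs k j = (if j = 0 \<or> j = length (gs ! k) then (0, 0) else (k, j))"

definition bouquet_arcs :: "'x word list \<Rightarrow> (nat \<times> nat \<times> bool) set" where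
  "bouquet_arcs gs = {(k, j, b). k < length gs \<and> j < length (gs ! k)}"

definition bouquet :: "'x word list \<Rightarrow> (nat \<times> nat, nat \<times> nat \<times> bool, 'x) pgraph" where
  "bouquet gs =
     (\<lparr>dig = \<lparr>verts = {(0, 0)} \<union> {loop_vertex gs k j | k j. k < length gs \<and> j < length (gs ! k)},
              arcs = bouquet_arcs gs,
              tail = (\<lambda>(k, j, b). loop_vertex gs k (if b then j else Suc j)),
              head = (\<lambda>(k, j, b). loop_vertex gs k (if b then Suc j else j))\<rparr>,
       bar = (\<lambda>(k, j, b). if (k, j, b) \<in> bouquet_arcs gs then (k, j, \<not> b) else (k, j, b)),
       lab = (\<lambda>(k, j, b). if b then gs ! k ! j else inv_letter (gs ! k ! j))\<rparr>,
      (0, 0))"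

definition step1 :: "'x word list \<Rightarrow> (nat, nat, 'x) pgraph \<Rightarrow> bool" where
  "step1 gs \<Gamma>\<^sub>1 \<longleftrightarrow> pgraph_iso (bouquet gs) \<Gamma>\<^sub>1"

definition step2 :: "(nat, nat, 'x) pgraph \<Rightarrow> (nat, nat, 'x) pgraph \<Rightarrow> bool" where
  "step2 \<Gamma>\<^sub>1 \<Gamma>\<^sub>2 \<longleftrightarrow> (\<exists>\<Delta>. exhaust (sup fold_step cut_hair) \<Gamma>\<^sub>1 \<Delta> \<and> pgraph_iso \<Delta> \<Gamma>\<^sub>2)"

definition fold_to :: "(nat, nat, 'x) pgraph \<Rightarrow> (nat, nat, 'x) pgraph \<Rightarrow> bool" where
  "fold_to \<Gamma> \<Gamma>' \<longleftrightarrow> (\<exists>\<Delta>. exhaust fold_step \<Gamma> \<Delta> \<and> pgraph_iso \<Delta> \<Gamma>')"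


section \<open>Amalgams of finite groups and the remaining steps\<close>

datatype index = One | Two

locale amalgam =
  fixes X :: "index \<Rightarrow> 'x set" and R :: "index \<Rightarrow> 'x word set"
    and A :: "'a monoid" and \<phi> :: "index \<Rightarrow> 'a \<Rightarrow> 'x word set"
  assumes finite_X: "finite (X i)"
    and finite_R: "finite (R i)"
    and relators: "R i \<subseteq> words (X i)"
    and disjoint_X: "X One \<inter> X Two = {}"
    and finite_factor: "finite (carrier (gp (X i) (R i)))"
    and group_A: "group A"
    and mono_\<phi>: "\<phi> i \<in> mon A (gp (X i) (R i))"
begin

definition factor :: "index \<Rightarrow> 'x word set monoid" where
  "factor i = gp (X i) (R i)"

definition elt :: "index \<Rightarrow> 'x word \<Rightarrow> 'x word set" where
  "elt i w = word_class (X i) (R i) w"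

abbreviation XX :: "'x set" where
  "XX \<equiv> X One \<union> X Two"

text \<open>The elements of the factors are classes of words, so \<open>u \<in> \<phi> i a\<close> means that the word \<open>u\<close> over
  the \<open>i\<close>-th alphabet represents \<open>\<phi> i a\<close>.\<close>

definition amalgam_relators :: "'x word set" where
  "amalgam_relators = R One \<union> R Two
     \<union> {u @ inv_word w | u w a. a \<in> carrier A \<and> u \<in> \<phi> One a \<and> w \<in> \<phi> Two a}"

definition G :: "'x word set monoid" where
  "G = gp XX amalgam_relators"

definition eltG :: "'x word \<Rightarrow> 'x word set" where
  "eltG w = word_class XX amalgam_relators w"

text \<open>The relative Cayley graph of the \<open>i\<close>-th factor with respect to \<open>S\<close>. Its distinguished vertex
  \<open>S \<cdot> 1\<close> is \<open>S\<close> itself.\<close>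

definition cayley :: "index \<Rightarrow> 'x word set set \<Rightarrow> ('x word set set, 'x word set set \<times> 'x letter, 'x) lgraph"
where
  "cayley i S =
     \<lparr>dig = \<lparr>verts = rcosets\<^bsub>factor i\<^esub> S,
             arcs = (rcosets\<^bsub>factor i\<^esub> S) \<times> letters (X i),
             tail = fst,
             head = (\<lambda>(c, x). c #>\<^bsub>factor i\<^esub> elt i [x])\<rparr>,
      bar = (\<lambda>(c, x). if c \<in> rcosets\<^bsub>factor i\<^esub> S \<and> x \<in> letters (X i)
                      then (c #>\<^bsub>factor i\<^esub> elt i [x], inv_letter x) else (c, x)),
      lab = snd\<rparr>"

text \<open>The vertex \<open>g\<close> of the Cayley graph of a factor is rendered as the coset \<open>{g}\<close> of the trivial
  subgroup.\<close>

abbreviation cayley1 :: "index \<Rightarrow> ('x word set set, 'x word set set \<times> 'x letter, 'x) lgraph" where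
  "cayley1 i \<equiv> cayley i {\<one>\<^bsub>factor i\<^esub>}"

text \<open>Edges come in inverse pairs, so strong connectivity is connectivity.\<close>

definition mono_subgraph :: "index \<Rightarrow> ('v, 'e, 'x) lgraph \<Rightarrow> 'v set \<Rightarrow> 'e set \<Rightarrow> bool" where
  "mono_subgraph i \<Gamma> V E \<longleftrightarrow> V \<subseteq> lverts \<Gamma> \<and> E \<subseteq> larcs \<Gamma> \<and> E \<noteq> {} \<and> lgraph_wf (subgr \<Gamma> V E)
     \<and> strongly_connected (dig (subgr \<Gamma> V E)) \<and> lab \<Gamma> ` E \<subseteq> letters (X i)"

definition mono_component :: "index \<Rightarrow> ('v, 'e, 'x) lgraph \<Rightarrow> 'v set \<Rightarrow> 'e set \<Rightarrow> bool" where
  "mono_component i \<Gamma> V E \<longleftrightarrow> mono_subgraph i \<Gamma> V E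
     \<and> (\<forall>V' E'. mono_subgraph i \<Gamma> V' E' \<and> V \<subseteq> V' \<and> E \<subseteq> E' \<longrightarrow> V' = V \<and> E' = E)"

definition VB :: "('v, 'e, 'x) lgraph \<Rightarrow> 'v set" where
  "VB \<Gamma> = {v \<in> lverts \<Gamma>. \<forall>i. \<exists>e\<in>out_arcs (dig \<Gamma>) v. lab \<Gamma> e \<in> letters (X i)}"

definition VM :: "index \<Rightarrow> ('v, 'e, 'x) lgraph \<Rightarrow> 'v set" where
  "VM i \<Gamma> = {v \<in> lverts \<Gamma>. out_arcs (dig \<Gamma>) v \<noteq> {}
                \<and> (\<forall>e\<in>out_arcs (dig \<Gamma>) v. lab \<Gamma> e \<in> letters (X i))}"

definition colour :: "'x letter \<Rightarrow> index" where
  "colour x = (if x \<in> letters (X One) then One else Two)"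

text \<open>\<open>P\<close> is the set of chosen edges, one from each monochromatic component. All gluings are made in
  the graph after the second step, before any folding.\<close>

fun step3 :: "(nat, nat, 'x) pgraph \<Rightarrow> (nat, nat, 'x) pgraph \<Rightarrow> bool" where
  "step3 (\<Gamma>, v) \<Gamma>\<^sub>3 \<longleftrightarrow>
     (\<exists>P \<Delta> f. P \<subseteq> larcs \<Gamma>
        \<and> (\<forall>i V E. mono_component i \<Gamma> V E \<longrightarrow> (\<exists>!e. e \<in> P \<inter> E))
        \<and> (let col = (\<lambda>e. colour (lab \<Gamma> e));
               F = (\<lambda>e. cayley1 (col e));
               c = (\<lambda>e. ({\<one>\<^bsub>factor (col e)\<^esub>}, lab \<Gamma> e))
           in identify (djunion \<Gamma> P F)
                (\<Union>e\<in>P. {(Inl (ltail \<Gamma> e), Inr (e, ltail (F e) (c e))),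
                        (Inl (lhead \<Gamma> e), Inr (e, lhead (F e) (c e)))})
                (\<Union>e\<in>P. {(Inl e, Inr (e, c e)), (Inl (bar \<Gamma> e), Inr (e, bar (F e) (c e)))})
                \<Delta> f)
        \<and> fold_to (\<Delta>, f (Inl v)) \<Gamma>\<^sub>3)"

definition A_words :: "index \<Rightarrow> 'x word set" where
  "A_words i = (\<Union>a\<in>carrier A. \<phi> i a)"

definition step4_pairs :: "('v, 'e, 'x) lgraph \<Rightarrow> ('v \<times> 'v) set" where
  "step4_pairs \<Gamma> = {(w\<^sub>1, w\<^sub>2). w\<^sub>1 \<noteq> w\<^sub>2 \<and>
     (\<exists>v\<in>VB \<Gamma>. \<exists>p\<^sub>1 p\<^sub>2. pre_digraph.awalk (dig \<Gamma>) v p\<^sub>1 w\<^sub>1 \<and> pre_digraph.awalk (dig \<Gamma>) v p\<^sub>2 w\<^sub>2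
        \<and> map (lab \<Gamma>) p\<^sub>1 \<in> A_words One \<and> map (lab \<Gamma>) p\<^sub>2 \<in> A_words Two
        \<and> eltG (map (lab \<Gamma>) p\<^sub>1) = eltG (map (lab \<Gamma>) p\<^sub>2))}"

fun step4 :: "(nat, nat, 'x) pgraph \<Rightarrow> (nat, nat, 'x) pgraph \<Rightarrow> bool" where
  "step4 (\<Gamma>, v) \<Gamma>\<^sub>4 \<longleftrightarrow> (\<exists>\<Delta> f. identify \<Gamma> (step4_pairs \<Gamma>) {} \<Delta> f \<and> fold_to (\<Delta>, f v) \<Gamma>\<^sub>4)"

definition removable :: "('v, 'e, 'x) lgraph \<Rightarrow> 'v \<Rightarrow> 'v set \<Rightarrow> 'e set \<Rightarrow> bool" where
  "removable \<Gamma> v V E \<longleftrightarrow>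
     (\<exists>i K \<theta>. mono_component i \<Gamma> V E \<and> subgroup K A \<and> \<theta> \<in> V \<inter> VB \<Gamma>
        \<and> pgraph_iso (subgr \<Gamma> V E, \<theta>) (cayley i (\<phi> i ` K), \<phi> i ` K)
        \<and> card (V \<inter> VB \<Gamma>) = card (rcosets\<^bsub>A\<^esub> K)
        \<and> (K = {\<one>\<^bsub>A\<^esub>} \<and> v \<notin> V \<inter> VM i \<Gamma> \<or> K \<noteq> {\<one>\<^bsub>A\<^esub>} \<and> v \<notin> V))"

inductive remove_component :: "('v, 'e, 'x) pgraph \<Rightarrow> ('v, 'e, 'x) pgraph \<Rightarrow> bool" where
  "removable \<Gamma> v V E
   \<Longrightarrow> remove_component (\<Gamma>, v) (subgr \<Gamma> (lverts \<Gamma> - (V - VB \<Gamma>)) (larcs \<Gamma> - E), v)"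

fun is_cayley :: "('v, 'e, 'x) pgraph \<Rightarrow> bool" where
  "is_cayley (\<Gamma>, v) \<longleftrightarrow> VB \<Gamma> = {} \<and> (\<exists>i. pgraph_iso (\<Gamma>, v) (cayley1 i, {\<one>\<^bsub>factor i\<^esub>}))"

definition step5 :: "(nat, nat, 'x) pgraph \<Rightarrow> (nat, nat, 'x) pgraph \<Rightarrow> bool" where
  "step5 \<Gamma>\<^sub>4 \<Gamma>\<^sub>5 \<longleftrightarrow>
     (\<exists>\<Gamma> v. exhaust remove_component \<Gamma>\<^sub>4 (\<Gamma>, v)
        \<and> pgraph_iso (if is_cayley (\<Gamma>, v) then subgr \<Gamma> {v} {} else \<Gamma>, v) \<Gamma>\<^sub>5)"

definition step6_case :: "('v, 'e, 'x) pgraph \<Rightarrow> index \<Rightarrow> 'v set \<Rightarrow> 'e set \<Rightarrow> 'a set \<Rightarrow> bool" where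
  "step6_case = (\<lambda>(\<Gamma>, v) i V E L.
     v \<in> VM i \<Gamma> \<and> mono_component i \<Gamma> V E \<and> v \<in> V
     \<and> (\<exists>K. subgroup K (factor i) \<and> pgraph_iso (subgr \<Gamma> V E, v) (cayley i K, K)
          \<and> L = {a \<in> carrier A. \<phi> i a \<in> K})
     \<and> L \<noteq> {\<one>\<^bsub>A\<^esub>})"

fun step6 :: "(nat, nat, 'x) pgraph \<Rightarrow> (nat, nat, 'x) pgraph \<Rightarrow> bool" where
  "step6 (\<Gamma>, v) (\<Gamma>\<^sub>6, v\<^sub>6) \<longleftrightarrow>
     (if \<exists>i V E L. step6_case (\<Gamma>, v) i V E L
      then \<exists>i j V E L f. step6_case (\<Gamma>, v) i V E L \<and> i \<noteq> j
        \<and> identify (djunion \<Gamma> {()} (\<lambda>_. cayley j (\<phi> j ` L)))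
            ({(Inl v, Inr ((), \<phi> j ` L))}
              \<union> {(Inl w, Inr ((), (\<phi> j ` L) #>\<^bsub>factor j\<^esub> \<phi> j a)) | w a p. a \<in> carrier A - L
                   \<and> pre_digraph.awalk (dig (subgr \<Gamma> V E)) v p w \<and> map (lab \<Gamma>) p \<in> \<phi> i a})
            {} \<Gamma>\<^sub>6 f
        \<and> v\<^sub>6 = f (Inl v)
      else pgraph_iso (\<Gamma>, v) (\<Gamma>\<^sub>6, v\<^sub>6))"

text \<open>A run of the generalized Stallings' folding algorithm on the words \<open>gs\<close>: \<open>\<Gamma> k\<close> is the pointed
  graph after step \<open>k\<close>, and \<open>\<Gamma> 6\<close> is the output \<open>(\<Gamma>(H), v\<^sub>0)\<close> for the subgroup \<open>H\<close> generated by
  \<open>gs\<close>. The algorithm leaves some choices open, so this is a relation.\<close>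

definition stallings_run :: "'x word list \<Rightarrow> (nat \<Rightarrow> (nat, nat, 'x) pgraph) \<Rightarrow> bool" where
  "stallings_run gs \<Gamma> \<longleftrightarrow> step1 gs (\<Gamma> 1) \<and> step2 (\<Gamma> 1) (\<Gamma> 2) \<and> step3 (\<Gamma> 2) (\<Gamma> 3)
     \<and> step4 (\<Gamma> 3) (\<Gamma> 4) \<and> step5 (\<Gamma> 4) (\<Gamma> 5) \<and> step6 (\<Gamma> 5) (\<Gamma> 6)"

end


section \<open>Random access machines\<close>

text \<open>Structured programs for a random access machine with uniform cost. The machine has registers and
  arrays of natural numbers (a given program uses only finitely many of them). It can add, subtract
  (truncated at 0), and address arrays indirectly. Each instruction and each test takes one time
  unit.\<close>

record state =
  reg :: "nat \<Rightarrow> nat"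
  arr :: "nat \<Rightarrow> nat \<Rightarrow> nat"

datatype com =
    Skip
  | Const nat nat
  | Add nat nat nat
  | Sub nat nat nat
  | Load nat nat nat
  | Store nat nat nat
  | Seq com com
  | If nat com com
  | While nat com

definition set_reg :: "nat \<Rightarrow> nat \<Rightarrow> state \<Rightarrow> state" where
  "set_reg r n s = s\<lparr>reg := (reg s)(r := n)\<rparr>"

definition set_arr :: "nat \<Rightarrow> nat \<Rightarrow> nat \<Rightarrow> state \<Rightarrow> state" where
  "set_arr b p n s = s\<lparr>arr := (arr s)(b := (arr s b)(p := n))\<rparr>"

text \<open>\<open>exec c s t s'\<close>: started in state \<open>s\<close>, the program \<open>c\<close> halts after \<open>t\<close> time units in state \<open>s'\<close>.\<close>

inductive exec :: "com \<Rightarrow> state \<Rightarrow> nat \<Rightarrow> state \<Rightarrow> bool" where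
  Skip: "exec Skip s 1 s"
| Const: "exec (Const r n) s 1 (set_reg r n s)"
| Add: "exec (Add r p q) s 1 (set_reg r (reg s p + reg s q) s)"
| Sub: "exec (Sub r p q) s 1 (set_reg r (reg s p - reg s q) s)"
| Load: "exec (Load r b p) s 1 (set_reg r (arr s b (reg s p)) s)"
| Store: "exec (Store b p r) s 1 (set_arr b (reg s p) (reg s r) s)"
| Seq: "exec c\<^sub>1 s t\<^sub>1 s' \<Longrightarrow> exec c\<^sub>2 s' t\<^sub>2 s'' \<Longrightarrow> exec (Seq c\<^sub>1 c\<^sub>2) s (t\<^sub>1 + t\<^sub>2) s''"
| IfTrue: "reg s r \<noteq> 0 \<Longrightarrow> exec c\<^sub>1 s t s' \<Longrightarrow> exec (If r c\<^sub>1 c\<^sub>2) s (Suc t) s'"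
| IfFalse: "reg s r = 0 \<Longrightarrow> exec c\<^sub>2 s t s' \<Longrightarrow> exec (If r c\<^sub>1 c\<^sub>2) s (Suc t) s'"
| WhileFalse: "reg s r = 0 \<Longrightarrow> exec (While r c) s 1 s"
| WhileTrue: "reg s r \<noteq> 0 \<Longrightarrow> exec c s t\<^sub>1 s' \<Longrightarrow> exec (While r c) s' t\<^sub>2 s''
    \<Longrightarrow> exec (While r c) s (Suc (t\<^sub>1 + t\<^sub>2)) s''"

text \<open>The input occupies exactly \<open>m\<close> cells of two arrays, \<open>m\<close> being the sum of the lengths of the words:
  array 0 holds the codes of the letters of the concatenated words, array 1 marks the last letter of
  each word by 1, and register 0 holds \<open>m\<close>. Everything else is 0. Empty words, whose loops are trivial,
  leave no trace in the input; otherwise its size would not be bounded by any function of \<open>m\<close>.\<close>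

definition input_state :: "('x letter \<Rightarrow> nat) \<Rightarrow> 'x word list \<Rightarrow> state" where
  "input_state code gs =
     (let cs = map code (concat gs);
          fs = concat (map (\<lambda>g. map (\<lambda>j. if Suc j = length g then 1 else 0) [0..<length g]) gs);
          cell = (\<lambda>xs p. if p < length xs then xs ! p else 0)
      in \<lparr>reg = (\<lambda>_. 0)(0 := length cs), arr = (\<lambda>_ _. 0)(0 := cell cs, 1 := cell fs)\<rparr>)"

text \<open>Registers 0, 1, 2 hold the basepoint, the number of vertices and the number of edges. Array 0
  lists the vertices. The edges are numbered from 0, and arrays 1 to 4 give the tail, the head, the
  inverse and the label of each edge. The other registers and cells are arbitrary.\<close>

fun represents :: "('x letter \<Rightarrow> nat) \<Rightarrow> state \<Rightarrow> (nat, nat, 'x) pgraph \<Rightarrow> bool" where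
  "represents code s (\<Gamma>, v) \<longleftrightarrow> lgraph_wf \<Gamma> \<and> v \<in> lverts \<Gamma> \<and> reg s 0 = v
     \<and> bij_betw (arr s 0) {..<reg s 1} (lverts \<Gamma>)
     \<and> larcs \<Gamma> = {..<reg s 2}
     \<and> (\<forall>e\<in>larcs \<Gamma>. arr s 1 e = ltail \<Gamma> e \<and> arr s 2 e = lhead \<Gamma> e
            \<and> arr s 3 e = bar \<Gamma> e \<and> arr s 4 e = code (lab \<Gamma> e))"

end

theory Submission
  imports Defs
begin

text \<open>
  The theorem asserts that programs exist, so they have to be written; the point is that two nested loops
  of \<open>O(m)\<close> rounds suffice for each step.

  \<^item> After foldings a graph is determined, up to isomorphism, by its vertices and its set \<open>tri\<close> of labelled
    adjacencies (\<open>iso_folded\<close>). All maximal sequences of foldings end in the quotient by the least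
    equivalence relation \<open>lfc\<close> that is closed under folding (\<open>fold_exhaust\<close>, \<open>fold_to_quotient\<close>). A program
    therefore only has to find the classes of \<open>lfc\<close>. It merges two classes after a search for a conflict in
    a table indexed by class and label; one search takes time \<open>O(m)\<close>, and there are \<open>O(m)\<close> mergings
    (\<open>run_fold_prog\<close>). Hairs are cut in the same way, by \<open>O(m)\<close> scans (\<open>run_hair_prog\<close>).

  \<^item> In the third step a Cayley graph may be glued to every vertex rather than to one edge of each component:
    after folding, the copies are translates of each other (\<open>step3_glue\<close>). In the result each factor acts on
    the vertices of its colour, and components are orbits (\<open>based\<close>, \<open>component_cayley\<close>).

  \<^item> Because of the action, the walks of the fourth step matter only through their values, of which there are
    finitely many pairs. Each pair becomes a new letter, which turns the identifications into foldings
    (\<open>step4_amalgam\<close>).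

  \<^item> The condition on the components in the fifth step becomes a condition on the action at a single vertex,
    which is tested in constant time (\<open>removable_iff\<close>). Each removal deletes edges, so \<open>O(m)\<close> scans of the
    vertices exhaust the removals (\<open>run_remove_prog\<close>). The sixth step attaches one of finitely many graphs.

  The vertices are named by numbers below a constant multiple of \<open>m + 1\<close>. The programs are written in a
  language all of whose loops have the same number of rounds, so that the time can be read off the text
  (\<open>exec_comp\<close>).\<close>


abbreviation (input) equivalent (infixr "<->" 25) where "P <-> Q \<equiv> P = Q"
abbreviation lV where "lV \<equiv> lverts"
abbreviation lE where "lE \<equiv> larcs"

context amalgam
begin

text \<open>Brackets with an index denote the operations of the factor, and \<open>FC i\<close> is the set of its elements.\<close>

abbreviation FC where "FC i \<equiv> carrier (factor i)"
abbreviation LX where "LX i \<equiv> letters (X i)"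
abbreviation WX where "WX i \<equiv> words (X i)"
abbreviation oneA where "oneA \<equiv> \<one>\<^bsub>A\<^esub>"
abbreviation fmult ("(_ \<odot>[_]/ _)" [70, 0, 71] 70) where "g \<odot>[i] h \<equiv> g \<otimes>\<^bsub>factor i\<^esub> h"
abbreviation fcoset ("(_ #>[_]/ _)" [60, 0, 61] 60) where "S #>[i] g \<equiv> S #>\<^bsub>factor i\<^esub> g"
abbreviation fone ("\<one>[_]") where "\<one>[i] \<equiv> \<one>\<^bsub>factor i\<^esub>"
abbreviation finv ("inv[_] _" [0, 81] 80) where "inv[i] g \<equiv> inv\<^bsub>factor i\<^esub> g"
abbreviation frcosets ("rcosets[_] _" [0, 81] 80) where "rcosets[i] S \<equiv> rcosets\<^bsub>factor i\<^esub> S"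

end


section \<open>A loop language compiled to the machine\<close>

datatype expr =
 Num nat
|Var nat
|Cell nat expr
|Plus expr expr
|Minus expr expr

datatype stmt =
 Assign nat expr
|Write nat expr expr
|Then stmt stmt  (infixr ";;" 60)
|Cond expr stmt stmt
|For nat stmt

text \<open>All loops have the same number of rounds, the content of register 3, which a program sets once
 and for all. This makes the semantics total, and the running time can be read off the text.\<close>

primrec ev :: "expr => state => nat" where
 "ev (Num n) s = n"
| "ev (Var r) s = reg s r"
| "ev (Cell b e) s = arr s b (ev e s)"
| "ev (Plus e f) s = ev e s+ev f s"
| "ev (Minus e f) s = ev e s - ev f s"

primrec run :: "stmt => state => state" where
 "run (Assign r e) s = set_reg r (ev e s) s"
| "run (Write b e f) s = set_arr b (ev e s) (ev f s) s"
| "run (c ;; d) s = run d (run c s)"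
| "run (Cond e c d) s = (if ev e s~=0 then run c s else run d s)"
| "run (For i c) s = fold (%k s. run c (set_reg i k s)) [0..<reg s 3] s"

primrec eregs :: "expr => nat set" where
 "eregs (Num n) = {}"
| "eregs (Var r) = {r}"
| "eregs (Cell b e) = eregs e"
| "eregs (Plus e f) = eregs e Un eregs f"
| "eregs (Minus e f) = eregs e Un eregs f"

primrec earrs :: "expr => nat set" where
 "earrs (Num n) = {}"
| "earrs (Var r) = {}"
| "earrs (Cell b e) = insert b (earrs e)"
| "earrs (Plus e f) = earrs e Un earrs f"
| "earrs (Minus e f) = earrs e Un earrs f"

primrec wregs :: "stmt => nat set" where
 "wregs (Assign r e) = {r}"
| "wregs (Write b e f) = {}"
| "wregs (c ;; d) = wregs c Un wregs d"
| "wregs (Cond e c d) = wregs c Un wregs d"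
| "wregs (For i c) = insert i (wregs c)"

primrec warrs :: "stmt => nat set" where
 "warrs (Assign r e) = {}"
| "warrs (Write b e f) = {b}"
| "warrs (c ;; d) = warrs c Un warrs d"
| "warrs (Cond e c d) = warrs c Un warrs d"
| "warrs (For i c) = warrs c"

primrec uregs :: "stmt => nat set" where
 "uregs (Assign r e) = insert r (eregs e)"
| "uregs (Write b e f) = eregs e Un eregs f"
| "uregs (c ;; d) = uregs c Un uregs d"
| "uregs (Cond e c d) = eregs e Un uregs c Un uregs d"
| "uregs (For i c) = insert i (uregs c)"

primrec depth :: "stmt => nat" where
 "depth (Assign r e) = 0"
| "depth (Write b e f) = 0"
| "depth (c ;; d) = max (depth c) (depth d)"
| "depth (Cond e c d) = max (depth c) (depth d)"
| "depth (For i c) = Suc (depth c)"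

lemma set_reg_sel [simp]:
 "reg (set_reg r n s) = (reg s)(r := n)" "arr (set_reg r n s) = arr s" by(simp_all add:set_reg_def)

lemma set_arr_sel [simp]:
 "arr (set_arr b p n s) = (arr s)(b := (arr s b)(p := n))" "reg (set_arr b p n s) = reg s"
 by(simp_all add:set_arr_def)

lemma ev_cong:
 "(!!r. r:eregs e==>reg s r = reg t r)==>(!!b. b:earrs e==>arr s b = arr t b)
 ==>ev e s = ev e t" by(induction e) auto

lemma frame_reg:"r ~: wregs c==>reg (run c s) r = reg s r"
proof (induction c arbitrary: s)
 case (For i c)
 have "reg (fold (%k s. run c (set_reg i k s)) ks s) r = reg s r" for ks s
 using For by(induction ks arbitrary: s) auto
 thus ?case by simp qed auto

lemma frame_arr:"b ~: warrs c==>arr (run c s) b = arr s b"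
proof (induction c arbitrary: s)
 case (For i c)
 have "arr (fold (%k s. run c (set_reg i k s)) ks s) b = arr s b" for ks s
 using For by(induction ks arbitrary: s) auto
 thus ?case by simp qed auto

lemma run_For_rule:
 fixes I :: "nat => state => bool"
 assumes "I 0 s" and "!!k t. k < reg s 3==>I k t==>I (Suc k) (run c (set_reg i k t))"
 shows "I (reg s 3) (run (For i c) s)"
proof -
 have "n<=reg s 3==>I n (fold (%k s. run c (set_reg i k s)) [0..<n] s)" for n using assms by(induction n) auto
 thus ?thesis by simp qed

text \<open>In a round of a loop everything that the loop does not write may be taken from the initial
 state.\<close>

lemma For_rule:
 fixes I :: "nat => state => bool"
 assumes "I 0 s" and "!!k t. k < reg s 3==>I k t==>(!!r. r ~: wregs (For i c)==>reg t r = reg s r)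
 ==>(!!b. b ~: warrs c==>arr t b = arr s b)==>I (Suc k) (run c (set_reg i k t))" shows "I (reg s 3) (run (For i c) s)"
proof -
 define J where "J k t<->I k t&(ALL r. r ~: wregs (For i c)-->reg t r = reg s r)
 &(ALL b. b ~: warrs c-->arr t b = arr s b)" for k t
 have "J (reg s 3) (run (For i c) s)" unfolding J_def
 by(rule run_For_rule) (use assms in "auto simp:frame_reg frame_arr")
 thus ?thesis by(simp add:J_def) qed

lemma For_array_rule:
 fixes s :: state
 assumes "i ~: {3}" and "!!k (t :: state). k < reg s 3==>reg t i = k==>(!!r. r~=i==>reg t r = reg s r)
 ==>(!!c. c~=b==>arr t c = arr s c)==>(!!j. j >= k==>arr t b j = arr s b j)==>ev e t = F k"
 shows "arr (run (For i (Write b (Var i) e)) s) b = (%j. if j < reg s 3 then F j else arr s b j)"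
proof -
 have "(%n (t :: state). arr t b = (%j. if j < n then F j else arr s b j)) (reg s 3) (run (For i (Write b (Var i) e)) s)"
 proof (rule For_rule)
 fix k and t :: state assume *: "k < reg s 3" "arr t b = (%j. if j < k then F j else arr s b j)"
 "!!r. r ~: wregs (For i (Write b (Var i) e))==>reg t r = reg s r"
 "!!c. c ~: warrs (Write b (Var i) e)==>arr t c = arr s c"
 have "ev e (set_reg i k t) = F k" by(rule assms(2)) (use * in auto)
 thus "arr (run (Write b (Var i) e) (set_reg i k t)) b = (%j. if j < Suc k then F j else arr s b j)"
 using * by(auto simp:fun_eq_iff) qed auto
 thus ?thesis by simp qed

definition seqs :: "stmt list => stmt" where
 "seqs cs = foldr Then cs (Assign 20 (Num 0))"

lemma seqs_simps [simp]:
 "run (seqs []) s = set_reg 20 0 s" "run (seqs (c # cs)) s = run (seqs cs) (run c s)"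
 "wregs (seqs cs) = insert 20 (\<Union>c\<in>set cs. wregs c)" "warrs (seqs cs) = (\<Union>c\<in>set cs. warrs c)"
 "uregs (seqs cs) = insert 20 (\<Union>c\<in>set cs. uregs c)" by(induction cs) (auto simp:seqs_def)

lemma seqs_depth:"(!!c. c:set cs==>depth c<=d)==>depth (seqs cs)<=d" by(induction cs) (auto simp:seqs_def)

subsection \<open>Expressions used as tests\<close>

definition eSum :: "expr list => expr" where
 "eSum es = foldr Plus es (Num 0)"

lemma eSum_simps [simp]:
 "ev (eSum es) s = (\<Sum>e\<leftarrow>es. ev e s)" "eregs (eSum es) = (\<Union>e\<in>set es. eregs e)"
 "earrs (eSum es) = (\<Union>e\<in>set es. earrs e)" by(induction es) (auto simp:eSum_def)

definition eMul :: "nat => expr => expr" where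
 "eMul n e = eSum (replicate n e)"

lemma eMul_simps [simp]:
 "ev (eMul n e) s = n * ev e s" "eregs (eMul n e)<=eregs e" "earrs (eMul n e)<=earrs e"
 "n > 0==>eregs (eMul n e) = eregs e" "n > 0==>earrs (eMul n e) = earrs e" by(auto simp:eMul_def sum_list_replicate)

definition tNot :: "expr => expr" where
 "tNot e = Minus (Num 1) e"

definition tEq :: "expr => expr => expr" where
 "tEq e f = tNot (Plus (Minus e f) (Minus f e))"

definition tLess :: "expr => expr => expr" where
 "tLess e f = Minus f e"

text \<open>\<open>tPos e\<close> is 1 if \<open>e\<close> is nonzero, and 0 otherwise; the product of such values is 1 exactly if
 the sum of their complements vanishes.\<close>

definition tPos :: "expr => expr" where
 "tPos e = tNot (tNot e)"

definition tAll :: "expr list => expr" where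
 "tAll es = tNot (eSum (map tNot es))"

lemma tests [simp]:
 "ev (tNot e) s = (if ev e s = 0 then 1 else 0)" "eregs (tNot e) = eregs e" "earrs (tNot e) = earrs e"
 "ev (tEq e f) s = (if ev e s = ev f s then 1 else 0)" "eregs (tEq e f) = eregs e Un eregs f"
 "earrs (tEq e f) = earrs e Un earrs f"
 "ev (tPos e) s = (if ev e s = 0 then 0 else 1)" "eregs (tPos e) = eregs e" "earrs (tPos e) = earrs e"
 "ev (tLess e f) s = ev f s - ev e s" "eregs (tLess e f) = eregs e Un eregs f"
 "earrs (tLess e f) = earrs e Un earrs f" by(auto simp:tNot_def tEq_def tPos_def tLess_def)

lemma tAll_simps [simp]:
 "ev (tAll es) s = (if ALL e:set es. ev e s~=0 then 1 else 0)"
 "eregs (tAll es) = (\<Union>e\<in>set es. eregs e)" "earrs (tAll es) = (\<Union>e\<in>set es. earrs e)"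
proof -
 have "(\<Sum>e\<leftarrow>es. if ev e s = 0 then 1 else 0) = (0 :: nat)<->(ALL e:set es. ev e s~=0)"
 by(induction es) auto
 thus "ev (tAll es) s = (if ALL e:set es. ev e s~=0 then 1 else 0)" by(simp add:tAll_def comp_def)
qed (simp_all add:tAll_def)

subsection \<open>Compilation\<close>

text \<open>Registers from \<open>p\<close> on serve as a stack of intermediate results.\<close>

primrec comp_expr :: "nat => expr => com" where
 "comp_expr p (Num n) = Const p n"
| "comp_expr p (Var r) = Seq (Const p 0) (Add p p r)"
| "comp_expr p (Cell b e) = Seq (comp_expr p e) (Load p b p)"
| "comp_expr p (Plus e f) = Seq (comp_expr p e) (Seq (comp_expr (Suc p) f) (Add p p (Suc p)))"
| "comp_expr p (Minus e f) = Seq (comp_expr p e) (Seq (comp_expr (Suc p) f) (Sub p p (Suc p)))"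

text \<open>A loop keeps its round number in register \<open>p\<close> and the number of remaining rounds in the next
 one.\<close>

primrec comp :: "nat => stmt => com" where
 "comp p (Assign r e) = Seq (comp_expr p e) (Seq (Const (Suc p) 0) (Add r p (Suc p)))"
| "comp p (Write b e f) = Seq (comp_expr p e) (Seq (comp_expr (Suc p) f) (Store b p (Suc p)))"
| "comp p (c ;; d) = Seq (comp p c) (comp p d)"
| "comp p (Cond e c d) = Seq (comp_expr p e) (If p (comp p c) (comp p d))"
| "comp p (For i c) = Seq (Const p 0) (Seq (Sub (Suc p) 3 p)
 (While (Suc p) (Seq (Seq (Const (p+2) 0) (Add i p (p+2))) (Seq (comp (p+2) c)
 (Seq (Const (p+2) 1) (Seq (Add p p (p+2)) (Sub (Suc p) 3 p)))))))"

primrec ecost :: "expr => nat" where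
 "ecost (Num n) = 1"
| "ecost (Var r) = 2"
| "ecost (Cell b e) = ecost e+1"
| "ecost (Plus e f) = ecost e+ecost f+1"
| "ecost (Minus e f) = ecost e+ecost f+1"

primrec cost :: "stmt => nat" where
 "cost (Assign r e) = ecost e+2"
| "cost (Write b e f) = ecost e+ecost f+1"
| "cost (c ;; d) = cost c+cost d"
| "cost (Cond e c d) = ecost e+cost c+cost d+1"
| "cost (For i c) = cost c+9"

definition agree :: "nat => state => state => bool" where
 "agree q s t<->(ALL r<q. reg t r = reg s r)&arr t = arr s"

lemma exec_comp_expr:
 "eregs e<={..<q}==>q<=p==>agree q s s' ==>
 EX s''. exec (comp_expr p e) s' (ecost e) s''&reg s'' p = ev e s&agree p s' s''"
proof (induction e arbitrary: p s')
 case (Num n)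
 show ?case by(rule exI[of _ "set_reg p n s'"]) (simp add:agree_def exec.Const[unfolded One_nat_def])
next
 case (Var r)
 have "exec (comp_expr p (Var r)) s' (1+1) (set_reg p (reg (set_reg p 0 s') p+reg (set_reg p 0 s') r) (set_reg p 0 s'))"
 unfolding comp_expr.simps by(rule exec.Seq[OF exec.Const exec.Add])
 thus ?case using Var by(intro exI[of _ "set_reg p (reg (set_reg p 0 s') p+reg (set_reg p 0 s') r) (set_reg p 0 s')"])
 (auto simp:agree_def numeral_2_eq_2)
next
 case (Cell b e)
 from Cell.IH[OF Cell.prems[unfolded eregs.simps]] obtain s1 where
 1:"exec (comp_expr p e) s' (ecost e) s1" "reg s1 p = ev e s" "agree p s' s1" by blast
 have "exec (comp_expr p (Cell b e)) s' (ecost e+1) (set_reg p (arr s1 b (reg s1 p)) s1)"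
 unfolding comp_expr.simps by(rule exec.Seq[OF 1(1) exec.Load])
 thus ?case using 1 Cell by(intro exI[of _ "set_reg p (arr s1 b (reg s1 p)) s1"]) (auto simp:agree_def)
next
 case (Plus e f)
 hence u:"eregs e<={..<q}" "eregs f<={..<q}" "q<=Suc p" by auto
 from Plus.IH(1)[OF u(1) Plus.prems(2,3)] obtain s1 where
 1:"exec (comp_expr p e) s' (ecost e) s1" "reg s1 p = ev e s" "agree p s' s1" by blast
 hence "agree q s s1" using Plus.prems by(auto simp:agree_def)
 from Plus.IH(2)[OF u(2,3) this] obtain s2 where
 2:"exec (comp_expr (Suc p) f) s1 (ecost f) s2" "reg s2 (Suc p) = ev f s" "agree (Suc p) s1 s2" by blast
 have "exec (comp_expr p (Plus e f)) s' (ecost e+(ecost f+1)) (set_reg p (reg s2 p+reg s2 (Suc p)) s2)"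
 unfolding comp_expr.simps by(rule exec.Seq[OF 1(1) exec.Seq[OF 2(1) exec.Add]])
 thus ?case using 1 2 by(intro exI[of _ "set_reg p (reg s2 p+reg s2 (Suc p)) s2"]) (auto simp:agree_def add.assoc)
next
 case (Minus e f)
 hence u:"eregs e<={..<q}" "eregs f<={..<q}" "q<=Suc p" by auto
 from Minus.IH(1)[OF u(1) Minus.prems(2,3)] obtain s1 where
 1:"exec (comp_expr p e) s' (ecost e) s1" "reg s1 p = ev e s" "agree p s' s1" by blast
 hence "agree q s s1" using Minus.prems by(auto simp:agree_def)
 from Minus.IH(2)[OF u(2,3) this] obtain s2 where
 2:"exec (comp_expr (Suc p) f) s1 (ecost f) s2" "reg s2 (Suc p) = ev f s" "agree (Suc p) s1 s2" by blast
 have "exec (comp_expr p (Minus e f)) s' (ecost e+(ecost f+1)) (set_reg p (reg s2 p - reg s2 (Suc p)) s2)"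
 unfolding comp_expr.simps by(rule exec.Seq[OF 1(1) exec.Seq[OF 2(1) exec.Sub]])
 thus ?case using 1 2 by(intro exI[of _ "set_reg p (reg s2 p - reg s2 (Suc p)) s2"]) (auto simp:agree_def add.assoc)
qed

lemma cost_mono:"t<=c * Suc n ^ d==>d<=d'==>c<=c'==>t<=c' * Suc n ^ d'"
 by(rule order_trans,assumption,intro mult_mono power_increasing) auto

text \<open>Every loop has \<open>reg s 3\<close> rounds, so the time is at most the size of the text times
 a power of this number, the exponent being the depth of nesting. The program owns the registers below
 \<open>q\<close>, which is where \<open>agree\<close> compares the states; the compiled code works on those
 from \<open>p\<close> on.\<close>
theorem exec_comp:
 "uregs c<={..<q}==>3 ~: wregs c==>q<=p==>3 < q==>agree q s s' ==>
 EX t s''. exec (comp p c) s' t s''&agree q (run c s) s''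
 &(ALL r. q<=r-->r < p-->reg s'' r = reg s' r)&t<=cost c * Suc (reg s 3) ^ depth c"
proof (induction c arbitrary: p s s')
 case (Assign x e)
 then obtain s1 where 1:"exec (comp_expr p e) s' (ecost e) s1" "reg s1 p = ev e s" "agree p s' s1"
 using exec_comp_expr[of e q p s s'] by auto
 let ?s = "set_reg (Suc p) 0 s1"
 have "exec (comp p (Assign x e)) s' (ecost e+(1+1)) (set_reg x (reg ?s p+reg ?s (Suc p)) ?s)"
 unfolding comp.simps by(rule exec.Seq[OF 1(1) exec.Seq[OF exec.Const exec.Add]])
 thus ?case using 1 Assign by(intro exI[of _ "ecost e+(1+1)"] exI[of _ "set_reg x (reg ?s p+reg ?s (Suc p)) ?s"])
 (auto simp:agree_def)
next
 case (Write b e f)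
 then obtain s1 where 1:"exec (comp_expr p e) s' (ecost e) s1" "reg s1 p = ev e s" "agree p s' s1"
 using exec_comp_expr[of e q p s s'] by auto
 with Write have "agree q s s1" by(auto simp:agree_def)
 with Write obtain s2 where
 2:"exec (comp_expr (Suc p) f) s1 (ecost f) s2" "reg s2 (Suc p) = ev f s" "agree (Suc p) s1 s2"
 using exec_comp_expr[of f q "Suc p" s s1] by auto
 have "exec (comp p (Write b e f)) s' (ecost e+(ecost f+1)) (set_arr b (reg s2 p) (reg s2 (Suc p)) s2)"
 unfolding comp.simps by(rule exec.Seq[OF 1(1) exec.Seq[OF 2(1) exec.Store]])
 thus ?case using 1 2 Write
 by(intro exI[of _ "ecost e+(ecost f+1)"] exI[of _ "set_arr b (reg s2 p) (reg s2 (Suc p)) s2"])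
 (auto simp:agree_def)
next
 case (Then c d)
 have u:"uregs c<={..<q}" "3 ~: wregs c" "uregs d<={..<q}" "3 ~: wregs d" using Then.prems by auto
 then obtain t1 s1 where 1:"exec (comp p c) s' t1 s1" "agree q (run c s) s1"
 "ALL r. q<=r-->r < p-->reg s1 r = reg s' r" "t1<=cost c * Suc (reg s 3) ^ depth c"
 using Then.IH(1)[OF u(1,2) Then.prems(3,4,5)] by blast
 from 1 obtain t2 s2 where 2:"exec (comp p d) s1 t2 s2" "agree q (run d (run c s)) s2"
 "ALL r. q<=r-->r < p-->reg s2 r = reg s1 r" "t2<=cost d * Suc (reg (run c s) 3) ^ depth d"
 using Then.IH(2)[OF u(3,4) Then.prems(3,4) 1(2)] by blast
 have r:"reg (run c s) 3 = reg s 3" using Then.prems by(simp add:frame_reg)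
 have "t1<=cost c * Suc (reg s 3) ^ depth (c ;; d)" by(rule cost_mono[OF 1(4)]) auto
 moreover have "t2<=cost d * Suc (reg s 3) ^ depth (c ;; d)" by(rule cost_mono[OF 2(4)[unfolded r]]) auto
 ultimately have "t1+t2<=cost (c ;; d) * Suc (reg s 3) ^ depth (c ;; d)" by(simp only: cost.simps add_mult_distrib)
 moreover have "exec (comp p (c ;; d)) s' (t1+t2) s2" unfolding comp.simps by(rule exec.Seq[OF 1(1) 2(1)])
 ultimately show ?case using 1 2 by(intro exI[of _ "t1+t2"] exI[of _ s2]) simp
next
 case (Cond e c d)
 then obtain s1 where 1:"exec (comp_expr p e) s' (ecost e) s1" "reg s1 p = ev e s" "agree p s' s1"
 using exec_comp_expr[of e q p s s'] by auto
 with Cond have a:"agree q s s1" by(auto simp:agree_def)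
 let ?d = "depth (Cond e c d)"
 have u:"uregs c<={..<q}" "3 ~: wregs c" "uregs d<={..<q}" "3 ~: wregs d" using Cond.prems by auto
 show ?case
 proof (cases "ev e s = 0")
 case True
 obtain t2 s2 where 2:"exec (comp p d) s1 t2 s2" "agree q (run d s) s2"
 "ALL r. q<=r-->r < p-->reg s2 r = reg s1 r" "t2<=cost d * Suc (reg s 3) ^ depth d"
 using Cond.IH(2)[OF u(3,4) Cond.prems(3,4) a] by blast
 have "exec (comp p (Cond e c d)) s' (ecost e+Suc t2) s2"
 unfolding comp.simps using 1 2 True by(intro exec.Seq[OF 1(1)] exec.IfFalse) auto
 moreover have "t2<=cost d * Suc (reg s 3) ^ ?d" by(rule cost_mono[OF 2(4)]) auto
 hence "ecost e+Suc t2<=cost (Cond e c d) * Suc (reg s 3) ^ ?d"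
 using cost_mono[of "ecost e+1" "ecost e+1" "reg s 3" 0 ?d "ecost e+cost c+1"]
 unfolding cost.simps add_mult_distrib by simp
 ultimately show ?thesis using 1 2 Cond.prems True
 by(intro exI[of _ "ecost e+Suc t2"] exI[of _ s2]) (auto simp:agree_def)
 next
 case False
 obtain t2 s2 where 2:"exec (comp p c) s1 t2 s2" "agree q (run c s) s2"
 "ALL r. q<=r-->r < p-->reg s2 r = reg s1 r" "t2<=cost c * Suc (reg s 3) ^ depth c"
 using Cond.IH(1)[OF u(1,2) Cond.prems(3,4) a] by blast
 have "exec (comp p (Cond e c d)) s' (ecost e+Suc t2) s2"
 unfolding comp.simps using 1 2 False by(intro exec.Seq[OF 1(1)] exec.IfTrue) auto
 moreover have "t2<=cost c * Suc (reg s 3) ^ ?d" by(rule cost_mono[OF 2(4)]) auto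
 hence "ecost e+Suc t2<=cost (Cond e c d) * Suc (reg s 3) ^ ?d"
 using cost_mono[of "ecost e+1" "ecost e+1" "reg s 3" 0 ?d "ecost e+cost d+1"]
 unfolding cost.simps add_mult_distrib by simp
 ultimately show ?thesis using 1 2 Cond.prems False
 by(intro exI[of _ "ecost e+Suc t2"] exI[of _ s2]) (auto simp:agree_def) qed
next
 case (For i c)
 let ?N = "reg s 3"
 let ?K = "cost c * Suc ?N ^ depth c"
 let ?body = "Seq (Seq (Const (p+2) 0) (Add i p (p+2))) (Seq (comp (p+2) c)
 (Seq (Const (p+2) 1) (Seq (Add p p (p+2)) (Sub (Suc p) 3 p))))"
 let ?f = "%k s. run c (set_reg i k s)"
 have i3:"i~=3" "i < q" and sub:"uregs c<={..<q}" "3 ~: wregs c" "i~=p" using For.prems by auto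
 have loop:"EX t u''. exec (While (Suc p) ?body) u' t u''&agree q (fold ?f [k..<?N] u) u''
 &(ALL r. q<=r-->r < p-->reg u'' r = reg u' r)&t<=1+(?N - k) * (?K+6)"
 if "k<=?N" "reg u 3 = ?N" "agree q u u'" "reg u' p = k" "reg u' (Suc p) = ?N - k" for k u u' using that
 proof (induction "?N - k" arbitrary: k u u')
 case 0
 hence "exec (While (Suc p) ?body) u' 1 u'" by(intro exec.WhileFalse) auto
 thus ?case using 0 by auto
 next
 case (Suc n)
 let ?u1 = "set_reg (p+2) 0 u'"
 let ?u2 = "set_reg i (reg ?u1 p+reg ?u1 (p+2)) ?u1"
 have "agree q (set_reg i k u) ?u2" using Suc.prems For.prems by(auto simp:agree_def)
 from For.IH[OF sub(1,2) _ _ this,of "p+2"] For.prems obtain t3 u3 where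
 3:"exec (comp (p+2) c) ?u2 t3 u3" "agree q (?f k u) u3"
 "ALL r. q<=r-->r < p+2-->reg u3 r = reg ?u2 r"
 "t3<=cost c * Suc (reg (set_reg i k u) 3) ^ depth c" by auto
 have r3:"reg u3 p = k" "reg u3 3 = ?N" "reg (?f k u) 3 = ?N"
 using 3(3)[rule_format,of p] 3(2) For.prems i3 Suc.prems sub by(auto simp:agree_def frame_reg)
 let ?u4 = "set_reg (p+2) 1 u3"
 let ?u5 = "set_reg p (reg ?u4 p+reg ?u4 (p+2)) ?u4"
 let ?u6 = "set_reg (Suc p) (reg ?u5 3 - reg ?u5 p) ?u5"
 have b:"exec ?body u' (1+1+(t3+(1+(1+1)))) ?u6" by(rule exec.Seq[OF exec.Seq[OF exec.Const exec.Add] exec.Seq[OF 3(1)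
 exec.Seq[OF exec.Const exec.Seq[OF exec.Add exec.Sub]]]])
 have p3:"3~=p" "3~=Suc p" "3~=p+2" using For.prems by auto
 have "EX t u''. exec (While (Suc p) ?body) ?u6 t u''&agree q (fold ?f [Suc k..<?N] (?f k u)) u''
 &(ALL r. q<=r-->r < p-->reg u'' r = reg ?u6 r)&t<=1+(?N - Suc k) * (?K+6)"
 using Suc.hyps(2) r3 3(2) For.prems(3,4) p3 by(intro Suc.hyps(1)) (auto simp:agree_def)
 then obtain t7 u7 where 7:"exec (While (Suc p) ?body) ?u6 t7 u7"
 "agree q (fold ?f [Suc k..<?N] (?f k u)) u7"
 "ALL r. q<=r-->r < p-->reg u7 r = reg ?u6 r" "t7<=1+(?N - Suc k) * (?K+6)" by blast
 have e:"exec (While (Suc p) ?body) u' (Suc (1+1+(t3+(1+(1+1)))+t7)) u7"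
 using Suc.hyps(2) Suc.prems by(intro exec.WhileTrue[OF _ b 7(1)]) auto
 have up:"[k..<?N] = k # [Suc k..<?N]" using Suc.hyps(2) by(simp add:upt_conv_Cons)
 have "?N - k = Suc (?N - Suc k)" using Suc.hyps(2) by simp
 moreover have "t3<=?K" using 3(4) i3 Suc.prems by simp
 ultimately have "Suc (1+1+(t3+(1+(1+1)))+t7)<=1+(?N - k) * (?K+6)" using 7(4) by simp
 thus ?case using e 7(2,3) up 3(3) i3 For.prems(3) by(intro exI[of _ "Suc (1+1+(t3+(1+(1+1)))+t7)"] exI[of _ u7]) auto
 qed
 let ?s1 = "set_reg p 0 s'"
 let ?s2 = "set_reg (Suc p) (reg ?s1 3 - reg ?s1 p) ?s1"
 have p3:"3~=p" "3~=Suc p" "reg s' 3 = ?N" using For.prems by(auto simp:agree_def)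
 have "EX t u''. exec (While (Suc p) ?body) ?s2 t u''&agree q (fold ?f [0..<?N] s) u''
 &(ALL r. q<=r-->r < p-->reg u'' r = reg ?s2 r)&t<=1+(?N - 0) * (?K+6)"
 using p3 For.prems by(intro loop) (auto simp:agree_def)
 then obtain t u where u:"exec (While (Suc p) ?body) ?s2 t u" "agree q (fold ?f [0..<?N] s) u"
 "ALL r. q<=r-->r < p-->reg u r = reg ?s2 r" "t<=1+(?N - 0) * (?K+6)" by blast
 have "exec (comp p (For i c)) s' (1+(1+t)) u"
 unfolding comp.simps by(rule exec.Seq[OF exec.Const exec.Seq[OF exec.Sub u(1)]])
 moreover have "1+(1+t)<=cost (For i c) * Suc ?N ^ depth (For i c)"
 proof -
 have "1+(1+t)<=3+?N * ?K+6 * ?N" using u(4) by(simp add:algebra_simps)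
 also have "\<dots><=?N * ?K+9 * Suc ?N" by simp
 finally have 1:"1+(1+t)<=?N * ?K+9 * Suc ?N" .
 have "9 * Suc ?N<=9 * (Suc ?N * Suc ?N ^ depth c)"
 proof -
 have "1<=Suc ?N ^ depth c" by(rule one_le_power) simp
 from mult_le_mono2[OF this,of "9 * Suc ?N"] show ?thesis by(simp only: mult_1_right mult.assoc) qed
 with 1 have "1+(1+t)<=?N * ?K+9 * (Suc ?N * Suc ?N ^ depth c)" by linarith
 also have "\<dots><=Suc ?N * ?K+9 * (Suc ?N * Suc ?N ^ depth c)" by simp
 finally show ?thesis by(simp add:algebra_simps) qed
 moreover have "ALL r. q<=r-->r < p-->reg u r = reg s' r" using u(3) by simp
 ultimately show ?case using u(2) unfolding run.simps by blast qed

section \<open>Groups given by presentations\<close>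

declare in_lists_conv_set [simp del] in_listsD [rule del] in_listsI [rule del]

lemma words_simps [simp]:
 "[]:words X" "x # w:words X<->x:letters X&w:words X"
 "u @ w:words X<->u:words X&w:words X" by auto

lemma inv_letter_simps [simp]:
 "inv_letter (inv_letter x) = x" "inv_letter x~=x" "x~=inv_letter x"
 "inv_letter x:letters X<->x:letters X" "inv_letter x = inv_letter y<->x = y"
proof -
 obtain a b c d where "x = (a,b)" "y = (c,d)" by(cases x,cases y) blast
 thus "inv_letter (inv_letter x) = x" "inv_letter x~=x" "x~=inv_letter x"
 "inv_letter x:letters X<->x:letters X" "inv_letter x = inv_letter y<->x = y" by(auto simp:letters_def) qed

lemma inv_word_simps [simp]:
 "inv_word [] = []" "inv_word (x # w) = inv_word w @ [inv_letter x]"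
 "inv_word (u @ w) = inv_word w @ inv_word u" "inv_word (inv_word w) = w"
 "inv_word w:words X<->w:words X"
proof -
 show "inv_word (inv_word w) = w" by(induction w) (auto simp:inv_word_def)
 show "inv_word w:words X<->w:words X" by(auto simp:inv_word_def in_lists_conv_set simp del: inv_letter.simps)
qed (auto simp:inv_word_def)

context
 fixes X :: "'x set" and R :: "'x word set"
 assumes R:"R<=words X"
begin

lemma pres_rel_words:"(u,w):pres_rel X R==>u:words X&w:words X" by(induction rule:pres_rel.induct) (use R in auto)

lemma equiv_pres_rel:"equiv (words X) (pres_rel X R)" using pres_rel_words
 by(intro equivI refl_onI symI transI) (auto intro:pres_rel.intros)

lemma pres_rel_context:
 "(u,w):pres_rel X R==>p:words X==>q:words X==>(p @ u @ q,p @ w @ q):pres_rel X R"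
proof (induction rule:pres_rel.induct)
 case (cancel u w a)
 thus ?case using pres_rel.cancel[of "p @ u" X "w @ q" a R] by simp
next
 case (relator u w r)
 thus ?case using pres_rel.relator[of "p @ u" X "w @ q" r R] by simp
next
 case (refl w)
 thus ?case by(intro pres_rel.refl) auto qed (blast intro:pres_rel.intros)+

lemma pres_rel_append:
 assumes "(u,u'):pres_rel X R" "(w,w'):pres_rel X R" shows "(u @ w,u' @ w'):pres_rel X R"
 using pres_rel_context[OF assms(1),of "[]" w] pres_rel_context[OF assms(2),of u' "[]"]
 pres_rel_words[OF assms(1)] pres_rel_words[OF assms(2)] by(auto intro:pres_rel.trans)

lemma word_class_eq:
 "u:words X==>w:words X==>word_class X R u = word_class X R w<->(u,w):pres_rel X R"
 unfolding word_class_def by(rule eq_equiv_class_iff[OF equiv_pres_rel])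

lemma in_word_class:"w:words X==>u:word_class X R w<->u:words X&word_class X R u = word_class X R w"
 using pres_rel_words[of w u] word_class_eq[of u w] by(auto simp:word_class_def intro:pres_rel.sym)

lemma gp_mult:
 assumes "u:words X" "w:words X"
 shows "word_class X R u \<otimes>\<^bsub>gp X R\<^esub> word_class X R w = word_class X R (u @ w)"
proof -
 have *: "word_class X R (p @ q) = word_class X R (u @ w)" if "p:word_class X R u" "q:word_class X R w" for p q
 using that assms pres_rel_words pres_rel_append by(subst word_class_eq) (auto simp:word_class_def intro:pres_rel.sym)
 have "(\<Union>p\<in>word_class X R u. \<Union>q\<in>word_class X R w. word_class X R (p @ q))
 = (\<Union>p\<in>word_class X R u. \<Union>q\<in>word_class X R w. word_class X R (u @ w))"
 by(rule SUP_cong[OF HOL.refl],rule SUP_cong[OF HOL.refl],rule *)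
 moreover have "u:word_class X R u" "w:word_class X R w" using assms by(auto simp:word_class_def intro:pres_rel.refl)
 hence "(\<Union>p\<in>word_class X R u. \<Union>q\<in>word_class X R w. word_class X R (u @ w)) = word_class X R (u @ w)"
 by blast
 ultimately show ?thesis by(simp add:gp_def) qed

lemma gp_carrier:"carrier (gp X R) = word_class X R ` words X" by(auto simp:gp_def quotient_def word_class_def)

lemma inv_word_cancel:"w:words X==>(inv_word w @ w,[]):pres_rel X R"
proof (induction w)
 case (Cons x w)
 hence "(inv_word w @ [inv_letter x,inv_letter (inv_letter x)] @ w,inv_word w @ w):pres_rel X R"
 by(intro pres_rel.cancel) auto
 with Cons show ?case by(auto intro:pres_rel.trans) qed (auto intro:pres_rel.refl)

lemma gp_group:"group (gp X R)"
proof (rule groupI)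
 show "\<one>\<^bsub>gp X R\<^esub>:carrier (gp X R)" by(auto simp:gp_carrier) (simp add:gp_def)
 have one:"\<one>\<^bsub>gp X R\<^esub> = word_class X R []" by(simp add:gp_def)
 fix x assume x:"x:carrier (gp X R)"
 then obtain u where u:"u:words X" "x = word_class X R u" by(auto simp:gp_carrier)
 thus "\<one>\<^bsub>gp X R\<^esub> \<otimes>\<^bsub>gp X R\<^esub> x = x" by(simp only: one gp_mult words_simps append_Nil)
 show "EX y:carrier (gp X R). y \<otimes>\<^bsub>gp X R\<^esub> x = \<one>\<^bsub>gp X R\<^esub>"
 using u by(intro bexI[of _ "word_class X R (inv_word u)"])
 (auto simp:gp_mult one gp_carrier word_class_eq inv_word_cancel) qed (auto simp:gp_carrier gp_mult)

end

context amalgam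
begin

lemma grp:"group (factor i)" unfolding factor_def by(rule gp_group[OF relators])

lemma carrier_factor:"FC i = elt i ` WX i" unfolding factor_def elt_def by(subst gp_carrier[OF relators]) auto

lemma elt_closed [simp]:"w:WX i==>elt i w:FC i" by(auto simp:carrier_factor)

lemma elt_append:"u:WX i==>w:WX i==>elt i (u @ w) = elt i u \<odot>[i] elt i w"
 unfolding factor_def elt_def by(simp add:gp_mult[OF relators])

lemma elt_Nil:"elt i [] = \<one>[i]" by(simp add:elt_def factor_def gp_def)

lemma elt_Cons:"x:LX i==>w:WX i==>elt i (x # w) = elt i [x] \<odot>[i] elt i w" using elt_append[of "[x]" i w] by simp

lemma elt_inv_word:"w:WX i==>elt i (inv_word w) = inv[i] elt i w"
proof -
 interpret group "factor i" by(rule grp)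
 assume w:"w:WX i"
 hence "elt i (inv_word w) \<odot>[i] elt i w = \<one>[i]"
 using inv_word_cancel[OF relators w] word_class_eq[OF relators,of "inv_word w @ w" i "[]"]
 by(simp flip: elt_append elt_Nil) (simp add:elt_def)
 with w show ?thesis by(intro inv_equality[symmetric]) auto qed

lemma fin_car:"finite (FC i)" using finite_factor by(simp add:factor_def)

lemma \<phi>_hom:"\<phi> i:hom A (factor i)" and \<phi>_inj:"inj_on (\<phi> i) (carrier A)"
 using mono_\<phi>[of i] by(auto simp:mon_def factor_def)

lemma \<phi>_closed [simp]:"a:carrier A==>\<phi> i a:FC i" using \<phi>_hom[of i] by(auto simp:hom_def)

lemma in_\<phi>: "a:carrier A==>u:\<phi> i a<->u:WX i&elt i u = \<phi> i a"
 using \<phi>_closed[of a i] in_word_class[OF relators,of _ i u] by(auto simp:carrier_factor) (auto simp:elt_def)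

lemma finite_A:"finite (carrier A)"
 using fin_car[of One] \<phi>_inj[of One] by(meson \<phi>_closed finite_imageD finite_subset image_subsetI)

lemma \<phi>_one:"\<phi> i oneA = \<one>[i]" using hom_one[OF \<phi>_hom group_A grp] .

lemma \<phi>_mult:"a:carrier A==>b:carrier A==>\<phi> i (a \<otimes>\<^bsub>A\<^esub> b) = \<phi> i a \<odot>[i] \<phi> i b"
 using \<phi>_hom by(rule hom_mult)

lemma \<phi>_group_hom:"group_hom A (factor i) (\<phi> i)"
 using group_A grp \<phi>_hom by(simp add:group_hom_def group_hom_axioms_def)

lemma \<phi>_subgroup:"subgroup K A==>subgroup (\<phi> i ` K) (factor i)"
 by(rule group_hom.subgroup_img_is_subgroup[OF \<phi>_group_hom])

lemma letters_disjoint:"i~=j==>x:LX i==>x ~: letters (X j)"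
 using disjoint_X by(cases i; cases j) (auto simp:letters_def)

lemma letters_XX:"letters (X One Un X Two) = letters (X One) Un letters (X Two)" by(auto simp:letters_def)

lemma letters_mono:"x:LX i==>x:letters (X One Un X Two)" by(cases i) (auto simp:letters_def)

lemma colour_eq:"x:LX i==>colour x = i" using letters_disjoint[of One Two x] by(cases i) (auto simp:colour_def)

lemma in_letters_colour:"x:letters (X One Un X Two)==>x:letters (X (colour x))" by(auto simp:colour_def letters_XX)

lemma finite_letters:"finite (LX i)" using finite_X by(simp add:letters_def)

end

section \<open>Folded graphs and least folding congruences\<close>

definition tri :: "('v,'e,'x) lgraph => ('v \<times> 'x letter \<times> 'v) set" where
 "tri H = (%e. (ltail H e,lab H e,lhead H e)) ` lE H"

definition folded :: "('v,'e,'x) lgraph => bool" where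
 "folded H<->(ALL d:lE H. ALL e:lE H. ltail H d = ltail H e&lab H d = lab H e-->d = e)"

definition tmap :: "('v => 'w) => 'v \<times> 'k \<times> 'v => 'w \<times> 'k \<times> 'w" where
 "tmap f = (%(u,x,w). (f u,x,f w))"

lemma tmap_simps [simp]:"tmap f (u,x,w) = (f u,x,f w)" "tmap (%x. x) = (%t. t)" by(auto simp:tmap_def)

lemma tmap_image:"tmap f ` tmap g ` T = tmap (f \<circ> g) ` T" by(force simp:tmap_def)

definition fold_cong :: "('v \<times> 'k \<times> 'v) set => ('v => 'w) => bool" where
 "fold_cong T h<->(ALL u x w u' w'. (u,x,w):T-->(u',x,w'):T-->h u = h u'-->h w = h w')"

text \<open>Folding forces the ends of two edges with the same label together as soon as their origins are
 together. The classes of this relation are the vertices of the folded graph, whatever the order of the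
 foldings.\<close>
inductive lfc :: "('v \<times> 'k \<times> 'v) set => 'v => 'v => bool" for T where
 refl:"lfc T u u"
| sym:"lfc T u w==>lfc T w u"
| trans:"lfc T u v==>lfc T v w==>lfc T u w"
| fold:"(u,x,w):T==>(u',x,w'):T==>lfc T u u'==>lfc T w w'"

lemma fold_congD:"fold_cong T h==>(u,x,w):T==>(u',x,w'):T==>h u = h u'==>h w = h w'" unfolding fold_cong_def by blast

lemma fold_congI:
 "(!!u x w u' w'. (u,x,w):T==>(u',x,w'):T==>h u = h u'==>h w = h w')==>fold_cong T h" unfolding fold_cong_def by blast

lemma lfc_least:"lfc T u w==>fold_cong T h==>h u = h w"
proof (induction rule:lfc.induct)
 case (fold u x w u' w')
 thus ?case by(blast intro:fold_congD) qed simp_all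

lemma lgraph_wfD:
 assumes "lgraph_wf H" "e:lE H" shows "ltail H e:lV H" "lhead H e:lV H" "bar H e:lE H" "bar H e~=e"
 "bar H (bar H e) = e" "ltail H (bar H e) = lhead H e" "lhead H (bar H e) = ltail H e"
 "lab H (bar H e) = inv_letter (lab H e)"
proof -
 interpret bidirected_digraph "dig H" "bar H" using assms by(simp add:lgraph_wf_def)
 show "ltail H e:lV H" "lhead H e:lV H" "bar H e:lE H" "bar H e~=e"
 "bar H (bar H e) = e" "ltail H (bar H e) = lhead H e" "lhead H (bar H e) = ltail H e"
 "lab H (bar H e) = inv_letter (lab H e)" using assms arev_dom by(auto simp:lgraph_wf_def) qed

lemma lgraph_wfI:
 assumes "!!e. e:lE H==>ltail H e:lV H&lhead H e:lV H&bar H e:lE H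
 &bar H (bar H e) = e&ltail H (bar H e) = lhead H e&lab H (bar H e) = inv_letter (lab H e)"
 and "!!e. e ~: lE H==>bar H e = e" shows "lgraph_wf H"
 unfolding lgraph_wf_def by(metis inv_letter_simps(2) wf_digraph.bidirected_digraphI wf_digraph.intro assms) 

lemma triD:
 assumes "lgraph_wf H" "(u,x,w):tri H" shows "u:lV H" "w:lV H" "(w,inv_letter x,u):tri H"
proof -
 from assms obtain e where e:"e:lE H" "u = ltail H e" "x = lab H e" "w = lhead H e" by(auto simp:tri_def)
 note d = lgraph_wfD[OF assms(1) e(1)]
 show "u:lV H" "w:lV H" using d e by auto
 show "(w,inv_letter x,u):tri H" unfolding tri_def by(rule image_eqI[of _ _ "bar H e"]) (use d e in auto) qed

lemma folded_tri:"folded H==>(u,x,w):tri H==>(u,x,w'):tri H==>w = w'" by(fastforce simp:folded_def tri_def)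

lemma triE:
 assumes "(u,x,w):tri H"
 obtains e where "e:lE H" "u = ltail H e" "x = lab H e" "w = lhead H e" using assms by(auto simp:tri_def)

lemma triI:"e:lE H==>(ltail H e,lab H e,lhead H e):tri H" by(auto simp:tri_def)

text \<open>In a folded graph an edge is determined by its origin and its label, so that a bijection of the
 vertices that respects labelled adjacency extends to the edges in exactly one way.\<close>

lemma iso_folded:
 assumes wf:"lgraph_wf H" "lgraph_wf H'" and fo:"folded H" "folded H'"
 and f:"inj_on f (lV H)" "lV H' = f ` lV H" "tri H' = tmap f ` tri H" and v:"v:lV H" "v' = f v"
 shows "pgraph_iso (H,v) (H',v')"
proof -
 have "EX e'. e':lE H'&ltail H' e' = f (ltail H e)&lab H' e' = lab H e&lhead H' e' = f (lhead H e)" if "e:lE H" for e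
 proof -
 have "(f (ltail H e),lab H e,f (lhead H e)):tri H'" using triI[OF that] f(3) by(force simp:tmap_def)
 thus ?thesis by(auto elim!: triE) qed
 then obtain g where g:"!!e. e:lE H==>g e:lE H'&ltail H' (g e) = f (ltail H e)
 &lab H' (g e) = lab H e&lhead H' (g e) = f (lhead H e)" by metis
 have "lgraph_hom H H' f g" unfolding lgraph_hom_def
 proof (intro conjI ballI)
 fix e assume e:"e:lE H"
 note d = lgraph_wfD[OF wf(1) e] and g1 = g[OF e]
 note d' = lgraph_wfD[OF wf(2) conjunct1[OF g1]] and g2 = g[OF d(3)]
 show "bar H' (g e) = g (bar H e)"
 using fo(2)[unfolded folded_def,rule_format,of "bar H' (g e)" "g (bar H e)"] d d' g1 g2 by auto qed (use f g in auto)
 moreover have "inj_on g (lE H)"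
 proof (rule inj_onI)
 fix d e assume de:"d:lE H" "e:lE H" "g d = g e"
 hence "f (ltail H d) = f (ltail H e)" "lab H d = lab H e" using g by metis+
 thus "d = e" using fo(1) f(1) lgraph_wfD(1)[OF wf(1) de(1)] lgraph_wfD(1)[OF wf(1) de(2)] de(1,2)
 by(auto simp:folded_def inj_on_def) qed
 moreover have "g ` lE H = lE H'"
 proof (intro equalityI subsetI)
 fix e' assume e': "e':lE H'"
 then obtain u x w where t:"(u,x,w):tri H" "ltail H' e' = f u" "lab H' e' = x"
 using triI[OF e'] f(3) by(auto simp:tmap_def)
 then obtain e where e:"e:lE H" "u = ltail H e" "x = lab H e" by(auto elim:triE)
 have "g e = e'" using g[OF e(1)] e t fo(2) e' by(auto simp:folded_def)
 thus "e':g ` lE H" using e by auto qed (use g in auto)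
 ultimately show ?thesis using f v by(auto simp:bij_betw_def) qed

lemma pgraph_iso_tri:
 assumes "pgraph_iso (H,v) (H',v')" "lgraph_wf H"
 obtains f where "bij_betw f (lV H) (lV H')" "f v = v'" "tri H' = tmap f ` tri H"
proof -
 from assms obtain f g where f:"lgraph_hom H H' f g" "bij_betw f (lV H) (lV H')"
 "bij_betw g (lE H) (lE H')" "f v = v'" by auto
 have "tri H' = tmap f ` tri H" unfolding tri_def bij_betw_imp_surj_on[OF f(3),symmetric] image_image
 using f(1) by(intro image_cong) (auto simp:lgraph_hom_def)
 with f that show ?thesis by blast qed

lemma folded_no_step:"folded Z==>~ fold_step (Z,v) X" by(auto simp:folded_def elim:fold_step.cases)

lemma rtrancl_kernel:
 assumes "(u,w):(RV Un RV\<inverse>)\<^sup>*" "!!a b. (a,b):RV==>h a = h b" shows "h u = h w"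
 using assms(1) by(induction rule:rtrancl_induct) (use assms(2) in auto)

lemma fold_once:
 assumes wf:"lgraph_wf Z" and fin:"finite (lE Z)"
 and de:"d:lE Z" "e:lE Z" "d~=e" "ltail Z d = ltail Z e" "lab Z d = lab Z e"
 defines "f == id(lhead Z d := lhead Z e)"
 shows "EX De. fold_step (Z,v) (De,f v)&lgraph_wf De&finite (lE De)&card (lE De) < card (lE Z)
 &lV De = f ` lV Z&tri De = tmap f ` tri Z"
proof -
 note dd = lgraph_wfD[OF wf de(1)] and ee = lgraph_wfD[OF wf de(2)]
 define g where "g = id(d := e,bar Z d := bar Z e)"
 define E where "E = lE Z - {d,bar Z d}"
 define De where "De = \<lparr>dig = \<lparr>verts = f ` lV Z,arcs = E,tail = f \<circ> ltail Z,head = f \<circ> lhead Z\<rparr>,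
 bar = (%a. if a:E then bar Z a else a),lab = lab Z\<rparr>"
 have ne:"d~=bar Z e" "e~=bar Z d" "bar Z e~=bar Z d" using dd ee de by(metis inv_letter_simps(2))+
 have barE:"bar Z a:E" if "a:E" for a using that lgraph_wfD[OF wf,of a] dd by(auto simp:E_def)
 have Dewf:"lgraph_wf De" by(rule lgraph_wfI) (use barE lgraph_wfD[OF wf] in \<open>auto simp:De_def E_def\<close>)
 have gE:"g ` lE Z = E" using de ne dd ee by(auto simp:g_def E_def image_iff)
 have hom:"lgraph_hom Z De f g" unfolding lgraph_hom_def
 proof (intro conjI ballI)
 fix a assume a:"a:lE Z"
 note aa = lgraph_wfD[OF wf a]
 have "g a:E" using a gE by blast
 show "ltail De (g a) = f (ltail Z a)" "lhead De (g a) = f (lhead Z a)" "lab De (g a) = lab Z a"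
 using de dd ee by(auto simp:De_def g_def f_def)
 show "bar De (g a) = g (bar Z a)" using `g a:E` aa dd ee ne a de by(auto simp:De_def g_def)
 qed (use gE in \<open>auto simp:De_def\<close>)
 have kv:"f u = f w<->(u,w):({(lhead Z d,lhead Z e)} Un {(lhead Z d,lhead Z e)}\<inverse>)\<^sup>*" for u w
 proof
 assume "f u = f w" thus "(u,w):({(lhead Z d,lhead Z e)} Un {(lhead Z d,lhead Z e)}\<inverse>)\<^sup>*"
 by(auto simp:f_def split:if_splits)
 next
 assume "(u,w):({(lhead Z d,lhead Z e)} Un {(lhead Z d,lhead Z e)}\<inverse>)\<^sup>*"
 thus "f u = f w" by(rule rtrancl_kernel) (auto simp:f_def) qed
 let ?RE = "{(d,e),(bar Z d,bar Z e)}"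
 have ke:"g u = g w<->(u,w):(?RE Un ?RE\<inverse>)\<^sup>*" for u w
 proof
 assume "g u = g w" thus "(u,w):(?RE Un ?RE\<inverse>)\<^sup>*"
 using ne dd(4) ee(4) de(3) by(auto simp:g_def split:if_splits intro:r_into_rtrancl)
 next
 assume "(u,w):(?RE Un ?RE\<inverse>)\<^sup>*"
 thus "g u = g w" by(rule rtrancl_kernel) (use ne dd ee in "auto simp:g_def") qed
 have "identify Z {(lhead Z d,lhead Z e)} ?RE De f" unfolding identify_def using Dewf hom gE kv ke
 by(intro conjI exI[of _ g]) (auto simp:De_def)
 hence "fold_step (Z,v) (De,f v)" using de by(intro fold_step.intros)
 moreover have "tri De = tmap f ` tri Z"
 proof -
 have "tri De = (%a. (ltail De a,lab De a,lhead De a)) ` g ` lE Z" using gE by(simp add:tri_def De_def)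
 also have "\<dots> = tmap f ` tri Z"
 unfolding tri_def image_image using hom by(intro image_cong) (auto simp:lgraph_hom_def)
 finally show ?thesis . qed
 moreover have "card E < card (lE Z)" unfolding E_def using fin de by(intro psubset_card_mono) auto
 ultimately show ?thesis using Dewf fin by(intro exI[of _ De]) (auto simp:De_def E_def) qed

text \<open>Folding only identifies what every folding congruence identifies. The induction is on the number
 of edges, and a congruence of the graph factors through each folding.\<close>

lemma fold_exhaust:
 fixes Z :: "('v,'e,'x) lgraph"
 assumes "lgraph_wf Z" "finite (lE Z)"
 shows "EX (De :: ('v,'e,'x) lgraph) f. fold_step^** (Z,v) (De,f v)&lgraph_wf De&folded De
 &finite (lE De)&lV De = f ` lV Z&tri De = tmap f ` tri Z
 &(ALL h :: 'v => nat. fold_cong (tri Z) h-->(ALL u w. f u = f w-->h u = h w))" using assms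
proof (induction "card (lE Z)" arbitrary: Z v rule:less_induct)
 case less
 show ?case
 proof (cases "folded Z")
 case True
 thus ?thesis using less.prems by(intro exI[of _ Z] exI[of _ "%x. x"]) auto
 next
 case False
 then obtain d e where de:"d:lE Z" "e:lE Z" "d~=e" "ltail Z d = ltail Z e" "lab Z d = lab Z e"
 by(auto simp:folded_def)
 define f where "f = id(lhead Z d := lhead Z e)"
 obtain De where De: "fold_step (Z,v) (De,f v)" "lgraph_wf De" "finite (lE De)"
 "card (lE De) < card (lE Z)" "lV De = f ` lV Z" "tri De = tmap f ` tri Z"
 using fold_once[OF less.prems de,of v] unfolding f_def by auto
 obtain De' f' where De': "fold_step^** (De,f v) (De',f' (f v))" "lgraph_wf De'" "folded De'"
 "finite (lE De')" "lV De' = f' ` lV De" "tri De' = tmap f' ` tri De"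
 "!!(h :: 'v => nat) u w. fold_cong (tri De) h==>f' u = f' w==>h u = h w"
 using less.hyps[OF De(4,2,3),of "f v"] by(metis (no_types,lifting))
 have "h u = h w" if h:"fold_cong (tri Z) h" and uw:"(f' \<circ> f) u = (f' \<circ> f) w" for h :: "'v => nat" and u w
 proof -
 have uw:"f' (f u) = f' (f w)" using uw by simp
 have "h (lhead Z d) = h (lhead Z e)" using fold_congD[OF h] triI[OF de(1)] triI[OF de(2)] de(4,5) by metis
 hence hf:"h (f u) = h u" for u by(auto simp:f_def)
 have "fold_cong (tri De) h" unfolding De(6)
 proof (rule fold_congI)
 fix a x b a' b' assume *: "(a,x,b):tmap f ` tri Z" "(a',x,b'):tmap f ` tri Z" "h a = h a'"
 then obtain a0 b0 a1 b1 where "(a0,x,b0):tri Z" "(a1,x,b1):tri Z" "a = f a0" "b = f b0" "a' = f a1" "b' = f b1"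
 by(auto simp:tmap_def)
 with fold_congD[OF h,of a0 x b0 a1 b1] *(3) show "h b = h b'" by(simp add:hf) qed
 from De'(7)[OF this uw] show ?thesis by(simp add:hf) qed
 moreover have "tri De' = tmap (f' \<circ> f) ` tri Z" by(simp only: De'(6) De(6) tmap_image)
 moreover have "fold_step^** (Z,v) (De',(f' \<circ> f) v)"
 using converse_rtranclp_into_rtranclp[OF De(1) De'(1)] by simp
 moreover have "lV De' = (f' \<circ> f) ` lV Z" by(simp only: De'(5) De(5) image_comp)
 ultimately show ?thesis using De'(2-4) by(intro exI[of _ De'] exI[of _ "f' \<circ> f"] conjI allI impI) simp_all qed
qed

text \<open>\<open>shape\<close>: up to the names of its vertices, a folded graph is given by its vertex set and its set of
 labelled adjacencies.\<close>

definition shape :: "('v,'e,'x) pgraph => 'w set => ('w \<times> 'x letter \<times> 'w) set => 'w => ('v => 'w) => bool" where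
 "shape = (%(De,v') V T v q. lgraph_wf De&folded De&finite (lE De)&v':lV De
 &inj_on q (lV De)&q ` lV De = V&tmap q ` tri De = T&q v' = v)"

lemma shape_folded:"shape (De,v') V T v q==>folded De" by(simp add:shape_def)

lemma shape_iso:
 assumes "shape (De,v') V T v q" "lgraph_wf Z" "folded Z" "lV Z = V" "tri Z = T" shows "pgraph_iso (De,v') (Z,v)"
 by(rule iso_folded[of _ _ q]) (use assms in "auto simp:shape_def")

lemma factor_map:
 assumes "!!u w. u:V==>w:V==>f u = f w<->g u = g w"
 shows "EX q. (ALL u:V. q (f u) = g u)&inj_on q (f ` V)&q ` f ` V = g ` V"
proof -
 define q where "q y = g (inv_into V f y)" for y
 have q:"q (f u) = g u" if "u:V" for u
 using that assms[of u "inv_into V f (f u)"] f_inv_into_f[of "f u" f V] inv_into_into[of "f u" f V]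
 by(auto simp:q_def)
 with assms have "inj_on q (f ` V)" by(auto simp:inj_on_def)
 moreover have "q ` f ` V = g ` V" unfolding image_image using q by(intro image_cong) auto
 ultimately show ?thesis using q by blast qed

lemma tmap_cong:
 "(!!u. u:V==>f u = g u)==>(!!u x w. (u,x,w):T==>u:V&w:V)
 ==>tmap f ` T = tmap g ` T" by(rule image_cong) (auto simp:tmap_def)

definition least_cong :: "('v \<times> 'k \<times> 'v) set => 'v set => ('v => nat) => bool" where
 "least_cong T V L<->fold_cong T L
 &(ALL h :: 'v => nat. fold_cong T h-->(ALL u:V. ALL w:V. L u = L w-->h u = h w))"

lemma fold_shape:
 fixes Z :: "(nat,'e,'x) lgraph"
 assumes wf:"lgraph_wf Z" "finite (lE Z)" and v:"v:lV Z" and least_cong:"least_cong (tri Z) (lV Z) L"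
 shows "EX (De :: (nat,'e,'x) lgraph) v' q. fold_step^** (Z,v) (De,v')&shape (De,v') (L ` lV Z) (tmap L ` tri Z) (L v) q"
proof -
 from fold_exhaust[OF wf,of v] obtain De f where De: "fold_step^** (Z,v) (De,f v)" "lgraph_wf De" "folded De"
 "finite (lE De)" "lV De = f ` lV Z" "tri De = tmap f ` tri Z"
 "!!(h :: nat => nat) u w. fold_cong (tri Z) h==>f u = f w==>h u = h w" by(metis (no_types,lifting))
 note T = triD[OF wf(1)]
 have L:"fold_cong (tri Z) L" using least_cong by(simp add:least_cong_def)
 define j :: "nat => nat" where "j = (%x. x)"
 have j:"inj_on j (lV Z)" by(simp add:j_def)
 have fin:"f u:lV De" if "u:lV Z" for u using De(5) that by auto
 have "f u = f w<->L u = L w" if uw:"u:lV Z" "w:lV Z" for u w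
 proof
 assume "f u = f w" thus "L u = L w" by(rule De(7)[OF L])
 next
 assume "L u = L w"
 define J where "J y = inv_into (lV Z) f y" for y
 have J:"f (J (f u)) = f u" "J (f u):lV Z" if "u:lV Z" for u using that by(auto simp:J_def f_inv_into_f inv_into_into)
 have "fold_cong (tri Z) (%u. j (J (f u)))"
 proof (rule fold_congI)
 fix a x b a' b' assume *: "(a,x,b):tri Z" "(a',x,b'):tri Z" "j (J (f a)) = j (J (f a'))"
 hence "f a = f a'" using J[of a] J[of a'] T(1,2)[OF *(1)] T(1,2)[OF *(2)] j by(metis inj_onD)
 moreover have "(f a,x,f b):tri De" "(f a',x,f b'):tri De" using * unfolding De(6) by(force simp:tmap_def)+
 ultimately show "j (J (f b)) = j (J (f b'))" using folded_tri[OF De(3)] by metis qed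
 hence "j (J (f u)) = j (J (f w))" using least_cong uw `L u = L w` unfolding least_cong_def by blast
 thus "f u = f w" using J[OF uw(1)] J[OF uw(2)] j by(metis inj_onD) qed
 hence "EX q. (ALL u:lV Z. q (f u) = L u)&inj_on q (f ` lV Z)&q ` f ` lV Z = L ` lV Z" by(rule factor_map)
 then obtain q where q:"ALL u:lV Z. q (f u) = L u" "inj_on q (f ` lV Z)"
 "q ` f ` lV Z = L ` lV Z" by(elim exE conjE)
 have "tmap q ` tri De = tmap L ` tri Z" unfolding De(6) tmap_image by(rule tmap_cong[of "lV Z"]) (use q T in auto)
 hence "shape (De,f v) (L ` lV Z) (tmap L ` tri Z) (L v) q" using De q v by(auto simp:shape_def)
 with De(1) show ?thesis by blast qed

text \<open>Identifying and then folding yields the quotient by the least folding congruence that contains the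
 identified pairs; hence the intermediate graph need not be computed.\<close>

lemma fold_to_quotient:
 fixes D :: "('v,'e,'x) lgraph" and L :: "'v => nat" and De :: "(nat,nat,'x) lgraph"
 assumes id:"identify D RV RE De f" and wf:"lgraph_wf D" "finite (lE D)" and v:"v:lV D"
 and RVV:"!!u w. (u,w):RV==>u:lV D&w:lV D" and RV:"!!u w. (u,w):RV==>L u = L w" and L:"fold_cong (tri D) L"
 and least:"!!(h :: 'v => nat) u w. fold_cong (tri D) h==>(!!u w. (u,w):RV==>h u = h w)
 ==>u:lV D==>w:lV D==>L u = L w==>h u = h w"
 and Z: "lgraph_wf Z" "folded Z" "lV Z = L ` lV D" "tri Z = tmap L ` tri D" shows "fold_to (De,f v) (Z,L v)"
proof -
 from id obtain g where g:"lgraph_wf De" "lgraph_hom D De f g" "f ` lV D = lV De" "g ` lE D = lE De"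
 and ker:"!!u w. u:lV D==>w:lV D==>f u = f w<->(u,w):(RV Un RV\<inverse>)\<^sup>*" unfolding identify_def by blast
 note T = triD[OF wf(1)]
 have triDe: "tri De = tmap f ` tri D"
 unfolding tri_def g(4)[symmetric] image_image using g(2) by(intro image_cong) (auto simp:lgraph_hom_def)
 define J where "J y = inv_into (lV D) f y" for y
 have J:"f (J (f u)) = f u" "J (f u):lV D" if "u:lV D" for u using that by(auto simp:J_def f_inv_into_f inv_into_into)
 have LJ:"L (J (f u)) = L u" if "u:lV D" for u
 using ker[of "J (f u)" u] J[OF that] that rtrancl_kernel[of "J (f u)" u RV L] RV by blast
 define M where "M = L \<circ> J"
 have M:"M (f u) = L u" if "u:lV D" for u using LJ[OF that] by(simp add:M_def)
 have fcM:"fold_cong (tri De) M" unfolding triDe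
 proof (rule fold_congI)
 fix a x b a' b' assume *: "(a,x,b):tmap f ` tri D" "(a',x,b'):tmap f ` tri D" "M a = M a'"
 then obtain a0 b0 a1 b1 where "(a0,x,b0):tri D" "(a1,x,b1):tri D" "a = f a0" "b = f b0" "a' = f a1" "b' = f b1"
 by(auto simp:tmap_def)
 with fold_congD[OF L,of a0 x b0 a1 b1] *(3) T show "M b = M b'" by(simp add:M) qed
 have leastM:"h u = h w" if h:"fold_cong (tri De) h" and uw:"u:lV De" "w:lV De" "M u = M w"
 for h :: "nat => nat" and u w
 proof -
 from uw obtain u0 w0 where 0:"u0:lV D" "w0:lV D" "u = f u0" "w = f w0" unfolding g(3)[symmetric] by auto
 have cf:"fold_cong (tri D) (h \<circ> f)"
 proof (rule fold_congI)
 fix a x b a' b' assume *: "(a,x,b):tri D" "(a',x,b'):tri D" "(h \<circ> f) a = (h \<circ> f) a'"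
 hence "(f a,x,f b):tri De" "(f a',x,f b'):tri De" unfolding triDe by(force simp:tmap_def)+
 from fold_congD[OF h this] *(3) show "(h \<circ> f) b = (h \<circ> f) b'" by simp qed
 have "f a = f b" if "(a,b):RV" for a b using that ker[of a b] RVV[OF that] by blast
 hence "(h \<circ> f) u0 = (h \<circ> f) w0" using least[OF cf,of u0 w0] 0 uw(3) M[OF 0(1)] M[OF 0(2)] by auto
 thus ?thesis using 0 by simp qed
 have fin:"finite (lE De)" using wf(2) g(4) by(metis finite_imageI)
 have fv:"f v:lV De" using v g(3) by blast
 have "least_cong (tri De) (lV De) M" using fcM leastM unfolding least_cong_def by blast
 from fold_shape[OF g(1) fin fv this] obtain De' v' q where
 De': "fold_step^** (De,f v) (De',v')" "shape (De',v') (M ` lV De) (tmap M ` tri De) (M (f v)) q" by(elim exE conjE)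
 have "M ` lV De = L ` lV D" unfolding g(3)[symmetric] image_image using M by(intro image_cong) auto
 moreover have "tmap M ` tri De = tmap L ` tri D"
 unfolding triDe tmap_image by(rule tmap_cong[of "lV D"]) (use M T in auto)
 ultimately have "pgraph_iso (De',v') (Z,L v)" using De'(2) Z M[OF v] by(intro shape_iso) auto
 moreover have "exhaust fold_step (De,f v) (De',v')"
 using De'(1) folded_no_step[OF shape_folded[OF De'(2)]] unfolding exhaust_def by blast
 ultimately show ?thesis by(auto simp:fold_to_def) qed

lemma equiv_generated:"equiv UNIV ((r Un r\<inverse>)\<^sup>*)"
 by(intro equivI refl_rtrancl sym_rtrancl trans_rtrancl sym_Un_converse) simp

lemma identify_exists:
 fixes D :: "('v,'e,'x) lgraph"
 assumes wf:"lgraph_wf D" and fin:"finite (lV D)" "finite (lE D)"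
 and RE:"!!d e. (d,e):RE==>d:lE D&e:lE D&lab D d = lab D e
 &(ltail D d,ltail D e):(RV Un RV\<inverse>)\<^sup>*&(lhead D d,lhead D e):(RV Un RV\<inverse>)\<^sup>*
 &(bar D d,bar D e):(RE Un RE\<inverse>)\<^sup>*" shows "EX (De :: (nat,nat,'x) lgraph) f. identify D RV RE De f"
proof -
 let ?EV = "(RV Un RV\<inverse>)\<^sup>*" and ?EE = "(RE Un RE\<inverse>)\<^sup>*"
 have symV:"(b,a):?EV" if "(a,b):?EV" for a b using equiv_generated[of RV] that by(auto simp:equiv_def dest:symD)
 have symE:"(b,a):?EE" if "(a,b):?EE" for a b using equiv_generated[of RE] that by(auto simp:equiv_def dest:symD)
 obtain j :: "'v set => nat" where j:"inj_on j ((%u. ?EV `` {u}) ` lV D)"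
 using finite_imp_inj_to_nat_seg[of "(%u. ?EV `` {u}) ` lV D"] fin by blast
 obtain k :: "'e set => nat" where k:"inj_on k ((%u. ?EE `` {u}) ` lE D)"
 using finite_imp_inj_to_nat_seg[of "(%u. ?EE `` {u}) ` lE D"] fin by blast
 define f where "f u = j (?EV `` {u})" for u
 define g where "g e = k (?EE `` {e})" for e
 have fk:"f u = f w<->(u,w):?EV" if "u:lV D" "w:lV D" for u w
 using inj_on_eq_iff[OF j,of "?EV `` {u}" "?EV `` {w}"] that eq_equiv_class_iff[OF equiv_generated,of u w RV]
 by(simp add:f_def)
 have gk:"g u = g w<->(u,w):?EE" if "u:lE D" "w:lE D" for u w
 using inj_on_eq_iff[OF k,of "?EE `` {u}" "?EE `` {w}"] that eq_equiv_class_iff[OF equiv_generated,of u w RE]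
 by(simp add:g_def)
 have EE:"e:lE D&lab D d = lab D e&(ltail D d,ltail D e):?EV&(lhead D d,lhead D e):?EV
 &(bar D d,bar D e):?EE" if "(d,e):?EE" "d:lE D" for d e using that
 proof (induction rule:rtrancl_induct)
 case (step e e')
 hence IH:"e:lE D" "lab D d = lab D e" "(ltail D d,ltail D e):?EV" "(lhead D d,lhead D e):?EV"
 "(bar D d,bar D e):?EE" by auto
 have "e':lE D&lab D e = lab D e'&(ltail D e,ltail D e'):?EV&(lhead D e,lhead D e'):?EV
 &(bar D e,bar D e'):?EE"
 proof (cases "(e,e'):RE")
 case True
 thus ?thesis using RE by blast
 next
 case False
 hence "(e',e):RE" using step by auto
 from RE[OF this] show ?thesis using symV symE by auto qed
 with IH show ?case by(auto intro:rtrancl_trans) qed auto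
 define G where "G a = inv_into (lE D) g a" for a
 have G:"G (g e):lE D" "(G (g e),e):?EE" if "e:lE D" for e
 proof -
 show a:"G (g e):lE D" using that by(simp add:G_def inv_into_into)
 have "g (G (g e)) = g e" using that by(simp add:G_def f_inv_into_f)
 thus "(G (g e),e):?EE" using gk a that by blast qed
 define De where "De = \<lparr>dig = \<lparr>verts = f ` lV D,arcs = g ` lE D,tail = %a. f (ltail D (G a)),
 head = %a. f (lhead D (G a))\<rparr>,bar = %a. if a:g ` lE D then g (bar D (G a)) else a,lab = %a. lab D (G a)\<rparr>"
 note W = lgraph_wfD[OF wf]
 have De: "ltail De (g e) = f (ltail D e)" "lhead De (g e) = f (lhead D e)" "lab De (g e) = lab D e"
 "bar De (g e) = g (bar D e)" if e:"e:lE D" for e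
 proof -
 note GG = G[OF e]
 note X = EE[OF GG(2) GG(1)]
 show "ltail De (g e) = f (ltail D e)" using X fk[of "ltail D (G (g e))" "ltail D e"] W(1) e GG by(simp add:De_def)
 show "lhead De (g e) = f (lhead D e)" using X fk[of "lhead D (G (g e))" "lhead D e"] W(2) e GG by(simp add:De_def)
 show "lab De (g e) = lab D e" using X by(simp add:De_def)
 show "bar De (g e) = g (bar D e)" using X gk[of "bar D (G (g e))" "bar D e"] W(3) e GG by(simp add:De_def) qed
 have ar:"lE De = g ` lE D" "lV De = f ` lV D" by(simp_all add:De_def)
 have "lgraph_wf De"
 proof (rule lgraph_wfI)
 fix a assume "a:lE De"
 then obtain e where e:"e:lE D" "a = g e" using ar by auto
 show "ltail De a:lV De&lhead De a:lV De&bar De a:lE De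
 &bar De (bar De a) = a&ltail De (bar De a) = lhead De a&lab De (bar De a) = inv_letter (lab De a)"
 unfolding e(2) ar using De[OF e(1)] De[OF W(3)[OF e(1)]] W[OF e(1)] by simp qed (simp add:De_def)
 moreover have "lgraph_hom D De f g" using De ar by(auto simp:lgraph_hom_def)
 ultimately have "identify D RV RE De f" unfolding identify_def using fk gk ar by blast
 thus ?thesis by blast qed

subsection \<open>Hairs\<close>

text \<open>Hairs in terms of triples: exactly one triple starts at \<open>u\<close>. The basepoint
 \<open>v\<close> is exempt.\<close>
definition hair :: "'w => 'w set \<times> ('w \<times> 'x letter \<times> 'w) set => 'w set \<times> ('w \<times> 'x letter \<times> 'w) set => bool" where
 "hair v P Q<->(EX u x w. (u,x,w):snd P&u~=v&(ALL y z. (u,y,z):snd P-->y = x&z = w)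
 &Q = (fst P - {u},snd P - {(u,x,w),(w,inv_letter x,u)}))"

lemma tri_subgr:"E<=lE H==>tri (subgr H V E) = {(ltail H e,lab H e,lhead H e)|e. e:E}" by(auto simp:tri_def subgr_def)

lemma subgr_simps [simp]:
 "lV (subgr H V E) = V" "lE (subgr H V E) = E" "ltail (subgr H V E) = ltail H"
 "lhead (subgr H V E) = lhead H" "lab (subgr H V E) = lab H"
 "bar (subgr H V E) = (%e. if e:E then bar H e else e)" by(simp_all add:subgr_def)

lemma subgr_wf:
 assumes "lgraph_wf H" "E<=lE H" "!!e. e:E==>ltail H e:V&bar H e:E" shows "lgraph_wf (subgr H V E)"
proof (rule lgraph_wfI)
 fix e assume "e:lE (subgr H V E)"
 hence e:"e:E" "e:lE H" using assms by auto
 note W = lgraph_wfD[OF assms(1) e(2)] and a = assms(3)[OF e(1)]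
 have h:"lhead H e:V" using assms(3)[of "bar H e"] a W(6) by auto
 show "ltail (subgr H V E) e:lV (subgr H V E)&lhead (subgr H V E) e:lV (subgr H V E) &
 bar (subgr H V E) e:lE (subgr H V E)&bar (subgr H V E) (bar (subgr H V E) e) = e &
 ltail (subgr H V E) (bar (subgr H V E) e) = lhead (subgr H V E) e &
 lab (subgr H V E) (bar (subgr H V E) e) = inv_letter (lab (subgr H V E) e)"
 unfolding subgr_simps using W a h e by simp qed simp

lemma hair_transfer:
 assumes sh:"shape (De,v') V T v q" and h:"hair v (V,T) (V',T')"
 shows "EX De'. cut_hair (De,v') (De',v')&shape (De',v') V' T' v q"
proof -
 from h[unfolded hair_def fst_conv snd_conv prod.inject] obtain u x w where
 1:"(u,x,w):T" "u~=v" "ALL y z. (u,y,z):T-->y = x&z = w"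
 "V' = V - {u}" "T' = T - {(u,x,w),(w,inv_letter x,u)}" by(elim exE conjE)
 have wf:"lgraph_wf De" and fo:"folded De" and fin:"finite (lE De)" and v': "v':lV De" "q v' = v"
 and q:"inj_on q (lV De)" "q ` lV De = V" "tmap q ` tri De = T" using sh by(auto simp:shape_def)
 note W = lgraph_wfD[OF wf]
 from 1(1) q(3) obtain e where e:"e:lE De" "u = q (ltail De e)" "x = lab De e" "w = q (lhead De e)"
 by(auto simp:tmap_def elim!: triE)
 let ?u = "ltail De e"
 have inT:"(q (ltail De a),lab De a,q (lhead De a)):T" if "a:lE De" for a
 using triI[OF that] q(3) by(force simp:tmap_def)
 have uniq:"a = e" if "a:lE De" "ltail De a = ?u" for a
 proof -
 have "lab De a = lab De e" using inT[OF that(1)] 1(3) unfolding that(2) e(2,3) by blast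
 with that e(1) fo show ?thesis by(simp add:folded_def) qed
 have "out_arcs (dig De) ?u = {e}" using uniq e by auto
 hence "cut_hair (De,v') (subgr De (lV De - {lhead De (bar De e)}) (lE De - {bar De e,bar De (bar De e)}),v')"
 using W[OF e(1)] 1(2) e(2) v'(2) by(intro cut_hair.intros) (simp_all add:out_degree_def,metis)
 hence cut:"cut_hair (De,v') (subgr De (lV De - {?u}) (lE De - {e,bar De e}),v')"
 using W[OF e(1)] by(simp add:insert_commute)
 let ?E = "lE De - {e,bar De e}" and ?V = "lV De - {?u}"
 have wf': "lgraph_wf (subgr De ?V ?E)"
 proof (rule subgr_wf[OF wf])
 fix a assume a:"a:?E"
 hence "bar De a~=e" "bar De a~=bar De e" using W(5)[of a] W(5)[OF e(1)] by auto
 thus "ltail De a:?V&bar De a:?E" using a W[of a] uniq[of a] by auto qed auto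
 have "tmap q ` tri (subgr De ?V ?E) = T'"
 proof (intro equalityI subsetI)
 fix t assume "t:tmap q ` tri (subgr De ?V ?E)"
 then obtain a where a:"a:?E" "t = (q (ltail De a),lab De a,q (lhead De a))" by(auto simp:tri_subgr tmap_def)
 have "ltail De a~=?u" using uniq[of a] a by auto
 hence "q (ltail De a)~=u" using q(1) W(1)[of a] W(1)[OF e(1)] a e(2) by(auto dest:inj_onD)
 moreover have "t~=(w,inv_letter x,u)"
 proof
 assume t:"t = (w,inv_letter x,u)"
 hence "ltail De a = lhead De e" using q(1) W(1)[of a] W(2)[OF e(1)] a e(4) by(auto dest:inj_onD)
 hence "a = bar De e" using fo t a W[OF e(1)] e(3) by(auto simp:folded_def)
 with a show False by simp qed
 ultimately show "t:T'" using inT[of a] a 1(5) by auto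
 next
 fix t assume t:"t:T'"
 then obtain a where a:"a:lE De" "t = (q (ltail De a),lab De a,q (lhead De a))"
 unfolding 1(5) using q(3) by(auto simp:tri_def tmap_def)
 have "a~=e" "a~=bar De e" using a t e 1(5) W[OF e(1)] by auto
 hence "(ltail De a,lab De a,lhead De a):tri (subgr De ?V ?E)" using a by(auto simp:tri_subgr)
 thus "t:tmap q ` tri (subgr De ?V ?E)" using a by(force simp:tmap_def) qed
 moreover have "q ` ?V = V'" using q(1,2) 1(4) e(2) W(1)[OF e(1)] by(auto dest:inj_onD)
 moreover have "v'~=?u" using 1(2) v'(2) e(2) by auto
 ultimately have "shape (subgr De ?V ?E,v') V' T' v q"
 using wf' fo fin v' inj_on_subset[OF q(1),of ?V] by(auto simp:shape_def folded_def)
 with cut show ?thesis by blast qed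

lemma hair_complete:
 assumes sh:"shape (De,v') V T v q" and c:"cut_hair (De,v') X" shows "EX V' T'. hair v (V,T) (V',T')"
proof -
 have wf:"lgraph_wf De" and v': "v':lV De" "q v' = v" and q:"inj_on q (lV De)" "tmap q ` tri De = T"
 using sh by(auto simp:shape_def)
 note W = lgraph_wfD[OF wf]
 from c obtain e where e:"e:lE De" "lhead De e~=v'" "out_degree (dig De) (lhead De e) = 1"
 by(auto elim:cut_hair.cases)
 then obtain a where oa:"out_arcs (dig De) (lhead De e) = {a}" by(auto simp:out_degree_def card_1_singleton_iff)
 have "bar De e:out_arcs (dig De) (lhead De e)" using W[OF e(1)] by simp
 with oa have ba:"bar De e = a" by simp
 have a:"b = bar De e" if "b:lE De" "ltail De b = lhead De e" for b
 proof -
 have "b:out_arcs (dig De) (lhead De e)" using that by simp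
 with oa ba show ?thesis by simp qed
 have "(q (lhead De e),lab De (bar De e),q (ltail De e)):T"
 using triI[OF W(3)[OF e(1)]] W[OF e(1)] q(2) by(force simp:tmap_def)
 moreover have "q (lhead De e)~=v" using q(1) v' e W(2)[OF e(1)] by(auto dest:inj_onD)
 moreover have "y = lab De (bar De e)&z = q (ltail De e)" if t:"(q (lhead De e),y,z):T" for y z
 proof -
 from t q(2) obtain b where b:"b:lE De" "q (lhead De e) = q (ltail De b)" "y = lab De b" "z = q (lhead De b)"
 by(auto simp:tmap_def elim!: triE)
 hence "ltail De b = lhead De e" using q(1) W(1)[OF b(1)] W(2)[OF e(1)] by(auto dest:inj_onD)
 from a[OF b(1) this] show ?thesis using b W[OF e(1)] by simp qed
 ultimately show ?thesis unfolding hair_def fst_conv snd_conv by blast qed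

text \<open>Cutting a hair creates no new folding, so one may first fold as far as possible and then cut
 hairs in the quotient.\<close>
lemma step2I:
 fixes Z :: "(nat,nat,'x) lgraph" and L :: "nat => nat"
 assumes wf:"lgraph_wf Z" "finite (lE Z)" and v:"v:lV Z" and L:"least_cong (tri Z) (lV Z) L"
 and ch:"(hair (L v))^** (L ` lV Z,tmap L ` tri Z) (V,T)" and ex:"!!X. ~ hair (L v) (V,T) X"
 and Z': "lgraph_wf Z'" "folded Z'" "lV Z' = V" "tri Z' = T" shows "step2 (Z,v) (Z',L v)"
proof -
 from fold_shape[OF wf v L] obtain De v' q where
 1:"fold_step^** (Z,v) (De,v')" "shape (De,v') (L ` lV Z) (tmap L ` tri Z) (L v) q" by(elim exE conjE)
 have "EX De'. cut_hair^** (De,v') (De',v')&shape (De',v') V T (L v) q" using ch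
 proof (induction "(V,T)" arbitrary: V T rule:rtranclp_induct)
 case base
 thus ?case using 1(2) by auto
 next
 case (step Y)
 obtain V0 T0 where Y:"Y = (V0,T0)" by(cases Y)
 from step(3)[OF Y] obtain De1 where De1:"cut_hair^** (De,v') (De1,v')" "shape (De1,v') V0 T0 (L v) q" by blast
 from hair_transfer[OF De1(2)] step(2) Y obtain De2 where
 "cut_hair (De1,v') (De2,v')" "shape (De2,v') V T (L v) q" by blast
 with De1 show ?case by(meson rtranclp.rtrancl_into_rtrancl) qed
 then obtain De' where 2:"cut_hair^** (De,v') (De',v')" "shape (De',v') V T (L v) q" by blast
 have "(sup fold_step cut_hair)^** (Z,v) (De',v')"
 using rtranclp_trans[OF predicate2D[OF rtranclp_mono[OF sup_ge1] 1(1)] predicate2D[OF rtranclp_mono[OF sup_ge2] 2(1)]] .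
 moreover have "~ (sup fold_step cut_hair) (De',v') X" for X
 proof
 assume "(sup fold_step cut_hair) (De',v') X"
 thus False
 proof (rule sup2E)
 assume "fold_step (De',v') X" thus False using folded_no_step[OF shape_folded[OF 2(2)]] by blast
 next
 assume "cut_hair (De',v') X" thus False using hair_complete[OF 2(2)] ex by blast qed qed
 moreover have "pgraph_iso (De',v') (Z',L v)" using shape_iso[OF 2(2) Z'] .
 ultimately show ?thesis unfolding step2_def exhaust_def by blast qed

section \<open>The action of the factors\<close>

fun trav :: "('v \<times> 'k \<times> 'v) set => 'v => 'k list => 'v => bool" where
 "trav T u [] w<->u = w"
| "trav T u (x # xs) w<->(EX z. (u,x,z):T&trav T z xs w)"

definition det :: "('v \<times> 'k \<times> 'v) set => bool" where
 "det T<->(ALL u x w w'. (u,x,w):T-->(u,x,w'):T-->w = w')"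

definition symm :: "('v \<times> 'x letter \<times> 'v) set => bool" where
 "symm T<->(ALL u x w. (u,x,w):T-->(w,inv_letter x,u):T)"

lemma detD:"det T==>(u,x,w):T==>(u,x,w'):T==>w = w'" unfolding det_def by blast

lemma symmD:"symm T==>(u,x,w):T==>(w,inv_letter x,u):T" unfolding symm_def by blast

lemma det_tri:"folded H==>det (tri H)" unfolding det_def by(intro allI impI) (rule folded_tri)

lemma symm_tri:"lgraph_wf H==>symm (tri H)" unfolding symm_def by(intro allI impI) (rule triD(3))

lemma trav_append:"trav T u (p @ q) w<->(EX z. trav T u p z&trav T z q w)" by(induction p arbitrary: u) auto

lemma trav_det:"det T==>trav T u p w==>trav T u p w'==>w = w'"
proof (induction p arbitrary: u)
 case (Cons x p)
 from Cons.prems(2,3) obtain z z' where "(u,x,z):T" "trav T z p w" "(u,x,z'):T" "trav T z' p w'" by auto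
 with detD[OF Cons.prems(1)] Cons.IH[OF Cons.prems(1)] show ?case by metis qed simp

lemma trav_inv:"symm T==>trav T u p w==>trav T w (inv_word p) u"
proof (induction p arbitrary: u)
 case (Cons x p)
 from Cons.prems(2) obtain z where z:"(u,x,z):T" "trav T z p w" by auto
 have "trav T z [inv_letter x] u" using symmD[OF Cons.prems(1) z(1)] by simp
 with Cons.IH[OF Cons.prems(1) z(2)] show ?case by(auto simp:trav_append simp del: trav.simps) qed simp

lemma trav_map:"trav T u p w==>trav (tmap f ` T) (f u) p (f w)"
proof (induction p arbitrary: u)
 case (Cons x p)
 then obtain z where "(u,x,z):T" "trav (tmap f ` T) (f z) p (f w)" by auto
 thus ?case by(force simp:tmap_def) qed simp

lemma trav_cong:"fold_cong T h==>h u = h u'==>trav T u p w==>trav T u' p w'==>h w = h w'"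
proof (induction p arbitrary: u u')
 case (Cons x p)
 from Cons.prems(3,4) obtain z z' where z:"(u,x,z):T" "trav T z p w" "(u',x,z'):T" "trav T z' p w'" by auto
 from Cons.IH[OF Cons.prems(1) fold_congD[OF Cons.prems(1) z(1,3) Cons.prems(2)] z(2,4)] show ?case . qed simp

lemma trav_mono:"trav T u p w==>(!!a x b. x:set p==>(a,x,b):T==>(a,x,b):T')==>trav T' u p w"
 by(induction p arbitrary: u) (simp,metis list.set_intros trav.simps(2))

lemma awalk_trav:
 assumes "lgraph_wf H" shows "(EX p. pre_digraph.awalk (dig H) u p v&map (lab H) p = w)<->u:lV H&trav (tri H) u w v"
proof -
 have 1:"trav (tri H) u (map (lab H) p) v" if "pre_digraph.cas (dig H) u p v" "set p<=lE H" for p u using that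
 proof (induction p arbitrary: u)
 case (Cons e p)
 hence "e:lE H" "ltail H e = u" "trav (tri H) (lhead H e) (map (lab H) p) v" by(auto simp:pre_digraph.cas.simps)
 with triI[of e H] show ?case by auto qed (simp add:pre_digraph.cas.simps)
 have 2:"EX p. pre_digraph.cas (dig H) u p v&set p<=lE H&map (lab H) p = w" if "trav (tri H) u w v" for u using that
 proof (induction w arbitrary: u)
 case (Cons x w)
 then obtain z where z:"(u,x,z):tri H" "trav (tri H) z w v" by auto
 from Cons.IH[OF z(2)] obtain p where p:"pre_digraph.cas (dig H) z p v" "set p<=lE H" "map (lab H) p = w" by blast
 from z(1) obtain e where "e:lE H" "u = ltail H e" "x = lab H e" "z = lhead H e" by(rule triE)
 with p show ?case by(intro exI[of _ "e # p"]) (simp add:pre_digraph.cas.simps)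
 qed (auto intro!: exI[of _ "[]"] simp:pre_digraph.cas.simps)
 show ?thesis unfolding pre_digraph.awalk_def using 1 2 by blast qed

context amalgam
begin

definition has :: "index => ('v \<times> 'x letter \<times> 'v) set => 'v => bool" where
 "has i T v<->(EX x:LX i. EX w. (v,x,w):T)"

lemma hasI:"x:LX i==>(v,x,w):T==>has i T v" unfolding has_def by blast

lemma has_trav:
 assumes "symm T" "has i T v" "p:WX i" "trav T v p w" shows "has i T w" using assms(2-4)
proof (induction p arbitrary: v)
 case (Cons x p)
 from Cons.prems obtain z where z:"(v,x,z):T" "trav T z p w" by auto
 have "has i T z" using symmD[OF assms(1) z(1)] Cons.prems(2) by(intro hasI[of "inv_letter x"]) auto
 with Cons z show ?case by auto qed simp

subsection \<open>Monochromatic components\<close>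

definition comp_V :: "index => ('v,'e,'x) lgraph => 'v => 'v set" where
 "comp_V i H v = {u. EX p:WX i. trav (tri H) v p u}"

definition comp_E :: "index => ('v,'e,'x) lgraph => 'v => 'e set" where
 "comp_E i H v = {e:lE H. ltail H e:comp_V i H v&lab H e:LX i}"

lemma comp_vertsI:"p:WX i==>trav (tri H) v p u==>u:comp_V i H v" unfolding comp_V_def by blast

lemma comp_V_refl:"v:comp_V i H v" by(rule comp_vertsI[of "[]"]) auto

lemma comp_V_step:
 assumes "u:comp_V i H v" "(u,x,w):tri H" "x:LX i" shows "w:comp_V i H v"
proof -
 from assms(1) obtain p where p:"p:WX i" "trav (tri H) v p u" unfolding comp_V_def by blast
 have "trav (tri H) v (p @ [x]) w" unfolding trav_append using p(2) assms(2) by auto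
 with p(1) assms(3) show ?thesis by(intro comp_vertsI[of "p @ [x]"]) auto qed

lemma comp_V_sub:"lgraph_wf H==>v:lV H==>comp_V i H v<=lV H"
proof -
 assume wf:"lgraph_wf H" and v:"v:lV H"
 have "trav (tri H) v p u==>u:lV H" for p u using v
 proof (induction p arbitrary: v)
 case (Cons x p)
 thus ?case using triD(2)[OF wf] by(metis trav.simps(2)) qed simp
 thus ?thesis by(auto simp:comp_V_def) qed

lemma comp_E_bar:
 assumes "lgraph_wf H" "e:comp_E i H v" shows "bar H e:comp_E i H v"
proof -
 have e:"e:lE H" "ltail H e:comp_V i H v" "lab H e:LX i" using assms(2) by(auto simp:comp_E_def)
 from comp_V_step[OF e(2) triI[OF e(1)] e(3)] lgraph_wfD[OF assms(1) e(1)] e(3)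
 show ?thesis by(simp add:comp_E_def) qed

lemma comp_wf:
 assumes "lgraph_wf H" shows "lgraph_wf (subgr H (comp_V i H v) (comp_E i H v))"
proof (rule subgr_wf[OF assms])
 fix e assume e:"e:comp_E i H v"
 thus "ltail H e:comp_V i H v&bar H e:comp_E i H v" using comp_E_bar[OF assms e] by(simp add:comp_E_def)
qed (auto simp:comp_E_def)

lemma comp_mono_subgraph:
 assumes wf:"lgraph_wf H" and h:"has i (tri H) v" shows "mono_subgraph i H (comp_V i H v) (comp_E i H v)"
proof -
 let ?V = "comp_V i H v" and ?E = "comp_E i H v"
 let ?S = "dig (subgr H ?V ?E)"
 from h obtain x w where xw:"x:LX i" "(v,x,w):tri H" unfolding has_def by blast
 then obtain e where "e:lE H" "v = ltail H e" "x = lab H e" by(auto elim:triE)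
 with xw comp_V_refl[of v i H] have ne:"?E~={}" unfolding comp_E_def by blast
 have v:"v:lV H" using triD(1)[OF wf xw(2)] .
 have wf': "lgraph_wf (subgr H ?V ?E)" by(rule comp_wf[OF wf])
 then interpret wf_digraph ?S by(simp add:lgraph_wf_def bidirected_digraph_def)
 have reach:"u \<rightarrow>\<^sup>*\<^bsub>?S\<^esub> w" if "trav (tri H) u p w" "p:WX i" "u:?V" for p u w using that
 proof (induction p arbitrary: u)
 case Nil
 thus ?case by(auto intro!: reachable_refl)
 next
 case (Cons x p)
 from Cons.prems obtain z where z:"(u,x,z):tri H" "trav (tri H) z p w" by auto
 from z(1) obtain e where e:"e:lE H" "u = ltail H e" "x = lab H e" "z = lhead H e" by(rule triE)
 have x:"x:LX i" "p:WX i" using Cons.prems(2) by auto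
 have "e:?E" using e x Cons.prems(3) unfolding comp_E_def by blast
 hence "u \<rightarrow>\<^bsub>?S\<^esub> z" unfolding arcs_ends_def arc_to_ends_def using e by force
 moreover have "z \<rightarrow>\<^sup>*\<^bsub>?S\<^esub> w"
 by(rule Cons.IH[OF z(2) x(2) comp_V_step[OF Cons.prems(3) z(1) x(1)]])
 ultimately show ?case by(rule adj_reachable_trans) qed
 have "strongly_connected ?S" unfolding strongly_connected_def
 proof (intro conjI ballI)
 show "verts ?S~={}" using comp_V_refl[of v i H] by auto
 fix a b assume "a:verts ?S" "b:verts ?S"
 hence ab:"a:?V" "b:?V" by auto
 then obtain p q where p:"p:WX i" "trav (tri H) v p a" and q:"q:WX i" "trav (tri H) v q b"
 unfolding comp_V_def by blast
 have t:"trav (tri H) a (inv_word p @ q) b"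
 unfolding trav_append using trav_inv[OF symm_tri[OF wf] p(2)] q(2) by blast
 show "a \<rightarrow>\<^sup>*\<^bsub>?S\<^esub> b" by(rule reach[OF t _ ab(1)]) (use p(1) q(1) in simp) qed
 moreover have "lab H ` ?E<=LX i" "?E<=lE H" by(auto simp:comp_E_def)
 ultimately show ?thesis unfolding mono_subgraph_def using comp_V_sub[OF wf v] ne wf' by blast qed

lemma mono_subgraph_sub:
 assumes wf:"lgraph_wf H" and m:"mono_subgraph i H V E" and v:"v:V"
 shows "V<=comp_V i H v" "E<=comp_E i H v" "has i (tri H) v"
proof -
 from m have m:"V<=lV H" "E<=lE H" "E~={}" "lgraph_wf (subgr H V E)"
 "strongly_connected (dig (subgr H V E))" "lab H ` E<=LX i" by(auto simp:mono_subgraph_def)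
 interpret wf_digraph "dig (subgr H V E)" using m(4) by(simp add:lgraph_wf_def bidirected_digraph_def)
 show V:"V<=comp_V i H v"
 proof
 fix u assume "u:V"
 hence "v \<rightarrow>\<^sup>*\<^bsub>dig (subgr H V E)\<^esub> u" using m(5) v by(auto simp:strongly_connected_def)
 thus "u:comp_V i H v"
 proof (induction rule:reachable_induct)
 case base
 show ?case by(rule comp_V_refl)
 next
 case (step x y)
 from step(2) obtain e where e:"e:E" "ltail H e = x" "lhead H e = y"
 unfolding arcs_ends_def arc_to_ends_def subgr_simps by blast
 have "(x,lab H e,y):tri H" using triI[of e H] e m(2) by blast
 moreover have "lab H e:LX i" using m(6) e(1) by blast
 ultimately show ?case by(rule comp_V_step[OF step(3)]) qed qed
 have tE:"ltail H e:V" if "e:E" for e using lgraph_wfD(1)[OF m(4),of e] that by simp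
 show "E<=comp_E i H v"
 proof
 fix e assume "e:E"
 thus "e:comp_E i H v" using tE[of e] V m(2,6) unfolding comp_E_def by blast qed
 from m(3) obtain e where e:"e:E" by blast
 have he:"has i (tri H) (ltail H e)" using triI[of e H] e m(2,6) by(intro hasI[of "lab H e"]) auto
 have "ltail H e:comp_V i H v" using tE[OF e] V by blast
 then obtain p where p:"p:WX i" "trav (tri H) v p (ltail H e)" unfolding comp_V_def by blast
 have "inv_word p:WX i" using p(1) by simp
 from has_trav[OF symm_tri[OF wf] he this trav_inv[OF symm_tri[OF wf] p(2)]] show "has i (tri H) v" . qed

lemma mono_component_comp:
 assumes wf:"lgraph_wf H" and h:"has i (tri H) v" shows "mono_component i H (comp_V i H v) (comp_E i H v)"
 unfolding mono_component_def
proof (intro conjI allI impI)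
 show "mono_subgraph i H (comp_V i H v) (comp_E i H v)" by(rule comp_mono_subgraph[OF wf h])
 fix V' E' assume *: "mono_subgraph i H V' E'&comp_V i H v<=V'&comp_E i H v<=E'"
 hence "v:V'" using comp_V_refl[of v i H] by blast
 with * mono_subgraph_sub[OF wf,of i V' E' v] show "V' = comp_V i H v" "E' = comp_E i H v" by blast+ qed

lemma mono_componentD:
 assumes wf:"lgraph_wf H" and m:"mono_component i H V E" and v:"v:V"
 shows "has i (tri H) v" "V = comp_V i H v" "E = comp_E i H v"
proof -
 have m': "mono_subgraph i H V E" using m unfolding mono_component_def by blast
 note s = mono_subgraph_sub[OF wf m' v]
 show "has i (tri H) v" by(rule s(3))
 from comp_mono_subgraph[OF wf s(3)] m s(1,2)
 show "V = comp_V i H v" "E = comp_E i H v" unfolding mono_component_def by blast+ qed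

lemma mono_component_nonempty:"mono_component i H V E==>V~={}"
 unfolding mono_component_def mono_subgraph_def strongly_connected_def by simp

subsection \<open>Graphs based on Cayley graphs\<close>

text \<open>In a graph without further foldings in which every monochromatic component is a relative Cayley
 graph, the factors act on the vertices of their colour. These are the two properties of a Cayley
 graph that give the action: every letter can be read everywhere, and relators are closed walks.\<close>

definition based :: "('v \<times> 'x letter \<times> 'v) set => bool" where
 "based T<->det T&symm T&(ALL u x w. (u,x,w):T-->x:letters XX)
 &(ALL i v. has i T v-->(ALL x:LX i. EX w. (v,x,w):T))
 &(ALL i v. has i T v-->(ALL r:WX i. elt i r = \<one>[i]-->trav T v r v))"

lemma basedD:
 assumes "based T" shows "det T" "symm T" "(u,x,w):T==>x:letters XX"
 "has i T v==>x:LX i==>EX w. (v,x,w):T"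
 "has i T v==>r:WX i==>elt i r = \<one>[i]==>trav T v r v" using assms unfolding based_def by blast+

definition act :: "index => ('v \<times> 'x letter \<times> 'v) set => 'v => 'x word set => 'v" where
 "act i T v g = (SOME u. EX p:WX i. elt i p = g&trav T v p u)"

context
 fixes T :: "('v \<times> 'x letter \<times> 'v) set"
 assumes based:"based T"
begin

lemma based_trav_ex:
 assumes "has i T v" "p:WX i" shows "EX u. trav T v p u" using assms
proof (induction p arbitrary: v)
 case (Cons x p)
 hence "x:LX i" by simp
 from basedD(4)[OF based Cons.prems(1) this] obtain z where z:"(v,x,z):T" by blast
 have "has i T z" using symmD[OF basedD(2)[OF based] z] Cons.prems(2) by(intro hasI[of "inv_letter x"]) auto
 with Cons obtain u where "trav T z p u" by auto
 with z show ?case by auto qed (metis trav.simps(1))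

lemma based_trav_eq:
 assumes h:"has i T v" and p:"p:WX i" "trav T v p u" and q:"q:WX i" "trav T v q w" and e:"elt i p = elt i q"
 shows "u = w"
proof -
 interpret group "factor i" by(rule grp)
 note B = basedD[OF based]
 have iq:"inv_word q:WX i" using q by simp
 have hu:"has i T u" by(rule has_trav[OF B(2) h p])
 from based_trav_ex[OF hu iq] obtain z where z:"trav T u (inv_word q) z" by blast
 have "trav T v (p @ inv_word q) z" unfolding trav_append using p(2) z by blast
 moreover have "elt i (p @ inv_word q) = \<one>[i]" using p(1) q(1) by(simp add:elt_append elt_inv_word e)
 hence "trav T v (p @ inv_word q) v" using B(5)[OF h] p(1) iq by simp
 ultimately have "z = v" by(rule trav_det[OF B(1)])
 with trav_inv[OF B(2) z] have "trav T v q u" by simp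
 with q(2) show "u = w" by(meson trav_det[OF B(1)]) qed

text \<open>Reading one word forwards and another one with the same value backwards is a walk with trivial
 value, which is closed; so the end of a walk depends on the value of its label only.\<close>
lemma act_trav:
 assumes "has i T v" "p:WX i" shows "trav T v p u<->u = act i T v (elt i p)"
proof -
 from based_trav_ex[OF assms] obtain w where w:"trav T v p w" by blast
 hence "EX w. EX q:WX i. elt i q = elt i p&trav T v q w" using assms(2) by blast
 from someI_ex[OF this] obtain q where q:"q:WX i" "elt i q = elt i p" "trav T v q (act i T v (elt i p))"
 unfolding act_def by blast
 have "act i T v (elt i p) = w" by(rule based_trav_eq[OF assms(1) q(1,3) assms(2) w q(2)])
 with w show ?thesis using trav_det[OF basedD(1)[OF based] w] by blast qed

lemma act_one:"has i T v==>act i T v \<one>[i] = v" using act_trav[of i v "[]" v] by(simp add:elt_Nil)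

lemma act_word:
 assumes "g:FC i" "has i T v"
 obtains p where "p:WX i" "elt i p = g" "trav T v p (act i T v g)"
proof -
 from assms(1) obtain p where p:"p:WX i" "elt i p = g" by(auto simp:carrier_factor)
 with act_trav[OF assms(2) p(1)] that show ?thesis by blast qed

lemma has_act:"g:FC i==>has i T v==>has i T (act i T v g)" by(metis act_word has_trav basedD(2) based)

lemma act_mult:
 assumes "g:FC i" "h:FC i" "has i T v" shows "act i T v (g \<odot>[i] h) = act i T (act i T v g) h"
proof -
 from act_word[OF assms(1,3)] obtain p where p:"p:WX i" "elt i p = g" "trav T v p (act i T v g)" .
 from act_word[OF assms(2) has_act[OF assms(1,3)]] obtain q where
 q:"q:WX i" "elt i q = h" "trav T (act i T v g) q (act i T (act i T v g) h)" .
 have "trav T v (p @ q) (act i T (act i T v g) h)" unfolding trav_append using p(3) q(3) by blast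
 with act_trav[OF assms(3),of "p @ q"] p q show ?thesis by(simp add:elt_append) qed

definition stab :: "index => 'v => 'x word set set" where
 "stab i v = {g:FC i. act i T v g = v}"

lemma act_eq_iff:
 assumes "g:FC i" "h:FC i" "has i T v" shows "act i T v g = act i T v h<->g \<odot>[i] inv[i] h:stab i v"
proof -
 interpret group "factor i" by(rule grp)
 have 1:"act i T v (g \<odot>[i] inv[i] h) = act i T (act i T v g) (inv[i] h)" using assms by(intro act_mult) auto
 have 2:"act i T (act i T v h) (inv[i] h) = v" using assms act_mult[of h i "inv[i] h" v] by(simp add:act_one)
 have 3:"act i T v (g \<odot>[i] inv[i] h \<odot>[i] h) = act i T (act i T v (g \<odot>[i] inv[i] h)) h"
 using assms by(intro act_mult) auto
 have 4:"g \<odot>[i] inv[i] h \<odot>[i] h = g" using assms by(simp add:m_assoc)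
 show ?thesis
 proof
 assume "act i T v g = act i T v h"
 with 1 2 show "g \<odot>[i] inv[i] h:stab i v" using assms by(simp add:stab_def)
 next
 assume "g \<odot>[i] inv[i] h:stab i v"
 hence "act i T v (g \<odot>[i] inv[i] h) = v" by(simp add:stab_def)
 with 3 4 show "act i T v g = act i T v h" by simp qed qed

lemma stab_subgroup:
 assumes "has i T v" shows "subgroup (stab i v) (factor i)"
proof -
 interpret group "factor i" by(rule grp)
 show ?thesis
 proof (rule subgroupI)
 show "stab i v<=FC i" by(auto simp:stab_def)
 show "stab i v~={}" using act_one[OF assms] one_closed unfolding stab_def by blast
 next
 fix a assume a:"a:stab i v"
 hence "act i T v \<one>[i] = act i T v a" "a:FC i" using act_one[OF assms] by(auto simp:stab_def)
 with act_eq_iff[OF one_closed this(2) assms] show "inv[i] a:stab i v" by simp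
 next
 fix a b assume "a:stab i v" "b:stab i v"
 thus "a \<odot>[i] b:stab i v" using act_mult[of a i b v] assms by(auto simp:stab_def) qed qed

lemma coset_stab:
 assumes "has i T v" "g:FC i" shows "stab i v #>[i] g = {h:FC i. act i T v h = act i T v g}"
proof -
 interpret group "factor i" by(rule grp)
 show ?thesis
 proof (intro equalityI subsetI)
 fix h assume "h:stab i v #>[i] g"
 then obtain s where s:"s:stab i v" "h = s \<odot>[i] g" unfolding r_coset_def by blast
 hence "s:FC i" "act i T v s = v" by(auto simp:stab_def)
 with s act_mult[of s i g v] assms show "h:{h:FC i. act i T v h = act i T v g}" by simp
 next
 fix h assume h:"h:{h:FC i. act i T v h = act i T v g}"
 hence "h \<odot>[i] inv[i] g:stab i v" using act_eq_iff[of h i g v] assms by simp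
 moreover have "h = h \<odot>[i] inv[i] g \<odot>[i] g" using h assms by(simp add:m_assoc)
 ultimately show "h:stab i v #>[i] g" unfolding r_coset_def by blast qed qed

end

lemma comp_V_act:
 assumes "lgraph_wf H" "based (tri H)" "has i (tri H) v" shows "comp_V i H v = act i (tri H) v ` FC i"
proof (intro equalityI subsetI)
 fix u assume "u:comp_V i H v"
 then obtain p where p:"p:WX i" "trav (tri H) v p u" unfolding comp_V_def by blast
 with act_trav[OF assms(2,3) p(1)] show "u:act i (tri H) v ` FC i" by auto
next
 fix u assume "u:act i (tri H) v ` FC i"
 then obtain g where g:"g:FC i" "u = act i (tri H) v g" by blast
 from act_word[OF assms(2) g(1) assms(3)] obtain p where "p:WX i" "trav (tri H) v p u" using g(2) by blast
 thus "u:comp_V i H v" by(rule comp_vertsI) qed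

subsection \<open>Relative Cayley graphs\<close>

lemma cayley_simps [simp]:
 "lV (cayley i S) = rcosets[i] S" "lE (cayley i S) = (rcosets[i] S) \<times> LX i"
 "ltail (cayley i S) (c,x) = c" "lhead (cayley i S) (c,x) = c #>[i] elt i [x]"
 "lab (cayley i S) (c,x) = x"
 "bar (cayley i S) (c,x) = (if c:rcosets[i] S&x:LX i then (c #>[i] elt i [x],inv_letter x) else (c,x))"
 by(simp_all add:cayley_def)

lemma elt_inv_letter:"x:LX i==>elt i [inv_letter x] = inv[i] elt i [x]" using elt_inv_word[of "[x]" i] by simp

context
 fixes i S assumes S:"subgroup S (factor i)"
begin

lemma rcoset_mult:
 "g:FC i==>h:FC i==>S #>[i] g #>[i] h = S #>[i] (g \<odot>[i] h)"
 using group.coset_mult_assoc[OF grp subgroup.subset[OF S]] .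

lemma rcosets_eq:"rcosets[i] S = (%g. S #>[i] g) ` FC i" by(auto simp:RCOSETS_def)

lemma cayley_wf:"lgraph_wf (cayley i S)"
proof (rule lgraph_wfI)
 interpret group "factor i" by(rule grp)
 fix e assume "e:lE (cayley i S)"
 then obtain g x where e:"e = (S #>[i] g,x)" "g:FC i" "x:LX i" by(auto simp:rcosets_eq)
 let ?h = "g \<odot>[i] elt i [x]"
 have c:"elt i [x]:FC i" "?h:FC i" using e by auto
 have m:"S #>[i] g #>[i] elt i [x] = S #>[i] ?h" by(rule rcoset_mult[OF e(2) c(1)])
 have r:"S #>[i] ?h #>[i] elt i [inv_letter x] = S #>[i] g" using e c by(simp add:rcoset_mult elt_inv_letter m_assoc)
 have v:"S #>[i] g:rcosets[i] S" "S #>[i] ?h:rcosets[i] S" using e(2) c(2) unfolding rcosets_eq by blast+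
 show "ltail (cayley i S) e:lV (cayley i S)&lhead (cayley i S) e:lV (cayley i S) &
 bar (cayley i S) e:lE (cayley i S)&bar (cayley i S) (bar (cayley i S) e) = e &
 ltail (cayley i S) (bar (cayley i S) e) = lhead (cayley i S) e &
 lab (cayley i S) (bar (cayley i S) e) = inv_letter (lab (cayley i S) e)" using v r e(3) by(simp add:e(1) m)
qed (auto split:prod.splits simp:cayley_def)

lemma cayley_folded:"folded (cayley i S)" by(auto simp:folded_def)

lemma tri_cayley:
 "tri (cayley i S) = {(S #>[i] g,x,S #>[i] (g \<odot>[i] elt i [x]))|g x. g:FC i&x:LX i}"
proof -
 have "tri (cayley i S) = (%(c,x). (c,x,c #>[i] elt i [x])) ` ((rcosets[i] S) \<times> LX i)"
 unfolding tri_def by(intro image_cong) auto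
 also have "\<dots> = {(S #>[i] g,x,S #>[i] g #>[i] elt i [x])|g x. g:FC i&x:LX i}" unfolding rcosets_eq by auto
 also have "\<dots> = {(S #>[i] g,x,S #>[i] (g \<odot>[i] elt i [x]))|g x. g:FC i&x:LX i}"
 proof -
 have "S #>[i] g #>[i] elt i [x] = S #>[i] (g \<odot>[i] elt i [x])" if "g:FC i" "x:LX i" for g x
 using that by(intro rcoset_mult) auto
 thus ?thesis by(intro Collect_cong ex_cong1) blast qed
 finally show ?thesis . qed

lemma S_coset:"S #>[i] \<one>[i] = S" using group.coset_mult_one[OF grp subgroup.subset[OF S]] .

end

text \<open>The component of a vertex is the Cayley graph relative to its stabilizer: a vertex corresponds to
 the set of the group elements that lead to it, which is a coset.\<close>

lemma component_cayley:
 assumes wf:"lgraph_wf H" and fo:"folded H" and b:"based (tri H)" and h:"has i (tri H) v"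
 shows "pgraph_iso (subgr H (comp_V i H v) (comp_E i H v),v) (cayley i (stab (tri H) i v),stab (tri H) i v)"
proof (rule iso_folded)
 interpret group "factor i" by(rule grp)
 let ?V = "comp_V i H v" and ?E = "comp_E i H v" and ?T = "tri H"
 let ?S = "stab ?T i v"
 have S:"subgroup ?S (factor i)" by(rule stab_subgroup[OF b h])
 note V = comp_V_act[OF wf b h]
 define f where "f u = {g:FC i. act i ?T v g = u}" for u
 have f:"f (act i ?T v g) = ?S #>[i] g" if "g:FC i" for g using coset_stab[OF b h that] by(simp add:f_def)
 show "lgraph_wf (subgr H ?V ?E)" by(rule comp_wf[OF wf])
 show "lgraph_wf (cayley i ?S)" by(rule cayley_wf[OF S])
 show "folded (cayley i ?S)" by(rule cayley_folded[OF S])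
 show "folded (subgr H ?V ?E)" using fo by(auto simp:folded_def comp_E_def)
 show "inj_on f (lV (subgr H ?V ?E))" unfolding subgr_simps V by(rule inj_onI) (auto simp:f_def)
 show "lV (cayley i ?S) = f ` lV (subgr H ?V ?E)"
 unfolding subgr_simps cayley_simps V rcosets_eq[OF S] image_image by(intro image_cong) (auto simp:f)
 show "v:lV (subgr H ?V ?E)" by(simp add:comp_V_refl)
 show "?S = f v" by(simp add:f_def stab_def[OF b])
 show "tri (cayley i ?S) = tmap f ` tri (subgr H ?V ?E)"
 proof (intro equalityI subsetI)
 fix t assume "t:tri (cayley i ?S)"
 then obtain g x where g:"g:FC i" "x:LX i"
 "t = (?S #>[i] g,x,?S #>[i] (g \<odot>[i] elt i [x]))" unfolding tri_cayley[OF S] by blast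
 let ?u = "act i ?T v g"
 have hu:"has i ?T ?u" by(rule has_act[OF b g(1) h])
 have "trav ?T ?u [x] (act i ?T ?u (elt i [x]))" using act_trav[OF b hu,of "[x]"] g(2) by simp
 hence "(?u,x,act i ?T v (g \<odot>[i] elt i [x])):?T" using act_mult[OF b g(1) _ h,of "elt i [x]"] g(2) by simp
 then obtain e where e:"e:lE H" "?u = ltail H e" "x = lab H e" "act i ?T v (g \<odot>[i] elt i [x]) = lhead H e" by(rule triE)
 have "?u:?V" using g(1) unfolding V by blast
 hence "e:?E" using e g(2) by(simp add:comp_E_def)
 hence "(ltail H e,lab H e,lhead H e):tri (subgr H ?V ?E)" using triI[of e "subgr H ?V ?E"] by simp
 moreover have "t = tmap f (ltail H e,lab H e,lhead H e)"
 using g(3) f[OF g(1)] f[of "g \<odot>[i] elt i [x]"] g(1,2) unfolding e(2)[symmetric] e(3)[symmetric] e(4)[symmetric] by simp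
 ultimately show "t:tmap f ` tri (subgr H ?V ?E)" by blast
 next
 fix t assume "t:tmap f ` tri (subgr H ?V ?E)"
 then obtain e where e:"e:?E" "t = (f (ltail H e),lab H e,f (lhead H e))" by(auto simp:tri_def)
 hence e': "e:lE H" "ltail H e:?V" "lab H e:LX i" by(auto simp:comp_E_def)
 from e'(2) obtain g where g:"g:FC i" "ltail H e = act i ?T v g" unfolding V by blast
 have hu:"has i ?T (act i ?T v g)" by(rule has_act[OF b g(1) h])
 have "trav ?T (act i ?T v g) [lab H e] (lhead H e)" using triI[OF e'(1)] g(2) by simp
 hence "lhead H e = act i ?T v (g \<odot>[i] elt i [lab H e])"
 using act_trav[OF b hu,of "[lab H e]"] e'(3) act_mult[OF b g(1) _ h,of "elt i [lab H e]"] by simp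
 hence "t = (?S #>[i] g,lab H e,?S #>[i] (g \<odot>[i] elt i [lab H e]))"
 using e(2) g f[OF g(1)] f[of "g \<odot>[i] elt i [lab H e]"] e'(3) by simp
 thus "t:tri (cayley i ?S)" unfolding tri_cayley[OF S] using g(1) e'(3) by blast qed qed

lemma trav_cayley:
 assumes S:"subgroup S (factor i)" shows "p:WX i==>g:FC i
 ==>trav (tri (cayley i S)) (S #>[i] g) p (S #>[i] (g \<odot>[i] elt i p))"
proof (induction p arbitrary: g)
 case Nil
 interpret group "factor i" by(rule grp)
 from Nil show ?case by(simp add:elt_Nil)
next
 case (Cons x p)
 interpret group "factor i" by(rule grp)
 have x:"x:LX i" "p:WX i" using Cons.prems by auto
 have c:"elt i [x]:FC i" "elt i p:FC i" "g \<odot>[i] elt i [x]:FC i" using x Cons.prems(2) by auto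
 have "(S #>[i] g,x,S #>[i] (g \<odot>[i] elt i [x])):tri (cayley i S)"
 unfolding tri_cayley[OF S] using x(1) Cons.prems(2) by blast
 moreover have eq:"g \<odot>[i] elt i (x # p) = g \<odot>[i] elt i [x] \<odot>[i] elt i p"
 using elt_Cons[OF x] m_assoc[OF Cons.prems(2) c(1,2)] by simp
 ultimately show ?case unfolding trav.simps eq using Cons.IH[OF x(2) c(3)] by blast qed

text \<open>Isomorphisms preserve closed walks, so the subgroup whose relative Cayley graph the component is
 can be no other than the stabilizer.\<close>
lemma stab_of_iso:
 assumes wf:"lgraph_wf H" and b:"based (tri H)" and h:"has i (tri H) v" and S:"subgroup S (factor i)"
 and iso:"pgraph_iso (subgr H (comp_V i H v) (comp_E i H v),v) (cayley i S,S)" shows "stab (tri H) i v = S"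
proof -
 interpret group "factor i" by(rule grp)
 let ?V = "comp_V i H v" and ?E = "comp_E i H v" and ?T = "tri H"
 from iso comp_wf[OF wf] obtain f where f:"bij_betw f (lV (subgr H ?V ?E)) (lV (cayley i S))" "f v = S"
 "tri (cayley i S) = tmap f ` tri (subgr H ?V ?E)" by(rule pgraph_iso_tri)
 have inE:"trav (tri (subgr H ?V ?E)) u p w" if "trav ?T u p w" "p:WX i" "u:?V" for p u w using that
 proof (induction p arbitrary: u)
 case (Cons x p)
 from Cons.prems obtain z where z:"(u,x,z):?T" "trav ?T z p w" by auto
 have x:"x:LX i" "p:WX i" using Cons.prems by auto
 from z(1) obtain e where e:"e:lE H" "u = ltail H e" "x = lab H e" "z = lhead H e" by(rule triE)
 have "e:?E" using e x Cons.prems(3) by(simp add:comp_E_def)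
 hence "(u,x,z):tri (subgr H ?V ?E)" using triI[of e "subgr H ?V ?E"] e by simp
 with Cons.IH[OF z(2) x(2) comp_V_step[OF Cons.prems(3) z(1) x(1)]] show ?case by auto qed simp
 have key:"f (act i ?T v g) = S #>[i] g" if g:"g:FC i" for g
 proof -
 from act_word[OF b g h] obtain p where p:"p:WX i" "elt i p = g" "trav ?T v p (act i ?T v g)" .
 have "trav (tri (cayley i S)) (f v) p (f (act i ?T v g))"
 unfolding f(3) by(rule trav_map[OF inE[OF p(3,1) comp_V_refl]])
 moreover have "trav (tri (cayley i S)) (f v) p (S #>[i] g)"
 using trav_cayley[OF S p(1) one_closed] p(2) g S_coset[OF S] f(2) by simp
 ultimately show ?thesis by(rule trav_det[OF det_tri[OF cayley_folded[OF S]]]) qed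
 have "act i ?T v g = v<->g:S" if g:"g:FC i" for g
 proof -
 have inV:"act i ?T v g:?V" using comp_V_act[OF wf b h] g by blast
 have "act i ?T v g = v<->f (act i ?T v g) = f v"
 using f(1) inV comp_V_refl[of v i H] by(auto simp:bij_betw_def dest:inj_onD)
 also have "\<dots><->S #>[i] g = S" by(simp add:key[OF g] f(2))
 also have "\<dots><->g:S" using coset_join1[OF _ g S] coset_join2[OF g S] by blast
 finally show ?thesis . qed
 thus ?thesis using subgroup.subset[OF S] unfolding stab_def[OF b] by blast qed

end

section \<open>Gluing Cayley graphs\<close>

lemma in_Plus [simp]:"Inl a:A <+> B<->a:A" "Inr b:A <+> B<->b:B" by auto

lemma djunion_simps [simp]:
 "lV (djunion Z P F) = lV Z <+> (SIGMA p:P. lV (F p))"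
 "lE (djunion Z P F) = lE Z <+> (SIGMA p:P. lE (F p))"
 "ltail (djunion Z P F) (Inl e) = Inl (ltail Z e)"
 "ltail (djunion Z P F) (Inr (p,d)) = Inr (p,ltail (F p) d)"
 "lhead (djunion Z P F) (Inl e) = Inl (lhead Z e)"
 "lhead (djunion Z P F) (Inr (p,d)) = Inr (p,lhead (F p) d)"
 "bar (djunion Z P F) (Inl e) = Inl (bar Z e)"
 "bar (djunion Z P F) (Inr (p,d)) = Inr (p,if p:P then bar (F p) d else d)"
 "lab (djunion Z P F) (Inl e) = lab Z e"
 "lab (djunion Z P F) (Inr (p,d)) = lab (F p) d" by(simp_all add:djunion_def)

lemma djunion_wf:
 assumes "lgraph_wf Z" "!!p. p:P==>lgraph_wf (F p)" shows "lgraph_wf (djunion Z P F)"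
proof (rule lgraph_wfI)
 fix a assume "a:lE (djunion Z P F)"
 then consider e where "a = Inl e" "e:lE Z"|p d where "a = Inr (p,d)" "p:P" "d:lE (F p)" by auto
 thus "ltail (djunion Z P F) a:lV (djunion Z P F)&lhead (djunion Z P F) a:lV (djunion Z P F)
 &bar (djunion Z P F) a:lE (djunion Z P F)&bar (djunion Z P F) (bar (djunion Z P F) a) = a
 &ltail (djunion Z P F) (bar (djunion Z P F) a) = lhead (djunion Z P F) a
 &lab (djunion Z P F) (bar (djunion Z P F) a) = inv_letter (lab (djunion Z P F) a)"
 proof cases
 case 1
 with lgraph_wfD[OF assms(1) 1(2)] show ?thesis by simp
 next
 case 2
 with lgraph_wfD[OF assms(2)[OF 2(2)] 2(3)] show ?thesis by simp qed
next
 have bar_out:"bar H e = e" if "lgraph_wf H" "e ~: lE H" for H :: "('y,'z,'u) lgraph" and e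
 using that bidirected_digraph.arev_dom by(fastforce simp:lgraph_wf_def)
 fix a assume a:"a ~: lE (djunion Z P F)"
 show "bar (djunion Z P F) a = a"
 proof (cases a)
 case (Inl e)
 with a bar_out[OF assms(1),of e] show ?thesis by simp
 next
 case (Inr pd)
 obtain p d where "pd = (p,d)" by(cases pd)
 with Inr a bar_out[OF assms(2),of p d] show ?thesis by auto qed qed

lemma tri_djunion:
 "tri (djunion Z P F) = tmap Inl ` tri Z Un (\<Union>p\<in>P. tmap (%c. Inr (p,c)) ` tri (F p))"
proof -
 have "tri (djunion Z P F) = (%e. (ltail (djunion Z P F) e,lab (djunion Z P F) e,lhead (djunion Z P F) e)) `
 (Inl ` lE Z Un (\<Union>p\<in>P. (%d. Inr (p,d)) ` lE (F p)))"
 unfolding tri_def by(intro arg_cong[of _ _ "(`) _"]) auto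
 thus ?thesis by(simp add:image_Un image_UN image_image tri_def) qed

context amalgam
begin

lemma triv_coset:"g:FC i==>{\<one>[i]} #>[i] g = {g}"
proof -
 interpret group "factor i" by(rule grp)
 show "g:FC i==>{\<one>[i]} #>[i] g = {g}" by(simp add:r_coset_def) qed

lemma triv_sub:"subgroup {\<one>[i]} (factor i)" by(rule group.triv_subgroup[OF grp])

lemma m_cl: "g:FC i==>h:FC i==>g \<odot>[i] h:FC i" by(rule monoid.m_closed[OF group.is_monoid[OF grp]])

lemma m_assoc': "g:FC i==>h:FC i==>k:FC i
==>g \<odot>[i] h \<odot>[i] k = g \<odot>[i] (h \<odot>[i] k)" by(rule monoid.m_assoc[OF group.is_monoid[OF grp]])

lemma one_cl: "\<one>[i]:FC i" by(rule monoid.one_closed[OF group.is_monoid[OF grp]])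

lemma l_one': "g:FC i==>\<one>[i] \<odot>[i] g = g" by(rule monoid.l_one[OF group.is_monoid[OF grp]])

lemma r_one': "g:FC i==>g \<odot>[i] \<one>[i] = g" by(rule monoid.r_one[OF group.is_monoid[OF grp]])

lemma cayley1_verts:"lV (cayley1 i) = (%g. {g}) ` FC i"
 unfolding cayley_simps rcosets_eq[OF triv_sub] by(intro image_cong HOL.refl) (rule triv_coset)

lemma tri_cayley1:
 "tri (cayley1 i) = {({g},x,{g \<odot>[i] elt i [x]})|g x. g:FC i&x:LX i}"
proof -
 have "({\<one>[i]} #>[i] g,x,{\<one>[i]} #>[i] (g \<odot>[i] elt i [x])) = ({g},x,{g \<odot>[i] elt i [x]})"
 if "g:FC i" "x:LX i" for g x using that by(simp add:triv_coset m_cl)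
 thus ?thesis unfolding tri_cayley[OF triv_sub] by(intro Collect_cong ex_cong1) metis qed

lemma trav_cayley1:
 assumes "p:WX i" "g:FC i" shows "trav (tri (cayley1 i)) {g} p {g \<odot>[i] elt i p}"
 using trav_cayley[OF triv_sub assms] assms by(simp add:triv_coset m_cl)

lemma component_arc:
 assumes wf:"lgraph_wf H" and m:"mono_component i H V E" and e:"e:E"
 shows "has i (tri H) (ltail H e)" "V = comp_V i H (ltail H e)" "E = comp_E i H (ltail H e)"
 "e:lE H" "lab H e:LX i"
proof -
 from mono_component_nonempty[OF m] obtain v where v:"v:V" by blast
 note D = mono_componentD[OF wf m v]
 from e have a:"e:lE H" "ltail H e:V" "lab H e:LX i" unfolding D(3) D(2) comp_E_def by auto
 note D' = mono_componentD[OF wf m a(2)]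
 show "has i (tri H) (ltail H e)" "V = comp_V i H (ltail H e)" "E = comp_E i H (ltail H e)"
 "e:lE H" "lab H e:LX i" by(fact D' a)+ qed

lemma component_representatives:
 fixes H :: "('v,'e,'x) lgraph"
 assumes wf:"lgraph_wf H"
 obtains P where "P<=lE H" "!!i V E. mono_component i H V E==>EX! e. e:P Int E"
 "!!e. e:P==>EX i V E. mono_component i H V E&e:E"
proof -
 define ch where "ch E = (SOME e. e:E)" for E :: "'e set"
 define P where "P = {ch E|i V E. mono_component i H V E}"
 have ch:"ch E:E" if "mono_component i H V E" for i V E
 using that unfolding ch_def mono_component_def mono_subgraph_def by(intro some_in_eq[THEN iffD2]) blast
 have eq:"E = E'" if "mono_component i H V E" "mono_component i' H V' E'" "e:E" "e:E'" for i V E i' V' E' e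
 by(metis component_arc wf that(1,3) that(2,4) letters_disjoint) 
 show ?thesis
 proof (rule that[of P])
 show "P<=lE H" unfolding P_def using ch component_arc(4)[OF wf] by blast
 show "EX! e. e:P Int E" if m:"mono_component i H V E" for i V E
 proof (rule ex1I[of _ "ch E"])
 show "ch E:P Int E" using ch[OF m] m unfolding P_def by blast
 fix e assume "e:P Int E"
 then obtain i' V' E' where m': "mono_component i' H V' E'" "e = ch E'" "e:E" unfolding P_def by blast
 thus "e = ch E" using eq[OF m m'(1) m'(3)] ch[OF m'(1)] by simp qed
 show "EX i V E. mono_component i H V E&e:E" if "e:P" for e using that ch unfolding P_def by blast qed qed

subsection \<open>A copy of a Cayley graph at every vertex\<close>

text \<open>Instead of choosing edges, a copy of the Cayley graph of its colour may be glued to every vertex of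
 the component: after folding, the copies at other vertices are translates of the one that is
 required. This needs no information about components. The vertex \<open>g\<close> of the copy at \<open>v\<close> has the
 name \<open>vid v i g\<close>, and its vertex 1 is \<open>v\<close> itself.\<close>

context
 fixes Z :: "(nat,nat,'x) lgraph" and N :: nat and sl :: "index => 'x word set => nat"
begin

definition vid :: "nat => index => 'x word set => nat" where
 "vid v i g = sl i g * N+v"

definition glue_arcs :: "(nat \<times> 'x letter \<times> nat) set" where
 "glue_arcs = tri Z Un {(vid v i g,x,vid v i (g \<odot>[i] elt i [x]))|v i g x.
 has i (tri Z) v&g:FC i&x:LX i}"

definition glue_verts :: "nat set" where
 "glue_verts = lV Z Un {vid v i g|v i g. has i (tri Z) v&g:FC i}"

lemma glue_arcsI:
 "has i (tri Z) v==>g:FC i==>x:LX i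
 ==>(vid v i g,x,vid v i (g \<odot>[i] elt i [x])):glue_arcs" unfolding glue_arcs_def by blast

context
 assumes wf:"lgraph_wf Z" and fin:"finite (lE Z)" and vN:"lV Z<={..<N}"
 and labs:"!!u x w. (u,x,w):tri Z==>x:letters XX" and sl_one:"!!i. sl i \<one>[i] = 0"
 and sl_pos:"!!i g. g:FC i==>g~=\<one>[i]==>sl i g > 0"
 and sl_inj:"!!i g i' g'. g:FC i==>g':carrier (factor i')==>sl i g > 0==>sl i g = sl i' g'
 ==>i = i'&g = g'"
begin

lemma vid_one:"vid v i \<one>[i] = v" by(simp add:vid_def sl_one)

lemma glue_trav:
 assumes "has i (tri Z) v" shows "p:WX i==>g:FC i==>trav glue_arcs (vid v i g) p (vid v i (g \<odot>[i] elt i p))"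
proof (induction p arbitrary: g)
 case Nil
 thus ?case by(simp add:elt_Nil r_one')
next
 case (Cons x p)
 have x:"x:LX i" "p:WX i" using Cons.prems by auto
 hence c:"elt i [x]:FC i" "elt i p:FC i" "g \<odot>[i] elt i [x]:FC i" using Cons.prems(2) by(auto intro:m_cl)
 have "(vid v i g,x,vid v i (g \<odot>[i] elt i [x])):glue_arcs"
 unfolding glue_arcs_def using assms x(1) Cons.prems(2) by blast
 moreover have eq:"g \<odot>[i] elt i (x # p) = g \<odot>[i] elt i [x] \<odot>[i] elt i p"
 using elt_Cons[OF x] m_assoc'[OF Cons.prems(2) c(1,2)] by simp
 ultimately show ?case unfolding trav.simps eq using Cons.IH[OF x(2) c(3)] by blast qed

lemma glue_arcs_verts:"(u,x,w):glue_arcs==>u:glue_verts&w:glue_verts"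
proof -
 assume a:"(u,x,w):glue_arcs"
 show ?thesis
 proof (cases "(u,x,w):tri Z")
 case True
 thus ?thesis using triD(1,2)[OF wf True] by(simp add:glue_verts_def)
 next
 case False
 with a obtain v i g where v:"u = vid v i g" "w = vid v i (g \<odot>[i] elt i [x])" "has i (tri Z) v"
 "g:FC i" "x:LX i" unfolding glue_arcs_def by blast
 hence "g \<odot>[i] elt i [x]:FC i" by(intro m_cl) auto
 with v show ?thesis unfolding glue_verts_def by blast qed qed

context
 fixes L :: "nat => nat" and Z3 :: "(nat,nat,'x) lgraph"
 assumes L:"!!u w. u:glue_verts==>w:glue_verts==>L u = L w<->lfc glue_arcs u w"
 and wf3:"lgraph_wf Z3" and folded3:"folded Z3"
 and verts3:"lV Z3 = L ` glue_verts" and tri3:"tri Z3 = tmap L ` glue_arcs"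
begin

lemma glue_cong:"fold_cong glue_arcs L"
proof (rule fold_congI)
 fix u x w u' w' assume *: "(u,x,w):glue_arcs" "(u',x,w'):glue_arcs" "L u = L u'"
 note v = glue_arcs_verts[OF *(1)] glue_arcs_verts[OF *(2)]
 have "lfc glue_arcs u u'" using L v *(3) by blast
 hence "lfc glue_arcs w w'" by(rule lfc.fold[OF *(1,2)])
 thus "L w = L w'" using L v by blast qed

text \<open>Every vertex of the quotient with edges of colour \<open>i\<close> lies in the image of a copy
 of a Cayley graph, where all letters can be read and relators are closed.\<close>
lemma glue_based:"based (tri Z3)"
proof -
 have det:"det (tri Z3)" by(rule det_tri[OF folded3])
 have ex:"EX v g. has i (tri Z) v&g:FC i&y = L (vid v i g)" if h:"has i (tri Z3) y" for i y
 proof -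
 from h obtain x w where x:"x:LX i" "(y,x,w):tri Z3" unfolding has_def by blast
 then obtain u w' where u:"(u,x,w'):glue_arcs" "y = L u" unfolding tri3 tmap_def by auto
 show ?thesis
 proof (cases "(u,x,w'):tri Z")
 case True
 with x(1) have "has i (tri Z) u" by(rule hasI)
 with u(2) vid_one[of u i] one_cl[of i] show ?thesis by metis
 next
 case False
 with u(1) obtain v j g where v:"u = vid v j g" "has j (tri Z) v" "g:FC j" "x:letters (X j)"
 unfolding glue_arcs_def by blast
 have "j = i" using v(4) x(1) letters_disjoint by blast
 with v u(2) show ?thesis by blast qed qed
 have sat:"EX w. (y,x,w):tri Z3" if h:"has i (tri Z3) y" and x:"x:LX i" for i y x
 proof -
 from ex[OF h] obtain v g where v:"has i (tri Z) v" "g:FC i" "y = L (vid v i g)" by blast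
 hence "(vid v i g,x,vid v i (g \<odot>[i] elt i [x])):glue_arcs" unfolding glue_arcs_def using x by blast
 hence "tmap L (vid v i g,x,vid v i (g \<odot>[i] elt i [x])):tri Z3" unfolding tri3 by(rule imageI)
 with v(3) show ?thesis by auto qed
 have rel:"trav (tri Z3) y r y" if h:"has i (tri Z3) y" and r:"r:WX i" "elt i r = \<one>[i]" for i y r
 proof -
 from ex[OF h] obtain v g where v:"has i (tri Z) v" "g:FC i" "y = L (vid v i g)" by blast
 have "trav glue_arcs (vid v i g) r (vid v i g)" using glue_trav[OF v(1) r(1) v(2)] r(2) v(2) by(simp add:r_one')
 thus ?thesis unfolding tri3 v(3) by(rule trav_map) qed
 have labs3:"x:letters XX" if "(u,x,w):tri Z3" for u x w
 proof -
 from that obtain a b where "(a,x,b):glue_arcs" unfolding tri3 tmap_def by auto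
 thus ?thesis unfolding glue_arcs_def using labs letters_mono by blast qed
 show ?thesis unfolding based_def using det symm_tri[OF wf3] labs3 sat rel by blast qed

text \<open>One inclusion between the two quotients is clear. For the other one, a folding congruence of the
 graph with one copy per component is extended to the copy at any vertex \<open>v\<close>: if
 \<open>v\<close> is reached from the origin of the chosen edge by a walk with value \<open>g\<close>, the
 vertex \<open>k\<close> of the copy at \<open>v\<close> gets the value of the vertex \<open>g k\<close> of
 the chosen copy.\<close>
theorem step3_glue:
 assumes v0:"v0:lV Z" shows "step3 (Z,v0) (Z3,L v0)"
proof -
 from component_representatives[OF wf] obtain P where
 P:"P<=lE Z" "!!i V E. mono_component i Z V E==>EX! e. e:P Int E"
 "!!e. e:P==>EX i V E. mono_component i Z V E&e:E" by blast
 define col where "col = (%e. colour (lab Z e))"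
 define F where "F = (%e. cayley1 (col e))"
 define c where "c = (%e. ({\<one>[col e]},lab Z e))"
 define D where "D = djunion Z P F"
 define RV :: "((nat+nat \<times> 'x word set set) \<times> (nat+nat \<times> 'x word set set)) set" where "RV = (\<Union>e\<in>P. {(Inl (ltail Z e),Inr (e,ltail (F e) (c e))),(Inl (lhead Z e),Inr (e,lhead (F e) (c e)))})"
 define RE :: "((nat+nat \<times> 'x word set set \<times> 'x letter) \<times> (nat+nat \<times> 'x word set set \<times> 'x letter)) set" where "RE = (\<Union>e\<in>P. {(Inl e,Inr (e,c e)),(Inl (bar Z e),Inr (e,bar (F e) (c e)))})"
 note W = lgraph_wfD[OF wf]
 have Pe:"e:lE Z" "lab Z e:letters (X (col e))" "has (col e) (tri Z) (ltail Z e)" if "e:P" for e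
 proof -
 show e:"e:lE Z" using P(1) that by blast
 show "lab Z e:letters (X (col e))" unfolding col_def by(rule in_letters_colour[OF labs[OF triI[OF e]]])
 thus "has (col e) (tri Z) (ltail Z e)" using triI[OF e] by(rule hasI) qed
 have Fe:"ltail (F e) (c e) = {\<one>[col e]}" "lhead (F e) (c e) = {elt (col e) [lab Z e]}" "lab (F e) (c e) = lab Z e"
 "c e:lE (F e)" "lgraph_wf (F e)" if "e:P" for e
 proof -
 have "elt (col e) [lab Z e]:carrier (factor (col e))" using Pe(2)[OF that] by simp
 moreover have "{\<one>[col e]}:rcosets[col e] {\<one>[col e]}"
 using cayley1_verts[of "col e"] one_cl[of "col e"] by auto
 ultimately show "ltail (F e) (c e) = {\<one>[col e]}" "lhead (F e) (c e) = {elt (col e) [lab Z e]}"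
 "lab (F e) (c e) = lab Z e" "c e:lE (F e)" using Pe(2)[OF that] by(simp_all add:F_def c_def triv_coset)
 show "lgraph_wf (F e)" unfolding F_def by(rule cayley_wf[OF triv_sub]) qed
 have wfD:"lgraph_wf D" unfolding D_def by(rule djunion_wf[OF wf Fe(5)])
 have finP:"finite P" by(rule finite_subset[OF P(1) fin])
 have finF:"finite (lV (F e))" "finite (lE (F e))" for e
 proof -
 have "finite (lV (cayley1 (col e)))" unfolding cayley1_verts using fin_car by blast
 thus "finite (lV (F e))" "finite (lE (F e))" using finite_letters by(simp_all add:F_def) qed
 have finD:"finite (lV D)" "finite (lE D)" using finP finF fin finite_subset[OF vN] by(simp_all add:D_def)
 have triD': "tri D = tmap Inl ` tri Z Un (\<Union>e\<in>P. tmap (%c. Inr (e,c)) ` tri (F e))"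
 unfolding D_def by(rule tri_djunion)
 have TD:"(Inl a,x,Inl b):tri D" if "(a,x,b):tri Z" for a x b
 proof -
 have "tmap Inl (a,x,b):tmap Inl ` tri Z" using that by(rule imageI)
 thus ?thesis unfolding triD' tmap_simps by(rule UnI1) qed
 have RVv:"(Inl (ltail Z e),Inr (e,{\<one>[col e]})):RV"
 "(Inl (lhead Z e),Inr (e,{elt (col e) [lab Z e]})):RV" if "e:P" for e using that Fe[OF that] unfolding RV_def by auto
 have RVE:"EX e:P. a = Inl (ltail Z e)&b = Inr (e,{\<one>[col e]}) |
 a = Inl (lhead Z e)&b = Inr (e,{elt (col e) [lab Z e]})" if "(a,b):RV" for a b using that Fe unfolding RV_def by auto
 have REI:"(Inl e,Inr (e,c e)):RE" "(Inl (bar Z e),Inr (e,bar (F e) (c e))):RE" if "e:P" for e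
 using that unfolding RE_def by auto
 have "EX De f. identify D RV RE (De :: (nat,nat,'x) lgraph) f"
 proof (rule identify_exists[OF wfD finD])
 fix d a assume "(d,a):RE"
 then obtain e where e:"e:P" "d = Inl e&a = Inr (e,c e)|d = Inl (bar Z e)&a = Inr (e,bar (F e) (c e))"
 unfolding RE_def by auto
 note p = Pe[OF e(1)] and fe = Fe[OF e(1)] and rv = RVv[OF e(1)] and re = REI[OF e(1)]
 note w = W[OF p(1)] and wF = lgraph_wfD[OF fe(5) fe(4)]
 from e(2) show "d:lE D&a:lE D&lab D d = lab D a&(ltail D d,ltail D a):(RV Un RV\<inverse>)\<^sup>* &
 (lhead D d,lhead D a):(RV Un RV\<inverse>)\<^sup>*&(bar D d,bar D a):(RE Un RE\<inverse>)\<^sup>*"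
 using e(1) p fe rv re w wF by(auto simp:D_def r_into_rtrancl)  qed
 then obtain De :: "(nat,nat,'x) lgraph" and f where De: "identify D RV RE De f" by blast
 \<comment> \<open>\<open>nm\<close> embeds the copies at the chosen edges into the copies at all vertices.\<close>
 define nm where "nm = case_sum (%v. v) (%(e,C). vid (ltail Z e) (col e) (the_elem C))"
 have nm:"nm (Inl v) = v" "nm (Inr (e,{g})) = vid (ltail Z e) (col e) g" for v e g by(simp_all add:nm_def)
 have vertsD:"u:lV D<->(EX v:lV Z. u = Inl v)|(EX e:P. EX g:carrier (factor (col e)). u = Inr (e,{g}))" for u
 unfolding D_def djunion_simps F_def cayley1_verts by auto
 have nmV:"nm u:glue_verts" if "u:lV D" for u
 proof -
 from that consider v where "v:lV Z" "u = Inl v"|e g where "e:P" "g:carrier (factor (col e))" "u = Inr (e,{g})"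
 unfolding vertsD by blast
 thus ?thesis
 proof cases
 case 1
 thus ?thesis by(simp add:nm glue_verts_def)
 next
 case 2
 thus ?thesis unfolding 2(3) nm glue_verts_def using Pe(3)[OF 2(1)] by blast qed qed
 have trD:"trav (tri D) (Inl u) p (Inl w)" if "trav (tri Z) u p w" for u p w
 proof (rule trav_mono[OF trav_map[OF that]])
 show "(a,x,b):tri D" if "(a,x,b):tmap Inl ` tri Z" for a x b using that unfolding triD' by blast qed
 have trF:"trav (tri D) (Inr (e,{g})) p (Inr (e,{g \<odot>[(col e)] elt (col e) p}))"
 if "e:P" "p:words (X (col e))" "g:carrier (factor (col e))" for e p g
 proof (rule trav_mono[OF trav_map[OF trav_cayley1[OF that(2,3)]]])
 show "(a,x,b):tri D" if "(a,x,b):tmap (%C. Inr (e,C)) ` tri (cayley1 (col e))" for a x b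
 using that `e:P` unfolding triD' F_def by blast qed
 have nmT:"(nm a,x,nm b):glue_arcs" if "(a,x,b):tri D" for a x b
 proof -
 from that consider a' b' where "a = Inl a'" "b = Inl b'" "(a',x,b'):tri Z"
 |e a' b' where "e:P" "a = Inr (e,a')" "b = Inr (e,b')" "(a',x,b'):tri (F e)" unfolding triD' tmap_def by auto
 thus ?thesis
 proof cases
 case 1
 thus ?thesis by(simp add:nm glue_arcs_def)
 next
 case 2
 from 2(4) obtain g where g:"a' = {g}" "b' = {g \<odot>[(col e)] elt (col e) [x]}" "g:carrier (factor (col e))" "x:letters (X (col e))"
 unfolding F_def tri_cayley1 by blast
 show ?thesis unfolding 2(2,3) g(1,2) nm by(rule glue_arcsI[OF Pe(3)[OF 2(1)] g(3,4)]) qed qed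
 \<comment> \<open>Every coloured vertex is identified with a vertex of the copy at the chosen edge of its component.\<close>
 have cover:"EX e g. e:P&col e = i&g:FC i&h (Inl v) = h (Inr (e,{g}))"
 if h:"fold_cong (tri D) h" "!!a b. (a,b):RV==>h a = h b" and v:"has i (tri Z) v" for h :: "_ => nat" and i v
 proof -
 from P(2)[OF mono_component_comp[OF wf v]] obtain e where e:"e:P" "e:comp_E i Z v" by blast
 hence ci:"col e = i" unfolding col_def by(intro colour_eq) (simp add:comp_E_def)
 from e(2) obtain p where p:"p:WX i" "trav (tri Z) v p (ltail Z e)" unfolding comp_E_def comp_V_def by blast
 have ip:"inv_word p:WX i" using p(1) by simp
 have t:"trav (tri D) (Inl (ltail Z e)) (inv_word p) (Inl v)" by(rule trD[OF trav_inv[OF symm_tri[OF wf] p(2)]])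
 have "trav (tri D) (Inr (e,{\<one>[i]})) (inv_word p) (Inr (e,{elt i (inv_word p)}))"
 using trF[OF e(1),of "inv_word p" "\<one>[i]"] ip one_cl[of i] by(simp add:ci l_one')
 hence t': "trav (tri D) (Inr (e,{\<one>[col e]})) (inv_word p) (Inr (e,{elt i (inv_word p)}))" by(simp only: ci)
 have "h (Inl v) = h (Inr (e,{elt i (inv_word p)}))" by(rule trav_cong[OF h(1) h(2)[OF RVv(1)[OF e(1)]] t t'])
 with e(1) ci ip show ?thesis using elt_closed[OF ip] by blast qed
 have shift:"h (Inr (e,{g \<odot>[i] k})) = h (Inr (e',{g' \<odot>[i] k}))"
 if h:"fold_cong (tri D) h" and e:"e:P" "col e = i" "e':P" "col e' = i" and g:"g:FC i" "g':FC i"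
 "k:FC i" and eq:"h (Inr (e,{g})) = h (Inr (e',{g'}))" for h :: "_ => nat" and i e e' g g' k
 using trav_cong[OF h eq trF[OF e(1)] trF[OF e(3)]] g by(auto simp:carrier_factor e) 
 define LD where "LD = L \<circ> nm"
 have LDc:"fold_cong (tri D) LD"
 proof (rule fold_congI)
 fix u x w u' w' assume *: "(u,x,w):tri D" "(u',x,w'):tri D" "LD u = LD u'"
 from fold_congD[OF glue_cong nmT[OF *(1)] nmT[OF *(2)]] *(3) show "LD w = LD w'" by(simp add:LD_def) qed
 have LDr:"LD a = LD b" if "(a,b):RV" for a b
 proof -
 from RVE[OF that] obtain e where e:"e:P" "a = Inl (ltail Z e)&b = Inr (e,{\<one>[col e]}) |
 a = Inl (lhead Z e)&b = Inr (e,{elt (col e) [lab Z e]})" by blast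
 note p = Pe[OF e(1)]
 have c:"elt (col e) [lab Z e]:carrier (factor (col e))" using p(2) by simp
 have 1:"(ltail Z e,lab Z e,lhead Z e):glue_arcs" using triI[OF p(1)] by(simp add:glue_arcs_def)
 have 2:"(vid (ltail Z e) (col e) \<one>[col e],lab Z e,vid (ltail Z e) (col e) (\<one>[col e] \<odot>[(col e)] elt (col e) [lab Z e])):glue_arcs"
 unfolding glue_arcs_def using p one_cl[of "col e"] by blast
 have "L (lhead Z e) = L (vid (ltail Z e) (col e) (elt (col e) [lab Z e]))"
 using fold_congD[OF glue_cong 1 2] c by(simp add:vid_one l_one')
 with e(2) show ?thesis by(auto simp:LD_def nm vid_one) qed
 \<comment> \<open>The converse: a congruence of the chosen copies extends to all copies by translation.\<close>
 have least:"h u = h w" if h:"fold_cong (tri D) h" and r:"!!a b. (a,b):RV==>h a = h b"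
 and uw:"u:lV D" "w:lV D" "LD u = LD w" for h :: "_ => nat" and u w
 proof -
 have "ALL i v. EX eg. has i (tri Z) v-->fst eg:P&col (fst eg) = i&snd eg:FC i
 &h (Inl v) = h (Inr (fst eg,{snd eg}))" using cover[OF h r] by(metis fst_conv snd_conv)
 then obtain eg where "ALL i v. has i (tri Z) v-->fst (eg i v):P&col (fst (eg i v)) = i&snd (eg i v):FC i
 &h (Inl v) = h (Inr (fst (eg i v),{snd (eg i v)}))" by metis
 hence eg:"fst (eg i v):P" "col (fst (eg i v)) = i" "snd (eg i v):FC i"
 "h (Inl v) = h (Inr (fst (eg i v),{snd (eg i v)}))" if "has i (tri Z) v" for i v using that by blast+
 define ext where "ext i v k = h (Inr (fst (eg i v),{snd (eg i v) \<odot>[i] k}))" for i v k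
 define h' where "h' n = (if n div N = 0 then h (Inl (n mod N)) else
 (let ig = (SOME ig. snd ig:carrier (factor (fst ig))&sl (fst ig) (snd ig) = n div N) in ext (fst ig) (n mod N) (snd ig)))" for n
 have h'v:"h' v = h (Inl v)" if "v < N" for v using that by(simp add:h'_def)
 have h'c:"h' (vid v i g) = ext i v g" if v:"has i (tri Z) v" and g:"g:FC i" for v i g
 proof -
 have "v < N" using v triD(1)[OF wf] vN unfolding has_def by blast
 hence dm:"vid v i g div N = sl i g" "vid v i g mod N = v" by(auto simp:vid_def)
 show ?thesis
 proof (cases "g = \<one>[i]")
 case True
 thus ?thesis using `v < N` eg[OF v] by(simp add:vid_one h'v ext_def r_one')
 next
 case False
 with sl_pos[OF g] have pos:"sl i g > 0" by simp
 have "EX ig. snd ig:carrier (factor (fst ig))&sl (fst ig) (snd ig) = sl i g" using g by(intro exI[of _ "(i,g)"]) simp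
 from someI_ex[OF this] have s:"snd (SOME ig. snd ig:carrier (factor (fst ig))&sl (fst ig) (snd ig) = sl i g)
 :carrier (factor (fst (SOME ig. snd ig:carrier (factor (fst ig))&sl (fst ig) (snd ig) = sl i g)))
 &sl (fst (SOME ig. snd ig:carrier (factor (fst ig))&sl (fst ig) (snd ig) = sl i g))
 (snd (SOME ig. snd ig:carrier (factor (fst ig))&sl (fst ig) (snd ig) = sl i g)) = sl i g" .
 have "(SOME ig. snd ig:carrier (factor (fst ig))&sl (fst ig) (snd ig) = sl i g) = (i,g)"
 using sl_inj[OF g conjunct1[OF s] pos conjunct2[OF s,symmetric]] by(simp add:prod_eq_iff)
 with pos show ?thesis by(simp add:h'_def dm Let_def) qed qed
 have lift:"EX a' b'. (a',x,b'):tri D&h' a = h a'&h' b = h b'" if "(a,x,b):glue_arcs" for a x b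
 proof (cases "(a,x,b):tri Z")
 case True
 hence "(Inl a,x,Inl b):tri D" by(rule TD)
 moreover have "a < N" "b < N" using triD(1,2)[OF wf True] vN by auto
 ultimately show ?thesis using h'v by blast
 next
 case False
 with that obtain v i g where v:"a = vid v i g" "b = vid v i (g \<odot>[i] elt i [x])" "has i (tri Z) v"
 "g:FC i" "x:LX i" unfolding glue_arcs_def by blast
 have c:"elt i [x]:FC i" using v(5) by simp
 have c2:"g \<odot>[i] elt i [x]:FC i" by(rule m_cl[OF v(4) c])
 note e = eg[OF v(3)]
 have c3:"snd (eg i v) \<odot>[i] g:FC i" by(rule m_cl[OF e(3) v(4)])
 have "trav (tri D) (Inr (fst (eg i v),{snd (eg i v) \<odot>[i] g})) [x]
 (Inr (fst (eg i v),{snd (eg i v) \<odot>[i] g \<odot>[i] elt i [x]}))"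
 using trF[OF e(1),of "[x]" "snd (eg i v) \<odot>[i] g"] c3 v(5) by(simp only: e(2)) simp
 hence "(Inr (fst (eg i v),{snd (eg i v) \<odot>[i] g}),x,
 Inr (fst (eg i v),{snd (eg i v) \<odot>[i] g \<odot>[i] elt i [x]})):tri D" by simp
 moreover have "h' a = h (Inr (fst (eg i v),{snd (eg i v) \<odot>[i] g}))"
 using h'c[OF v(3,4)] v(1) by(simp add:ext_def)
 moreover have "h' b = h (Inr (fst (eg i v),{snd (eg i v) \<odot>[i] g \<odot>[i] elt i [x]}))"
 using h'c[OF v(3) c2] v(2) by(simp add:ext_def m_assoc'[OF e(3) v(4) c])
 ultimately show ?thesis by blast qed
 have "fold_cong glue_arcs h'"
 proof (rule fold_congI)
 fix u x w u' w' assume *: "(u,x,w):glue_arcs" "(u',x,w'):glue_arcs" "h' u = h' u'"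
 from lift[OF *(1)] obtain a b where 1:"(a,x,b):tri D" "h' u = h a" "h' w = h b" by blast
 from lift[OF *(2)] obtain a' b' where 2:"(a',x,b'):tri D" "h' u' = h a'" "h' w' = h b'" by blast
 from fold_congD[OF h 1(1) 2(1)] 1 2 *(3) show "h' w = h' w'" by simp qed
 moreover have "lfc glue_arcs (nm u) (nm w)" using L[OF nmV[OF uw(1)] nmV[OF uw(2)]] uw(3) by(simp add:LD_def)
 ultimately have eq:"h' (nm u) = h' (nm w)" by(intro lfc_least)
 have h_nm:"h' (nm u) = h u" if "u:lV D" for u
 proof -
 from that consider v where "v:lV Z" "u = Inl v"
 |e g where "e:P" "g:carrier (factor (col e))" "u = Inr (e,{g})" unfolding vertsD by blast
 thus ?thesis
 proof cases
 case 1
 hence "v < N" using vN by blast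
 thus ?thesis using h'v[of v] 1 by(simp add:nm)
 next
 case 2
 let ?v = "ltail Z e" and ?i = "col e"
 note hp = Pe(3)[OF 2(1)]
 note e = eg[OF hp]
 have "h (Inr (fst (eg ?i ?v),{snd (eg ?i ?v)})) = h (Inr (e,{\<one>\<^bsub>factor ?i\<^esub>}))"
 using e(4) r[OF RVv(1)[OF 2(1)]] by simp
 from shift[OF h e(1,2) 2(1) HOL.refl e(3) one_cl 2(2) this] show ?thesis
 using h'c[OF hp 2(2)] 2(2) by(simp add:2(3) nm ext_def l_one') qed qed
 from eq h_nm[OF uw(1)] h_nm[OF uw(2)] show "h u = h w" by simp qed
 have copy:"EX e g'. e:P&col e = i&g':FC i&(ALL k:FC i. L (vid v i k) = LD (Inr (e,{g' \<odot>[i] k})))"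
 if v:"has i (tri Z) v" for v i
 proof -
 from cover[OF LDc LDr v] obtain e g' where e:"e:P" "col e = i" "g':FC i" "LD (Inl v) = LD (Inr (e,{g'}))" by blast
 have "L (vid v i k) = LD (Inr (e,{g' \<odot>[i] k}))" if k:"k:FC i" for k
 proof -
 from k obtain p where p:"p:WX i" "k = elt i p" by(auto simp:carrier_factor)
 have eq:"L (vid v i \<one>[i]) = L (vid (ltail Z e) i g')" using e(2,4) by(simp add:LD_def nm vid_one)
 have he:"has i (tri Z) (ltail Z e)" using Pe(3)[OF e(1)] e(2) by simp
 from trav_cong[OF glue_cong eq glue_trav[OF v p(1) one_cl] glue_trav[OF he p(1) e(3)]] k show ?thesis
 by(simp add:LD_def nm e(2) p(2) l_one') qed
 with e show ?thesis by blast qed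
 have v3:"lV Z3 = LD ` lV D" unfolding verts3
 proof (intro equalityI subsetI)
 fix y assume "y:L ` glue_verts"
 then consider v where "v:lV Z" "y = L v"|v i g where "has i (tri Z) v" "g:FC i" "y = L (vid v i g)"
 unfolding glue_verts_def by blast
 thus "y:LD ` lV D"
 proof cases
 case 1
 hence "y = LD (Inl v)" "Inl v:lV D" using vertsD[of "Inl v"] by(simp_all add:LD_def nm)
 thus ?thesis by blast
 next
 case 2
 from copy[OF 2(1)] obtain e g' where e:"e:P" "col e = i" "g':FC i"
 "L (vid v i g) = LD (Inr (e,{g' \<odot>[i] g}))" using 2(2) by blast
 have "Inr (e,{g' \<odot>[i] g}):lV D" unfolding vertsD using e(1,2) m_cl[OF e(3) 2(2)] by blast
 with e(4) 2(3) show ?thesis by blast qed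
 next
 fix y assume "y:LD ` lV D"
 then obtain u where "u:lV D" "y = L (nm u)" unfolding LD_def by auto
 with nmV[OF this(1)] show "y:L ` glue_verts" by blast qed
 have t3:"tri Z3 = tmap LD ` tri D" unfolding tri3
 proof (intro equalityI subsetI)
 fix t assume "t:tmap L ` glue_arcs"
 then obtain a x b where t:"t = (L a,x,L b)" "(a,x,b):glue_arcs" by(auto simp:tmap_def)
 show "t:tmap LD ` tri D"
 proof (cases "(a,x,b):tri Z")
 case True
 hence "(Inl a,x,Inl b):tri D" by(rule TD)
 hence "tmap LD (Inl a,x,Inl b):tmap LD ` tri D" by(rule imageI)
 thus ?thesis by(simp add:t(1) LD_def nm)
 next
 case False
 with t(2) obtain v i g where v:"a = vid v i g" "b = vid v i (g \<odot>[i] elt i [x])" "has i (tri Z) v"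
 "g:FC i" "x:LX i" unfolding glue_arcs_def by blast
 have c:"elt i [x]:FC i" using v(5) by simp
 have c2:"g \<odot>[i] elt i [x]:FC i" by(rule m_cl[OF v(4) c])
 from copy[OF v(3)] obtain e g' where e:"e:P" "col e = i" "g':FC i"
 "L a = LD (Inr (e,{g' \<odot>[i] g}))" "L b = LD (Inr (e,{g' \<odot>[i] (g \<odot>[i] elt i [x])}))"
 using v(1,2,4) c2 by blast
 have "trav (tri D) (Inr (e,{g' \<odot>[i] g})) [x] (Inr (e,{g' \<odot>[i] g \<odot>[i] elt i [x]}))"
 using trF[OF e(1),of "[x]" "g' \<odot>[i] g"] m_cl[OF e(3) v(4)] v(5) by(simp only: e(2)) simp
 hence "(Inr (e,{g' \<odot>[i] g}),x,Inr (e,{g' \<odot>[i] (g \<odot>[i] elt i [x])})):tri D"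
 using m_assoc'[OF e(3) v(4) c] by simp
 hence "tmap LD (Inr (e,{g' \<odot>[i] g}),x,Inr (e,{g' \<odot>[i] (g \<odot>[i] elt i [x])})):tmap LD ` tri D"
 by(rule imageI)
 thus ?thesis by(simp add:t(1) e(4,5)) qed
 next
 fix t assume "t:tmap LD ` tri D"
 then obtain a x b where t:"t = (LD a,x,LD b)" "(a,x,b):tri D" by(auto simp:tmap_def)
 hence "tmap L (nm a,x,nm b):tmap L ` glue_arcs" using nmT by blast
 thus "t:tmap L ` glue_arcs" by(simp add:t(1) LD_def) qed
 have RVV:"a:lV D&b:lV D" if "(a,b):RV" for a b
 unfolding vertsD using RVE[OF that] Pe(2) W(1,2) Pe(1) one_cl by auto 
 have v0D:"Inl v0:lV D" using v0 vertsD by blast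
 have "fold_to (De,f (Inl v0)) (Z3,LD (Inl v0))"
 using fold_to_quotient[where L = LD,OF De wfD finD(2) v0D] least RVV LDr LDc wf3 folded3 v3 t3 by blast 
 hence "fold_to (De,f (Inl v0)) (Z3,L v0)" by(simp add:LD_def nm)
 moreover have "identify (djunion Z P F) RV RE De f" using De by(simp add:D_def)
 ultimately show ?thesis using P(1,2) unfolding step3.simps Let_def RV_def RE_def F_def c_def col_def by blast qed

end

end

end

subsection \<open>Identifying the two actions of the amalgamated subgroup\<close>

lemma based_image:
 assumes b:"based T" and L:"fold_cong T L" and det:"det (tmap L ` T)" and sy:"symm (tmap L ` T)"
 shows "based (tmap L ` T)"
proof -
 let ?T = "tmap L ` T"
 have ex:"EX v. has i T v&y = L v" if "has i ?T y" for i y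
 proof -
 from that obtain x w where "x:LX i" "(y,x,w):?T" unfolding has_def by blast
 then obtain u w' where "(u,x,w'):T" "y = L u" "x:LX i" by(auto simp:tmap_def)
 thus ?thesis using hasI[of x i u w' T] by blast qed
 have sat:"EX w. (y,x,w):?T" if h:"has i ?T y" and x:"x:LX i" for i y x
 proof -
 from ex[OF h] obtain v where v:"has i T v" "y = L v" by blast
 from basedD(4)[OF b v(1) x] obtain w where "(v,x,w):T" by blast
 hence "tmap L (v,x,w):?T" by(rule imageI)
 with v(2) show ?thesis by auto qed
 have rel:"trav ?T y r y" if h:"has i ?T y" and r:"r:WX i" "elt i r = \<one>[i]" for i y r
 by(metis ex h trav_map basedD(5) b r) 
 have labs:"x:letters XX" if "(u,x,w):?T" for u x w
 proof -
 from that obtain a c where "(a,x,c):T" by(auto simp:tmap_def)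
 from basedD(3)[OF b this] show ?thesis . qed
 show ?thesis unfolding based_def using det sy sat rel labs by blast qed

lemma VB_has:"VB H = {v:lV H. ALL i. has i (tri H) v}"
proof -
 have "(EX e:out_arcs (dig H) v. lab H e:LX i)<->has i (tri H) v" for i v
 proof
 assume "EX e:out_arcs (dig H) v. lab H e:LX i"
 then obtain e where "e:lE H" "v = ltail H e" "lab H e:LX i" by auto
 thus "has i (tri H) v" using triI[of e H] by(blast intro:hasI)
 next
 assume "has i (tri H) v"
 then obtain x w where "x:LX i" "(v,x,w):tri H" unfolding has_def by blast
 thus "EX e:out_arcs (dig H) v. lab H e:LX i" by(auto elim!: triE) qed
 thus ?thesis unfolding VB_def by simp qed

definition pair_list :: "('x word \<times> 'x word) list => bool" where
 "pair_list prs<->(ALL (u,u'):set prs. u:A_words One&u':A_words Two&eltG u = eltG u')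
 &(ALL u u'. u:A_words One-->u':A_words Two-->eltG u = eltG u' -->
 (EX (w,w'):set prs. elt One w = elt One u&elt Two w' = elt Two u'))"

lemma A_wd:"u:A_words i==>u:WX i" unfolding A_words_def using in_\<phi> by blast

lemma pair_list_exists:"EX prs. pair_list prs"
proof -
 let ?Q = "{(u,u'). u:A_words One&u':A_words Two&eltG u = eltG u'}"
 let ?cl = "%(u,u'). (elt One u,elt Two u')"
 have "?cl ` ?Q<=carrier (factor One) \<times> carrier (factor Two)" using A_wd by auto
 hence "finite (?cl ` ?Q)" using fin_car by(meson finite_SigmaI finite_subset)
 from finite_subset_image[OF this order_refl] obtain S where "S<=?Q&finite S&?cl ` ?Q = ?cl ` S" by(elim exE)
 hence S:"S<=?Q" "finite S" "?cl ` S = ?cl ` ?Q" by simp_all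
 obtain prs where prs:"set prs = S" using finite_list[OF S(2)] by blast
 have 2:"EX (w,w'):S. elt One w = elt One u&elt Two w' = elt Two u'" if "(u,u'):?Q" for u u'
 proof -
 have "?cl (u,u'):?cl ` S" unfolding S(3) using that by(rule imageI)
 then obtain s where s:"s:S" "?cl (u,u') = ?cl s" by(rule imageE)
 thus ?thesis by(intro bexI[of _ s]) (simp_all add:case_prod_beta) qed
 have "pair_list prs" unfolding pair_list_def prs
 proof (intro conjI allI impI)
 show "ALL (u,u'):S. u:A_words One&u':A_words Two&eltG u = eltG u'" using S(1) by blast
 fix u u' assume "u:A_words One" "u':A_words Two" "eltG u = eltG u'"
 thus "EX (w,w'):S. elt One w = elt One u&elt Two w' = elt Two u'" by(intro 2) simp qed
 thus ?thesis by blast qed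

lemma pair_listD:
 assumes "pair_list prs" "k < length prs"
 shows "fst (prs ! k):A_words One" "snd (prs ! k):A_words Two" "eltG (fst (prs ! k)) = eltG (snd (prs ! k))"
proof -
 have "case prs ! k of (u,u') => u:A_words One&u':A_words Two&eltG u = eltG u'"
 using assms(1)[unfolded pair_list_def,THEN conjunct1] nth_mem[OF assms(2)] by(rule bspec)
 thus "fst (prs ! k):A_words One" "snd (prs ! k):A_words Two" "eltG (fst (prs ! k)) = eltG (snd (prs ! k))"
 by(simp_all add:case_prod_beta) qed

text \<open>The pairs of vertices that are to be identified are encoded by further letters, one for each
 pair of words: from every bichromatic vertex the new letter leads to the ends of both walks.\<close>

definition amalgam_arcs :: "('x word \<times> 'x word) list => ('v,'e,'x) lgraph => ('v \<times> ('x letter+nat) \<times> 'v) set" where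
 "amalgam_arcs prs H = {(u,Inl x,w)|u x w. (u,x,w):tri H}
 Un {(v,Inr k,act One (tri H) v (elt One (fst (prs ! k))))|v k. v:VB H&k < length prs}
 Un {(v,Inr k,act Two (tri H) v (elt Two (snd (prs ! k))))|v k. v:VB H&k < length prs}"

lemma act_V:
 assumes "lgraph_wf H" "based (tri H)" "has i (tri H) v" "g:FC i" shows "act i (tri H) v g:lV H"
proof -
 have "v:lV H" using assms(3) triD(1)[OF assms(1)] unfolding has_def by blast
 from comp_V_sub[OF assms(1) this] comp_V_act[OF assms(1-3)] assms(4) show ?thesis by blast qed

text \<open>Folding the two edges with a new letter identifies the ends of the two walks. Conversely every
 pair that the step identifies arises in this way, as the list has a pair of words with the same
 values.\<close>
theorem step4_amalgam:
 fixes Z Z4 :: "(nat,nat,'x) lgraph" and L :: "nat => nat"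
 assumes wf:"lgraph_wf Z" and fin:"finite (lE Z)" "finite (lV Z)" and b:"based (tri Z)" and prs:"pair_list prs"
 and L:"!!u w. u:lV Z==>w:lV Z==>L u = L w<->lfc (amalgam_arcs prs Z) u w"
 and Z4:"lgraph_wf Z4" "folded Z4" "lV Z4 = L ` lV Z" "tri Z4 = tmap L ` tri Z" and v0:"v0:lV Z"
 shows "step4 (Z,v0) (Z4,L v0)" "based (tri Z4)"
proof -
 let ?T = "tri Z" and ?E = "amalgam_arcs prs Z"
 have prs1:"fst (prs ! k):words (X One)" "snd (prs ! k):words (X Two)" if "k < length prs" for k
 using A_wd[OF pair_listD(1)[OF prs that]] A_wd[OF pair_listD(2)[OF prs that]] by blast+
 have VBD:"has i ?T v" if "v:VB Z" for v i using that by(simp add:VB_has)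
 have VBV:"v:lV Z" if "v:VB Z" for v using that by(simp add:VB_has)
 have Ev:"u:lV Z&w:lV Z" if "(u,x,w):?E" for u x w
 proof -
 from that consider y where "(u,y,w):?T"
 |k where "u:VB Z" "k < length prs" "w = act One ?T u (elt One (fst (prs ! k)))"
 |k where "u:VB Z" "k < length prs" "w = act Two ?T u (elt Two (snd (prs ! k)))" unfolding amalgam_arcs_def by blast
 thus ?thesis by(metis triD(1,2) wf VBV act_V b VBD elt_closed prs1(1) prs1(2))  qed
 have LE:"fold_cong ?E L"
 proof (rule fold_congI)
 fix u x w u' w' assume *: "(u,x,w):?E" "(u',x,w'):?E" "L u = L u'"
 have "lfc ?E u u'" using L Ev[OF *(1)] Ev[OF *(2)] *(3) by blast
 hence "lfc ?E w w'" by(rule lfc.fold[OF *(1,2)])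
 thus "L w = L w'" using L Ev[OF *(1)] Ev[OF *(2)] by blast qed
 have LT:"fold_cong ?T L"
 proof (rule fold_congI)
 fix u x w u' w' assume *: "(u,x,w):?T" "(u',x,w'):?T" "L u = L u'"
 hence "(u,Inl x,w):?E" "(u',Inl x,w'):?E" unfolding amalgam_arcs_def by blast+
 from fold_congD[OF LE this *(3)] show "L w = L w'" . qed
 show "based (tri Z4)"
 unfolding Z4(4) by(rule based_image[OF b LT]) (use det_tri[OF Z4(2)] symm_tri[OF Z4(1)] Z4(4) in simp_all)
 have sp:"EX v p q. v:VB Z&p:A_words One&q:A_words Two&eltG p = eltG q
 &w1 = act One ?T v (elt One p)&w2 = act Two ?T v (elt Two q)" if "(w1,w2):step4_pairs Z" for w1 w2
 proof -
 from that obtain v p1 p2 where v:"v:VB Z" "pre_digraph.awalk (dig Z) v p1 w1" "pre_digraph.awalk (dig Z) v p2 w2"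
 "map (lab Z) p1:A_words One" "map (lab Z) p2:A_words Two" "eltG (map (lab Z) p1) = eltG (map (lab Z) p2)"
 unfolding step4_pairs_def by blast
 have "trav ?T v (map (lab Z) p1) w1" "trav ?T v (map (lab Z) p2) w2" using awalk_trav[OF wf] v(2,3) by blast+
 with act_trav[OF b VBD[OF v(1)] A_wd[OF v(4)]] act_trav[OF b VBD[OF v(1)] A_wd[OF v(5)]]
 show ?thesis using v(1,4,5,6) by blast qed
 have spI:"(w1,w2):step4_pairs Z" if "v:VB Z" "k < length prs" "w1~=w2" "w1 = act One ?T v (elt One (fst (prs ! k)))"
 "w2 = act Two ?T v (elt Two (snd (prs ! k)))" for v k w1 w2
 proof -
 note a = pair_listD[OF prs that(2)]
 have "trav ?T v (fst (prs ! k)) w1" "trav ?T v (snd (prs ! k)) w2"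
 using act_trav[OF b VBD[OF that(1)]] prs1[OF that(2)] that(4,5) by blast+
 moreover have "v:lV Z" by(rule VBV[OF that(1)])
 ultimately obtain p1 p2 where "pre_digraph.awalk (dig Z) v p1 w1" "map (lab Z) p1 = fst (prs ! k)"
 "pre_digraph.awalk (dig Z) v p2 w2" "map (lab Z) p2 = snd (prs ! k)"
 using awalk_trav[OF wf,of v w1 "fst (prs ! k)"] awalk_trav[OF wf,of v w2 "snd (prs ! k)"] by blast
 with a that(1,3) show ?thesis unfolding step4_pairs_def mem_Collect_eq case_prod_conv by metis qed
 have RVV:"w1:lV Z&w2:lV Z" if "(w1,w2):step4_pairs Z" for w1 w2
 by(metis sp[OF that] act_V wf b VBD elt_closed A_wd) 
 have RV:"L w1 = L w2" if "(w1,w2):step4_pairs Z" for w1 w2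
 proof -
 from sp[OF that] obtain v p q where v:"v:VB Z" "p:A_words One" "q:A_words Two" "eltG p = eltG q"
 "w1 = act One ?T v (elt One p)" "w2 = act Two ?T v (elt Two q)" by blast
 from prs v(2-4) obtain w w' where "(w,w'):set prs" and e:"elt One w = elt One p" "elt Two w' = elt Two q"
 unfolding pair_list_def by blast
 then obtain k where k:"k < length prs" "prs ! k = (w,w')" by(auto simp:in_set_conv_nth)
 have "(v,Inr k,w1):?E" unfolding amalgam_arcs_def using v(1,5) k e by force
 moreover have "(v,Inr k,w2):?E" unfolding amalgam_arcs_def using v(1,6) k e by force
 ultimately show ?thesis by(rule fold_congD[OF LE]) simp qed
 have least:"h u = h w" if h:"fold_cong ?T h" and r:"!!a b. (a,b):step4_pairs Z==>h a = h b"
 and uw:"u:lV Z" "w:lV Z" "L u = L w" for h :: "nat => nat" and u w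
 proof -
 have hk:"h w = h (act One ?T v (elt One (fst (prs ! k))))" if "(v,Inr k,w):?E" for v k w
 proof -
 from that have v:"v:VB Z" "k < length prs" "w = act One ?T v (elt One (fst (prs ! k)))|w = act Two ?T v (elt Two (snd (prs ! k)))"
 unfolding amalgam_arcs_def by blast+
 thus ?thesis using spI[OF v(1,2) _ HOL.refl HOL.refl] r by metis qed
 have "fold_cong ?E h"
 proof (rule fold_congI)
 fix a y c a' c' assume *: "(a,y,c):?E" "(a',y,c'):?E" "h a = h a'"
 show "h c = h c'"
 proof (cases y)
 case (Inl x)
 with * have "(a,x,c):?T" "(a',x,c'):?T" unfolding amalgam_arcs_def by blast+
 from fold_congD[OF h this *(3)] show ?thesis .
 next
 case (Inr k)
 from *(1,2) Inr have v:"a:VB Z" "a':VB Z" "k < length prs" unfolding amalgam_arcs_def by blast+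
 note p = prs1(1)[OF v(3)]
 have "trav ?T a (fst (prs ! k)) (act One ?T a (elt One (fst (prs ! k))))"
 "trav ?T a' (fst (prs ! k)) (act One ?T a' (elt One (fst (prs ! k))))"
 using act_trav[OF b VBD[OF v(1)] p] act_trav[OF b VBD[OF v(2)] p] by blast+
 from trav_cong[OF h *(3) this] hk[of a k c] hk[of a' k c'] * Inr show ?thesis by simp qed qed
 moreover have "lfc ?E u w" using L uw by blast
 ultimately show ?thesis using lfc_least by metis qed
 have "EX (De :: (nat,nat,'x) lgraph) f. identify Z (step4_pairs Z) {} De f"
 by(rule identify_exists[OF wf fin(2,1)]) simp
 then obtain De :: "(nat,nat,'x) lgraph" and f where De: "identify Z (step4_pairs Z) {} De f" by blast
 have "fold_to (De,f v0) (Z4,L v0)"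
 using fold_to_quotient[where L = L,OF De wf fin(1) v0] least RVV RV LT Z4 by blast 
 with De show "step4 (Z,v0) (Z4,L v0)" unfolding step4.simps by blast qed

end

section \<open>Removing redundant components\<close>

lemma lgraph_bar_out:"lgraph_wf H==>e ~: lE H==>bar H e = e"
 using bidirected_digraph.arev_dom by(fastforce simp:lgraph_wf_def)

lemma subgr_self:"lgraph_wf H==>subgr H (lV H) (lE H) = H"
 by(rule lgraph.equality) (auto simp:subgr_def lgraph_bar_out)

lemma pgraph_iso_refl:"v:lV H==>pgraph_iso (H,v) (H,v)"
 by(auto simp:lgraph_hom_def intro!: exI[of _ "%x. x"] bij_betw_id[unfolded id_def])

context amalgam
begin

lemma inv_closed': "g:FC i==>inv[i] g:FC i" by(rule group.inv_closed[OF grp])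

lemma preimage_subgroup:
 assumes "subgroup S (factor i)" shows "subgroup {a:carrier A. \<phi> i a:S} A"
proof -
 interpret A: group A by(rule group_A)
 interpret group_hom A "factor i" "\<phi> i" by(rule \<phi>_group_hom)
 show ?thesis
 proof (rule A.subgroupI)
 show "{a:carrier A. \<phi> i a:S}~={}" using \<phi>_one[of i] subgroup.one_closed[OF assms] by force
 fix a assume "a:{a:carrier A. \<phi> i a:S}"
 thus "inv\<^bsub>A\<^esub> a:{a:carrier A. \<phi> i a:S}" using subgroup.m_inv_closed[OF assms] by simp
 next
 fix a b assume "a:{a:carrier A. \<phi> i a:S}" "b:{a:carrier A. \<phi> i a:S}"
 thus "a \<otimes>\<^bsub>A\<^esub> b:{a:carrier A. \<phi> i a:S}" using subgroup.m_closed[OF assms] by simp qed auto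
qed

lemma VM_has:
 assumes "based (tri H)" shows "v:VM i H<->v:lV H&has i (tri H) v&(ALL j. j~=i-->~ has j (tri H) v)"
proof -
 have out:"(EX e:out_arcs (dig H) v. lab H e:letters (X j))<->has j (tri H) v" for j
 proof
 assume "EX e:out_arcs (dig H) v. lab H e:letters (X j)"
 then obtain e where "e:lE H" "v = ltail H e" "lab H e:letters (X j)" by auto
 thus "has j (tri H) v" using triI[of e H] by(blast intro:hasI)
 next
 assume "has j (tri H) v"
 then obtain x w where "x:letters (X j)" "(v,x,w):tri H" unfolding has_def by blast
 thus "EX e:out_arcs (dig H) v. lab H e:letters (X j)" by(auto elim!: triE) qed
 have lab:"lab H e:letters (X (colour (lab H e)))" if "e:out_arcs (dig H) v" for e
 using in_letters_colour[OF basedD(3)[OF assms triI[of e H]]] that by simp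
 show ?thesis
 proof
 assume v:"v:VM i H"
 hence 1:"v:lV H" "out_arcs (dig H) v~={}" "!!e. e:out_arcs (dig H) v==>lab H e:LX i" unfolding VM_def by blast+
 hence "has i (tri H) v" using out by blast
 moreover have "~ has j (tri H) v" if "j~=i" for j using 1(3) out[of j] letters_disjoint[OF that] by blast
 ultimately show "v:lV H&has i (tri H) v&(ALL j. j~=i-->~ has j (tri H) v)" using 1(1) by blast
 next
 assume v:"v:lV H&has i (tri H) v&(ALL j. j~=i-->~ has j (tri H) v)"
 hence "out_arcs (dig H) v~={}" using out[of i] by blast
 moreover have "lab H e:LX i" if e:"e:out_arcs (dig H) v" for e
 proof -
 have "has (colour (lab H e)) (tri H) v" using out lab[OF e] e by blast
 with v have "colour (lab H e) = i" by blast
 with lab[OF e] show ?thesis by simp qed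
 ultimately show "v:VM i H" unfolding VM_def using v by blast qed qed

text \<open>Here the subgroup \<open>K\<close> of the algorithm is the preimage of the stabilizer. That it
 exists is the inclusion of the stabilizer in the image of \<open>A\<close>; the number of bichromatic
 vertices is counted with multiplicity, see \<open>orbit_count\<close>.\<close>
definition rem_cond :: "('v,'e,'x) lgraph => 'v => index => 'v => bool" where
 "rem_cond H v0 i p0<->p0:VB H&stab (tri H) i p0<=\<phi> i ` carrier A
 &card {g:FC i. act i (tri H) p0 g:VB H} = card (carrier A)
 &(if stab (tri H) i p0 = {\<one>[i]} then ~ (v0:comp_V i H p0&v0:VM i H)
 else v0 ~: comp_V i H p0)"

text \<open>Counting the group elements that lead from a vertex to a bichromatic one, rather than the
 bichromatic vertices themselves, multiplies by the order of the stabilizer; the condition on their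
 number becomes independent of the stabilizer.\<close>

lemma orbit_count:
 assumes wf:"lgraph_wf H" and b:"based (tri H)" and h:"has i (tri H) v"
 shows "card {g:FC i. act i (tri H) v g:B} = card (comp_V i H v Int B) * card (stab (tri H) i v)"
proof -
 let ?a = "act i (tri H) v" and ?C = "FC i" and ?S = "stab (tri H) i v"
 have V:"comp_V i H v = ?a ` ?C" by(rule comp_V_act[OF wf b h])
 have fib:"card {g:?C. ?a g = u} = card ?S" if u:"u:comp_V i H v" for u
 proof -
 from u obtain k where k:"k:?C" "u = ?a k" unfolding V by blast
 have "{g:?C. ?a g = u} = ?S #>[i] k" using coset_stab[OF b h k(1)] k(2) by simp
 moreover have "?S #>[i] k:rcosets[i] ?S" using k(1) unfolding RCOSETS_def by blast
 ultimately show ?thesis using group.card_rcosets_equal[OF grp _ subgroup.subset[OF stab_subgroup[OF b h]]] by simp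
 qed
 have "{g:?C. ?a g:B} = (\<Union>u\<in>comp_V i H v Int B. {g:?C. ?a g = u})" unfolding V by auto
 also have "card \<dots> = (\<Sum>u\<in>comp_V i H v Int B. card {g:?C. ?a g = u})"
 by(rule card_UN_disjoint) (use fin_car V in auto)
 also have "\<dots> = (\<Sum>u\<in>comp_V i H v Int B. card ?S)" by(intro sum.cong) (use fib in auto)
 finally show ?thesis by simp qed

lemma card_cosets_A:"subgroup K A==>card (rcosets\<^bsub>A\<^esub> K) * card K = card (carrier A)"
 using group.lagrange[OF group_A,of K] by(simp add:order_def)

lemma card_\<phi>: "subgroup K A==>card (\<phi> i ` K) = card K"
 using inj_on_subset[OF \<phi>_inj subgroup.subset] by(intro card_image) blast

lemma card_sub_pos:"subgroup K A==>card K > 0"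
 using subgroup.one_closed[of K A] finite_subset[OF subgroup.subset finite_A,of K] by(auto simp:card_gt_0_iff)

lemma \<phi>_triv_iff:
 assumes "subgroup K A" shows "\<phi> i ` K = {\<one>[i]}<->K = {oneA}"
proof
 assume e:"\<phi> i ` K = {\<one>[i]}"
 have "a = oneA" if "a:K" for a
 proof (rule inj_onD[OF \<phi>_inj])
 show "\<phi> i a = \<phi> i oneA" using e that \<phi>_one[of i] by blast
 show "a:carrier A" "oneA:carrier A" using that subgroup.subset[OF assms] subgroup.one_closed[OF assms] by blast+ qed
 thus "K = {oneA}" using subgroup.one_closed[OF assms] by blast qed (simp add:\<phi>_one)

lemma removable_iff:
 assumes wf:"lgraph_wf H" and fo:"folded H" and b:"based (tri H)"
 shows "removable H v0 V E<->(EX i p0. rem_cond H v0 i p0&V = comp_V i H p0&E = comp_E i H p0)"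
proof
 assume "removable H v0 V E"
 then obtain i K p0 where r:"mono_component i H V E" "subgroup K A" "p0:V Int VB H"
 "pgraph_iso (subgr H V E,p0) (cayley i (\<phi> i ` K),\<phi> i ` K)" "card (V Int VB H) = card (rcosets\<^bsub>A\<^esub> K)"
 "K = {oneA}&v0 ~: V Int VM i H|K~={oneA}&v0 ~: V" unfolding removable_def by(elim exE conjE)
 from r(3) have "p0:V" by blast
 note D = mono_componentD[OF wf r(1) this]
 have S:"stab (tri H) i p0 = \<phi> i ` K"
 by(rule stab_of_iso[OF wf b D(1) \<phi>_subgroup[OF r(2)]]) (use r(4) D(2,3) in simp)
 have "card {g:FC i. act i (tri H) p0 g:VB H} = card (carrier A)"
 unfolding orbit_count[OF wf b D(1)] S card_\<phi>[OF r(2)] using r(5) card_cosets_A[OF r(2)] D(2) by simp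
 moreover have "stab (tri H) i p0<=\<phi> i ` carrier A" unfolding S using subgroup.subset[OF r(2)] by blast
 moreover have tr:"stab (tri H) i p0 = {\<one>[i]}<->K = {oneA}" unfolding S by(rule \<phi>_triv_iff[OF r(2)])
 moreover have "if stab (tri H) i p0 = {\<one>[i]} then ~ (v0:comp_V i H p0&v0:VM i H) else v0 ~: comp_V i H p0"
 using r(6) unfolding tr D(2)[symmetric] by(cases "K = {oneA}") simp_all
 moreover have "p0:VB H" using r(3) by blast
 ultimately have "rem_cond H v0 i p0" unfolding rem_cond_def by blast
 with D show "EX i p0. rem_cond H v0 i p0&V = comp_V i H p0&E = comp_E i H p0" by blast
next
 assume "EX i p0. rem_cond H v0 i p0&V = comp_V i H p0&E = comp_E i H p0"
 then obtain i p0 where c:"rem_cond H v0 i p0" and V:"V = comp_V i H p0" "E = comp_E i H p0" by blast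
 have vb:"p0:VB H" and sub:"stab (tri H) i p0<=\<phi> i ` carrier A"
 and card:"card {g:FC i. act i (tri H) p0 g:VB H} = card (carrier A)"
 and last:"if stab (tri H) i p0 = {\<one>[i]} then ~ (v0:comp_V i H p0&v0:VM i H) else v0 ~: comp_V i H p0"
 using c by(auto simp:rem_cond_def)
 from vb have h:"has i (tri H) p0" by(simp add:VB_has)
 define K where "K = {a:carrier A. \<phi> i a:stab (tri H) i p0}"
 have K:"subgroup K A" unfolding K_def by(rule preimage_subgroup[OF stab_subgroup[OF b h]])
 have S:"stab (tri H) i p0 = \<phi> i ` K" unfolding K_def using sub by blast
 have "card (V Int VB H) * card K = card (rcosets\<^bsub>A\<^esub> K) * card K"
 using card orbit_count[OF wf b h,of "VB H"] card_cosets_A[OF K] by(simp add:V S card_\<phi>[OF K])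
 hence "card (V Int VB H) = card (rcosets\<^bsub>A\<^esub> K)" using card_sub_pos[OF K] by simp
 moreover have "pgraph_iso (subgr H V E,p0) (cayley i (\<phi> i ` K),\<phi> i ` K)"
 using component_cayley[OF wf fo b h] by(simp add:V S)
 moreover have "mono_component i H V E" unfolding V by(rule mono_component_comp[OF wf h])
 moreover have "p0:V Int VB H" using vb comp_V_refl[of p0 i H] V by blast
 moreover have tr:"stab (tri H) i p0 = {\<one>[i]}<->K = {oneA}" unfolding S by(rule \<phi>_triv_iff[OF K])
 moreover have "K = {oneA}&v0 ~: V Int VM i H|K~={oneA}&v0 ~: V"
 using last unfolding tr V by(cases "K = {oneA}") simp_all
 ultimately show "removable H v0 V E" unfolding removable_def using K by blast qed

definition removed :: "('v,'e,'x) lgraph => index => 'v => ('v,'e,'x) lgraph" where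
 "removed H i p0 = subgr H (lV H - (comp_V i H p0 - VB H)) (lE H - comp_E i H p0)"

lemma tri_removed:"tri (removed H i p0) = {(u,x,w):tri H. ~ (u:comp_V i H p0&x:LX i)}"
 unfolding removed_def tri_def comp_E_def by auto

lemma other_index:"i~=j==>k~=j==>i = (k :: index)" by(cases i; cases j; cases k) auto

lemma removed_step:
 assumes wf:"lgraph_wf H" and fo:"folded H" and b:"based (tri H)" and c:"rem_cond H v0 i p0"
 shows "remove_component (H,v0) (removed H i p0,v0)"
 unfolding removed_def by(rule remove_component.intros) (use removable_iff[OF wf fo b] c in blast)

text \<open>A removal deletes one orbit of one factor; the other orbits, and hence the actions on them,
 stay.\<close>
lemma removed_props:
 assumes wf:"lgraph_wf H" and fo:"folded H" and b:"based (tri H)" and v0:"v0:lV H" and c:"rem_cond H v0 i p0"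
 shows "lgraph_wf (removed H i p0)" "folded (removed H i p0)" "based (tri (removed H i p0))"
 "v0:lV (removed H i p0)" "lE (removed H i p0) \<subset> lE H" "lV (removed H i p0)<=lV H"
proof -
 let ?V = "comp_V i H p0" and ?E = "comp_E i H p0" and ?R = "removed H i p0"
 have vb:"p0:VB H" using c by(simp add:rem_cond_def)
 hence h:"has i (tri H) p0" by(simp add:VB_has)
 have hV:"has i (tri H) u" if "u:?V" for u using that has_trav[OF symm_tri[OF wf] h] unfolding comp_V_def by blast
 note B = basedD[OF b]
 have vbI:"u:VB H" if "has i (tri H) u" "has j (tri H) u" "j~=i" for u j
 proof -
 have "has k (tri H) u" for k using that other_index[of k i j] by(cases "k = i") auto
 moreover have "u:lV H" using that(1) triD(1)[OF wf] unfolding has_def by blast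
 ultimately show ?thesis by(simp add:VB_has) qed
 show "lgraph_wf ?R" unfolding removed_def
 proof (rule subgr_wf[OF wf])
 fix e assume e:"e:lE H - ?E"
 have "ltail H e ~: ?V - VB H"
 proof
 assume t:"ltail H e:?V - VB H"
 have e': "e:lE H" using e by blast
 have l:"lab H e:letters (X (colour (lab H e)))" by(rule in_letters_colour[OF B(3)[OF triI[OF e']]])
 have "has (colour (lab H e)) (tri H) (ltail H e)" by(rule hasI[OF l triI[OF e']])
 moreover have "has i (tri H) (ltail H e)" using t hV by blast
 ultimately have "colour (lab H e) = i" using vbI t by blast
 with l e' t have "e:?E" by(simp add:comp_E_def)
 with e show False by blast qed
 moreover have "bar H e ~: ?E"
 proof
 assume "bar H e:?E"
 from comp_E_bar[OF wf this] lgraph_wfD(5)[OF wf,of e] e show False by simp qed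
 ultimately show "ltail H e:lV H - (?V - VB H)&bar H e:lE H - ?E" using lgraph_wfD(1,3)[OF wf,of e] e by blast
 qed auto
 hence wfR:"lgraph_wf ?R" .
 show foR:"folded ?R" using fo by(auto simp:folded_def removed_def)
 have "?E~={}" using comp_mono_subgraph[OF wf h] by(simp add:mono_subgraph_def)
 moreover have "?E<=lE H" by(auto simp:comp_E_def)
 ultimately show "lE ?R \<subset> lE H" unfolding removed_def subgr_simps by blast
 show "lV ?R<=lV H" by(auto simp:removed_def)
 show "v0:lV ?R"
 proof (rule ccontr)
 assume "v0 ~: lV ?R"
 hence v:"v0:?V" "v0 ~: VB H" using v0 by(auto simp:removed_def)
 have "has i (tri H) v0" by(rule hV[OF v(1)])
 moreover have "~ has j (tri H) v0" if "j~=i" for j using vbI[OF `has i (tri H) v0` _ that] v(2) by blast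
 ultimately have "v0:VM i H" using VM_has[OF b,of v0 i] v0 by blast
 with c v(1) show False by(auto simp:rem_cond_def split:if_splits) qed
 have sub:"t:tri H" if "t:tri ?R" for t using that unfolding tri_removed by auto
 have hsub:"has j (tri H) u" if "has j (tri ?R) u" for j u using that sub unfolding has_def by blast
 have keep:"(u,x,w):tri ?R" if "(u,x,w):tri H" "x:letters (X j)" "j~=i|u ~: ?V" for u x w j
 using that letters_disjoint[of j i x] unfolding tri_removed by blast
 have out:"j~=i|u ~: ?V" if "has j (tri ?R) u" for j u using that unfolding has_def tri_removed by blast
 have sat:"EX w. (u,x,w):tri ?R" if hu:"has j (tri ?R) u" and x:"x:letters (X j)" for j u x
 using B(4)[OF hsub[OF hu] x] keep[OF _ x out[OF hu]] by blast
 have stay:"z ~: ?V" if "u ~: ?V" "(u,x,z):tri H" "x:LX i" for u x z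
 using comp_V_step[of z i H p0 "inv_letter x" u] symmD[OF B(2) that(2)] that(1,3) by auto
 have trav:"trav (tri ?R) u p w" if "trav (tri H) u p w" "p:words (X j)" "j~=i|u ~: ?V" for u p w j using that
 proof (induction p arbitrary: u)
 case (Cons x p)
 from Cons.prems obtain z where z:"(u,x,z):tri H" "trav (tri H) z p w" by auto
 have x:"x:letters (X j)" "p:words (X j)" using Cons.prems(2) by auto
 have "j~=i|z ~: ?V" using stay[OF _ z(1)] x(1) Cons.prems(3) by blast
 from Cons.IH[OF z(2) x(2) this] keep[OF z(1) x(1) Cons.prems(3)] show ?case by auto qed simp
 have rel:"trav (tri ?R) u r u" if hu:"has j (tri ?R) u" and r:"r:words (X j)" "elt j r = \<one>[j]" for j u r
 by(rule trav[OF B(5)[OF hsub[OF hu] r] r(1) out[OF hu]])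
 have labs:"x:letters XX" if "(u,x,w):tri ?R" for u x w by(rule B(3)[OF sub[OF that]])
 show "based (tri ?R)" unfolding based_def using det_tri[OF foR] symm_tri[OF wfR] labs sat rel by blast qed

definition cay_cond :: "('v,'e,'x) lgraph => 'v => bool" where
 "cay_cond H v0<->VB H = {}&(EX i. has i (tri H) v0&stab (tri H) i v0 = {\<one>[i]}
 &card (lV H) = card (FC i))"

lemma cay_cond_is_cayley:
 assumes wf:"lgraph_wf H" and fo:"folded H" and b:"based (tri H)" and fin:"finite (lV H)" and c:"cay_cond H v0"
 shows "is_cayley (H,v0)"
proof -
 from c obtain i where VB:"VB H = {}" and h:"has i (tri H) v0" and S:"stab (tri H) i v0 = {\<one>[i]}"
 and card:"card (lV H) = card (FC i)" unfolding cay_cond_def by blast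
 let ?V = "comp_V i H v0" and ?a = "act i (tri H) v0"
 have V:"?V = ?a ` FC i" by(rule comp_V_act[OF wf b h])
 have "inj_on ?a (FC i)"
 proof (rule inj_onI)
 fix g k assume g:"g:FC i" "k:FC i" "?a g = ?a k"
 interpret group "factor i" by(rule grp)
 have "g \<odot>[i] inv[i] k = \<one>[i]" using act_eq_iff[OF b g(1,2) h] g(3) S by simp
 thus "g = k" using g(1,2) by(metis inv_closed inv_equality inv_inv) qed
 hence "card ?V = card (lV H)" unfolding V card by(rule card_image)
 moreover have "v0:lV H" using h triD(1)[OF wf] unfolding has_def by blast
 hence "?V<=lV H" by(rule comp_V_sub[OF wf])
 ultimately have VV:"?V = lV H" using fin by(intro card_subset_eq) auto
 have EE:"comp_E i H v0 = lE H"
 proof (intro equalityI subsetI)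
 fix e assume e:"e:lE H"
 hence t:"ltail H e:?V" using lgraph_wfD(1)[OF wf e] VV by blast
 hence hi:"has i (tri H) (ltail H e)" using has_trav[OF symm_tri[OF wf] h] unfolding comp_V_def by blast
 have l:"lab H e:letters (X (colour (lab H e)))" by(rule in_letters_colour[OF basedD(3)[OF b triI[OF e]]])
 have hc:"has (colour (lab H e)) (tri H) (ltail H e)" by(rule hasI[OF l triI[OF e]])
 have "colour (lab H e) = i"
 proof (rule ccontr)
 assume ne:"colour (lab H e)~=i"
 have "has k (tri H) (ltail H e)" for k using hi hc ne other_index[of k i "colour (lab H e)"] by(cases "k = i") auto
 hence "ltail H e:VB H" using lgraph_wfD(1)[OF wf e] by(simp add:VB_has)
 with VB show False by blast qed
 with l e t show "e:comp_E i H v0" by(simp add:comp_E_def) qed (auto simp:comp_E_def)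
 have "pgraph_iso (H,v0) (cayley1 i,{\<one>[i]})"
 using component_cayley[OF wf fo b h] unfolding VV EE S subgr_self[OF wf] .
 with VB show ?thesis unfolding is_cayley.simps by blast qed

lemma is_cayley_cases:
 assumes wf:"lgraph_wf H" and b:"based (tri H)" and v0:"v0:lV H" and c:"is_cayley (H,v0)"
 shows "cay_cond H v0|lV H = {v0}&tri H = {}"
proof -
 from c obtain i where VB:"VB H = {}" and iso:"pgraph_iso (H,v0) (cayley1 i,{\<one>[i]})"
 unfolding is_cayley.simps by blast
 from iso wf obtain f where f:"bij_betw f (lV H) (lV (cayley1 i))" "f v0 = {\<one>[i]}"
 "tri (cayley1 i) = tmap f ` tri H" by(rule pgraph_iso_tri)
 have card:"card (lV H) = card (FC i)"
 using bij_betw_same_card[OF f(1)] unfolding cayley1_verts by(simp add:card_image)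
 show ?thesis
 proof (cases "LX i = {}")
 case True
 have "WX i = {[]}" using True by(auto elim:lists.cases)
 hence "FC i = {\<one>[i]}" by(simp add:carrier_factor elt_Nil)
 with card have "card (lV H) = 1" by simp
 with v0 have "lV H = {v0}" by(auto simp:card_1_singleton_iff)
 moreover have "tri H = {}" using f(3) True unfolding tri_cayley1 by auto
 ultimately show ?thesis by blast
 next
 case False
 then obtain x where x:"x:LX i" by blast
 have "({\<one>[i]},x,{\<one>[i] \<odot>[i] elt i [x]}):tri (cayley1 i)" unfolding tri_cayley1 using x one_cl by blast
 then obtain u w where u:"(u,x,w):tri H" "f u = {\<one>[i]}" unfolding f(3) tmap_def by auto
 have "u = v0" by(rule inj_onD[OF bij_betw_imp_inj_on[OF f(1)] _ triD(1)[OF wf u(1)] v0]) (simp add:u(2) f(2))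
 with u(1) x have h:"has i (tri H) v0" by(blast intro:hasI)
 have "g = \<one>[i]" if "g:stab (tri H) i v0" for g
 proof -
 from that have g:"g:FC i" "act i (tri H) v0 g = v0" by(auto simp:stab_def[OF b])
 from act_word[OF b g(1) h] obtain p where p:"p:WX i" "elt i p = g" "trav (tri H) v0 p v0" using g(2) by metis
 have "trav (tri (cayley1 i)) {\<one>[i]} p {\<one>[i]}" using trav_map[OF p(3),of f] unfolding f(3)[symmetric] f(2) .
 moreover have "trav (tri (cayley1 i)) {\<one>[i]} p {g}"
 using trav_cayley1[OF p(1) one_cl] p(2) g(1) by(simp add:l_one')
 ultimately have "{\<one>[i]} = {g}" by(rule trav_det[OF det_tri[OF cayley_folded[OF triv_sub]]])
 thus ?thesis by simp qed
 hence "stab (tri H) i v0 = {\<one>[i]}" using subgroup.one_closed[OF stab_subgroup[OF b h]] by blast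
 with VB h card show ?thesis unfolding cay_cond_def by blast qed qed

theorem step5I:
 assumes ch:"remove_component^** (Z,v0) (H,v0)" and wf:"lgraph_wf H" and fo:"folded H" and b:"based (tri H)"
 and fin:"finite (lV H)" and v0:"v0:lV H" and no:"!!i p0. ~ rem_cond H v0 i p0" and Z5:"lgraph_wf Z5" "folded Z5"
 and c5:"cay_cond H v0==>lV Z5 = {v0}&tri Z5 = {}" and n5:"~ cay_cond H v0==>lV Z5 = lV H&tri Z5 = tri H"
 shows "step5 (Z,v0) (Z5,v0)"
proof -
 have "~ remove_component (H,v0) Y" for Y
 proof
 assume "remove_component (H,v0) Y"
 thus False
 proof (cases rule:remove_component.cases)
 case (1 V E)
 with removable_iff[OF wf fo b,of v0 V E] no show False by blast qed qed
 hence ex:"exhaust remove_component (Z,v0) (H,v0)" using ch unfolding exhaust_def by blast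
 have same:"pgraph_iso (H',v0) (Z5,v0)"
 if "lgraph_wf H'" "folded H'" "v0:lV H'" "lV Z5 = lV H'" "tri Z5 = tri H'" for H'
 by(rule iso_folded[OF that(1) Z5(1) that(2) Z5(2),of "%x. x"]) (simp_all add:that(3-5))
 have triv:"lgraph_wf (subgr H {v0} {})" "folded (subgr H {v0} {})" "tri (subgr H {v0} {}) = {}"
 by(rule lgraph_wfI; simp) (simp_all add:folded_def tri_def)
 have "pgraph_iso (if is_cayley (H,v0) then subgr H {v0} {} else H,v0) (Z5,v0)"
 proof (cases "is_cayley (H,v0)")
 case True
 have 5:"lV Z5 = {v0}&tri Z5 = {}" using is_cayley_cases[OF wf b v0 True] c5 n5 by(cases "cay_cond H v0") auto
 show ?thesis unfolding if_P[OF True] by(rule same[OF triv(1,2)]) (use 5 triv(3) in simp_all)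
 next
 case False
 hence "~ cay_cond H v0" using cay_cond_is_cayley[OF wf fo b fin] by blast
 note n = n5[OF this]
 show ?thesis unfolding if_not_P[OF False] by(rule same[OF wf fo v0 conjunct1[OF n] conjunct2[OF n]]) qed
 with ex show ?thesis unfolding step5_def by blast qed

section \<open>The Cayley graph at the basepoint\<close>

lemma step6_case_iff:
 assumes wf:"lgraph_wf H" and fo:"folded H" and b:"based (tri H)"
 shows "step6_case (H,v) i V E L<->v:VM i H&V = comp_V i H v&E = comp_E i H v
 &L = {a:carrier A. \<phi> i a:stab (tri H) i v}&L~={oneA}"
proof
 assume "step6_case (H,v) i V E L"
 then obtain K where s:"v:VM i H" "mono_component i H V E" "v:V" "subgroup K (factor i)"
 "pgraph_iso (subgr H V E,v) (cayley i K,K)" "L = {a:carrier A. \<phi> i a:K}" "L~={oneA}"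
 unfolding step6_case_def by auto
 note D = mono_componentD[OF wf s(2,3)]
 have "stab (tri H) i v = K" by(rule stab_of_iso[OF wf b D(1) s(4)]) (use s(5) D(2,3) in simp)
 with s D show "v:VM i H&V = comp_V i H v&E = comp_E i H v
 &L = {a:carrier A. \<phi> i a:stab (tri H) i v}&L~={oneA}" by simp
next
 assume s:"v:VM i H&V = comp_V i H v&E = comp_E i H v
 &L = {a:carrier A. \<phi> i a:stab (tri H) i v}&L~={oneA}"
 hence h:"has i (tri H) v" using VM_has[OF b,of v i] by blast
 show "step6_case (H,v) i V E L" unfolding step6_case_def prod.case
 using s mono_component_comp[OF wf h] comp_V_refl[of v i H] stab_subgroup[OF b h] component_cayley[OF wf fo b h] by blast
qed

lemma step6_skip:
 assumes wf:"lgraph_wf H" and fo:"folded H" and b:"based (tri H)" and v:"v:lV H"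
 and no:"!!i. v:VM i H==>{a:carrier A. \<phi> i a:stab (tri H) i v} = {oneA}" shows "step6 (H,v) (H,v)"
proof -
 have "~ (EX i V E L. step6_case (H,v) i V E L)" unfolding step6_case_iff[OF wf fo b] using no by blast
 thus ?thesis using pgraph_iso_refl[OF v] by simp qed

lemma trav_comp:
 assumes "trav (tri H) u p w" "p:WX i" "u:comp_V i H v"
 shows "trav (tri (subgr H (comp_V i H v) (comp_E i H v))) u p w" using assms
proof (induction p arbitrary: u)
 case (Cons x p)
 from Cons.prems obtain z where z:"(u,x,z):tri H" "trav (tri H) z p w" by auto
 have x:"x:LX i" "p:WX i" using Cons.prems by auto
 from z(1) obtain e where e:"e:lE H" "u = ltail H e" "x = lab H e" "z = lhead H e" by(rule triE)
 have "e:comp_E i H v" using e x Cons.prems(3) by(simp add:comp_E_def)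
 hence "(u,x,z):tri (subgr H (comp_V i H v) (comp_E i H v))"
 using triI[of e "subgr H (comp_V i H v) (comp_E i H v)"] e by simp
 with Cons.IH[OF z(2) x(2) comp_V_step[OF Cons.prems(3) z(1) x(1)]] show ?case by auto qed simp

text \<open>The result is given directly instead of as a quotient: \<open>nu\<close> names the vertices
 of the attached graph, the cosets of elements of \<open>A\<close> being vertices that exist already, and
 \<open>ep\<close> its edges. No two edges become equal.\<close>
theorem step6_glue:
 fixes H Z6 :: "(nat,nat,'x) lgraph"
 assumes wf:"lgraph_wf H" and fo:"folded H" and b:"based (tri H)" and v:"v:VM i H" and ij:"i~=j"
 and L:"L = {a:carrier A. \<phi> i a:stab (tri H) i v}" "L~={oneA}"
 and nuA:"!!a. a:carrier A==>nu (\<phi> j ` L #>[j] \<phi> j a) = act i (tri H) v (\<phi> i a)"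
 and nunew:"!!c. c:rcosets[j] (\<phi> j ` L)==>(!!a. a:carrier A==>c~=\<phi> j ` L #>[j] \<phi> j a)==>nu c ~: lV H"
 and nuinj:"inj_on nu (rcosets[j] (\<phi> j ` L))"
 and epinj:"inj_on ep (lE (cayley j (\<phi> j ` L)))" and epnew:"ep ` lE (cayley j (\<phi> j ` L)) Int lE H = {}"
 and V6:"lV Z6 = lV H Un nu ` (rcosets[j] (\<phi> j ` L))" and E6:"lE Z6 = lE H Un ep ` lE (cayley j (\<phi> j ` L))"
 and old:"!!e. e:lE H==>ltail Z6 e = ltail H e&lhead Z6 e = lhead H e&bar Z6 e = bar H e&lab Z6 e = lab H e"
 and new:"!!d. d:lE (cayley j (\<phi> j ` L))==>ltail Z6 (ep d) = nu (ltail (cayley j (\<phi> j ` L)) d)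
 &lhead Z6 (ep d) = nu (lhead (cayley j (\<phi> j ` L)) d)&bar Z6 (ep d) = ep (bar (cayley j (\<phi> j ` L)) d)
 &lab Z6 (ep d) = lab (cayley j (\<phi> j ` L)) d" and out:"!!e. e ~: lE Z6==>bar Z6 e = e"
 shows "step6 (H,v) (Z6,v)" "lgraph_wf Z6"
proof -
 let ?S = "\<phi> j ` L" and ?C = "cayley j (\<phi> j ` L)" and ?T = "tri H"
 let ?V = "comp_V i H v" and ?E = "comp_E i H v"
 from v have vv:"v:lV H" and h:"has i ?T v" using VM_has[OF b,of v i] by blast+
 have LA:"subgroup L A" unfolding L(1) by(rule preimage_subgroup[OF stab_subgroup[OF b h]])
 have S:"subgroup ?S (factor j)" by(rule \<phi>_subgroup[OF LA])
 have wfC:"lgraph_wf ?C" by(rule cayley_wf[OF S])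
 have Ssub:"?S<=FC j" by(rule subgroup.subset[OF S])
 show wf6:"lgraph_wf Z6"
 proof (rule lgraph_wfI)
 fix e assume "e:lE Z6"
 then consider "e:lE H"|d where "d:lE ?C" "e = ep d" unfolding E6 by blast
 thus "ltail Z6 e:lV Z6&lhead Z6 e:lV Z6&bar Z6 e:lE Z6
 &bar Z6 (bar Z6 e) = e&ltail Z6 (bar Z6 e) = lhead Z6 e&lab Z6 (bar Z6 e) = inv_letter (lab Z6 e)"
 proof cases
 case 1
 note w = lgraph_wfD[OF wf 1] and o = old[OF 1]
 note o' = old[OF w(3)]
 show ?thesis using w o o' unfolding V6 E6 by simp
 next
 case 2
 note w = lgraph_wfD[OF wfC 2(1)] and o = new[OF 2(1)]
 note o' = new[OF w(3)]
 have "ltail ?C d:rcosets[j] ?S" "lhead ?C d:rcosets[j] ?S" using w(1,2) by simp_all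
 thus ?thesis using w o o' imageI[OF w(3),of ep] unfolding V6 E6 2(2) by simp qed qed (rule out)
 define RV :: "((nat+unit \<times> 'x word set set) \<times> (nat+unit \<times> 'x word set set)) set" where "RV = {(Inl v,Inr ((),?S))} Un {(Inl w,Inr ((),?S #>[j] \<phi> j a))|w a p. a:carrier A - L
 &pre_digraph.awalk (dig (subgr H ?V ?E)) v p w&map (lab H) p:\<phi> i a}"
 define D where "D = djunion H {()} (%_. ?C)"
 define f where "f = case_sum (%u. u) (%(_ :: unit,c). nu c)"
 define g where "g = case_sum (%u. u) (%(_ :: unit,c). ep c)"
 have f:"f (Inl u) = u" "f (Inr ((),c)) = nu c" for u c by(simp_all add:f_def)
 have g:"g (Inl e) = e" "g (Inr ((),d)) = ep d" for e d by(simp_all add:g_def)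
 have vD:"x:lV D<->(EX u:lV H. x = Inl u)|(EX c:rcosets[j] ?S. x = Inr ((),c))" for x unfolding D_def by auto
 have aD:"x:lE D<->(EX e:lE H. x = Inl e)|(EX d:lE ?C. x = Inr ((),d))" for x unfolding D_def djunion_simps by auto
 have act1:"\<phi> i a:FC i" if "a:carrier A" for a using that by simp
 have awalk:"w = act i ?T v (\<phi> i a)" if "a:carrier A" "pre_digraph.awalk (dig (subgr H ?V ?E)) v p w" "map (lab H) p:\<phi> i a" for w a p
 proof -
 have 1:"map (lab H) p:WX i" "elt i (map (lab H) p) = \<phi> i a" using in_\<phi>[OF that(1)] that(3) by auto
 have "trav (tri (subgr H ?V ?E)) v (map (lab H) p) w"
 using awalk_trav[OF comp_wf[OF wf],of i v v w "map (lab H) p"] that(2) by auto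
 hence "trav ?T v (map (lab H) p) w" by(rule trav_mono) (auto simp:tri_def comp_E_def)
 with act_trav[OF b h 1(1)] 1(2) show ?thesis by simp qed
 have awalk': "EX p. pre_digraph.awalk (dig (subgr H ?V ?E)) v p (act i ?T v (\<phi> i a))&map (lab H) p:\<phi> i a" if a:"a:carrier A" for a
 proof -
 from act_word[OF b act1[OF a] h] obtain q where q:"q:WX i" "elt i q = \<phi> i a" "trav ?T v q (act i ?T v (\<phi> i a))" .
 from trav_comp[OF q(3,1) comp_V_refl] awalk_trav[OF comp_wf[OF wf],of i v v "act i ?T v (\<phi> i a)" q] comp_V_refl[of v i H]
 obtain p where "pre_digraph.awalk (dig (subgr H ?V ?E)) v p (act i ?T v (\<phi> i a))" "map (lab H) p = q" by auto
 thus ?thesis using in_\<phi>[OF a] q(1,2) by blast qed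
 have one:"oneA:carrier A" using subgroup.one_closed[OF LA] subgroup.subset[OF LA] by blast
 have nuS:"nu ?S = v"
 using nuA[OF one] \<phi>_one[of i] \<phi>_one[of j] act_one[OF b h] group.coset_mult_one[OF grp Ssub] by simp
 have rel:"(Inl (nu c),Inr ((),c)):RV" if c:"c:rcosets[j] ?S" "nu c:lV H" for c
 proof -
 from nunew[OF c(1)] c(2) obtain a where a:"a:carrier A" "c = ?S #>[j] \<phi> j a" by blast
 show ?thesis
 proof (cases "a:L")
 case True
 hence "?S #>[j] \<phi> j a = ?S" using group.coset_join2[OF grp \<phi>_closed[OF a(1)] S] by blast
 thus ?thesis unfolding a(2) using nuS by(simp add:RV_def)
 next
 case False
 from awalk'[OF a(1)] obtain p where "pre_digraph.awalk (dig (subgr H ?V ?E)) v p (act i ?T v (\<phi> i a))" "map (lab H) p:\<phi> i a" by blast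
 thus ?thesis unfolding a(2) nuA[OF a(1)] RV_def using False a(1) by blast qed qed
 have RVf:"f x = f y" if "(x,y):RV" for x y
 proof -
 from that consider "x = Inl v" "y = Inr ((),?S)"
 |w a p where "x = Inl w" "y = Inr ((),?S #>[j] \<phi> j a)" "a:carrier A - L"
 "pre_digraph.awalk (dig (subgr H ?V ?E)) v p w" "map (lab H) p:\<phi> i a" unfolding RV_def by blast
 thus ?thesis
 proof cases
 case 1
 thus ?thesis by(simp add:f nuS)
 next
 case 2
 thus ?thesis using awalk[of a p w] nuA[of a] by(simp add:f) qed qed
 have ker:"f x = f y<->(x,y):(RV Un RV\<inverse>)\<^sup>*" if x:"x:lV D" and y:"y:lV D" for x y
 proof
 assume e:"f x = f y"
 from x y consider u w where "x = Inl u" "y = Inl w"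
 |u c where "x = Inl u" "y = Inr ((),c)" "u:lV H" "c:rcosets[j] ?S"
 |u c where "y = Inl u" "x = Inr ((),c)" "u:lV H" "c:rcosets[j] ?S"
 |c d where "x = Inr ((),c)" "y = Inr ((),d)" "c:rcosets[j] ?S" "d:rcosets[j] ?S" unfolding vD by blast
 thus "(x,y):(RV Un RV\<inverse>)\<^sup>*"
 proof cases
 case 1
 thus ?thesis using e by(simp add:f)
 next
 case 2
 hence "(x,y):RV" using e rel[of c] by(simp add:f)
 thus ?thesis by blast
 next
 case 3
 hence "(y,x):RV" using e rel[of c] by(simp add:f)
 thus ?thesis by blast
 next
 case 4
 hence "c = d" using e nuinj by(simp add:f inj_on_def)
 with 4 show ?thesis by simp qed
 next
 assume "(x,y):(RV Un RV\<inverse>)\<^sup>*"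
 thus "f x = f y" by(rule rtrancl_kernel) (rule RVf) qed
 have kerE:"g x = g y<->(x,y):({} Un {}\<inverse>)\<^sup>*" if x:"x:lE D" and y:"y:lE D" for x y
 proof -
 have "g x = g y-->x = y"
 proof
 assume e:"g x = g y"
 from x y consider u w where "x = Inl u" "y = Inl w"
 |u c where "x = Inl u" "y = Inr ((),c)" "u:lE H" "c:lE ?C"
 |u c where "y = Inl u" "x = Inr ((),c)" "u:lE H" "c:lE ?C"
 |c d where "x = Inr ((),c)" "y = Inr ((),d)" "c:lE ?C" "d:lE ?C" unfolding aD by blast
 thus "x = y"
 proof cases
 case 1
 thus ?thesis using e by(simp add:g)
 next
 case 2
 hence "u = ep c" using e by(simp add:g)
 thus ?thesis using epnew 2(3,4) by blast
 next
 case 3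
 hence "u = ep c" using e by(simp add:g)
 thus ?thesis using epnew 3(3,4) by blast
 next
 case 4
 hence "ep c = ep d" using e by(simp add:g)
 thus ?thesis using inj_onD[OF epinj _ 4(3,4)] 4(1,2) by simp qed qed
 thus ?thesis by auto qed
 have "lgraph_hom D Z6 f g" unfolding lgraph_hom_def
 proof (intro conjI ballI)
 show "f ` lV D<=lV Z6" unfolding V6 using vD by(auto simp:f)
 show "g ` lE D<=lE Z6" unfolding E6
 proof
 fix y assume "y:g ` lE D"
 then obtain x where x:"x:lE D" "y = g x" by blast
 then consider e where "e:lE H" "x = Inl e"|d where "d:lE ?C" "x = Inr ((),d)" unfolding aD by blast
 thus "y:lE H Un ep ` lE ?C" by cases (use x in "auto simp:g") qed
 fix x assume "x:lE D"
 then consider e where "e:lE H" "x = Inl e"|d where "d:lE ?C" "x = Inr ((),d)" unfolding aD by blast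
 hence "ltail Z6 (g x) = f (ltail D x)&lhead Z6 (g x) = f (lhead D x)&bar Z6 (g x) = g (bar D x)&lab Z6 (g x) = lab D x"
 proof cases
 case 1
 thus ?thesis using old[OF 1(1)] by(simp add:D_def f g)
 next
 case 2
 thus ?thesis using new[OF 2(1)] by(simp add:D_def f g) qed
 thus "ltail Z6 (g x) = f (ltail D x)" "lhead Z6 (g x) = f (lhead D x)" "bar Z6 (g x) = g (bar D x)" "lab Z6 (g x) = lab D x" by blast+
 qed
 moreover have "f ` lV D = lV Z6"
 unfolding V6 D_def djunion_simps Plus_def image_Un image_image f by(auto simp:f image_iff)
 moreover have "g ` lE D = lE Z6" unfolding E6 D_def djunion_simps(2) Plus_def image_Un image_image g
 proof -
 have "(%x. g (Inr x)) ` (SIGMA p:{()}. lE ?C) = ep ` lE ?C" by(auto simp:g_def image_iff split:unit.splits)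
 thus "(%x. x) ` lE H Un (%x. g (Inr x)) ` (SIGMA p:{()}. lE ?C) = lE H Un ep ` lE ?C" by simp qed
 ultimately have id:"identify D RV {} Z6 f" unfolding identify_def using wf6 ker kerE by blast
 have c6:"step6_case (H,v) i ?V ?E L" unfolding step6_case_iff[OF wf fo b] using v L by blast
 hence "EX i V E L. step6_case (H,v) i V E L" by blast
 moreover have "EX i j V E L f. step6_case (H,v) i V E L&i~=j
 &identify (djunion H {()} (%_. cayley j (\<phi> j ` L)))
 ({(Inl v,Inr ((),\<phi> j ` L))}
 Un {(Inl w,Inr ((),(\<phi> j ` L) #>[j] \<phi> j a))|w a p. a:carrier A - L
 &pre_digraph.awalk (dig (subgr H V E)) v p w&map (lab H) p:\<phi> i a})
 {} Z6 f
 &v = f (Inl v)"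
 by(rule exI[of _ i],rule exI[of _ j],rule exI[of _ ?V],rule exI[of _ ?E],rule exI[of _ L],rule exI[of _ f],
 intro conjI,rule c6,rule ij,rule id[unfolded D_def RV_def],rule f(1)[symmetric])
 ultimately show "step6 (H,v) (Z6,v)" unfolding step6.simps by(simp only: if_True simp_thms) qed

end

section \<open>The programs for folding\<close>

definition skip :: stmt where
 "skip = Assign 20 (Num 0)"

lemma skip_simps [simp]:
 "run skip s = set_reg 20 0 s" "wregs skip = {20}" "warrs skip = {}" "uregs skip = {20}" "depth skip = 0"
 by(simp_all add:skip_def)

text \<open>Registers: 4 holds a bound of the names of vertices, 5 the number of triples. Arrays: 5 marks
 the vertices, 6 is the table of edges, 7 to 9 are the origins, the labels and the ends of the triples
 that are to be folded, 10 is the name of the class of each vertex, 11 is a table that is built anew in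
 each round.\<close>

definition key :: "nat => expr => expr" where
 "key W e = Plus (eMul W (Cell 10 (Cell 7 e))) (Cell 8 e)"

definition fold_probe :: "nat => stmt" where
 "fold_probe W = Assign 11 (key W (Var 7)) ;; Assign 12 (Cell 10 (Cell 9 (Var 7))) ;;
 Cond (Cell 11 (Var 11))
 (Cond (tEq (Cell 11 (Var 11)) (Plus (Var 12) (Num 1))) skip
 (Assign 9 (Minus (Cell 11 (Var 11)) (Num 1)) ;; Assign 10 (Var 12)))
 (Write 11 (Var 11) (Plus (Var 12) (Num 1)))"

definition search :: "nat => stmt" where
 "search W = For 7 (Cond (tLess (Var 7) (Var 5)) (fold_probe W) skip)"

definition fold_round :: "nat => stmt" where
 "fold_round W = For 7 (Write 11 (Var 7) (Num 0)) ;; Assign 9 (Num 0) ;; Assign 10 (Num 0) ;;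
 search W ;;
 For 7 (Cond (tEq (Cell 10 (Var 7)) (Var 9)) (Write 10 (Var 7) (Var 10)) skip)"

definition fold_prog :: "nat => stmt" where
 "fold_prog W = For 6 (Write 10 (Var 6) (Var 6)) ;; For 6 (fold_round W)"

definition tset :: "state => (nat \<times> nat \<times> nat) set" where
 "tset s = {(arr s 7 e,arr s 8 e,arr s 9 e)|e. e < reg s 5}"

definition fold_ok :: "nat => nat => state => bool" where
 "fold_ok W N s<->reg s 5<=reg s 3&W * N<=reg s 3&0 < W&0 < N
 &(ALL e<reg s 5. arr s 7 e < N&arr s 8 e < W&arr s 9 e < N)"

lemma key_inj:
 assumes "W * u+x = W * u'+x'" "x < W" "x' < (W :: nat)" shows "u = u'&x = x'"
proof -
 have "(W * u+x) div W = u" "(W * u'+x') div W = u'" using assms(2,3) by simp_all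
 hence "u = u'" using assms(1) by simp
 with assms(1) show ?thesis by simp qed

lemma key_less:"u < N==>x < W==>W * N<=B==>W * u+x < (B :: nat)"
proof -
 assume "u < N" "x < W" "W * N<=B"
 hence "W * u+x < W * Suc u" by simp
 also have "\<dots><=W * N" using `u < N` by(intro mult_le_mono2) simp
 finally show ?thesis using `W * N<=B` by simp qed

lemma tset_lfc_less:
 assumes "fold_ok W N s" "lfc (tset s) u w" shows "u = w|u < N&w < N" using assms(2)
proof (induction rule:lfc.induct)
 case (fold u x w u' w')
 thus ?case using assms(1) by(auto simp:tset_def fold_ok_def) qed auto

lemma run_fold_search:
 fixes s :: state
 defines "n == reg s 5" and "L == arr s 10" and "S == arr s 7" and "X == arr s 8" and "D == arr s 9"
 assumes ok:"fold_ok W N s" and LN:"!!j. j < N==>L j < N" and T0:"!!q. q < reg s 3==>arr s 11 q = 0"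
 and ab:"reg s 9 = reg s 10" shows "let t = run (search W) s in
 (reg t 9 = reg t 10&fold_cong (tset s) L)
 |(reg t 9~=reg t 10&(EX e<n. EX e'<n. L (S e) = L (S e')&X e = X e'&reg t 9 = L (D e)&reg t 10 = L (D e')))"
proof -
 define k where "k e = W * L (S e)+X e" for e
 have kB:"k e < reg s 3" if "e < n" for e
 using ok LN that unfolding k_def fold_ok_def n_def L_def S_def X_def by(intro key_less[of _ N]) auto
 have kinj:"L (S e) = L (S e')&X e = X e'" if "k e = k e'" "e < n" "e' < n" for e e'
 using that ok unfolding k_def fold_ok_def n_def X_def by(intro key_inj) auto
 define I where "I m t<->(ALL q<reg s 3. ALL w. arr t 11 q = Suc w-->(EX e<n. q = k e&w = L (D e)))
 &((reg t 9 = reg t 10&(ALL e<n. e < m-->arr t 11 (k e) = Suc (L (D e))))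
 |(reg t 9~=reg t 10&(EX e<n. EX e'<n. k e = k e'&reg t 9 = L (D e)&reg t 10 = L (D e'))))" for m and t :: state
 have "I (reg s 3) (run (search W) s)" unfolding search_def
 proof (rule For_rule)
 show "I 0 s" unfolding I_def using T0 ab by simp
 next
 fix m and t :: state
 assume m:"m < reg s 3" and It:"I m t"
 and fr:"!!r. r ~: wregs (For 7 (Cond (tLess (Var 7) (Var 5)) (fold_probe W) skip))==>reg t r = reg s r"
 and fa:"!!b. b ~: warrs (Cond (tLess (Var 7) (Var 5)) (fold_probe W) skip)==>arr t b = arr s b"
 have f:"reg t 5 = n" "arr t 7 = S" "arr t 8 = X" "arr t 9 = D" "arr t 10 = L"
 using fr[of 5] fa[of 7] fa[of 8] fa[of 9] fa[of 10] by(simp_all add:fold_probe_def n_def S_def X_def D_def L_def)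
 show "I (Suc m) (run (Cond (tLess (Var 7) (Var 5)) (fold_probe W) skip) (set_reg 7 m t))" (is "I _ ?t")
 proof (cases "m < n")
 case False
 hence "reg ?t 9 = reg t 9" "reg ?t 10 = reg t 10" "arr ?t 11 = arr t 11" using f by simp_all
 thus ?thesis using It False unfolding I_def by(simp add:less_Suc_eq)
 next
 case True
 have t:"arr ?t 11 = (if arr t 11 (k m) = 0 then (arr t 11)(k m := Suc (L (D m))) else arr t 11)"
 "reg ?t 9 = (if arr t 11 (k m) = 0|arr t 11 (k m) = Suc (L (D m)) then reg t 9 else arr t 11 (k m) - 1)"
 "reg ?t 10 = (if arr t 11 (k m) = 0|arr t 11 (k m) = Suc (L (D m)) then reg t 10 else L (D m))"
 using True f by(simp_all add:fold_probe_def key_def k_def)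
 from It have I1:"!!q w. q < reg s 3==>arr t 11 q = Suc w==>EX e<n. q = k e&w = L (D e)"
 and I2:"(reg t 9 = reg t 10&(ALL e<n. e < m-->arr t 11 (k e) = Suc (L (D e))))
 |(reg t 9~=reg t 10&(EX e<n. EX e'<n. k e = k e'&reg t 9 = L (D e)&reg t 10 = L (D e')))" unfolding I_def by blast+
 consider "arr t 11 (k m) = 0"|"arr t 11 (k m) = Suc (L (D m))"
 |w where "arr t 11 (k m) = Suc w" "w~=L (D m)" by(cases "arr t 11 (k m)") auto
 thus ?thesis
 proof cases
 case 1
 have "EX e<n. q = k e&w = L (D e)" if "q < reg s 3" "((arr t 11)(k m := Suc (L (D m)))) q = Suc w" for q w
 using that I1[of q w] True by(cases "q = k m") auto
 moreover have "((arr t 11)(k m := Suc (L (D m)))) (k e) = Suc (L (D e))"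
 if "ALL e<n. e < m-->arr t 11 (k e) = Suc (L (D e))" "e < n" "e < Suc m" for e using that 1 by(cases "e = m") auto
 moreover have t1:"arr ?t 11 = (arr t 11)(k m := Suc (L (D m)))" "reg ?t 9 = reg t 9" "reg ?t 10 = reg t 10"
 using t 1 by simp_all
 ultimately show ?thesis unfolding I_def t1 using I2 by blast
 next
 case 2
 thus ?thesis unfolding I_def t using I1 I2 less_antisym by(auto simp:less_Suc_eq)
 next
 case 3
 then obtain e where e:"e < n" "k m = k e" "w = L (D e)" using I1[OF kB[OF True]] by blast
 have t1:"arr ?t 11 = arr t 11" "reg ?t 9 = L (D e)" "reg ?t 10 = L (D m)" using t 3 e(3) by simp_all
 have "EX e<n. EX e'<n. k e = k e'&reg ?t 9 = L (D e)&reg ?t 10 = L (D e')"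
 by(rule exI[of _ e],intro conjI e(1),rule exI[of _ m],simp only: t1 e(2) True simp_thms)
 moreover have "reg ?t 9~=reg ?t 10" unfolding t1 using 3(2) e(3) by simp
 moreover have "ALL q<reg s 3. ALL w. arr ?t 11 q = Suc w-->(EX e<n. q = k e&w = L (D e))" unfolding t1 using I1 by blast
 ultimately show ?thesis unfolding I_def by(intro conjI disjI2) qed qed qed
 hence "(reg (run (search W) s) 9 = reg (run (search W) s) 10&(ALL e<n. arr (run (search W) s) 11 (k e) = Suc (L (D e))))
 |(reg (run (search W) s) 9~=reg (run (search W) s) 10&(EX e<n. EX e'<n. k e = k e'&reg (run (search W) s) 9 = L (D e)&reg (run (search W) s) 10 = L (D e')))"
 using ok unfolding I_def fold_ok_def n_def by auto
 thus ?thesis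
 proof
 assume a:"reg (run (search W) s) 9 = reg (run (search W) s) 10&(ALL e<n. arr (run (search W) s) 11 (k e) = Suc (L (D e)))"
 have "fold_cong (tset s) L"
 proof (rule fold_congI)
 fix u x w u' w' assume *: "(u,x,w):tset s" "(u',x,w'):tset s" "L u = L u'"
 then obtain e e' where e:"e < n" "u = S e" "x = X e" "w = D e" "e' < n" "u' = S e'" "x = X e'" "w' = D e'"
 unfolding tset_def n_def S_def X_def D_def by blast
 hence "k e = k e'" using *(3) by(simp add:k_def)
 with a e show "L w = L w'" by(metis nat.inject) qed
 with a show ?thesis by(simp add:Let_def)
 next
 assume "reg (run (search W) s) 9~=reg (run (search W) s) 10&(EX e<n. EX e'<n. k e = k e'&reg (run (search W) s) 9 = L (D e)&reg (run (search W) s) 10 = L (D e'))"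
 thus ?thesis unfolding Let_def using kinj by blast qed qed

text \<open>A round either finds that the current classes form a folding congruence or merges two classes.\<close>

lemma run_fold_round:
 fixes s :: state
 defines "L == arr s 10" and "B == reg s 3"
 assumes ok:"fold_ok W N s" and lf:"!!j. j < B==>lfc (tset s) j (L j)"
 defines "L' == arr (run (fold_round W) s) 10"
 shows "(ALL j<B. lfc (tset s) j (L' j))&(fold_cong (tset s) L&(ALL j<B. L' j = L j)|card (L' ` {..<B}) < card (L ` {..<B}))"
proof -
 let ?c1 = "For 7 (Write 11 (Var 7) (Num 0)) ;; Assign 9 (Num 0) ;; Assign 10 (Num 0)"
 let ?c3 = "For 7 (Cond (tEq (Cell 10 (Var 7)) (Var 9)) (Write 10 (Var 7) (Var 10)) skip)"
 define s1 where "s1 = run ?c1 s"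
 define s2 where "s2 = run (search W) s1"
 have r:"run (fold_round W) s = run ?c3 s2" by(simp only: fold_round_def run.simps s1_def s2_def)
 have z:"arr (run (For 7 (Write 11 (Var 7) (Num 0))) s) 11 = (%j. if j < reg s 3 then 0 else arr s 11 j)"
 by(rule For_array_rule) auto
 have f1:"reg s1 5 = reg s 5" "reg s1 3 = B" "arr s1 7 = arr s 7" "arr s1 8 = arr s 8" "arr s1 9 = arr s 9" "arr s1 10 = L"
 unfolding s1_def L_def B_def by(simp_all add:frame_reg frame_arr del: run.simps)
 have s1:"!!q. q < B==>arr s1 11 q = 0" "reg s1 9 = reg s1 10"
 using z unfolding s1_def B_def by(simp_all del: run.simps(5))
 have ok1:"fold_ok W N s1" and ts:"tset s1 = tset s" using ok f1 unfolding fold_ok_def tset_def B_def by simp_all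
 have NB:"N<=B" using ok unfolding fold_ok_def B_def
 by(metis One_nat_def Suc_leI mult.commute mult_le_mono2 nat_mult_1_right order_trans)
 have LN:"L j < N" if "j < N" for j using tset_lfc_less[OF ok lf[of j]] that NB by auto
 have f2:"reg s2 3 = B" "arr s2 10 = L"
 unfolding s2_def using f1 by(simp_all add:frame_reg frame_arr search_def fold_probe_def del: run.simps)
 have L': "L' = (%j. if j < B&L j = reg s2 9 then reg s2 10 else L j)"
 proof -
 have "(%m t. arr t 10 = (%j. if j < m&L j = reg s2 9 then reg s2 10 else L j)) (reg s2 3) (run ?c3 s2)"
 proof (rule For_rule)
 show "arr s2 10 = (%j. if j < 0&L j = reg s2 9 then reg s2 10 else L j)" using f2 by simp
 next
 fix k and t :: state assume k:"arr t 10 = (%j. if j < k&L j = reg s2 9 then reg s2 10 else L j)"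
 "!!r. r ~: wregs ?c3==>reg t r = reg s2 r"
 have "reg t 9 = reg s2 9" "reg t 10 = reg s2 10" using k(2)[of 9] k(2)[of 10] by simp_all
 thus "arr (run (Cond (tEq (Cell 10 (Var 7)) (Var 9)) (Write 10 (Var 7) (Var 10)) skip) (set_reg 7 k t)) 10
 = (%j. if j < Suc k&L j = reg s2 9 then reg s2 10 else L j)" using k(1) by(auto simp:fun_eq_iff less_Suc_eq) qed
 thus ?thesis unfolding L'_def r f2(1) by simp qed
 have alt:"(reg s2 9 = reg s2 10&fold_cong (tset s) L)
 |(reg s2 9~=reg s2 10&(EX e<reg s 5. EX e'<reg s 5. L (arr s 7 e) = L (arr s 7 e')&arr s 8 e = arr s 8 e'&reg s2 9 = L (arr s 9 e)&reg s2 10 = L (arr s 9 e')))"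
 using run_fold_search[OF ok1] LN s1 unfolding f1 ts Let_def s2_def by blast
 thus ?thesis
 proof
 assume a:"reg s2 9 = reg s2 10&fold_cong (tset s) L"
 hence "L' = L" unfolding L' by(auto simp:fun_eq_iff)
 with a lf show ?thesis by simp
 next
 assume "reg s2 9~=reg s2 10&(EX e<reg s 5. EX e'<reg s 5. L (arr s 7 e) = L (arr s 7 e')&arr s 8 e = arr s 8 e'&reg s2 9 = L (arr s 9 e)&reg s2 10 = L (arr s 9 e'))"
 then obtain e e' where e:"reg s2 9~=reg s2 10" "e < reg s 5" "e' < reg s 5" "L (arr s 7 e) = L (arr s 7 e')"
 "arr s 8 e = arr s 8 e'" "reg s2 9 = L (arr s 9 e)" "reg s2 10 = L (arr s 9 e')" by blast
 have lt:"arr s 7 e < B" "arr s 7 e' < B" "arr s 9 e < B" "arr s 9 e' < B"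
 using ok e(2,3) NB unfolding fold_ok_def by(auto intro:less_le_trans)
 have "lfc (tset s) (arr s 7 e) (arr s 7 e')" using lf[OF lt(1)] lf[OF lt(2)] e(4) by(metis lfc.sym lfc.trans)
 moreover have "(arr s 7 e,arr s 8 e,arr s 9 e):tset s" "(arr s 7 e',arr s 8 e,arr s 9 e'):tset s"
 using e unfolding tset_def by auto
 ultimately have "lfc (tset s) (arr s 9 e) (arr s 9 e')" by(metis lfc.fold)
 hence ab:"lfc (tset s) (reg s2 9) (reg s2 10)"
 using lf[OF lt(3)] lf[OF lt(4)] unfolding e(6,7) by(metis lfc.sym lfc.trans)
 have "lfc (tset s) j (L' j)" if "j < B" for j using lf[OF that] ab unfolding L' by(auto intro:lfc.trans)
 moreover have "card (L' ` {..<B}) < card (L ` {..<B})"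
 proof (rule psubset_card_mono)
 have "L' ` {..<B}<=L ` {..<B}" unfolding L' e(7) using lt(4) by auto
 moreover have "reg s2 9:L ` {..<B}" unfolding e(6) using lt(3) by blast
 moreover have "reg s2 9 ~: L' ` {..<B}" unfolding L' using e(1) by auto
 ultimately show "L' ` {..<B} \<subset> L ` {..<B}" by blast qed simp
 ultimately show ?thesis by blast qed qed

text \<open>A round that does not find a folding congruence reduces the number of classes, so as many rounds
 as there are names suffice.\<close>
theorem run_fold_prog:
 fixes s :: state
 assumes ok:"fold_ok W N s"
 defines "L == arr (run (fold_prog W) s) 10" and "B == reg s 3"
 shows "fold_cong (tset s) L" "!!j. j < B==>lfc (tset s) j (L j)"
 "!!j k. j < B==>k < B==>L j = L k<->lfc (tset s) j k"
proof -
 define s1 where "s1 = run (For 6 (Write 10 (Var 6) (Var 6))) s"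
 have L1:"arr s1 10 = (%j. if j < reg s 3 then j else arr s 10 j)" unfolding s1_def by(rule For_array_rule) auto
 have f1:"reg s1 5 = reg s 5" "reg s1 3 = B" "arr s1 7 = arr s 7" "arr s1 8 = arr s 8" "arr s1 9 = arr s 9"
 unfolding s1_def B_def by(simp_all add:frame_reg frame_arr del: run.simps)
 define I where "I m t<->(ALL j<B. lfc (tset s) j (arr t 10 j))
 &(fold_cong (tset s) (arr t 10)|card (arr t 10 ` {..<B})+m<=B)" for m and t :: state
 have NB:"N<=B" "0 < N" using ok unfolding fold_ok_def B_def
 by(metis One_nat_def Suc_leI mult.commute mult_le_mono2 nat_mult_1_right order_trans,simp)
 have "I (reg s1 3) (run (For 6 (fold_round W)) s1)"
 proof (rule For_rule)
 have "arr s1 10 ` {..<B} = {..<B}" unfolding L1 B_def by auto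
 thus "I 0 s1" unfolding I_def L1 B_def by(auto intro:lfc.refl)
 next
 fix m and t :: state assume m:"m < reg s1 3" and I:"I m t"
 and fr:"!!r. r ~: wregs (For 6 (fold_round W))==>reg t r = reg s1 r"
 and fa:"!!b. b ~: warrs (fold_round W)==>arr t b = arr s1 b"
 have f:"reg t 5 = reg s 5" "reg t 3 = B" "arr t 7 = arr s 7" "arr t 8 = arr s 8" "arr t 9 = arr s 9"
 using fr[of 5] fr[of 3] fa[of 7] fa[of 8] fa[of 9] f1 by(simp_all add:fold_round_def search_def fold_probe_def)
 let ?t = "set_reg 6 m t"
 have ok': "fold_ok W N ?t" and ts:"tset ?t = tset s" using ok f unfolding fold_ok_def tset_def B_def by simp_all
 have lf:"lfc (tset s) j (arr t 10 j)" if "j < B" for j using I that unfolding I_def by blast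
 have rd:"(ALL j<B. lfc (tset s) j (arr (run (fold_round W) ?t) 10 j)) &
 (fold_cong (tset s) (arr t 10)&(ALL j<B. arr (run (fold_round W) ?t) 10 j = arr t 10 j) |
 card (arr (run (fold_round W) ?t) 10 ` {..<B}) < card (arr t 10 ` {..<B}))"
 using run_fold_round[OF ok'] lf f(2) unfolding ts by simp
 show "I (Suc m) (run (fold_round W) ?t)"
 proof (cases "card (arr (run (fold_round W) ?t) 10 ` {..<B}) < card (arr t 10 ` {..<B})&card (arr t 10 ` {..<B})+m<=B")
 case True
 thus ?thesis using rd unfolding I_def by simp
 next
 case nc: False
 show ?thesis
 proof (cases "fold_cong (tset s) (arr t 10)")
 case True
 have tlt:"u < B&w < B" if "(u,x,w):tset s" for u x w using that ok NB unfolding tset_def fold_ok_def by auto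
 have same:"arr t 10 i = arr t 10 j" if "lfc (tset s) i j" for i j using lfc_least[OF that True] .
 have "fold_cong (tset s) (arr (run (fold_round W) ?t) 10)"
 proof (rule fold_congI)
 fix u x w u' w' assume *: "(u,x,w):tset s" "(u',x,w'):tset s"
 "arr (run (fold_round W) ?t) 10 u = arr (run (fold_round W) ?t) 10 u'"
 show "arr (run (fold_round W) ?t) 10 w = arr (run (fold_round W) ?t) 10 w'"
 proof (cases "ALL j<B. arr (run (fold_round W) ?t) 10 j = arr t 10 j")
 case True
 thus ?thesis using fold_congD[OF `fold_cong (tset s) (arr t 10)` *(1,2)] *(3) tlt[OF *(1)] tlt[OF *(2)] by simp
 next
 case False
 with rd have less:"card (arr (run (fold_round W) ?t) 10 ` {..<B}) < card (arr t 10 ` {..<B})" by blast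
 have "card (arr t 10 ` {..<B})<=card (arr (run (fold_round W) ?t) 10 ` {..<B})"
 proof (rule surj_card_le[of _ _ "arr t 10"])
 show "arr t 10 ` {..<B}<=arr t 10 ` (arr (run (fold_round W) ?t) 10 ` {..<B})" using rd same by(force simp:image_iff)
 qed simp
 with less show ?thesis by simp qed qed
 with rd show ?thesis unfolding I_def by blast
 next
 case False
 with I nc rd show ?thesis unfolding I_def by auto qed qed qed
 moreover have "run (fold_prog W) s = run (For 6 (fold_round W)) s1" by(simp only: fold_prog_def run.simps s1_def)
 ultimately have I:"I B (run (fold_prog W) s)" using f1(2) by simp
 have "card (L ` {..<B}) > 0" using NB by(auto simp:card_gt_0_iff lessThan_empty_iff bot_nat_def)
 with I show fc:"fold_cong (tset s) L" unfolding I_def L_def by linarith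
 show lf:"lfc (tset s) j (L j)" if "j < B" for j using I that unfolding I_def L_def by blast
 show "L j = L k<->lfc (tset s) j k" if "j < B" "k < B" for j k
 proof
 assume "L j = L k"
 with lf[OF that(1)] lf[OF that(2)] show "lfc (tset s) j k" by(metis lfc.sym lfc.trans)
 next
 assume "lfc (tset s) j k" thus "L j = L k" using fc by(rule lfc_least) qed qed

lemma fold_prog_frame [simp]:
 "wregs (fold_prog W) = {6,7,9,10,11,12,20}" "warrs (fold_prog W) = {10,11}"
 by(auto simp:fold_prog_def fold_round_def search_def fold_probe_def)

section \<open>Tables of folded graphs\<close>

lemma sum_list_upt:"(\<Sum>k\<leftarrow>[0..<n]. f k) = (\<Sum>k<n. f k :: nat)"
 by(simp add:interv_sum_list_conv_sum_set_nat atLeast0LessThan)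

lemma ex_less_Suc:"m < n==>(EX e<n. e < Suc m&P e)<->(EX e<n. e < m&P e)|P m" by(auto simp:less_Suc_eq)

lemma one_hot:
 fixes n :: nat
 assumes "(\<Sum>k<n. if P k then 1 else 0 :: nat) = 1"
 obtains k where "k < n" "P k" "!!j. j < n==>P j==>j = k" "!!f. (\<Sum>j<n. f j * (if P j then 1 else 0 :: nat)) = f k"
proof -
 have "(\<Sum>k<n. if P k then 1 else 0 :: nat) = card {k. k < n&P k}"
 using sum.inter_filter[OF finite_lessThan[of n],of "%_. 1 :: nat" P] by simp
 with assms obtain k where k:"{k. k < n&P k} = {k}" by(auto simp:card_1_singleton_iff)
 hence 1:"k < n" "P k" "!!j. j < n==>P j==>j = k" by blast+
 have "(\<Sum>j<n. f j * (if P j then 1 else 0 :: nat)) = f k" for f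
 proof -
 have "(\<Sum>j<n. f j * (if P j then 1 else 0 :: nat)) = (\<Sum>j<n. if j = k then f k else 0)"
 proof (rule sum.cong[OF HOL.refl])
 fix j assume "j:{..<n}"
 hence j:"j < n" by simp
 show "f j * (if P j then 1 else 0 :: nat) = (if j = k then f k else 0)"
 proof (cases "j = k")
 case True
 with 1(2) show ?thesis by simp
 next
 case False
 with 1(3)[OF j] have "~ P j" by blast
 with False show ?thesis by simp qed qed
 thus ?thesis using 1(1) by simp qed
 with 1 that show ?thesis by blast qed

locale letter_table =
 fixes ls :: "'x letter list" and W :: nat and code :: "'x letter => nat"
 assumes dist:"distinct ls" and len:"length ls<=W" "0 < W" and code_inj:"inj_on code (set ls)"
 and ls_inv:"!!x. x:set ls==>inv_letter x:set ls"
begin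

abbreviation "K == length ls"

definition idx :: "'x letter => nat" where
 "idx x = (SOME k. k < K&ls ! k = x)"

definition iv :: "nat => nat" where
 "iv k = idx (inv_letter (ls ! k))"

lemma idx:"x:set ls==>idx x < K" "x:set ls==>ls ! idx x = x"
 using someI_ex[of "%k. k < K&ls ! k = x"] by(auto simp:idx_def in_set_conv_nth)

lemma idx_nth:"k < K==>idx (ls ! k) = k" using idx[of "ls ! k"] dist by(simp add:nth_eq_iff_index_eq)

lemma iv:"k < K==>iv k < K" "k < K==>ls ! iv k = inv_letter (ls ! k)"
 using idx[of "inv_letter (ls ! k)"] ls_inv[of "ls ! k"] by(simp_all add:iv_def)

lemma nth_eq:"j < K==>k < K==>ls ! j = ls ! k<->j = k" using dist by(simp add:nth_eq_iff_index_eq)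

text \<open>The entry \<open>W * v + k\<close> of the table is 0 if no edge with the \<open>k\<close>-th letter starts at \<open>v\<close>, and
 otherwise the successor of the end of this edge.\<close>

definition tabs :: "state => nat => nat set => (nat \<times> 'x letter \<times> nat) set => bool" where
 "tabs s N V T<->V<={..<N}&W * N<=reg s 3&(ALL v<reg s 3. arr s 5 v~=0<->v:V)
 &(ALL u x w. (u,x,w):T-->u:V&w:V&x:set ls)
 &(ALL q<reg s 3. ALL w. arr s 6 q = Suc w<->(EX v k. k < K&q = W * v+k&(v,ls ! k,w):T))"

lemma tabsD:
 assumes "tabs s N V T" shows "V<={..<N}" "W * N<=reg s 3" "v < reg s 3==>arr s 5 v~=0<->v:V"
 "(u,x,w):T==>u:V&w:V&x:set ls"
 "q < reg s 3==>arr s 6 q = Suc w<->(EX v k. k < K&q = W * v+k&(v,ls ! k,w):T)"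
 using assms unfolding tabs_def by blast+

lemma tabs_entry:
 assumes t:"tabs s N V T" and v:"v < N" and k:"k < W" shows "arr s 6 (W * v+k) = Suc w<->k < K&(v,ls ! k,w):T"
proof -
 have "W * v+k < reg s 3" by(rule key_less[OF v k tabsD(2)[OF t]])
 from tabsD(5)[OF t this] have "arr s 6 (W * v+k) = Suc w<->(EX v' k'. k' < K&W * v+k = W * v'+k'&(v',ls ! k',w):T)" .
 also have "\<dots><->k < K&(v,ls ! k,w):T" using key_inj[of W v k _ _] k len(1) by(metis less_le_trans)
 finally show ?thesis . qed

lemma tabs_entry_0:
 assumes t:"tabs s N V T" and v:"v < N" and k:"k < K" shows "arr s 6 (W * v+k)~=0<->(EX w. (v,ls ! k,w):T)"
proof -
 have "k < W" using k len(1) by simp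
 note e = tabs_entry[OF t v this]
 show ?thesis
 proof
 assume "arr s 6 (W * v+k)~=0"
 then obtain w where "arr s 6 (W * v+k) = Suc w" using not0_implies_Suc by blast
 with e show "EX w. (v,ls ! k,w):T" by blast
 next
 assume "EX w. (v,ls ! k,w):T"
 thus "arr s 6 (W * v+k)~=0" using e k by(metis nat.distinct(1)) qed qed

lemma tabs_cong:
 "tabs s N V T==>reg t 3 = reg s 3==>arr t 5 = arr s 5==>arr t 6 = arr s 6==>tabs t N V T" unfolding tabs_def by simp

lemma N_le:"W * N<=B==>N<=B"
 using len(2) by(metis One_nat_def Suc_leI mult.commute mult_le_mono2 nat_mult_1_right order_trans)

subsection \<open>Building the table from the classes\<close>

definition table_entry :: stmt where
 "table_entry = Write 11 (Cell 10 (Cell 7 (Var 6))) (Num 1) ;; Write 11 (Cell 10 (Cell 9 (Var 6))) (Num 1) ;;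
 Cond (tLess (Cell 8 (Var 6)) (Num K)) (Write 6 (key W (Var 6)) (Plus (Cell 10 (Cell 9 (Var 6))) (Num 1))) skip"

definition table_prog :: stmt where
 "table_prog = For 6 (Write 6 (Var 6) (Num 0)) ;; For 6 (Write 11 (Var 6) (Num 0)) ;;
 For 6 (Cond (tLess (Var 6) (Var 5)) table_entry skip) ;;
 For 6 (Cond (Cell 5 (Var 6)) (Write 11 (Cell 10 (Var 6)) (Num 1)) skip) ;;
 For 6 (Write 5 (Var 6) (Cell 11 (Var 6))) ;; Assign 0 (Cell 10 (Var 0))"

lemma table_prog_frame [simp]:
 "wregs table_prog = {0,6,20}" "warrs table_prog = {5,6,11}" by(auto simp:table_prog_def table_entry_def)

theorem run_table_prog:
 fixes s :: state
 assumes ok:"fold_ok W N s" and LN:"!!j. j < N==>arr s 10 j < N" and fc:"fold_cong (tset s) (arr s 10)"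
 and V0:"V0<={..<N}" "!!j. j < reg s 3==>arr s 5 j~=0<->j:V0"
 defines "t == run table_prog s" and "L == arr s 10"
 shows "tabs t N (L ` (V0 Un {u. EX x w. (u,x,w):tset s} Un {w. EX u x. (u,x,w):tset s}))
 {(L u,ls ! x,L w)|u x w. (u,x,w):tset s&x < K}"
 "reg t 0 = L (reg s 0)"
proof -
 define n where "n = reg s 5"
 define B where "B = reg s 3"
 define S where "S = arr s 7"
 define X where "X = arr s 8"
 define D where "D = arr s 9"
 define k where "k e = W * L (S e)+X e" for e
 have WN:"W * N<=B" "N<=B" "n<=B" using ok N_le by(auto simp:fold_ok_def B_def n_def)
 have SXD:"S e < N" "X e < W" "D e < N" if "e < n" for e using ok that by(auto simp:fold_ok_def S_def X_def D_def n_def)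
 have ts:"tset s = {(S e,X e,D e)|e. e < n}" by(simp add:tset_def S_def X_def D_def n_def)
 have kk:"L (S e) = L (S e')&X e = X e'" if "k e = k e'" "e < n" "e' < n" for e e'
 using that SXD unfolding k_def by(intro key_inj) auto
 have kD:"L (D e) = L (D e')" if "k e = k e'" "e < n" "e' < n" for e e'
 proof -
 have "(S e,X e,D e):tset s" "(S e',X e,D e'):tset s" using that kk[OF that] unfolding ts by auto
 from fold_congD[OF fc this] kk[OF that] show ?thesis by(simp add:L_def) qed
 define s1 where "s1 = run (For 6 (Write 6 (Var 6) (Num 0))) s"
 define s2 where "s2 = run (For 6 (Write 11 (Var 6) (Num 0))) s1"
 define s3 where "s3 = run (For 6 (Cond (tLess (Var 6) (Var 5)) table_entry skip)) s2"
 define s4 where "s4 = run (For 6 (Cond (Cell 5 (Var 6)) (Write 11 (Cell 10 (Var 6)) (Num 1)) skip)) s3"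
 define s5 where "s5 = run (For 6 (Write 5 (Var 6) (Cell 11 (Var 6)))) s4"
 have t:"t = run (Assign 0 (Cell 10 (Var 0))) s5"
 by(simp only: t_def table_prog_def run.simps(3) s1_def s2_def s3_def s4_def s5_def)
 have z6:"arr s1 6 = (%j. if j < reg s 3 then 0 else arr s 6 j)" unfolding s1_def by(rule For_array_rule) auto
 have f1:"reg s1 3 = B" "reg s1 5 = n" "arr s1 7 = S" "arr s1 8 = X" "arr s1 9 = D" "arr s1 10 = L" "arr s1 5 = arr s 5" "reg s1 0 = reg s 0"
 unfolding s1_def B_def n_def S_def X_def D_def L_def by(simp_all add:frame_reg frame_arr del: run.simps)
 have z11:"arr s2 11 = (%j. if j < reg s1 3 then 0 else arr s1 11 j)" unfolding s2_def by(rule For_array_rule) auto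
 have f2:"reg s2 3 = B" "reg s2 5 = n" "arr s2 7 = S" "arr s2 8 = X" "arr s2 9 = D" "arr s2 10 = L" "arr s2 5 = arr s 5" "arr s2 6 = arr s1 6" "reg s2 0 = reg s 0"
 unfolding s2_def by(simp_all add:frame_reg frame_arr f1 del: run.simps)
 define I where "I m t<->(ALL q<B. ALL w. arr t 6 q = Suc w<->(EX e<n. e < m&X e < K&q = k e&w = L (D e)))
 &(ALL v<B. arr t 11 v~=0<->(EX e<n. e < m&(v = L (S e)|v = L (D e))))" for m and t :: state
 have "I (reg s2 3) s3" unfolding s3_def
 proof (rule For_rule)
 show "I 0 s2" unfolding I_def z11 f2 z6 by(simp add:f1 B_def)
 next
 fix m and t :: state
 assume m:"m < reg s2 3" and It:"I m t"
 and fr:"!!r. r ~: wregs (For 6 (Cond (tLess (Var 6) (Var 5)) table_entry skip))==>reg t r = reg s2 r"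
 and fa:"!!b. b ~: warrs (Cond (tLess (Var 6) (Var 5)) table_entry skip)==>arr t b = arr s2 b"
 have f:"reg t 5 = n" "arr t 7 = S" "arr t 8 = X" "arr t 9 = D" "arr t 10 = L"
 using fr[of 5] fa[of 7] fa[of 8] fa[of 9] fa[of 10] f2 by(simp_all add:table_entry_def)
 show "I (Suc m) (run (Cond (tLess (Var 6) (Var 5)) table_entry skip) (set_reg 6 m t))" (is "I _ ?t")
 proof (cases "m < n")
 case False
 hence a:"arr ?t = arr t" using f(1) by simp
 have eq:"e < n&e < Suc m&Q<->e < n&e < m&Q" for e Q using False by auto
 show ?thesis using It unfolding I_def a eq .
 next
 case True
 have t:"arr ?t 11 = (arr t 11)(L (S m) := 1,L (D m) := 1)"
 "arr ?t 6 = (if X m < K then (arr t 6)(k m := Suc (L (D m))) else arr t 6)"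
 using True f by(simp_all add:table_entry_def key_def k_def)
 from It have I1:"!!q w. q < B==>arr t 6 q = Suc w<->(EX e<n. e < m&X e < K&q = k e&w = L (D e))"
 and I2:"!!v. v < B==>arr t 11 v~=0<->(EX e<n. e < m&(v = L (S e)|v = L (D e)))" unfolding I_def by blast+
 have "arr ?t 6 q = Suc w<->(EX e<n. e < Suc m&X e < K&q = k e&w = L (D e))" if q:"q < B" for q w
 proof (cases "X m < K&q = k m")
 case True
 hence a:"arr ?t 6 q = Suc (L (D m))" unfolding t by simp
 show ?thesis
 proof
 assume "arr ?t 6 q = Suc w"
 with a have "w = L (D m)" by simp
 with True `m < n` show "EX e<n. e < Suc m&X e < K&q = k e&w = L (D e)" by(intro exI[of _ m]) simp
 next
 assume "EX e<n. e < Suc m&X e < K&q = k e&w = L (D e)"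
 then obtain e where e:"e < n" "q = k e" "w = L (D e)" by blast
 have "k m = k e" using True e(2) by simp
 from kD[OF this `m < n` e(1)] a e(3) show "arr ?t 6 q = Suc w" by simp qed
 next
 case False
 hence "arr ?t 6 q = arr t 6 q" unfolding t by auto
 thus ?thesis unfolding ex_less_Suc[OF True] using I1[OF q,of w] False by auto qed
 moreover have "arr ?t 11 v~=0<->(EX e<n. e < Suc m&(v = L (S e)|v = L (D e)))" if v:"v < B" for v
 unfolding ex_less_Suc[OF True] t using I2[OF v] by simp
 ultimately show ?thesis unfolding I_def by blast qed qed
 hence IB:"I B s3" unfolding f2 .
 have eq:"e < n&e < B&Q<->e < n&Q" for e Q using WN(3) by auto
 have I:"!!q w. q < B==>arr s3 6 q = Suc w<->(EX e<n. X e < K&q = k e&w = L (D e))"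
 "!!v. v < B==>arr s3 11 v~=0<->(EX e<n. v = L (S e)|v = L (D e))" using IB unfolding I_def eq by blast+
 have f3:"reg s3 3 = B" "arr s3 10 = L" "arr s3 5 = arr s 5" "reg s3 0 = reg s 0"
 unfolding s3_def by(simp_all add:frame_reg frame_arr f2 table_entry_def del: run.simps)
 have I4:"(%m t. ALL v<B. arr t 11 v~=0<->(EX e<n. v = L (S e)|v = L (D e))|(EX j<m. arr s 5 j~=0&v = L j)) (reg s3 3) s4"
 unfolding s4_def
 proof (rule For_rule)
 show "ALL v<B. arr s3 11 v~=0<->(EX e<n. v = L (S e)|v = L (D e))|(EX j<0. arr s 5 j~=0&v = L j)" using I(2) by simp
 next
 fix m and t :: state
 assume It:"ALL v<B. arr t 11 v~=0<->(EX e<n. v = L (S e)|v = L (D e))|(EX j<m. arr s 5 j~=0&v = L j)"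
 and fa:"!!b. b ~: warrs (Cond (Cell 5 (Var 6)) (Write 11 (Cell 10 (Var 6)) (Num 1)) skip)==>arr t b = arr s3 b"
 have f:"arr t 5 = arr s 5" "arr t 10 = L" using fa[of 5] fa[of 10] f3 by simp_all
 show "ALL v<B. arr (run (Cond (Cell 5 (Var 6)) (Write 11 (Cell 10 (Var 6)) (Num 1)) skip) (set_reg 6 m t)) 11 v~=0
 <->(EX e<n. v = L (S e)|v = L (D e))|(EX j<Suc m. arr s 5 j~=0&v = L j)" using It f by(auto simp:less_Suc_eq) qed
 have f4:"reg s4 3 = B" "arr s4 10 = L" "arr s4 6 = arr s3 6" "reg s4 0 = reg s 0"
 unfolding s4_def by(simp_all add:frame_reg frame_arr f3 del: run.simps)
 have z5:"arr s5 5 = (%j. if j < reg s4 3 then arr s4 11 j else arr s4 5 j)" unfolding s5_def by(rule For_array_rule) auto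
 have f5:"reg s5 3 = B" "arr s5 10 = L" "arr s5 6 = arr s3 6" "reg s5 0 = reg s 0"
 unfolding s5_def by(simp_all add:frame_reg frame_arr f4 del: run.simps)
 have ft:"reg t 3 = B" "arr t 5 = arr s5 5" "arr t 6 = arr s3 6" unfolding t using f5 by simp_all
 show "reg t 0 = L (reg s 0)" unfolding t using f5 by simp
 let ?V = "L ` (V0 Un {u. EX x w. (u,x,w):tset s} Un {w. EX u x. (u,x,w):tset s})"
 let ?T = "{(L u,ls ! x,L w)|u x w. (u,x,w):tset s&x < K}"
 have V:"v:?V<->(EX e<n. v = L (S e)|v = L (D e))|(EX j:V0. v = L j)" for v unfolding ts by auto
 have T:"(v,x,w):?T<->(EX e<n. v = L (S e)&X e < K&x = ls ! X e&w = L (D e))" for v x w unfolding ts by auto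
 have "L j < N" if "j < N" for j using LN[OF that] by(simp add:L_def)
 hence VN:"?V<={..<N}" using V0(1) SXD unfolding ts by auto
 have V5:"(EX j<B. arr s 5 j~=0&v = L j)<->(EX j:V0. v = L j)" for v
 proof
 assume "EX j:V0. v = L j"
 then obtain j where j:"j:V0" "v = L j" by blast
 hence "j < B" using V0(1) WN(2) by auto
 with V0(2)[of j] j show "EX j<B. arr s 5 j~=0&v = L j" by(auto simp:B_def) qed (use V0(2) in "auto simp:B_def")
 show "tabs t N ?V ?T" unfolding tabs_def ft(1)
 proof (intro conjI allI impI)
 show "?V<={..<N}" by(rule VN)
 show "W * N<=B" by(rule WN(1))
 show "arr t 5 v~=0<->v:?V" if "v < B" for v unfolding ft z5 V f4 using I4[unfolded f3] that V5[of v] by simp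
 fix u x w assume "(u,x,w):?T"
 then obtain e where "e < n" "u = L (S e)" "X e < K" "x = ls ! X e" "w = L (D e)" unfolding T by blast
 thus "u:?V" "w:?V" "x:set ls" unfolding V by auto
 next
 fix q w assume q:"q < B"
 show "arr t 6 q = Suc w<->(EX v k. k < K&q = W * v+k&(v,ls ! k,w):?T)" unfolding ft I(1)[OF q] T
 proof
 assume "EX e<n. X e < K&q = k e&w = L (D e)"
 thus "EX v k. k < K&q = W * v+k&(EX e<n. v = L (S e)&X e < K&ls ! k = ls ! X e&w = L (D e))" unfolding k_def by blast
 next
 assume "EX v k. k < K&q = W * v+k&(EX e<n. v = L (S e)&X e < K&ls ! k = ls ! X e&w = L (D e))"
 thus "EX e<n. X e < K&q = k e&w = L (D e)" unfolding k_def by(metis nth_eq) qed qed qed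

subsection \<open>Cutting hairs\<close>

definition cell :: "nat => expr" where
 "cell k = Cell 6 (Plus (eMul W (Var 7)) (Num k))"

text \<open>At a vertex of degree 1 exactly one cell of the table is not empty, so the sums over all letters
 select its letter and the inverse of this letter.\<close>
definition hair_cut :: stmt where
 "hair_cut = Assign 9 (eSum (map (%k. eMul k (tPos (cell k))) [0..<K])) ;;
 Assign 10 (eSum (map (%k. eMul (iv k) (tPos (cell k))) [0..<K])) ;;
 Assign 11 (Minus (Cell 6 (Plus (eMul W (Var 7)) (Var 9))) (Num 1)) ;;
 Write 6 (Plus (eMul W (Var 11)) (Var 10)) (Num 0) ;; Write 6 (Plus (eMul W (Var 7)) (Var 9)) (Num 0) ;;
 Write 5 (Var 7) (Num 0)"

definition hair_test :: stmt where
 "hair_test = Cond (tAll [tLess (Var 7) (Var 4),Cell 5 (Var 7),tNot (tEq (Var 7) (Var 0)),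
 tEq (eSum (map (%k. tPos (cell k)) [0..<K])) (Num 1)]) hair_cut skip"

definition hair_prog :: stmt where
 "hair_prog = For 6 (For 7 hair_test)"

lemma hair_frame [simp]:
 "wregs hair_cut = {9,10,11}" "warrs hair_cut = {5,6}" "wregs hair_test = {9,10,11,20}" "warrs hair_test = {5,6}"
 "wregs hair_prog = {6,7,9,10,11,20}" "warrs hair_prog = {5,6}" by(auto simp:hair_prog_def hair_test_def hair_cut_def)

lemma ev_deg:"ev (eSum (map (%k. tPos (cell k)) [0..<K])) s = (\<Sum>k<K. if arr s 6 (W * reg s 7+k)~=0 then 1 else 0)"
 by(simp add:comp_def cell_def sum_list_upt if_not_P cong: if_cong) (intro sum.cong,auto)

lemma ev_pick:"ev (eSum (map (%k. eMul (f k) (tPos (cell k))) [0..<K])) s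
 = (\<Sum>k<K. f k * (if arr s 6 (W * reg s 7+k)~=0 then 1 else 0))"
 by(simp add:comp_def cell_def sum_list_upt cong: if_cong) (intro sum.cong,auto)

lemma hair_cut_step:
 assumes t:"tabs s N V T" and sy:"symm T" and de:"det T" and v:"reg s 7 = v" "v:V" "v~=v0"
 and deg:"(\<Sum>k<K. if arr s 6 (W * v+k)~=0 then 1 else 0 :: nat) = 1"
 shows "EX V' T'. hair v0 (V,T) (V',T')&tabs (run hair_cut s) N V' T'&V' \<subset> V&symm T'&det T'"
proof -
 have vN:"v < N" using v(2) tabsD(1)[OF t] by blast
 from deg obtain k where k:"k < K" "arr s 6 (W * v+k)~=0" "!!j. j < K==>arr s 6 (W * v+j)~=0==>j = k"
 "!!f. (\<Sum>j<K. f j * (if arr s 6 (W * v+j)~=0 then 1 else 0 :: nat)) = f k" by(rule one_hot) blast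
 have kW:"k < W" "iv k < W" using k(1) iv(1)[OF k(1)] len(1) by simp_all
 obtain w where w:"arr s 6 (W * v+k) = Suc w" using k(2) not0_implies_Suc by blast
 hence T:"(v,ls ! k,w):T" using tabs_entry[OF t vN kW(1)] by blast
 have wV:"w:V" using tabsD(4)[OF t T] by blast
 hence wN:"w < N" using tabsD(1)[OF t] by blast
 have uniq:"y = ls ! k&z = w" if "(v,y,z):T" for y z
 proof -
 have y:"y:set ls" using tabsD(4)[OF t that] by blast
 have "arr s 6 (W * v+idx y)~=0" using tabs_entry_0[OF t vN idx(1)[OF y]] idx(2)[OF y] that by auto
 hence "idx y = k" by(rule k(3)[OF idx(1)[OF y]])
 hence "y = ls ! k" using idx(2)[OF y] by simp
 with detD[OF de T] that show ?thesis by simp qed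
 have wv:"w~=v"
 proof
 assume "w = v"
 with symmD[OF sy T] have "(v,inv_letter (ls ! k),v):T" by simp
 from uniq[OF this] show False by simp qed
 define V' where "V' = V - {v}"
 define T' where "T' = T - {(v,ls ! k,w),(w,inv_letter (ls ! k),v)}"
 have hair:"hair v0 (V,T) (V',T')" unfolding hair_def fst_conv snd_conv V'_def T'_def using T v(3) uniq by blast
 have r:"arr (run hair_cut s) 6 = (arr s 6)(W * w+iv k := 0,W * v+k := 0)" "arr (run hair_cut s) 5 = (arr s 5)(v := 0)"
 "reg (run hair_cut s) 3 = reg s 3"
 using k(4)[unfolded neq0_conv] by(simp_all add:hair_cut_def ev_pick v(1) w del: eSum_simps)
 have "tabs (run hair_cut s) N V' T'" unfolding tabs_def r
 proof (intro conjI allI impI)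
 show "V'<={..<N}" using tabsD(1)[OF t] by(auto simp:V'_def)
 show "W * N<=reg s 3" by(rule tabsD(2)[OF t])
 show "((arr s 5)(v := 0)) u~=0<->u:V'" if "u < reg s 3" for u using tabsD(3)[OF t that] by(simp add:V'_def)
 fix a x b assume a:"(a,x,b):T'"
 hence aT:"(a,x,b):T" by(simp add:T'_def)
 note D = tabsD(4)[OF t aT]
 show "x:set ls" using D by blast
 show "a:V'" using uniq[of x b] a aT D by(auto simp:T'_def V'_def)
 have "b~=v"
 proof
 assume "b = v"
 from uniq[OF symmD[OF sy aT,unfolded this]] have "inv_letter x = ls ! k" "a = w" by blast+
 hence "(a,x,b) = (w,inv_letter (ls ! k),v)" using `b = v` by(metis inv_letter_simps(1))
 with a show False by(simp add:T'_def) qed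
 with D show "b:V'" by(simp add:V'_def)
 next
 fix q z assume q:"q < reg s 3"
 have ik:"ls ! iv k = inv_letter (ls ! k)" by(rule iv(2)[OF k(1)])
 have ex:"(EX u j. j < K&q = W * u+j&(u,ls ! j,z):T') <->
 (EX u j. j < K&q = W * u+j&(u,ls ! j,z):T)&q~=W * w+iv k&q~=W * v+k"
 proof
 assume "EX u j. j < K&q = W * u+j&(u,ls ! j,z):T'"
 then obtain u j where j:"j < K" "q = W * u+j" "(u,ls ! j,z):T" "(u,ls ! j,z)~=(v,ls ! k,w)"
 "(u,ls ! j,z)~=(w,inv_letter (ls ! k),v)" unfolding T'_def by blast
 have jW:"j < W" using j(1) len(1) by simp
 have "q~=W * v+k" using key_inj[of W u j v k] jW kW j uniq[of "ls ! j" z] by auto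
 moreover have "q~=W * w+iv k"
 proof
 assume "q = W * w+iv k"
 hence "u = w" "j = iv k" using key_inj[of W u j w "iv k"] jW kW j(2) by auto
 moreover have "z = v" using detD[OF de,of w "ls ! iv k" z v] j(3) symmD[OF sy T] ik `u = w` `j = iv k` by simp
 ultimately show False using j(5) ik by simp qed
 ultimately show "(EX u j. j < K&q = W * u+j&(u,ls ! j,z):T)&q~=W * w+iv k&q~=W * v+k" using j(1-3) by blast
 next
 assume a:"(EX u j. j < K&q = W * u+j&(u,ls ! j,z):T)&q~=W * w+iv k&q~=W * v+k"
 then obtain u j where j:"j < K" "q = W * u+j" "(u,ls ! j,z):T" by blast
 have "(u,ls ! j,z)~=(v,ls ! k,w)" using a j nth_eq[OF j(1) k(1)] by auto
 moreover have "(u,ls ! j,z)~=(w,inv_letter (ls ! k),v)" using a j nth_eq[OF j(1) iv(1)[OF k(1)]] ik by auto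
 ultimately show "EX u j. j < K&q = W * u+j&(u,ls ! j,z):T'" using j unfolding T'_def by blast qed
 show "((arr s 6)(W * w+iv k := 0,W * v+k := 0)) q = Suc z<->(EX u j. j < K&q = W * u+j&(u,ls ! j,z):T')"
 unfolding ex using tabsD(5)[OF t q,of z] by auto qed
 moreover have "V' \<subset> V" using v(2) by(auto simp:V'_def)
 moreover have "symm T'" unfolding symm_def
 proof (intro allI impI)
 fix a x b assume a:"(a,x,b):T'"
 hence "(b,inv_letter x,a):T" using symmD[OF sy] by(simp add:T'_def)
 moreover have "(b,inv_letter x,a)~=(v,ls ! k,w)"
 proof
 assume "(b,inv_letter x,a) = (v,ls ! k,w)"
 hence "(a,x,b) = (w,inv_letter (ls ! k),v)" by(metis inv_letter_simps(1) prod.inject)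
 with a show False by(simp add:T'_def) qed
 moreover have "(b,inv_letter x,a)~=(w,inv_letter (ls ! k),v)"
 proof
 assume "(b,inv_letter x,a) = (w,inv_letter (ls ! k),v)"
 hence "(a,x,b) = (v,ls ! k,w)" by simp
 with a show False by(simp add:T'_def) qed
 ultimately show "(b,inv_letter x,a):T'" by(simp add:T'_def) qed
 moreover have "det T'" using de unfolding det_def T'_def by blast
 ultimately show ?thesis using hair by blast qed

text \<open>A scan that cuts nothing shows that there is no hair left; every other scan removes a
 vertex.\<close>
theorem run_hair_prog:
 assumes t:"tabs s N V T" and sy:"symm T" and de:"det T" and N:"reg s 4 = N" and v0:"reg s 0:V"
 shows "EX V' T'. (hair (reg s 0))^** (V,T) (V',T')&tabs (run hair_prog s) N V' T'&symm T'&det T'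
 &(ALL Y. ~ hair (reg s 0) (V',T') Y)&reg s 0:V'"
proof -
 let ?v0 = "reg s 0" and ?B = "reg s 3"
 have NB:"N<=?B" by(rule N_le[OF tabsD(2)[OF t]])
 have v0stay:"?v0:fst Q" if "hair ?v0 P Q" "?v0:fst P" for P Q :: "nat set \<times> (nat \<times> 'x letter \<times> nat) set"
 proof -
 from that(1)[unfolded hair_def] obtain u x w where "u~=?v0" "Q = (fst P - {u},snd P - {(u,x,w),(w,inv_letter x,u)})"
 by(elim exE conjE)
 thus ?thesis using that(2) by simp qed
 define G where "G t V T<->tabs t N V T&symm T&det T&?v0:V" for t V and T :: "(nat \<times> 'x letter \<times> nat) set"
 have inner:"EX V' T'. (hair ?v0)^** (V,T) (V',T')&G (run (For 7 hair_test) t) V' T'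
 &(card V' < card V|V' = V&T' = T&(ALL Y. ~ hair ?v0 (V,T) Y))"
 if G:"G t V T" and r:"reg t 4 = N" "reg t 0 = ?v0" "reg t 3 = ?B" for t V T
 proof -
 define I where "I m t'<->(EX V' T'. (hair ?v0)^** (V,T) (V',T')&G t' V' T'
 &(V' \<subset> V|V' = V&T' = T&(ALL u<m. ALL x w. (u,x,w):T-->u~=?v0-->~ (ALL y z. (u,y,z):T-->y = x&z = w))))" for m t'
 have fV:"finite V" using G tabsD(1) unfolding G_def by(meson finite_lessThan finite_subset)
 have "I (reg t 3) (run (For 7 hair_test) t)"
 proof (rule For_rule)
 show "I 0 t" unfolding I_def using G by blast
 next
 fix m t' assume It:"I m t'" and m:"m < reg t 3" and fr:"!!r. r ~: wregs (For 7 hair_test)==>reg t' r = reg t r"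
 have f:"reg t' 4 = N" "reg t' 0 = ?v0" "reg t' 3 = ?B" using fr[of 4] fr[of 0] fr[of 3] r by simp_all
 from It obtain V' T' where h:"(hair ?v0)^** (V,T) (V',T')" "G t' V' T'"
 and alt:"V' \<subset> V|V' = V&T' = T&(ALL u<m. ALL x w. (u,x,w):T-->u~=?v0-->~ (ALL y z. (u,y,z):T-->y = x&z = w))"
 unfolding I_def by blast
 let ?t = "set_reg 7 m t'"
 have tb:"tabs ?t N V' T'" using h(2) unfolding G_def by(auto intro:tabs_cong)
 let ?deg = "(\<Sum>k<K. if arr t' 6 (W * m+k)~=0 then 1 else 0 :: nat)"
 have test:"run hair_test ?t = (if m < N&arr t' 5 m~=0&m~=?v0&?deg = 1 then run hair_cut ?t else run skip ?t)"
 unfolding hair_test_def by(simp add:ev_deg f del: eSum_simps)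
 have mV:"arr t' 5 m~=0<->m:V'" using tabsD(3)[OF tb,of m] m r f by simp
 show "I (Suc m) (run hair_test ?t)"
 proof (cases "m < N&arr t' 5 m~=0&m~=?v0&?deg = 1")
 case True
 have "EX V'' T''. hair ?v0 (V',T') (V'',T'')&tabs (run hair_cut ?t) N V'' T''&V'' \<subset> V'&symm T''&det T''"
 using hair_cut_step[OF tb,of m ?v0] h(2) True mV unfolding G_def by simp
 then obtain V'' T'' where s:"hair ?v0 (V',T') (V'',T'')" "tabs (run hair_cut ?t) N V'' T''" "V'' \<subset> V'" "symm T''" "det T''"
 by blast
 have "?v0:V''" using v0stay[OF s(1)] h(2) unfolding G_def by simp
 with s have "G (run hair_cut ?t) V'' T''" unfolding G_def by blast
 moreover have "(hair ?v0)^** (V,T) (V'',T'')" using h(1) s(1) by(rule rtranclp.rtrancl_into_rtrancl)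
 moreover have "V'' \<subset> V" using s(3) alt by blast
 moreover have "run hair_test ?t = run hair_cut ?t" using test unfolding if_P[OF True] .
 ultimately show ?thesis unfolding I_def by auto
 next
 case False
 have rt:"run hair_test ?t = run skip ?t" using test unfolding if_not_P[OF False] .
 have G': "G (run hair_test ?t) V' T'" unfolding rt using h(2) unfolding G_def by(auto intro:tabs_cong)
 have nh:"~ (ALL y z. (m,y,z):T-->y = x&z = w)" if eq:"V' = V" "T' = T" and xw:"(m,x,w):T" "m~=?v0" for x w
 proof
 assume u:"ALL y z. (m,y,z):T-->y = x&z = w"
 have mV': "m:V'" "x:set ls" using tabsD(4)[OF tb] xw(1) eq by blast+
 hence mN:"m < N" using tabsD(1)[OF tb] by blast
 have e:"arr t' 6 (W * m+k)~=0<->k = idx x" if "k < K" for k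
 proof -
 have "arr t' 6 (W * m+k)~=0<->(EX w. (m,ls ! k,w):T)" using tabs_entry_0[OF tb mN that] eq(2) by simp
 also have "\<dots><->ls ! k = x" using u xw(1) by blast
 also have "\<dots><->k = idx x" using idx_nth[OF that] idx(2)[OF mV'(2)] by auto
 finally show ?thesis . qed
 have "?deg = (\<Sum>k<K. if k = idx x then 1 else 0)" by(intro sum.cong) (use e in auto)
 also have "\<dots> = 1" using idx(1)[OF mV'(2)] by simp
 finally have "?deg = 1" .
 with False mN mV mV'(1) xw(2) show False by blast qed
 show ?thesis unfolding I_def
 proof (intro exI conjI)
 show "(hair ?v0)^** (V,T) (V',T')" by(rule h(1))
 show "G (run hair_test ?t) V' T'" by(rule G')
 show "V' \<subset> V|V' = V&T' = T&(ALL u<Suc m. ALL x w. (u,x,w):T-->u~=?v0-->~ (ALL y z. (u,y,z):T-->y = x&z = w))"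
 using alt nh unfolding less_Suc_eq by blast qed qed qed
 then obtain V' T' where h:"(hair ?v0)^** (V,T) (V',T')" "G (run (For 7 hair_test) t) V' T'"
 and alt:"V' \<subset> V|V' = V&T' = T&(ALL u<?B. ALL x w. (u,x,w):T-->u~=?v0-->~ (ALL y z. (u,y,z):T-->y = x&z = w))"
 unfolding I_def r(3) by blast
 have "ALL Y. ~ hair ?v0 (V,T) Y" if "ALL u<?B. ALL x w. (u,x,w):T-->u~=?v0-->~ (ALL y z. (u,y,z):T-->y = x&z = w)"
 proof (intro allI notI)
 fix Y assume "hair ?v0 (V,T) Y"
 hence "hair ?v0 (V,T) Y" .
 from this[unfolded hair_def snd_conv] obtain u x w where
 u:"(u,x,w):T" "u~=?v0" "ALL y z. (u,y,z):T-->y = x&z = w" by(elim exE conjE)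
 have "u:V" using G u(1) tabsD(4) unfolding G_def by blast
 hence "u < ?B" using G tabsD(1) NB unfolding G_def by(metis lessThan_iff less_le_trans subsetD)
 with that u show False by blast qed
 with alt h psubset_card_mono[OF fV] show ?thesis by blast qed
 define I where "I m t'<->(EX V' T'. (hair ?v0)^** (V,T) (V',T')&G t' V' T'
 &((ALL Y. ~ hair ?v0 (V',T') Y)|card V'+m<=card V))" for m t'
 have "I (reg s 3) (run hair_prog s)" unfolding hair_prog_def
 proof (rule For_rule)
 show "I 0 s" unfolding I_def G_def using t sy de v0 by auto
 next
 fix m t' assume It:"I m t'" and fr:"!!r. r ~: wregs (For 6 (For 7 hair_test))==>reg t' r = reg s r"
 have f:"reg (set_reg 6 m t') 4 = N" "reg (set_reg 6 m t') 0 = ?v0" "reg (set_reg 6 m t') 3 = ?B"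
 using fr[of 4] fr[of 0] fr[of 3] N by simp_all
 from It obtain V' T' where h:"(hair ?v0)^** (V,T) (V',T')" "G t' V' T'"
 and alt:"(ALL Y. ~ hair ?v0 (V',T') Y)|card V'+m<=card V" unfolding I_def by blast
 have "G (set_reg 6 m t') V' T'" using h(2) unfolding G_def by(auto intro:tabs_cong)
 from inner[OF this f] obtain V'' T'' where h2:"(hair ?v0)^** (V',T') (V'',T'')" "G (run (For 7 hair_test) (set_reg 6 m t')) V'' T''"
 and alt2:"card V'' < card V'|V'' = V'&T'' = T'&(ALL Y. ~ hair ?v0 (V',T') Y)" by blast
 have nh:"V'' = V'&T'' = T'" if "ALL Y. ~ hair ?v0 (V',T') Y" using h2(1) that by(cases rule:converse_rtranclpE) auto
 have "(ALL Y. ~ hair ?v0 (V'',T'') Y)|card V''+Suc m<=card V" using alt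
 proof
 assume a:"ALL Y. ~ hair ?v0 (V',T') Y"
 with nh show ?thesis by simp
 next
 assume a:"card V'+m<=card V"
 from alt2 show ?thesis
 proof
 assume "card V'' < card V'" with a show ?thesis by simp
 next
 assume "V'' = V'&T'' = T'&(ALL Y. ~ hair ?v0 (V',T') Y)" thus ?thesis by simp qed qed
 thus "I (Suc m) (run (For 7 hair_test) (set_reg 6 m t'))"
 unfolding I_def using rtranclp_trans[OF h(1) h2(1)] h2(2) by blast qed
 then obtain V' T' where h:"(hair ?v0)^** (V,T) (V',T')" "G (run hair_prog s) V' T'"
 and alt:"(ALL Y. ~ hair ?v0 (V',T') Y)|card V'+?B<=card V" unfolding I_def by blast
 have "card V' > 0" using h(2) tabsD(1)[of _ N V' T'] unfolding G_def by(metis card_gt_0_iff empty_iff finite_lessThan finite_subset)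
 moreover have "card V<=N" using card_mono[OF finite_lessThan tabsD(1)[OF t]] by simp
 ultimately have "~ card V'+?B<=card V" using NB by linarith
 with alt have "ALL Y. ~ hair ?v0 (V',T') Y" by blast
 with h show ?thesis unfolding G_def by blast qed

end

context letter_table
begin

subsection \<open>Writing the edge lists\<close>

text \<open>A constant table is evaluated as a sum with exactly one term that is not 0.\<close>
definition code_expr :: "expr => expr" where
 "code_expr e = eSum (map (%k. eMul (code (ls ! k)) (tEq e (Num k))) [0..<K])"

definition inv_expr :: "expr => expr" where
 "inv_expr e = eSum (map (%k. eMul (iv k) (tEq e (Num (code (ls ! k))))) [0..<K])"

definition idx_expr :: "expr => expr" where
 "idx_expr e = eSum (map (%k. eMul k (tEq e (Num (code (ls ! k))))) [0..<K])"

lemma code_eq:"j < K==>k < K==>code (ls ! j) = code (ls ! k)<->j = k"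
 using inj_on_eq_iff[OF code_inj nth_mem nth_mem] nth_eq by blast

lemma ev_code_expr:"ev e s < K==>ev (code_expr e) s = code (ls ! ev e s)"
proof -
 assume a:"ev e s < K"
 have "ev (code_expr e) s = (\<Sum>k<K. code (ls ! k) * (if ev e s = k then 1 else 0))"
 by(simp add:code_expr_def comp_def sum_list_upt)
 also have "\<dots> = (\<Sum>k<K. if k = ev e s then code (ls ! ev e s) else 0)" by(intro sum.cong) auto
 finally show ?thesis using a by simp qed

lemma ev_pick_code:
 assumes "ev e s = code (ls ! j)" "j < K"
 shows "ev (eSum (map (%k. eMul (f k) (tEq e (Num (code (ls ! k))))) [0..<K])) s = f j"
proof -
 have "ev (eSum (map (%k. eMul (f k) (tEq e (Num (code (ls ! k))))) [0..<K])) s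
 = (\<Sum>k<K. f k * (if ev e s = code (ls ! k) then 1 else 0))" by(simp add:comp_def sum_list_upt)
 also have "\<dots> = (\<Sum>k<K. if k = j then f j else 0)"
 by(rule sum.cong[OF HOL.refl]) (use assms code_eq in auto)
 finally show ?thesis using assms(2) by simp qed

lemma ev_inv_expr:"ev e s = code (ls ! j)==>j < K==>ev (inv_expr e) s = iv j"
 unfolding inv_expr_def by(rule ev_pick_code)

lemma ev_idx_expr:"ev e s = code (ls ! j)==>j < K==>ev (idx_expr e) s = j"
 unfolding idx_expr_def by(rule ev_pick_code)

definition out_verts :: stmt where
 "out_verts = For 6 (Cond (Cell 5 (Var 6)) (Write 0 (Var 1) (Var 6) ;; Assign 1 (Plus (Var 1) (Num 1))) skip)"

definition out_arc :: stmt where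
 "out_arc = Write 1 (Var 2) (Var 9) ;; Write 2 (Var 2) (Minus (Cell 6 (Var 6)) (Num 1)) ;;
 Write 4 (Var 2) (code_expr (Var 10)) ;; Write 12 (Var 6) (Var 2) ;; Assign 2 (Plus (Var 2) (Num 1))"

text \<open>Registers 9 and 10 follow the quotient and the remainder of the loop variable by \<open>W\<close>, since
 the machine cannot divide.\<close>

definition out_next :: stmt where
 "out_next = Assign 10 (Plus (Var 10) (Num 1)) ;;
 Cond (tEq (Var 10) (Num W)) (Assign 10 (Num 0) ;; Assign 9 (Plus (Var 9) (Num 1))) skip"

definition out_arcs :: stmt where
 "out_arcs = For 6 (Cond (Cell 6 (Var 6)) out_arc skip ;; out_next)"

definition out_bars :: stmt where
 "out_bars = For 6 (Cond (tLess (Var 6) (Var 2))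
 (Write 3 (Var 6) (Cell 12 (Plus (eMul W (Cell 2 (Var 6))) (inv_expr (Cell 4 (Var 6)))))) skip)"

definition out_prog :: stmt where
 "out_prog = Assign 1 (Num 0) ;; Assign 2 (Num 0) ;; out_verts ;; Assign 9 (Num 0) ;; Assign 10 (Num 0) ;;
 out_arcs ;; out_bars"

lemma out_frame [simp]:
 "wregs out_verts = {1,6,20}" "warrs out_verts = {0}" "wregs out_arc = {2}" "warrs out_arc = {1,2,4,12}"
 "wregs out_next = {9,10,20}" "warrs out_next = {}" "wregs out_arcs = {2,6,9,10,20}" "warrs out_arcs = {1,2,4,12}"
 "wregs out_bars = {6,20}" "warrs out_bars = {3}"
 "wregs out_prog = {1,2,6,9,10,20}" "warrs out_prog = {0,1,2,3,4,12}"
 by(auto simp:out_prog_def out_verts_def out_arcs_def out_bars_def out_arc_def out_next_def)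

lemma run_out_verts:
 assumes "reg s 1 = 0"
 shows "bij_betw (arr (run out_verts s) 0) {..<reg (run out_verts s) 1} {v. v < reg s 3&arr s 5 v~=0}"
proof -
 have "(%m t. bij_betw (arr t 0) {..<reg t 1} {v. v < m&arr s 5 v~=0}) (reg s 3) (run out_verts s)"
 unfolding out_verts_def
 proof (rule For_rule)
 show "bij_betw (arr s 0) {..<reg s 1} {v. v < 0&arr s 5 v~=0}" using assms by(simp add:bij_betw_def)
 next
 fix m and t :: state
 assume b:"bij_betw (arr t 0) {..<reg t 1} {v. v < m&arr s 5 v~=0}"
 and fa:"!!b. b ~: warrs (Cond (Cell 5 (Var 6)) (Write 0 (Var 1) (Var 6) ;; Assign 1 (Plus (Var 1) (Num 1))) skip)==>arr t b = arr s b"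
 have f:"arr t 5 = arr s 5" using fa[of 5] by simp
 show "bij_betw (arr (run (Cond (Cell 5 (Var 6)) (Write 0 (Var 1) (Var 6) ;; Assign 1 (Plus (Var 1) (Num 1))) skip) (set_reg 6 m t)) 0)
 {..<reg (run (Cond (Cell 5 (Var 6)) (Write 0 (Var 1) (Var 6) ;; Assign 1 (Plus (Var 1) (Num 1))) skip) (set_reg 6 m t)) 1}
 {v. v < Suc m&arr s 5 v~=0}"
 proof (cases "arr s 5 m = 0")
 case True
 hence "{v. v < Suc m&arr s 5 v~=0} = {v. v < m&arr s 5 v~=0}" by(auto simp:less_Suc_eq)
 thus ?thesis using True b f by simp
 next
 case False
 have e:"{v. v < Suc m&arr s 5 v~=0} = insert m {v. v < m&arr s 5 v~=0}" using False by(auto simp:less_Suc_eq)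
 have "bij_betw ((arr t 0)(reg t 1 := m)) {..<reg t 1} {v. v < m&arr s 5 v~=0}"
 using b by(subst bij_betw_cong[of _ _ "arr t 0"]) auto
 hence "bij_betw ((arr t 0)(reg t 1 := m)) (insert (reg t 1) {..<reg t 1}) (insert m {v. v < m&arr s 5 v~=0})"
 using notIn_Un_bij_betw[of "reg t 1" "{..<reg t 1}" "(arr t 0)(reg t 1 := m)" "{v. v < m&arr s 5 v~=0}"] by simp
 thus ?thesis unfolding e using False f by(simp add:lessThan_Suc) qed qed
 thus ?thesis . qed

lemma run_out_arcs:
 assumes r:"reg s 2 = 0" "reg s 9 = 0" "reg s 10 = 0" and small:"!!q. q < reg s 3==>arr s 6 q~=0==>q mod W < K"
 defines "t == run out_arcs s"
 shows "reg t 2<=reg s 3" "!!q. q < reg s 3==>arr s 6 q~=0==>arr t 12 q < reg t 2&arr t 1 (arr t 12 q) = q div W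
 &arr t 2 (arr t 12 q) = arr s 6 q - 1&arr t 4 (arr t 12 q) = code (ls ! (q mod W))"
 "!!e. e < reg t 2==>EX q<reg s 3. arr s 6 q~=0&arr t 12 q = e"
proof -
 define I where "I m t<->reg t 9 = m div W&reg t 10 = m mod W&reg t 2<=m
 &(ALL q<m. arr s 6 q~=0-->arr t 12 q < reg t 2&arr t 1 (arr t 12 q) = q div W
 &arr t 2 (arr t 12 q) = arr s 6 q - 1&arr t 4 (arr t 12 q) = code (ls ! (q mod W)))
 &(ALL e<reg t 2. EX q<m. arr s 6 q~=0&arr t 12 q = e)" for m and t :: state
 have "I (reg s 3) t" unfolding t_def out_arcs_def
 proof (rule For_rule)
 show "I 0 s" unfolding I_def using r by simp
 next
 fix m and t :: state
 assume m:"m < reg s 3" and It:"I m t"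
 and fa:"!!b. b ~: warrs (Cond (Cell 6 (Var 6)) out_arc skip ;; out_next)==>arr t b = arr s b"
 have f:"arr t 6 = arr s 6" using fa[of 6] by simp
 let ?t = "run (Cond (Cell 6 (Var 6)) out_arc skip) (set_reg 6 m t)"
 have I1:"reg t 9 = m div W" "reg t 10 = m mod W" "reg t 2<=m" using It unfolding I_def by blast+
 have I2:"arr t 12 q < reg t 2&arr t 1 (arr t 12 q) = q div W
 &arr t 2 (arr t 12 q) = arr s 6 q - 1&arr t 4 (arr t 12 q) = code (ls ! (q mod W))" if "q < m" "arr s 6 q~=0" for q
 using It that unfolding I_def by blast
 have I3:"EX q<m. arr s 6 q~=0&arr t 12 q = e" if "e < reg t 2" for e using It that unfolding I_def by blast
 have n:"reg (run out_next ?t) 9 = Suc m div W" "reg (run out_next ?t) 10 = Suc m mod W"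
 proof -
 have "reg ?t 9 = m div W" "reg ?t 10 = m mod W" using I1 by(simp_all add:frame_reg out_arc_def)
 thus "reg (run out_next ?t) 9 = Suc m div W" "reg (run out_next ?t) 10 = Suc m mod W"
 by(simp_all add:out_next_def div_Suc mod_Suc del: run.simps(4)) (auto simp:mod_Suc div_Suc) qed
 have nf:"reg (run out_next ?t) 2 = reg ?t 2" "arr (run out_next ?t) = arr ?t"
 by(simp_all add:frame_reg frame_arr fun_eq_iff)
 show "I (Suc m) (run (Cond (Cell 6 (Var 6)) out_arc skip ;; out_next) (set_reg 6 m t))"
 proof (cases "arr s 6 m = 0")
 case True
 hence e:"arr ?t = arr t" "reg ?t 2 = reg t 2" using f by simp_all
 show ?thesis unfolding I_def run.simps(3) n nf e
 proof (intro conjI allI impI HOL.refl)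
 show "reg t 2<=Suc m" using I1(3) by simp
 fix q assume q:"q < Suc m" "arr s 6 q~=0"
 hence "q < m" using True by(metis less_antisym)
 with I2 q(2) show "arr t 12 q < reg t 2" "arr t 1 (arr t 12 q) = q div W" "arr t 2 (arr t 12 q) = arr s 6 q - 1"
 "arr t 4 (arr t 12 q) = code (ls ! (q mod W))" by blast+
 next
 fix e assume "e < reg t 2"
 with I3 show "EX q<Suc m. arr s 6 q~=0&arr t 12 q = e" by(meson less_SucI) qed
 next
 case False
 let ?n = "reg t 2"
 have mk:"m mod W < K" by(rule small[OF m False])
 have e:"reg ?t 2 = Suc ?n" "arr ?t 12 = (arr t 12)(m := ?n)" "arr ?t 1 = (arr t 1)(?n := m div W)"
 "arr ?t 2 = (arr t 2)(?n := arr s 6 m - 1)" "arr ?t 4 = (arr t 4)(?n := code (ls ! (m mod W)))"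
 using False f I1 mk by(simp_all add:out_arc_def ev_code_expr)
 show ?thesis unfolding I_def run.simps(3) n nf e
 proof (intro conjI allI impI HOL.refl)
 show "Suc ?n<=Suc m" using I1(3) by simp
 fix q assume q:"q < Suc m" "arr s 6 q~=0"
 have *: "((arr t 12)(m := ?n)) q < Suc ?n&((arr t 1)(?n := m div W)) (((arr t 12)(m := ?n)) q) = q div W
 &((arr t 2)(?n := arr s 6 m - 1)) (((arr t 12)(m := ?n)) q) = arr s 6 q - 1
 &((arr t 4)(?n := code (ls ! (m mod W)))) (((arr t 12)(m := ?n)) q) = code (ls ! (q mod W))"
 proof (cases "q = m")
 case True
 thus ?thesis by simp
 next
 case False
 hence "q < m" using q(1) by simp
 from I2[OF this q(2)] False show ?thesis by simp qed
 show "((arr t 12)(m := ?n)) q < Suc ?n" "((arr t 1)(?n := m div W)) (((arr t 12)(m := ?n)) q) = q div W"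
 "((arr t 2)(?n := arr s 6 m - 1)) (((arr t 12)(m := ?n)) q) = arr s 6 q - 1"
 "((arr t 4)(?n := code (ls ! (m mod W)))) (((arr t 12)(m := ?n)) q) = code (ls ! (q mod W))" using * by blast+
 next
 fix e assume e:"e < Suc ?n"
 show "EX q<Suc m. arr s 6 q~=0&((arr t 12)(m := ?n)) q = e"
 proof (cases "e = ?n")
 case True
 thus ?thesis using False by(intro exI[of _ m]) simp
 next
 case ne: False
 hence "e < ?n" using e by simp
 from I3[OF this] obtain q where "q < m" "arr s 6 q~=0" "arr t 12 q = e" by blast
 thus ?thesis by(intro exI[of _ q]) simp qed qed qed qed
 thus "reg t 2<=reg s 3" "!!q. q < reg s 3==>arr s 6 q~=0==>arr t 12 q < reg t 2&arr t 1 (arr t 12 q) = q div W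
 &arr t 2 (arr t 12 q) = arr s 6 q - 1&arr t 4 (arr t 12 q) = code (ls ! (q mod W))"
 "!!e. e < reg t 2==>EX q<reg s 3. arr s 6 q~=0&arr t 12 q = e" unfolding I_def by blast+ qed

theorem run_out_prog:
 assumes t:"tabs s N V T" and de:"det T" and sy:"symm T" and v0:"reg s 0:V"
 shows "EX Z. represents code (run out_prog s) (Z,reg s 0)&lgraph_wf Z&folded Z&finite (lE Z)
 &lV Z = V&tri Z = T"
proof -
 define s1 where "s1 = run (Assign 1 (Num 0) ;; Assign 2 (Num 0)) s"
 define s2 where "s2 = run out_verts s1"
 define s3 where "s3 = run (Assign 9 (Num 0) ;; Assign 10 (Num 0)) s2"
 define s4 where "s4 = run out_arcs s3"
 define s5 where "s5 = run out_bars s4"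
 define B where "B = reg s 3"
 have run:"run out_prog s = s5" by(simp only: out_prog_def run.simps(3) s1_def s2_def s3_def s4_def s5_def)
 have f1:"reg s1 1 = 0" "reg s1 2 = 0" "reg s1 3 = B" "arr s1 = arr s" unfolding s1_def B_def by simp_all
 have f2:"reg s2 2 = 0" "reg s2 3 = B" "arr s2 6 = arr s 6" unfolding s2_def using f1 by(simp_all add:frame_reg frame_arr)
 have f3:"reg s3 2 = 0" "reg s3 3 = B" "reg s3 9 = 0" "reg s3 10 = 0" "arr s3 6 = arr s 6" "arr s3 = arr s2" "reg s3 1 = reg s2 1"
 unfolding s3_def using f2 by simp_all
 have f4:"reg s4 3 = B" "reg s4 1 = reg s2 1" "arr s4 0 = arr s2 0"
 unfolding s4_def using f3 by(simp_all add:frame_reg frame_arr)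
 let ?nx = "arr s 6" and ?M = "reg s4 2" and ?id = "arr s4 12"
 have f5:"reg s5 2 = ?M" "reg s5 1 = reg s2 1" "arr s5 0 = arr s2 0" "arr s5 1 = arr s4 1" "arr s5 2 = arr s4 2" "arr s5 4 = arr s4 4"
 unfolding s5_def using f4 by(simp_all add:frame_reg frame_arr)
 have f0:"reg s5 0 = reg s 0" unfolding run[symmetric] by(simp add:frame_reg)
 have NB:"N<=B" unfolding B_def by(rule N_le[OF tabsD(2)[OF t]])
 have act:"EX v k w. k < K&q = W * v+k&(v,ls ! k,w):T&?nx q = Suc w" if "q < B" "?nx q~=0" for q
 proof -
 from that(2) obtain w where "?nx q = Suc w" using not0_implies_Suc by blast
 with tabsD(5)[OF t,of q w] that(1) show ?thesis unfolding B_def by blast qed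
 have Wk:"k < W" if "k < K" for k using that len(1) by simp
 have small:"q mod W < K" if "q < B" "?nx q~=0" for q using act[OF that] Wk by fastforce
 have A:"?M<=B" "!!q. q < B==>?nx q~=0==>?id q < ?M&arr s4 1 (?id q) = q div W
 &arr s4 2 (?id q) = ?nx q - 1&arr s4 4 (?id q) = code (ls ! (q mod W))"
 "!!e. e < ?M==>EX q<B. ?nx q~=0&?id q = e"
 using run_out_arcs[of s3,OF f3(1,3,4)] small unfolding f3(2,5) s4_def by blast+
 define ad where "ad v x = W * v+idx x" for v x
 have adB:"ad v x < B" if "(v,x,w):T" for v x w
 using tabsD(4)[OF t that] tabsD(1)[OF t] Wk[OF idx(1)] unfolding ad_def B_def
 by(intro key_less[OF _ _ tabsD(2)[OF t]]) auto
 have nxad:"?nx (ad v x) = Suc w" if T:"(v,x,w):T" for v x w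
 proof -
 have x:"x:set ls" using tabsD(4)[OF t T] by blast
 have "EX v' k. k < K&ad v x = W * v'+k&(v',ls ! k,w):T"
 unfolding ad_def using idx[OF x] T by(intro exI[of _ v] exI[of _ "idx x"]) simp
 thus ?thesis using tabsD(5)[OF t,of "ad v x" w] adB[OF T] unfolding B_def by blast qed
 have B1:"?id (ad v x) < ?M&arr s4 1 (?id (ad v x)) = v&arr s4 2 (?id (ad v x)) = w&arr s4 4 (?id (ad v x)) = code x"
 if T:"(v,x,w):T" for v x w
 proof -
 have x:"x:set ls" using tabsD(4)[OF t T] by blast
 have "ad v x div W = v" "ad v x mod W = idx x" using Wk[OF idx(1)[OF x]] by(simp_all add:ad_def)
 with A(2)[OF adB[OF T]] nxad[OF T] idx(2)[OF x] show ?thesis by simp qed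
 have A1:"EX v x w. (v,x,w):T&?id (ad v x) = e" if e:"e < ?M" for e
 proof -
 from A(3)[OF e] obtain q where q:"q < B" "?nx q~=0" "?id q = e" by blast
 from act[OF q(1,2)] obtain v k w where k:"k < K" "q = W * v+k" "(v,ls ! k,w):T" by blast
 hence "ad v (ls ! k) = q" by(simp add:ad_def idx_nth)
 with k(3) q(3) show ?thesis by blast qed
 have bars:"arr s5 3 e = ?id (ad w (inv_letter x))" if T:"(v,x,w):T" and e:"?id (ad v x) = e" for v x w e
 proof -
 have x:"x:set ls" using tabsD(4)[OF t T] by blast
 let ?body = "Cond (tLess (Var 6) (Var 2)) (Write 3 (Var 6) (Cell 12 (Plus (eMul W (Cell 2 (Var 6))) (inv_expr (Cell 4 (Var 6)))))) skip"
 have "(%m t. ALL e<m. e < ?M-->(ALL v x w. (v,x,w):T-->?id (ad v x) = e-->arr t 3 e = ?id (ad w (inv_letter x)))) (reg s4 3) s5"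
 unfolding s5_def out_bars_def
 proof (rule For_rule)
 fix m and t' :: state
 assume IH:"ALL e<m. e < ?M-->(ALL v x w. (v,x,w):T-->?id (ad v x) = e-->arr t' 3 e = ?id (ad w (inv_letter x)))"
 and fr:"!!r. r ~: wregs (For 6 ?body)==>reg t' r = reg s4 r" and fa:"!!b. b ~: warrs ?body==>arr t' b = arr s4 b"
 have f:"reg t' 2 = ?M" "arr t' 12 = ?id" "arr t' 2 = arr s4 2" "arr t' 4 = arr s4 4"
 using fr[of 2] fa[of 12] fa[of 2] fa[of 4] by simp_all
 show "ALL e<Suc m. e < ?M-->(ALL v x w. (v,x,w):T-->?id (ad v x) = e-->arr (run ?body (set_reg 6 m t')) 3 e = ?id (ad w (inv_letter x)))"
 proof (intro allI impI)
 fix e v x w assume e:"e < Suc m" "e < ?M" and T:"(v,x,w):T" and i:"?id (ad v x) = e"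
 show "arr (run ?body (set_reg 6 m t')) 3 e = ?id (ad w (inv_letter x))"
 proof (cases "e = m")
 case False
 hence "arr t' 3 e = ?id (ad w (inv_letter x))" using IH e T i by(metis less_antisym)
 thus ?thesis using False by simp
 next
 case True
 have x:"x:set ls" using tabsD(4)[OF t T] by blast
 have "ev (Cell 4 (Var 6)) (set_reg 6 m t') = code (ls ! idx x)" using B1[OF T] i True f idx(2)[OF x] by simp
 from ev_inv_expr[OF this idx(1)[OF x]] have "ev (inv_expr (Cell 4 (Var 6))) (set_reg 6 m t') = idx (inv_letter x)"
 using idx(2)[OF x] by(simp add:iv_def)
 thus ?thesis using True e(2) f B1[OF T] i by(simp add:ad_def) qed qed qed simp
 moreover have "e < ?M" using B1[OF T] e by simp
 moreover have "e < B" using `e < ?M` A(1) by simp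
 ultimately show ?thesis using T e unfolding f4(1) by blast qed
 define Z where "Z = \<lparr>dig = \<lparr>verts = V,arcs = {..<?M},tail = arr s5 1,head = arr s5 2\<rparr>,
 bar = (%e. if e < ?M then arr s5 3 e else e),lab = (%e. inv_into (set ls) code (arr s5 4 e))\<rparr>"
 have data:"ltail Z e = v" "lhead Z e = w" "lab Z e = x" "bar Z e = ?id (ad w (inv_letter x))" "e < ?M"
 "arr s5 4 e = code x" if "(v,x,w):T" "?id (ad v x) = e" for v x w e
 proof -
 have x:"x:set ls" using tabsD(4)[OF t that(1)] by blast
 show "ltail Z e = v" "lhead Z e = w" "lab Z e = x" "e < ?M" "arr s5 4 e = code x"
 using B1[OF that(1)] that(2) inv_into_f_f[OF code_inj x] f5(4,5,6) by(simp_all add:Z_def)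
 show "bar Z e = ?id (ad w (inv_letter x))" using bars[OF that] B1[OF that(1)] that(2) by(simp add:Z_def) qed
 have ar:"lE Z = {..<?M}" "lV Z = V" by(simp_all add:Z_def)
 have wf:"lgraph_wf Z"
 proof (rule lgraph_wfI)
 fix e assume "e:lE Z"
 hence "e < ?M" by(simp add:ar)
 from A1[OF this] obtain v x w where T:"(v,x,w):T" "?id (ad v x) = e" by blast
 have T': "(w,inv_letter x,v):T" by(rule symmD[OF sy T(1)])
 note d = data[OF T] and d' = data[OF T' HOL.refl]
 show "ltail Z e:lV Z&lhead Z e:lV Z&bar Z e:lE Z&bar Z (bar Z e) = e&ltail Z (bar Z e) = lhead Z e
 &lab Z (bar Z e) = inv_letter (lab Z e)"
 using tabsD(4)[OF t T(1)] T(2) unfolding ar d(1-4) d'(1,3,4) inv_letter_simps(1) by(simp add:d'(5))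
 qed (simp add:Z_def)
 have fo:"folded Z" unfolding folded_def
 proof (intro ballI impI)
 fix d e assume de:"d:lE Z" "e:lE Z" "ltail Z d = ltail Z e&lab Z d = lab Z e"
 from de(1) A1[of d] obtain v x w where 1:"(v,x,w):T" "?id (ad v x) = d" by(auto simp:ar)
 from de(2) A1[of e] obtain v' x' w' where 2:"(v',x',w'):T" "?id (ad v' x') = e" by(auto simp:ar)
 have "v = v'" "x = x'" using de(3) data(1,3)[OF 1] data(1,3)[OF 2] by simp_all
 with 1(2) 2(2) show "d = e" by simp qed
 have tri:"tri Z = T"
 proof (intro equalityI subsetI)
 fix y assume "y:tri Z"
 then obtain e where e:"e < ?M" "y = (ltail Z e,lab Z e,lhead Z e)" by(auto simp:tri_def ar)
 from A1[OF e(1)] obtain v x w where T:"(v,x,w):T" "?id (ad v x) = e" by blast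
 with e(2) data(1-3)[OF T] show "y:T" by simp
 next
 fix y assume "y:T"
 then obtain v x w where T:"y = (v,x,w)" "(v,x,w):T" by(cases y) auto
 note d = data[OF T(2) HOL.refl]
 show "y:tri Z" unfolding tri_def T(1) by(rule image_eqI[of _ _ "?id (ad v x)"]) (use d in "simp_all add:ar") qed
 have "bij_betw (arr s5 0) {..<reg s5 1} V"
 proof -
 have "{v. v < B&arr s 5 v~=0} = V"
 proof (intro equalityI subsetI)
 fix v assume "v:V"
 hence "v < B" using tabsD(1)[OF t] NB by auto
 thus "v:{v. v < B&arr s 5 v~=0}" using tabsD(3)[OF t,of v] `v:V` by(simp add:B_def)
 next
 fix v assume "v:{v. v < B&arr s 5 v~=0}"
 thus "v:V" using tabsD(3)[OF t,of v] by(simp add:B_def) qed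
 thus ?thesis using run_out_verts[OF f1(1)] unfolding f5 s2_def[symmetric] f1 by simp qed
 note bij = this
 have ed:"arr s5 1 e = ltail Z e&arr s5 2 e = lhead Z e&arr s5 3 e = bar Z e&arr s5 4 e = code (lab Z e)" if e:"e < ?M" for e
 proof -
 from A1[OF e] obtain v x w where T:"(v,x,w):T" "?id (ad v x) = e" by blast
 from data(3,6)[OF T] e show ?thesis by(simp add:Z_def) qed
 have rp:"represents code s5 (Z,reg s 0)" unfolding represents.simps ar f5(1)
 proof (intro conjI ballI wf v0 f0 bij HOL.refl)
 fix e assume "e:{..<?M}"
 hence "e < ?M" by simp
 note ed[OF this]
 thus "arr s5 1 e = ltail Z e" "arr s5 2 e = lhead Z e" "arr s5 3 e = bar Z e" "arr s5 4 e = code (lab Z e)" by blast+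
 qed
 show ?thesis unfolding run by(intro exI[of _ Z] conjI rp wf fo tri) (simp_all only: ar finite_lessThan) qed

subsection \<open>Lists of triples\<close>

definition app_triple :: "expr \<times> expr \<times> nat \<times> expr => stmt" where
 "app_triple = (%(c,e,x,d). Cond c (Write 7 (Var 5) e ;; Write 8 (Var 5) (Num x) ;; Write 9 (Var 5) d ;;
 Assign 5 (Plus (Var 5) (Num 1))) skip)"

definition build_prog :: "(expr \<times> expr \<times> nat \<times> expr) list => stmt" where
 "build_prog l = Assign 5 (Num 0) ;; For 6 (Cond (tLess (Var 6) (Var 4)) (seqs (map app_triple l)) skip)"

text \<open>Appending a triple does not change the values of these expressions, so that they may be
 evaluated in the state before the loop.\<close>
definition pure :: "expr => bool" where
 "pure e<->eregs e Int {5,20} = {}&earrs e Int {7,8,9} = {}"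

definition pure_list :: "(expr \<times> expr \<times> nat \<times> expr) list => bool" where
 "pure_list l<->(ALL (c,e,x,d):set l. pure c&pure e&pure d)"

lemma append_frame [simp]:"wregs (app_triple p) = {5,20}" "warrs (app_triple p) = {7,8,9}"
 by(auto simp:app_triple_def split:prod.splits)

lemma build_frame [simp]:"wregs (build_prog l)<={5,6,20}" "warrs (build_prog l)<={7,8,9}" by(auto simp:build_prog_def)

lemma pure_ev:
 assumes "pure e" "!!r. r ~: {5,20}==>reg t r = reg s r" "!!b. b ~: {7,8,9}==>arr t b = arr s b"
 shows "ev e t = ev e s"
proof (rule ev_cong)
 fix r assume "r:eregs e"
 hence "r ~: {5,20}" using assms(1) unfolding pure_def by blast
 thus "reg t r = reg s r" by(rule assms(2))
next
 fix b assume "b:earrs e"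
 hence "b ~: {7,8,9}" using assms(1) unfolding pure_def by blast
 thus "arr t b = arr s b" by(rule assms(3)) qed

lemma tset_append:
 assumes "pure e" "pure d"
 shows "tset (run (app_triple (c,e,x,d)) t) = tset t Un (if ev c t~=0 then {(ev e t,x,ev d t)} else {})"
 "reg (run (app_triple (c,e,x,d)) t) 5<=Suc (reg t 5)"
proof -
 let ?n = "reg t 5"
 let ?t1 = "set_arr 7 ?n (ev e t) t"
 let ?t2 = "set_arr 8 ?n x ?t1"
 have d:"ev d ?t2 = ev d t" by(rule pure_ev[OF assms(2)]) simp_all
 have r:"run (app_triple (c,e,x,d)) t = (if ev c t~=0 then set_reg 5 (Suc ?n) (set_arr 9 ?n (ev d t) ?t2) else set_reg 20 0 t)"
 by(simp add:app_triple_def d)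
 show "tset (run (app_triple (c,e,x,d)) t) = tset t Un (if ev c t~=0 then {(ev e t,x,ev d t)} else {})"
 proof (cases "ev c t = 0")
 case True
 thus ?thesis unfolding r by(simp add:tset_def)
 next
 case False
 have "tset (set_reg 5 (Suc ?n) (set_arr 9 ?n (ev d t) ?t2)) = tset t Un {(ev e t,x,ev d t)}"
 proof (intro equalityI subsetI)
 fix y assume "y:tset (set_reg 5 (Suc ?n) (set_arr 9 ?n (ev d t) ?t2))"
 then obtain m where m:"m < Suc ?n" "y = (((arr t 7)(?n := ev e t)) m,((arr t 8)(?n := x)) m,((arr t 9)(?n := ev d t)) m)"
 by(auto simp:tset_def)
 show "y:tset t Un {(ev e t,x,ev d t)}"
 proof (cases "m = ?n")
 case True
 with m show ?thesis by simp
 next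
 case False
 with m show ?thesis by(auto simp:tset_def) qed
 next
 fix y assume "y:tset t Un {(ev e t,x,ev d t)}"
 then consider "y = (ev e t,x,ev d t)"|m where "m < ?n" "y = (arr t 7 m,arr t 8 m,arr t 9 m)" by(auto simp:tset_def)
 thus "y:tset (set_reg 5 (Suc ?n) (set_arr 9 ?n (ev d t) ?t2))"
 proof cases
 case 1
 thus ?thesis unfolding tset_def by(intro CollectI exI[of _ ?n]) simp
 next
 case 2
 thus ?thesis unfolding tset_def by(intro CollectI exI[of _ m]) simp qed qed
 thus ?thesis unfolding r using False by simp qed
 show "reg (run (app_triple (c,e,x,d)) t) 5<=Suc (reg t 5)" unfolding r by simp qed

lemma tset_append_list:
 assumes "pure_list l"
 shows "tset (run (seqs (map app_triple l)) t) = tset t Un {(ev e t,x,ev d t)|c e x d. (c,e,x,d):set l&ev c t~=0}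
 &reg (run (seqs (map app_triple l)) t) 5<=reg t 5+length l" using assms
proof (induction l arbitrary: t)
 case Nil
 thus ?case by(simp add:tset_def)
next
 case (Cons p l)
 obtain c e x d where p:"p = (c,e,x,d)" by(cases p) auto
 have pu:"pure e" "pure d" "pure_list l" using Cons.prems by(auto simp:pure_list_def p)
 let ?t = "run (app_triple p) t"
 have same:"ev e' ?t = ev e' t" if "pure e'" for e' by(rule pure_ev[OF that]) (simp_all add:frame_reg frame_arr)
 have "{(ev e ?t,x,ev d ?t)|c e x d. (c,e,x,d):set l&ev c ?t~=0} = {(ev e t,x,ev d t)|c e x d. (c,e,x,d):set l&ev c t~=0}"
 proof -
 have "((c,e,x,d):set l&ev c ?t~=0&y = (ev e ?t,x,ev d ?t)) = ((c,e,x,d):set l&ev c t~=0&y = (ev e t,x,ev d t))"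
 for c e x d y
 proof (cases "(c,e,x,d):set l")
 case True
 hence "pure c" "pure e" "pure d" using pu(3) by(auto simp:pure_list_def)
 thus ?thesis using same by simp qed simp
 thus ?thesis by blast qed
 moreover have "tset ?t = tset t Un (if ev c t~=0 then {(ev e t,x,ev d t)} else {})" "reg ?t 5<=Suc (reg t 5)"
 unfolding p by(rule tset_append[OF pu(1,2)])+
 moreover have "{(ev e t,x,ev d t)|c e x d. (c,e,x,d):set (p # l)&ev c t~=0}
 = (if ev c t~=0 then {(ev e t,x,ev d t)} else {}) Un {(ev e t,x,ev d t)|c e x d. (c,e,x,d):set l&ev c t~=0}"
 unfolding p by auto
 ultimately show ?case using Cons.IH[OF pu(3),of ?t] by(simp add:Un_assoc del: set_simps) qed

theorem run_build_prog:
 assumes l:"pure_list l" and N:"reg s 4 = N" "N<=reg s 3"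
 shows "tset (run (build_prog l) s) = {(ev e (set_reg 6 v s),x,ev d (set_reg 6 v s))|v c e x d. v < N&(c,e,x,d):set l&ev c (set_reg 6 v s)~=0}"
 "reg (run (build_prog l) s) 5<=N * length l"
proof -
 let ?body = "Cond (tLess (Var 6) (Var 4)) (seqs (map app_triple l)) skip"
 let ?s = "set_reg 5 0 s"
 define E where "E m = {(ev e (set_reg 6 v s),x,ev d (set_reg 6 v s))|v c e x d. v < m&v < N&(c,e,x,d):set l&ev c (set_reg 6 v s)~=0}" for m
 have "(%m t. tset t = E m&reg t 5<=min m N * length l) (reg ?s 3) (run (For 6 ?body) ?s)"
 proof (rule For_rule)
 show "tset ?s = E 0&reg ?s 5<=min 0 N * length l" by(simp add:tset_def E_def)
 next
 fix m and t :: state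
 assume IH:"tset t = E m&reg t 5<=min m N * length l"
 and fr:"!!r. r ~: wregs (For 6 ?body)==>reg t r = reg ?s r" and fa:"!!b. b ~: warrs ?body==>arr t b = arr ?s b"
 have fr': "reg t r = reg s r" if "r ~: {5,6,20}" for r using that fr[of r] by(auto split:if_splits)
 have fa': "arr t b = arr s b" if "b ~: {7,8,9}" for b using that fa[of b] by(auto split:if_splits)
 have r4:"reg t 4 = N" using fr'[of 4] N(1) by simp
 show "tset (run ?body (set_reg 6 m t)) = E (Suc m)&reg (run ?body (set_reg 6 m t)) 5<=min (Suc m) N * length l"
 proof (cases "m < N")
 case False
 hence "v < Suc m&v < N<->v < m&v < N" for v by(auto simp:less_Suc_eq)
 hence "E (Suc m) = E m" unfolding E_def by blast
 moreover have "run ?body (set_reg 6 m t) = set_reg 20 0 (set_reg 6 m t)" using False r4 by simp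
 ultimately show ?thesis using IH False by(simp add:tset_def)
 next
 case True
 have same:"ev e (set_reg 6 m t) = ev e (set_reg 6 m s)" if "pure e" for e
 by(rule pure_ev[OF that]) (use fr' fa' in auto)
 have "{(ev e (set_reg 6 m t),x,ev d (set_reg 6 m t))|c e x d. (c,e,x,d):set l&ev c (set_reg 6 m t)~=0}
 = {(ev e (set_reg 6 m s),x,ev d (set_reg 6 m s))|c e x d. (c,e,x,d):set l&ev c (set_reg 6 m s)~=0}" (is "?A = ?B")
 proof -
 have "((c,e,x,d):set l&ev c (set_reg 6 m t)~=0&y = (ev e (set_reg 6 m t),x,ev d (set_reg 6 m t)))
 = ((c,e,x,d):set l&ev c (set_reg 6 m s)~=0&y = (ev e (set_reg 6 m s),x,ev d (set_reg 6 m s)))" for c e x d y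
 proof (cases "(c,e,x,d):set l")
 case True
 hence "pure c" "pure e" "pure d" using l by(auto simp:pure_list_def)
 thus ?thesis using same by simp qed simp
 thus ?thesis by blast qed
 moreover have "E (Suc m) = E m Un ?B"
 proof -
 have "v < Suc m&v < N<->(v < m&v < N)|v = m" for v using True by auto
 thus ?thesis unfolding E_def by blast qed
 moreover have "run ?body (set_reg 6 m t) = run (seqs (map app_triple l)) (set_reg 6 m t)" using True r4 by simp
 moreover have "tset (set_reg 6 m t) = tset t" by(simp add:tset_def)
 ultimately show ?thesis using tset_append_list[OF l,of "set_reg 6 m t"] IH True by(simp add:min_def) qed qed
 hence r:"tset (run (build_prog l) s) = E (reg s 3)" "reg (run (build_prog l) s) 5<=min (reg s 3) N * length l"
 by(simp_all add:build_prog_def del: run.simps(5))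
 have "v < reg s 3&v < N&Q<->v < N&Q" for v Q using N(2) by auto
 with r(1) show "tset (run (build_prog l) s) = {(ev e (set_reg 6 v s),x,ev d (set_reg 6 v s))|v c e x d. v < N&(c,e,x,d):set l&ev c (set_reg 6 v s)~=0}"
 unfolding E_def by simp
 show "reg (run (build_prog l) s) 5<=N * length l" using r(2) N(2) by(simp add:min_def split:if_splits) qed

subsection \<open>Quotients and walks\<close>

definition quot_prog :: stmt where
 "quot_prog = fold_prog W ;; table_prog"

lemma quot_frame [simp]:
 "wregs quot_prog = {0,6,7,9,10,11,12,20}" "warrs quot_prog = {5,6,10,11}" by(auto simp:quot_prog_def)

theorem run_quot_prog:
 assumes ok:"fold_ok W N s" and V0:"V0<={..<N}" "!!j. j < reg s 3==>arr s 5 j~=0<->j:V0"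
 shows "EX L. (ALL j<N. L j < N)&(ALL j<N. ALL k<N. L j = L k<->lfc (tset s) j k)&fold_cong (tset s) L
 &tabs (run quot_prog s) N (L ` (V0 Un {u. EX x w. (u,x,w):tset s} Un {w. EX u x. (u,x,w):tset s}))
 {(L u,ls ! x,L w)|u x w. (u,x,w):tset s&x < K}
 &reg (run quot_prog s) 0 = L (reg s 0)"
proof -
 let ?t = "run (fold_prog W) s"
 let ?L = "arr ?t 10"
 have NB:"N<=reg s 3" using ok N_le by(auto simp:fold_ok_def)
 note F = run_fold_prog[OF ok]
 have ts:"tset ?t = tset s" and f:"reg ?t 3 = reg s 3" "arr ?t 5 = arr s 5" "reg ?t 0 = reg s 0"
 by(simp_all add:tset_def frame_reg frame_arr)
 have ok': "fold_ok W N ?t" using ok by(simp add:fold_ok_def frame_reg frame_arr)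
 have LN:"?L j < N" if "j < N" for j using tset_lfc_less[OF ok F(2)[of j]] that NB by auto
 have "tabs (run table_prog ?t) N (?L ` (V0 Un {u. EX x w. (u,x,w):tset s} Un {w. EX u x. (u,x,w):tset s}))
 {(?L u,ls ! x,?L w)|u x w. (u,x,w):tset s&x < K}&reg (run table_prog ?t) 0 = ?L (reg s 0)"
 using run_table_prog[OF ok' LN _ V0(1)] V0(2) F(1) unfolding ts f by blast
 moreover have "ALL j<N. ALL k<N. ?L j = ?L k<->lfc (tset s) j k" using F(3) NB by(meson less_le_trans)
 ultimately show ?thesis using LN F(1) unfolding quot_prog_def run.simps(3) by blast qed

definition arc_expr :: "expr => 'x letter => expr" where
 "arc_expr e x = Cell 6 (Plus (eMul W e) (Num (idx x)))"

primrec walk :: "expr => 'x word => expr" where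
 "walk e [] = e"
| "walk e (x # p) = walk (Minus (arc_expr e x) (Num 1)) p"

lemma arc_expr_uses:"eregs (arc_expr e x)<=eregs e" "earrs (arc_expr e x)<=insert 6 (earrs e)"
 using eMul_simps(2)[of W e] eMul_simps(3)[of W e] unfolding arc_expr_def eregs.simps earrs.simps by blast+

lemma walk_uses:"eregs (walk e p)<=eregs e" "earrs (walk e p)<=insert 6 (earrs e)"
proof (induction p arbitrary: e)
 case (Cons x p)
 { case 1 show ?case using Cons(1)[of "Minus (arc_expr e x) (Num 1)"] arc_expr_uses(1)[of e x] by auto }
 { case 2 show ?case using Cons(2)[of "Minus (arc_expr e x) (Num 1)"] arc_expr_uses(2)[of e x] by auto } qed auto

lemma ev_arc_expr:
 assumes t:"tabs s N V T" and v:"ev e s < N" and x:"x:set ls"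
 shows "ev (arc_expr e x) s = Suc w<->(ev e s,x,w):T" "ev (arc_expr e x) s~=0<->(EX w. (ev e s,x,w):T)"
proof -
 have "idx x < W" using idx(1)[OF x] len(1) by simp
 from tabs_entry[OF t v this,of w] idx[OF x] show "ev (arc_expr e x) s = Suc w<->(ev e s,x,w):T" by(simp add:arc_expr_def)
 from tabs_entry_0[OF t v idx(1)[OF x]] idx(2)[OF x] show "ev (arc_expr e x) s~=0<->(EX w. (ev e s,x,w):T)" by(simp add:arc_expr_def)
qed

lemma ev_walk:
 assumes t:"tabs s N V T" shows "ev e s < N==>trav T (ev e s) p u==>ev (walk e p) s = u"
proof (induction p arbitrary: e)
 case (Cons x p)
 from Cons.prems(2) obtain z where z:"(ev e s,x,z):T" "trav T z p u" by auto
 note D = tabsD(4)[OF t z(1)]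
 have "ev (arc_expr e x) s = Suc z" using ev_arc_expr(1)[OF t Cons.prems(1)] D z(1) by blast
 hence e:"ev (Minus (arc_expr e x) (Num 1)) s = z" by simp
 have "z < N" using D tabsD(1)[OF t] by blast
 with Cons.IH[of "Minus (arc_expr e x) (Num 1)"] z(2) show ?case unfolding walk.simps e by blast qed simp

end

lemma lfc_key:
 assumes "inj_on ka {x. EX u w. (u,x,w):E}" shows "lfc ((%(u,x,w). (u,ka x,w)) ` E) a b<->lfc E a b"
proof
 assume "lfc ((%(u,x,w). (u,ka x,w)) ` E) a b"
 thus "lfc E a b"
 proof (induction rule:lfc.induct)
 case (fold u x w u' w')
 then obtain y y' where "(u,y,w):E" "(u',y',w'):E" "x = ka y" "x = ka y'" by auto
 moreover hence "y = y'" using inj_onD[OF assms] by blast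
 ultimately show ?case using fold(3,4) lfc.fold by metis qed (blast intro:lfc.refl lfc.sym lfc.trans)+
next
 assume "lfc E a b"
 thus "lfc ((%(u,x,w). (u,ka x,w)) ` E) a b"
 proof (induction rule:lfc.induct)
 case (fold u x w u' w')
 hence "(u,ka x,w):(%(u,x,w). (u,ka x,w)) ` E" "(u',ka x,w'):(%(u,x,w). (u,ka x,w)) ` E" by force+
 thus ?case using fold.IH by(rule lfc.fold) qed (blast intro:lfc.refl lfc.sym lfc.trans)+ qed

lemma eMul_uses [simp]:
 "eregs (eMul n e) = (if n = 0 then {} else eregs e)" "earrs (eMul n e) = (if n = 0 then {} else earrs e)"
 by(auto simp:eMul_def)

text \<open>Registers from 40 on are left to the compiled code. Depth 2 is what quadratic time
 allows.\<close>
definition frugal :: "stmt => bool" where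
 "frugal c<->uregs c<={..<40}&3 ~: wregs c&depth c<=2"

lemma frugal_run:
 assumes "frugal c" shows "EX t s'. exec (comp 40 c) s t s'&agree 40 (run c s) s'&t<=cost c * Suc (reg s 3) ^ 2"
proof -
 have "agree 40 s s" by(simp add:agree_def)
 from exec_comp[OF _ _ _ _ this,of c 40] assms obtain t s' where
 e:"exec (comp 40 c) s t s'" "agree 40 (run c s) s'" "t<=cost c * Suc (reg s 3) ^ depth c"
 unfolding frugal_def by auto
 have "t<=cost c * Suc (reg s 3) ^ 2" by(rule cost_mono[OF e(3)]) (use assms in "simp_all add:frugal_def")
 with e show ?thesis by blast qed

lemma represents_agree:"represents code s P==>agree 40 s t==>represents code t P" by(cases P) (simp add:agree_def)

lemma frugal_then [simp]:"frugal (c ;; d)<->frugal c&frugal d" by(auto simp:frugal_def)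

section \<open>The program for the first step\<close>

lemma concat_nth:
 "k < length xss==>j < length (xss ! k)==>concat xss ! (length (concat (take k xss))+j) = xss ! k ! j"
proof (induction xss arbitrary: k)
 case (Cons xs xss)
 thus ?case by(cases k) (auto simp:nth_append) qed simp

lemma concat_position:
 "i < length (concat xss)==>EX k j. k < length xss&j < length (xss ! k)&i = length (concat (take k xss))+j"
proof (induction xss arbitrary: i)
 case (Cons xs xss)
 show ?case
 proof (cases "i < length xs")
 case True
 thus ?thesis by(intro exI[of _ 0] exI[of _ i]) simp
 next
 case False
 hence "i - length xs < length (concat xss)" using Cons.prems by simp
 from Cons.IH[OF this] obtain k j where "k < length xss" "j < length (xss ! k)"
 "i - length xs = length (concat (take k xss))+j" by blast
 thus ?thesis using False by(intro exI[of _ "Suc k"] exI[of _ j]) simp qed qed simp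

definition off :: "'x word list => nat => nat" where
 "off gs k = length (concat (take k gs))"

lemma off_mono:"k < k'==>k'<=length gs==>off gs k+length (gs ! k)<=off gs k'"
proof -
 assume k:"k < k'" "k'<=length gs"
 have "take k' gs = take k gs @ gs ! k # drop (Suc k) (take k' gs)"
 using id_take_nth_drop[of k "take k' gs"] k by(simp add:min_def)
 hence "concat (take k' gs) = concat (take k gs) @ gs ! k @ concat (drop (Suc k) (take k' gs))" by(metis concat.simps(2) concat_append)
 thus ?thesis unfolding off_def by simp qed

lemma off_inj:
 assumes "off gs k+j = off gs k'+j'" "k < length gs" "j < length (gs ! k)" "k' < length gs" "j' < length (gs ! k')"
 shows "k = k'&j = j'" using off_mono[of k k' gs] assms off_mono[of k' k gs] by fastforce 

lemma off_less:"k < length gs==>j < length (gs ! k)==>off gs k+j < length (concat gs)"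
 using off_mono[of k "length gs" gs] by(simp add:off_def)

definition flags :: "'x word list => nat list" where
 "flags gs = concat (map (%g. map (%j. if Suc j = length g then 1 else 0) [0..<length g]) gs)"

lemma flags:"length (flags gs) = length (concat gs)"
 "k < length gs==>j < length (gs ! k)==>flags gs ! (off gs k+j) = (if Suc j = length (gs ! k) then 1 else 0)"
proof -
 show len:"length (flags gs) = length (concat gs)" for gs :: "'x word list"
 unfolding flags_def by(induction gs) simp_all
 assume kj:"k < length gs" "j < length (gs ! k)"
 let ?f = "%g :: 'x word. map (%j. if Suc j = length g then 1 else 0 :: nat) [0..<length g]"
 have "length (concat (take k (map ?f gs))) = off gs k"
 using len[of "take k gs"] unfolding off_def flags_def by(simp only: take_map)
 thus "flags gs ! (off gs k+j) = (if Suc j = length (gs ! k) then 1 else 0)"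
 using concat_nth[of k "map ?f gs" j] kj unfolding flags_def by simp qed

text \<open>A position starts a word exactly if it is the first one or the preceding one ends a word.\<close>

lemma flags_start:
 assumes kj:"k < length gs" "j < length (gs ! k)" shows "(off gs k+j = 0|flags gs ! (off gs k+j - 1)~=0)<->j = 0"
proof (cases j)
 case (Suc l)
 thus ?thesis using flags(2)[of k gs l] kj by simp
next
 case 0
 have "flags gs ! (off gs k - 1)~=0" if p:"off gs k > 0"
 proof -
 have "off gs k - 1 < length (concat gs)" using off_less[OF kj] by simp
 from concat_position[OF this] obtain k' j' where k': "k' < length gs" "j' < length (gs ! k')" "off gs k - 1 = off gs k'+j'"
 unfolding off_def by blast
 have "Suc j' = length (gs ! k')"
 proof (rule ccontr)
 assume "Suc j'~=length (gs ! k')"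
 hence "Suc j' < length (gs ! k')" using k'(2) by simp
 moreover have "off gs k'+Suc j' = off gs k+j" using k'(3) p 0 by simp
 ultimately show False using off_inj[OF _ k'(1) _ kj] 0 by blast qed
 thus ?thesis using flags(2)[OF k'(1,2)] k'(3) by simp qed
 hence "off gs k = 0|flags gs ! (off gs k - 1)~=0" by blast
 thus ?thesis using 0 by simp qed

context letter_table
begin

definition inv_code :: "expr => expr" where
 "inv_code e = eSum (map (%k. eMul (code (ls ! iv k)) (tEq e (Num (code (ls ! k))))) [0..<K])"

lemma ev_inv_code:"ev e s = code x==>x:set ls==>ev (inv_code e) s = code (inv_letter x)"
 unfolding inv_code_def using ev_pick_code[of e s "idx x" "%k. code (ls ! iv k)"] iv(2)[of "idx x"] idx[of x] by simp

text \<open>The output arrays overlap with the input, which is therefore copied. The entry \<open>i\<close>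
 of array 16 tells whether position \<open>i\<close> starts a word.\<close>
definition loop_copy :: stmt where
 "loop_copy = Write 16 (Num 0) (Num 1) ;;
 For 6 (Write 15 (Var 6) (Cell 0 (Var 6)) ;; Write 16 (Plus (Var 6) (Num 1)) (Cell 1 (Var 6)))"

definition loop_ends :: stmt where
 "loop_ends = Cond (Cell 16 (Var 6)) (Assign 9 (Num 0)) (Assign 9 (Var 6)) ;;
 Cond (Cell 16 (Plus (Var 6) (Num 1))) (Assign 10 (Num 0)) (Assign 10 (Plus (Var 6) (Num 1))) ;;
 Cond (Cell 16 (Var 6)) skip (Write 0 (Var 1) (Var 6) ;; Assign 1 (Plus (Var 1) (Num 1)))"

definition loop_arcs :: stmt where
 "loop_arcs = loop_ends ;;
 Write 1 (Var 2) (Var 9) ;; Write 2 (Var 2) (Var 10) ;; Write 3 (Var 2) (Plus (Var 2) (Num 1)) ;;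
 Write 4 (Var 2) (Cell 15 (Var 6)) ;; Assign 2 (Plus (Var 2) (Num 1)) ;;
 Write 1 (Var 2) (Var 10) ;; Write 2 (Var 2) (Var 9) ;; Write 3 (Var 2) (Minus (Var 2) (Num 1)) ;;
 Write 4 (Var 2) (inv_code (Cell 15 (Var 6))) ;; Assign 2 (Plus (Var 2) (Num 1))"

definition loop_prog :: stmt where
 "loop_prog = Assign 4 (Plus (Var 0) (Num 1)) ;; loop_copy ;;
 Assign 1 (Num 1) ;; Assign 2 (Num 0) ;; Write 0 (Num 0) (Num 0) ;;
 For 6 (Cond (tLess (Var 6) (Var 0)) loop_arcs skip) ;; Assign 0 (Num 0)"

lemma loop_frame [simp]:
 "wregs loop_copy = {6}" "warrs loop_copy = {15,16}" "wregs loop_arcs = {1,2,9,10,20}" "warrs loop_arcs = {0,1,2,3,4}"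
 by(auto simp:loop_copy_def loop_arcs_def loop_ends_def)

lemma run_loop_copy:
 "arr (run loop_copy s) 15 i = (if i < reg s 3 then arr s 0 i else arr s 15 i)"
 "i<=reg s 3==>arr (run loop_copy s) 16 i = (if i = 0 then 1 else arr s 1 (i - 1))"
proof -
 let ?b = "Write 15 (Var 6) (Cell 0 (Var 6)) ;; Write 16 (Plus (Var 6) (Num 1)) (Cell 1 (Var 6))"
 let ?s = "run (Write 16 (Num 0) (Num 1)) s"
 define I where "I m t<->(ALL i. arr t 15 i = (if i < m then arr s 0 i else arr s 15 i))
 &(ALL i<=m. arr t 16 i = (if i = 0 then 1 else arr s 1 (i - 1)))" for m and t :: state
 have "I (reg ?s 3) (run (For 6 ?b) ?s)"
 proof (rule For_rule)
 show "I 0 ?s" unfolding I_def by simp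
 next
 fix m t assume It:"I m t" and fa:"!!b. b ~: warrs ?b==>arr t b = arr ?s b"
 have f:"arr t 0 = arr s 0" "arr t 1 = arr s 1" using fa[of 0] fa[of 1] by simp_all
 show "I (Suc m) (run ?b (set_reg 6 m t))" using It f unfolding I_def by(auto simp:less_Suc_eq le_Suc_eq) qed
 hence *: "I (reg s 3) (run loop_copy s)" unfolding loop_copy_def by simp
 show "arr (run loop_copy s) 15 i = (if i < reg s 3 then arr s 0 i else arr s 15 i)" using * unfolding I_def by blast
 show "i<=reg s 3==>arr (run loop_copy s) 16 i = (if i = 0 then 1 else arr s 1 (i - 1))" using * unfolding I_def by blast
qed

text \<open>The number \<open>i\<close> names the vertex before the \<open>i\<close>-th letter of the
 concatenated words. Where a word starts, this vertex is the basepoint, whose name is 0.\<close>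
theorem run_loop_prog:
 fixes gs :: "'x word list"
 assumes gs:"set (concat gs)<=set ls" and m:"m = length (concat gs)" and r:"reg s 0 = m" "m<=reg s 3"
 and a0:"!!i. i < m==>arr s 0 i = code (concat gs ! i)" and a1:"!!i. i < m==>arr s 1 i = flags gs ! i"
 defines "t == run loop_prog s"
 shows "EX Z. represents code t (Z,0)&pgraph_iso (bouquet gs) (Z,0)&lV Z<={..<m+1}&reg t 2 = 2 * m
 &reg t 4 = m+1&lab Z ` lE Z<=set ls"
proof -
 define s1 where "s1 = run loop_copy (set_reg 4 (m+1) s)"
 define s2 where "s2 = run (Assign 1 (Num 1) ;; Assign 2 (Num 0) ;; Write 0 (Num 0) (Num 0)) s1"
 define s3 where "s3 = run (For 6 (Cond (tLess (Var 6) (Var 0)) loop_arcs skip)) s2"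
 define fl where "fl i = arr s1 16 i" for i
 define ta where "ta i = (if fl i~=0 then 0 else i)" for i
 define he where "he i = (if fl (Suc i)~=0 then 0 else Suc i)" for i
 have run:"t = set_reg 0 0 s3" unfolding t_def loop_prog_def s3_def s2_def s1_def by(simp add:r del: run.simps(5))
 have f1:"reg s1 0 = m" "reg s1 3 = reg s 3" "reg s1 4 = m+1" unfolding s1_def by(simp_all add:frame_reg r)
 have f2:"reg s2 0 = m" "reg s2 3 = reg s 3" "reg s2 4 = m+1" "reg s2 1 = 1" "reg s2 2 = 0" "arr s2 0 0 = 0"
 "arr s2 15 = arr s1 15" "arr s2 16 = arr s1 16" unfolding s2_def using f1 by simp_all
 have fl:"fl i = (if i = 0 then 1 else flags gs ! (i - 1))" if "i<=m" for i
 using run_loop_copy(2)[of i "set_reg 4 (m+1) s"] a1[of "i - 1"] that r(2) unfolding fl_def s1_def by auto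
 have c15:"arr s1 15 i = code (concat gs ! i)" if "i < m" for i
 using run_loop_copy(1)[of "set_reg 4 (m+1) s" i] a0[OF that] that r(2) unfolding s1_def by simp
 have lsm:"concat gs ! i:set ls" if "i < m" for i using gs nth_mem[of i "concat gs"] that m by blast
 have fl0:"fl 0 = 1" using fl[of 0] by simp
 define I where "I n t<->bij_betw (arr t 0) {..<reg t 1} ({0} Un {i. i < n&fl i = 0})&reg t 2 = 2 * n
 &(ALL i<n. arr t 1 (2 * i) = ta i&arr t 2 (2 * i) = he i&arr t 3 (2 * i) = 2 * i+1&arr t 4 (2 * i) = code (concat gs ! i)
 &arr t 1 (2 * i+1) = he i&arr t 2 (2 * i+1) = ta i&arr t 3 (2 * i+1) = 2 * i
 &arr t 4 (2 * i+1) = code (inv_letter (concat gs ! i)))" for n and t :: state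
 have "(%k t. I (min k m) t) (reg s2 3) s3" unfolding s3_def
 proof (rule For_rule)
 have "inj_on (arr s2 0) {0}" "arr s2 0 ` {0} = {0}" using f2 by simp_all
 moreover have "{..<reg s2 1} = {0}" using f2(4) by auto
 ultimately have "bij_betw (arr s2 0) {..<reg s2 1} {0}" unfolding bij_betw_def by simp
 thus "I (min 0 m) s2" unfolding I_def using f2(5) by simp
 next
 fix n and t :: state
 assume It:"I (min n m) t" and n:"n < reg s2 3"
 and fr:"!!r. r ~: wregs (For 6 (Cond (tLess (Var 6) (Var 0)) loop_arcs skip))==>reg t r = reg s2 r"
 and fa:"!!b. b ~: warrs (Cond (tLess (Var 6) (Var 0)) loop_arcs skip)==>arr t b = arr s2 b"
 have f:"reg t 0 = m" "arr t 15 = arr s1 15" "arr t 16 = fl" using fr[of 0] fa[of 15] fa[of 16] f2 by(simp_all add:fl_def fun_eq_iff)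
 show "I (min (Suc n) m) (run (Cond (tLess (Var 6) (Var 0)) loop_arcs skip) (set_reg 6 n t))"
 proof (cases "n < m")
 case False
 hence m:"min (Suc n) m = min n m" by simp
 have rt:"run (Cond (tLess (Var 6) (Var 0)) loop_arcs skip) (set_reg 6 n t) = set_reg 20 0 (set_reg 6 n t)" using False f by simp
 show ?thesis using It unfolding m rt I_def by simp
 next
 case True
 have In:"I n t" "min (Suc n) m = Suc n" using It True by(simp_all add:min_def)
 let ?t = "run loop_arcs (set_reg 6 n t)"
 have rt:"run (Cond (tLess (Var 6) (Var 0)) loop_arcs skip) (set_reg 6 n t) = ?t" using True f by simp
 have c:"ev (Cell 15 (Var 6)) u = code (concat gs ! n)" if "reg u 6 = n" "arr u 15 = arr s1 15" for u :: state
 using that c15[OF True] by simp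
 have ic:"ev (inv_code (Cell 15 (Var 6))) u = code (inv_letter (concat gs ! n))" if "reg u 6 = n" "arr u 15 = arr s1 15" for u :: state
 by(rule ev_inv_code[OF c[OF that] lsm[OF True]])
 have b:"bij_betw (arr t 0) {..<reg t 1} ({0} Un {i. i < n&fl i = 0})" and r2:"reg t 2 = 2 * n" using In(1) unfolding I_def by blast+
 have ed:"arr t 1 (2 * i) = ta i&arr t 2 (2 * i) = he i&arr t 3 (2 * i) = 2 * i+1&arr t 4 (2 * i) = code (concat gs ! i)
 &arr t 1 (2 * i+1) = he i&arr t 2 (2 * i+1) = ta i&arr t 3 (2 * i+1) = 2 * i
 &arr t 4 (2 * i+1) = code (inv_letter (concat gs ! i))" if "i < n" for i using In(1) that unfolding I_def by blast
 have A:"arr ?t 1 = (arr t 1)(2 * n := ta n,2 * n+1 := he n)" "arr ?t 2 = (arr t 2)(2 * n := he n,2 * n+1 := ta n)"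
 "arr ?t 3 = (arr t 3)(2 * n := 2 * n+1,2 * n+1 := 2 * n)"
 "arr ?t 4 = (arr t 4)(2 * n := code (concat gs ! n),2 * n+1 := code (inv_letter (concat gs ! n)))"
 "reg ?t 2 = 2 * n+2" "reg ?t 1 = (if fl n~=0 then reg t 1 else Suc (reg t 1))"
 "arr ?t 0 = (if fl n~=0 then arr t 0 else (arr t 0)(reg t 1 := n))"
 proof -
 define u where "u = run loop_ends (set_reg 6 n t)"
 have u:"reg u 9 = ta n" "reg u 10 = he n" "reg u 6 = n" "reg u 2 = 2 * n" "arr u 15 = arr s1 15"
 "arr u 1 = arr t 1" "arr u 2 = arr t 2" "arr u 3 = arr t 3" "arr u 4 = arr t 4"
 and u1:"reg u 1 = (if fl n~=0 then reg t 1 else Suc (reg t 1))" and u0:"arr u 0 = (if fl n~=0 then arr t 0 else (arr t 0)(reg t 1 := n))"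
 unfolding u_def loop_ends_def using f r2 by(simp_all add:ta_def he_def)
 have rn:"?t = run (Write 1 (Var 2) (Var 9) ;; Write 2 (Var 2) (Var 10) ;; Write 3 (Var 2) (Plus (Var 2) (Num 1)) ;;
 Write 4 (Var 2) (Cell 15 (Var 6)) ;; Assign 2 (Plus (Var 2) (Num 1)) ;;
 Write 1 (Var 2) (Var 10) ;; Write 2 (Var 2) (Var 9) ;; Write 3 (Var 2) (Minus (Var 2) (Num 1)) ;;
 Write 4 (Var 2) (inv_code (Cell 15 (Var 6))) ;; Assign 2 (Plus (Var 2) (Num 1))) u"
 unfolding loop_arcs_def u_def by simp
 show "arr ?t 1 = (arr t 1)(2 * n := ta n,2 * n+1 := he n)" "arr ?t 2 = (arr t 2)(2 * n := he n,2 * n+1 := ta n)"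
 "arr ?t 3 = (arr t 3)(2 * n := 2 * n+1,2 * n+1 := 2 * n)"
 "arr ?t 4 = (arr t 4)(2 * n := code (concat gs ! n),2 * n+1 := code (inv_letter (concat gs ! n)))" "reg ?t 2 = 2 * n+2"
 unfolding rn using u c15[OF True] by(simp_all add:ic)
 show "reg ?t 1 = (if fl n~=0 then reg t 1 else Suc (reg t 1))" "arr ?t 0 = (if fl n~=0 then arr t 0 else (arr t 0)(reg t 1 := n))"
 unfolding rn u1[symmetric] u0[symmetric] by simp_all qed
 have "bij_betw (arr ?t 0) {..<reg ?t 1} ({0} Un {i. i < Suc n&fl i = 0})"
 proof (cases "fl n = 0")
 case False
 hence "{i. i < Suc n&fl i = 0} = {i. i < n&fl i = 0}" by(auto simp:less_Suc_eq)
 thus ?thesis unfolding A using b False by simp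
 next
 case z: True
 hence n0:"n~=0" using fl0 by(cases n) simp_all
 have e:"{0} Un {i. i < Suc n&fl i = 0} = insert n ({0} Un {i. i < n&fl i = 0})" using z by(auto simp:less_Suc_eq)
 have "bij_betw ((arr t 0)(reg t 1 := n)) {..<reg t 1} ({0} Un {i. i < n&fl i = 0})"
 using b by(subst bij_betw_cong[of _ _ "arr t 0"]) auto
 hence "bij_betw ((arr t 0)(reg t 1 := n)) (insert (reg t 1) {..<reg t 1}) (insert n ({0} Un {i. i < n&fl i = 0}))"
 using notIn_Un_bij_betw[of "reg t 1" "{..<reg t 1}" "(arr t 0)(reg t 1 := n)" "{0} Un {i. i < n&fl i = 0}"] n0 by simp
 thus ?thesis unfolding e A using z by(simp add:lessThan_Suc) qed
 moreover have "arr ?t 1 (2 * i) = ta i&arr ?t 2 (2 * i) = he i&arr ?t 3 (2 * i) = 2 * i+1&arr ?t 4 (2 * i) = code (concat gs ! i)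
 &arr ?t 1 (2 * i+1) = he i&arr ?t 2 (2 * i+1) = ta i&arr ?t 3 (2 * i+1) = 2 * i
 &arr ?t 4 (2 * i+1) = code (inv_letter (concat gs ! i))" if "i < Suc n" for i
 proof (cases "i = n")
 case True
 thus ?thesis unfolding A by simp
 next
 case False
 hence "i < n" using that by simp
 from ed[OF this] this show ?thesis unfolding A by auto qed
 ultimately show ?thesis unfolding rt In(2) I_def using A(5) by simp qed qed
 moreover have "min (reg s2 3) m = m" using f2(2) r(2) by simp
 ultimately have I3:"I m s3" by(simp only:)
 have f3:"reg s3 4 = m+1" unfolding s3_def using f2 by(simp add:frame_reg del: run.simps)
 define lb where "lb e = (if even e then concat gs ! (e div 2) else inv_letter (concat gs ! (e div 2)))" for e
 define Z :: "(nat,nat,'x) lgraph" where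
 "Z = \<lparr>dig = \<lparr>verts = {0} Un {i. i < m&fl i = 0},arcs = {..<2 * m},tail = arr s3 1,head = arr s3 2\<rparr>,
 bar = (%e. if e < 2 * m then arr s3 3 e else e),lab = lb\<rparr>"
 have b3:"bij_betw (arr s3 0) {..<reg s3 1} ({0} Un {i. i < m&fl i = 0})" and r2:"reg s3 2 = 2 * m" using I3 unfolding I_def by blast+
 have ed:"arr s3 1 (2 * i) = ta i&arr s3 2 (2 * i) = he i&arr s3 3 (2 * i) = 2 * i+1&arr s3 4 (2 * i) = code (concat gs ! i)
 &arr s3 1 (2 * i+1) = he i&arr s3 2 (2 * i+1) = ta i&arr s3 3 (2 * i+1) = 2 * i
 &arr s3 4 (2 * i+1) = code (inv_letter (concat gs ! i))" if "i < m" for i using I3 that unfolding I_def by blast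
 have two:"EX i<m. e = 2 * i|e = 2 * i+1" if "e < 2 * m" for e using that by presburger
 have flm:"fl m~=0" if m0:"m > 0"
 proof -
 from concat_position[of "m - 1" gs] m m0 obtain k j where kj:"k < length gs" "j < length (gs ! k)" "m - 1 = off gs k+j"
 unfolding off_def by auto
 have "Suc j = length (gs ! k)"
 proof (rule ccontr)
 assume "Suc j~=length (gs ! k)"
 hence "Suc j < length (gs ! k)" using kj(2) by simp
 from off_less[OF kj(1) this] kj(3) m m0 show False by simp qed
 thus ?thesis using fl[of m] flags(2)[OF kj(1,2)] kj(3) m0 by simp qed
 have taV:"ta i:lV Z" "he i:lV Z" if "i < m" for i
 using that flm by(cases "Suc i = m"; auto simp:Z_def ta_def he_def)+
 have wf:"lgraph_wf Z"
 proof (rule lgraph_wfI)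
 fix e assume "e:lE Z"
 hence "e < 2 * m" by(simp add:Z_def)
 from two[OF this] obtain i where i:"i < m" "e = 2 * i|e = 2 * i+1" by blast
 from i(2) show "ltail Z e:lV Z&lhead Z e:lV Z&bar Z e:lE Z&bar Z (bar Z e) = e&ltail Z (bar Z e) = lhead Z e
 &lab Z (bar Z e) = inv_letter (lab Z e)"
 using ed[OF i(1)] i(1) taV[OF i(1)] by(elim disjE) (simp_all add:Z_def lb_def) qed (simp add:Z_def)
 have "represents code s3' (Z,0)" if "reg s3' 0 = 0" "reg s3' 1 = reg s3 1" "reg s3' 2 = 2 * m" "arr s3' = arr s3" for s3'
 unfolding represents.simps that using wf b3 two ed by(fastforce simp:Z_def lb_def) 
 note rep' = this
 have rep:"represents code t (Z,0)" unfolding run by(rule rep') (simp_all add:r2)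
 have iso:"pgraph_iso (bouquet gs) (Z,0)"
 proof -
 define f where "f = (%(k,j). if j = 0 then 0 else off gs k+j)"
 define g where "g = (%(k,j,b). 2 * (off gs k+j)+(if b then 0 else 1))"
 have st:"fl (off gs k+j)~=0<->j = 0" "fl (Suc (off gs k+j))~=0<->Suc j = length (gs ! k)" "off gs k+j < m"
 "concat gs ! (off gs k+j) = gs ! k ! j" if kj:"k < length gs" "j < length (gs ! k)" for k j
 proof -
 show l:"off gs k+j < m" unfolding m by(rule off_less[OF kj])
 show "fl (off gs k+j)~=0<->j = 0" using flags_start[OF kj] fl[of "off gs k+j"] l by auto
 show "fl (Suc (off gs k+j))~=0<->Suc j = length (gs ! k)" using flags(2)[OF kj] fl[of "Suc (off gs k+j)"] l by simp
 show "concat gs ! (off gs k+j) = gs ! k ! j" using concat_nth[OF kj] by(simp add:off_def) qed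
 have fta:"f (loop_vertex gs k j) = ta (off gs k+j)" "f (loop_vertex gs k (Suc j)) = he (off gs k+j)"
 if kj:"k < length gs" "j < length (gs ! k)" for k j
 using st(1,2)[OF kj] kj by(auto simp:f_def loop_vertex_def ta_def he_def)
 obtain D where D:"bouquet gs = (D,(0,0))" unfolding bouquet_def by blast
 have Dv:"lV D = {(0,0)} Un {loop_vertex gs k j|k j. k < length gs&j < length (gs ! k)}" and Da:"lE D = bouquet_arcs gs"
 and Dt:"ltail D = (%(k,j,b). loop_vertex gs k (if b then j else Suc j))" "lhead D = (%(k,j,b). loop_vertex gs k (if b then Suc j else j))"
 and Db:"bar D = (%(k,j,b). if (k,j,b):bouquet_arcs gs then (k,j,~ b) else (k,j,b))"
 and Dl:"lab D = (%(k,j,b). if b then gs ! k ! j else inv_letter (gs ! k ! j))" using D unfolding bouquet_def by auto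
 have Dv': "lV D = {(0,0)} Un {(k,j). k < length gs&0 < j&j < length (gs ! k)}"
 proof (intro equalityI subsetI)
 fix p assume "p:lV D"
 thus "p:{(0,0)} Un {(k,j). k < length gs&0 < j&j < length (gs ! k)}"
 unfolding Dv loop_vertex_def by(auto split:if_splits)
 next
 fix p assume "p:{(0,0)} Un {(k,j). k < length gs&0 < j&j < length (gs ! k)}"
 then consider "p = (0,0)"|k j where "p = (k,j)" "k < length gs" "0 < j" "j < length (gs ! k)" by auto
 thus "p:lV D"
 proof cases
 case 2
 hence "p = loop_vertex gs k j" by(simp add:loop_vertex_def)
 with 2(2,4) show ?thesis unfolding Dv by blast qed (simp add:Dv) qed
 have G:"lV Z = {0} Un {i. i < m&fl i = 0}" "lE Z = {..<2 * m}" by(simp_all add:Z_def)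
 have bf:"bij_betw f (lV D) (lV Z)" unfolding bij_betw_def
 proof
 show "inj_on f (lV D)"
 proof (rule inj_onI)
 fix p q assume pq:"p:lV D" "q:lV D" "f p = f q"
 obtain k j k' j' where p:"p = (k,j)" "q = (k',j')" by(cases p,cases q) auto
 show "p = q"
 proof (cases "j = 0|j' = 0")
 case True
 hence "j = 0" "j' = 0" using pq(3) unfolding p f_def by(auto split:if_splits)
 thus ?thesis using pq(1,2) unfolding p Dv' by auto
 next
 case False
 hence "off gs k+j = off gs k'+j'" "k < length gs" "j < length (gs ! k)" "k' < length gs" "j' < length (gs ! k')"
 using pq unfolding p f_def Dv' by auto
 thus ?thesis unfolding p using off_inj by blast qed qed
 show "f ` lV D = lV Z"
 proof (intro equalityI subsetI)
 fix i assume "i:f ` lV D"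
 then obtain p where p:"p:lV D" "i = f p" by blast
 from p(1) consider "p = (0,0)"|k j where "p = (k,j)" "k < length gs" "0 < j" "j < length (gs ! k)" unfolding Dv' by auto
 thus "i:lV Z" using p(2) st(1,3) by(fastforce simp:f_def G) 
 next
 fix i assume "i:lV Z"
 then consider "i = 0"|"i < m" "fl i = 0" unfolding G by auto
 thus "i:f ` lV D"
 proof cases
 case 1
 thus ?thesis unfolding Dv' by(intro image_eqI[of _ _ "(0,0)"]) (simp_all add:f_def)
 next
 case 2
 from concat_position[OF 2(1)[unfolded m]] obtain k j where kj:"k < length gs" "j < length (gs ! k)" "i = off gs k+j"
 unfolding off_def by blast
 have "j~=0" using st(1)[OF kj(1,2)] 2(2) kj(3) by simp
 thus ?thesis unfolding Dv' using kj by(intro image_eqI[of _ _ "(k,j)"]) (simp_all add:f_def) qed qed qed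
 have bg:"bij_betw g (lE D) (lE Z)" unfolding bij_betw_def
 proof
 show "inj_on g (lE D)"
 proof (rule inj_onI)
 fix p q assume pq:"p:lE D" "q:lE D" "g p = g q"
 obtain k j b k' j' b' where p:"p = (k,j,b)" "q = (k',j',b')" by(cases p,cases q) auto
 have "2 * (off gs k+j)+(if b then 0 else 1) = 2 * (off gs k'+j')+(if b' then 0 else 1)" using pq(3) unfolding p g_def by simp
 hence "b = b'&off gs k+j = off gs k'+j'" by(cases b; cases b'; simp; presburger)
 with pq(1,2) show "p = q" unfolding p Da bouquet_arcs_def using off_inj by blast qed
 show "g ` lE D = lE Z"
 proof (intro equalityI subsetI)
 fix e assume "e:g ` lE D"
 then obtain k j b where "e = g (k,j,b)" "k < length gs" "j < length (gs ! k)" unfolding Da bouquet_arcs_def by auto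
 with st(3)[OF this(2,3)] show "e:lE Z" by(simp add:g_def G)
 next
 fix e assume "e:lE Z"
 hence "e < 2 * m" by(simp add:G)
 from two[OF this] obtain i where i:"i < m" "e = 2 * i|e = 2 * i+1" by blast
 from concat_position[OF i(1)[unfolded m]] obtain k j where kj:"k < length gs" "j < length (gs ! k)" "i = off gs k+j"
 unfolding off_def by blast
 show "e:g ` lE D" unfolding Da bouquet_arcs_def using kj i(2)
 by(intro image_eqI[of _ _ "(k,j,e = 2 * i)"]) (auto simp:g_def) qed qed
 have hom:"lgraph_hom D Z f g" unfolding lgraph_hom_def
 proof (intro conjI ballI)
 show "f ` lV D<=lV Z" "g ` lE D<=lE Z" using bf bg by(simp_all add:bij_betw_def)
 fix e assume e:"e:lE D"
 then obtain k j b where k:"e = (k,j,b)" "k < length gs" "j < length (gs ! k)" unfolding Da bouquet_arcs_def by auto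
 note s = st(3,4)[OF k(2,3)] and q = ed[OF st(3)[OF k(2,3)]] and ft = fta[OF k(2,3)]
 have "(k,j,b):bouquet_arcs gs" using k by(simp add:bouquet_arcs_def)
 hence bb:"bar D e = (k,j,~ b)" unfolding Db k(1) by simp
 have gl:"ltail Z = arr s3 1" "lhead Z = arr s3 2" "lab Z = lb" "bar Z d = (if d < 2 * m then arr s3 3 d else d)" for d by(simp_all add:Z_def)
 have lt:"2 * (off gs k+j)+1 < 2 * m" "2 * (off gs k+j) < 2 * m" using s(1) by simp_all
 have gT:"g (k,j,True) = 2 * (off gs k+j)" "g (k,j,False) = 2 * (off gs k+j)+1" by(simp_all add:g_def)
 have lbT:"lb (2 * (off gs k+j)) = gs ! k ! j" "lb (2 * (off gs k+j)+1) = inv_letter (gs ! k ! j)" using s(2) by(simp_all add:lb_def)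
 show "ltail Z (g e) = f (ltail D e)" using q ft unfolding gl Dt k(1) by(cases b) (simp_all only: gT prod.case if_True if_False)
 show "lhead Z (g e) = f (lhead D e)" using q ft unfolding gl Dt k(1) by(cases b) (simp_all only: gT prod.case if_True if_False)
 show "bar Z (g e) = g (bar D e)" using q lt unfolding bb unfolding gl k(1) by(cases b) (simp_all only: gT if_True not_True_eq_False not_False_eq_True)
 show "lab Z (g e) = lab D e" using lbT unfolding gl Dl k(1) by(cases b) (simp_all only: gT prod.case if_True if_False)
 qed
 show ?thesis unfolding D pgraph_iso.simps using hom bf bg by(intro exI[of _ f] exI[of _ g]) (simp add:Dv f_def) qed
 have "lab Z ` lE Z<=set ls"
 proof
 fix x assume "x:lab Z ` lE Z"
 then obtain e where e:"e < 2 * m" "x = lb e" by(auto simp:Z_def)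
 hence "e div 2 < m" by simp
 from lsm[OF this] ls_inv[OF lsm[OF this]] show "x:set ls" unfolding e(2) lb_def by simp qed
 moreover have "lV Z<={..<m+1}" by(auto simp:Z_def)
 ultimately show ?thesis using rep iso f3 r2 unfolding run by(intro exI[of _ Z] conjI) simp_all qed

section \<open>The program for the second step\<close>

definition load_prog :: stmt where
 "load_prog = For 6 (Write 5 (Var 6) (Num 0)) ;; For 6 (Cond (tLess (Var 6) (Var 1)) (Write 5 (Cell 0 (Var 6)) (Num 1)) skip) ;;
 For 6 (Write 7 (Var 6) (Cell 1 (Var 6))) ;; For 6 (Write 8 (Var 6) (idx_expr (Cell 4 (Var 6)))) ;;
 For 6 (Write 9 (Var 6) (Cell 2 (Var 6))) ;; Assign 5 (Var 2)"

lemma run_load_prog: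
 fixes Z :: "(nat,nat,'x) lgraph"
 assumes rep:"represents code s (Z,v)" and labs:"lab Z ` lE Z<=set ls" and N:"lV Z<={..<N}" "W * N<=reg s 3"
 and e:"reg s 2<=reg s 3" and N0:"0 < N"
 defines "t == run load_prog s"
 shows "fold_ok W N t" "tset t = (%(u,x,w). (u,idx x,w)) ` tri Z" "!!j. j < reg s 3==>arr t 5 j~=0<->j:lV Z"
proof -
 let ?B = "reg s 3"
 have NB:"N<=?B" by(rule N_le[OF N(2)])
 define s1 where "s1 = run (For 6 (Write 5 (Var 6) (Num 0))) s"
 define s2 where "s2 = run (For 6 (Cond (tLess (Var 6) (Var 1)) (Write 5 (Cell 0 (Var 6)) (Num 1)) skip)) s1"
 define s3 where "s3 = run (For 6 (Write 7 (Var 6) (Cell 1 (Var 6)))) s2"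
 define s4 where "s4 = run (For 6 (Write 8 (Var 6) (idx_expr (Cell 4 (Var 6))))) s3"
 define s5 where "s5 = run (For 6 (Write 9 (Var 6) (Cell 2 (Var 6)))) s4"
 have run:"t = set_reg 5 (reg s5 2) s5" unfolding t_def load_prog_def s5_def s4_def s3_def s2_def s1_def by(simp del: run.simps(5))
 have g1:"reg s1 r = reg s r" if "r~=6" for r using that unfolding s1_def by(simp add:frame_reg del: run.simps)
 have g2:"reg s2 r = reg s r" if "r ~: {6,20}" for r using that g1 unfolding s2_def by(simp add:frame_reg del: run.simps)
 have g3:"reg s3 r = reg s r" if "r ~: {6,20}" for r using that g2 unfolding s3_def by(simp add:frame_reg del: run.simps)
 have g4:"reg s4 r = reg s r" if "r ~: {6,20}" for r using that g3 unfolding s4_def by(simp add:frame_reg del: run.simps)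
 have g5:"reg s5 r = reg s r" if "r ~: {6,20}" for r using that g4 unfolding s5_def by(simp add:frame_reg del: run.simps)
 have a1:"arr s1 b = arr s b" if "b~=5" for b using that unfolding s1_def by(simp add:frame_arr del: run.simps)
 have a2:"arr s2 b = arr s b" if "b~=5" for b using that a1 unfolding s2_def by(simp add:frame_arr del: run.simps)
 have a3:"arr s3 b = arr s2 b" if "b~=7" for b using that unfolding s3_def by(simp add:frame_arr del: run.simps)
 have a4:"arr s4 b = arr s3 b" if "b~=8" for b using that unfolding s4_def by(simp add:frame_arr del: run.simps)
 have a5:"arr s5 b = arr s4 b" if "b~=9" for b using that unfolding s5_def by(simp add:frame_arr del: run.simps)
 have A1:"arr s1 5 = (%j. if j < reg s 3 then 0 else arr s 5 j)" unfolding s1_def by(rule For_array_rule) auto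
 have A7:"arr s3 7 = (%j. if j < reg s2 3 then arr s 1 j else arr s2 7 j)" unfolding s3_def
 by(rule For_array_rule) (use a2[of 1] in auto)
 have A8:"arr s4 8 = (%j. if j < reg s3 3 then ev (idx_expr (Cell 4 (Var 6))) (set_reg 6 j s) else arr s3 8 j)" unfolding s4_def
 proof (rule For_array_rule)
 fix k and t :: state assume k:"reg t 6 = k" "!!c. c~=8==>arr t c = arr s3 c"
 have "arr t 4 = arr s 4" using k(2)[of 4] a3[of 4] a2[of 4] by simp
 thus "ev (idx_expr (Cell 4 (Var 6))) t = ev (idx_expr (Cell 4 (Var 6))) (set_reg 6 k s)"
 using k(1) by(intro ev_cong) (auto simp:idx_expr_def split:if_splits) qed simp
 have A9:"arr s5 9 = (%j. if j < reg s4 3 then arr s 2 j else arr s4 9 j)" unfolding s5_def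
 by(rule For_array_rule) (use a4[of 2] a3[of 2] a2[of 2] in auto)
 have rp:"bij_betw (arr s 0) {..<reg s 1} (lV Z)" "lE Z = {..<reg s 2}" "lgraph_wf Z"
 "!!e. e < reg s 2==>arr s 1 e = ltail Z e&arr s 2 e = lhead Z e&arr s 4 e = code (lab Z e)" using rep by simp_all
 have nv:"reg s 1<=?B" using bij_betw_same_card[OF rp(1)] card_mono[OF _ N(1)] NB by simp 
 have T:"arr t 7 e = ltail Z e&arr t 8 e = idx (lab Z e)&arr t 9 e = lhead Z e" if el:"e < reg s 2" for e
 proof -
 have "lab Z e:set ls" using labs el rp(2) by auto
 note x = idx[OF this]
 have "ev (Cell 4 (Var 6)) (set_reg 6 e s) = code (ls ! idx (lab Z e))" using rp(4)[OF el] x by simp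
 hence "ev (idx_expr (Cell 4 (Var 6))) (set_reg 6 e s) = idx (lab Z e)" by(rule ev_idx_expr[OF _ x(1)])
 thus ?thesis using A7 A8 A9 a5[of 7] a5[of 8] a4[of 7] g2[of 3] g3[of 3] g4[of 3] rp(4)[OF el] el assms(5) unfolding run by simp
 qed
 have n5:"reg t 5 = reg s 2" "reg t 3 = ?B" unfolding run using g5[of 2] g5[of 3] by simp_all
 show "tset t = (%(u,x,w). (u,idx x,w)) ` tri Z"
 proof -
 have "tset t = (%e. (arr t 7 e,arr t 8 e,arr t 9 e)) ` {..<reg s 2}" unfolding tset_def n5 by blast
 also have "\<dots> = (%e. (ltail Z e,idx (lab Z e),lhead Z e)) ` {..<reg s 2}" using T by(intro image_cong) auto
 finally show ?thesis unfolding tri_def rp(2) image_image by simp qed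
 show "fold_ok W N t" unfolding fold_ok_def n5
 proof (intro conjI allI impI)
 fix e assume el:"e < reg s 2"
 hence "e:lE Z" using rp(2) by simp
 note w = lgraph_wfD(1,2)[OF rp(3) this]
 have "lab Z e:set ls" using labs el rp(2) by auto
 from idx(1)[OF this] T[OF el] w N(1) len(1) show "arr t 7 e < N" "arr t 8 e < W" "arr t 9 e < N" by auto
 qed (use e N(2) N0 len(2) in simp_all)
 have "(%m t. ALL j<?B. arr t 5 j~=0<->(EX k<min m (reg s 1). arr s 0 k = j)) (reg s1 3) s2" unfolding s2_def
 proof (rule For_rule)
 show "ALL j<?B. arr s1 5 j~=0<->(EX k<min 0 (reg s 1). arr s 0 k = j)" using A1 by simp
 next
 fix m and t :: state
 assume It:"ALL j<?B. arr t 5 j~=0<->(EX k<min m (reg s 1). arr s 0 k = j)"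
 and fr:"!!r. r ~: wregs (For 6 (Cond (tLess (Var 6) (Var 1)) (Write 5 (Cell 0 (Var 6)) (Num 1)) skip))==>reg t r = reg s1 r"
 and fa:"!!b. b ~: warrs (Cond (tLess (Var 6) (Var 1)) (Write 5 (Cell 0 (Var 6)) (Num 1)) skip)==>arr t b = arr s1 b"
 have f:"reg t 1 = reg s 1" "arr t 0 = arr s 0" using fr[of 1] fa[of 0] g1[of 1] a1[of 0] by simp_all
 show "ALL j<?B. arr (run (Cond (tLess (Var 6) (Var 1)) (Write 5 (Cell 0 (Var 6)) (Num 1)) skip) (set_reg 6 m t)) 5 j~=0
 <->(EX k<min (Suc m) (reg s 1). arr s 0 k = j)" using It f less_Suc_eq by auto  qed
 moreover have "min (reg s1 3) (reg s 1) = reg s 1" using g1[of 3] nv by simp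
 moreover have "arr t 5 = arr s2 5" unfolding run using a5[of 5] a4[of 5] a3[of 5] by simp
 ultimately have *: "ALL j<?B. arr t 5 j~=0<->(EX k<reg s 1. arr s 0 k = j)" by(simp only:)
 fix j assume "j < ?B"
 with * have "arr t 5 j~=0<->(EX k<reg s 1. arr s 0 k = j)" by blast
 also have "\<dots><->j:arr s 0 ` {..<reg s 1}" by auto
 finally show "arr t 5 j~=0<->j:lV Z" using bij_betw_imp_surj_on[OF rp(1)] by simp qed

theorem run_quot_key:
 assumes ok:"fold_ok W N s" and V0:"V0<={..<N}" "!!j. j < reg s 3==>arr s 5 j~=0<->j:V0"
 and E:"tset s = (%(u,x,w). (u,ka x,w)) ` E" and ka: "inj_on ka {x. EX u w. (u,x,w):E}"
 shows "EX L. (ALL j<N. L j < N)&(ALL j<N. ALL k<N. L j = L k<->lfc E j k)&fold_cong E L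
 &tabs (run quot_prog s) N (L ` (V0 Un {u. EX x w. (u,x,w):E} Un {w. EX u x. (u,x,w):E}))
 {(L u,ls ! ka x,L w)|u x w. (u,x,w):E&ka x < K}
 &reg (run quot_prog s) 0 = L (reg s 0)"
proof -
 obtain L where L:"(ALL j<N. L j < N)&(ALL j<N. ALL k<N. L j = L k<->lfc (tset s) j k)&fold_cong (tset s) L
 &tabs (run quot_prog s) N (L ` (V0 Un {u. EX x w. (u,x,w):tset s} Un {w. EX u x. (u,x,w):tset s}))
 {(L u,ls ! x,L w)|u x w. (u,x,w):tset s&x < K}
 &reg (run quot_prog s) 0 = L (reg s 0)" using run_quot_prog[OF ok V0] by(rule exE)
 have l:"lfc (tset s) j k<->lfc E j k" for j k unfolding E by(rule lfc_key[OF ka])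
 have v:"{u. EX x w. (u,x,w):tset s} = {u. EX x w. (u,x,w):E}" "{w. EX u x. (u,x,w):tset s} = {w. EX u x. (u,x,w):E}"
 unfolding E by force+
 have t:"{(L u,ls ! x,L w)|u x w. (u,x,w):tset s&x < K} = {(L u,ls ! ka x,L w)|u x w. (u,x,w):E&ka x < K}"
 unfolding E by force
 have "fold_cong E L"
 proof (rule fold_congI)
 fix u x w u' w' assume *: "(u,x,w):E" "(u',x,w'):E" "L u = L u'"
 have "(u,ka x,w):tset s" "(u',ka x,w'):tset s" unfolding E using *(1,2) by force+
 thus "L w = L w'" using fold_congD[of "tset s" L] L *(3) by blast qed
 thus ?thesis using L unfolding l v t by blast qed

lemma symm_quotient:"symm T==>symm (tmap L ` T)" unfolding symm_def by force

lemma det_quotient:"fold_cong T L==>det (tmap L ` T)"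
proof -
 assume L:"fold_cong T L"
 show ?thesis unfolding det_def
 proof (intro allI impI)
 fix u x w w' assume "(u,x,w):tmap L ` T" "(u,x,w'):tmap L ` T"
 then obtain a b a' b' where "(a,x,b):T" "(a',x,b'):T" "u = L a" "w = L b" "u = L a'" "w' = L b'" by auto
 thus "w = w'" using fold_congD[OF L] by metis qed qed

lemma decode:
 assumes "!!u x w. (u,x,w):E==>x:set ls" shows "{(L u,ls ! idx x,L w)|u x w. (u,x,w):E&idx x < K} = tmap L ` E"
proof (intro equalityI subsetI)
 fix y assume "y:{(L u,ls ! idx x,L w)|u x w. (u,x,w):E&idx x < K}"
 then obtain u x w where y:"y = (L u,ls ! idx x,L w)" "(u,x,w):E" by blast
 thus "y:tmap L ` E" using idx(2)[OF assms[OF y(2)]] by(intro image_eqI[of _ _ "(u,x,w)"]) simp_all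
next
 fix y assume "y:tmap L ` E"
 then obtain u x w where "y = (L u,x,L w)" "(u,x,w):E" by auto
 thus "y:{(L u,ls ! idx x,L w)|u x w. (u,x,w):E&idx x < K}" using idx[OF assms,of u x w]
 by(intro CollectI exI[of _ u] exI[of _ x] exI[of _ w]) simp qed

definition fold_step_prog :: stmt where
 "fold_step_prog = load_prog ;; quot_prog ;; hair_prog ;; out_prog"

theorem run_fold_step_prog:
 fixes Z :: "(nat,nat,'x) lgraph"
 assumes rep:"represents code s (Z,v)" and labs:"lab Z ` lE Z<=set ls" and N:"lV Z<={..<N}" "W * N<=reg s 3" "0 < N"
 and e:"reg s 2<=reg s 3" and r4:"reg s 4 = N"
 defines "t == run fold_step_prog s"
 shows "EX Z' v'. represents code t (Z',v')&step2 (Z,v) (Z',v')&folded Z'&tabs t N (lV Z') (tri Z')&reg t 4 = N"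
proof -
 define s1 where "s1 = run load_prog s"
 define s2 where "s2 = run quot_prog s1"
 define s3 where "s3 = run hair_prog s2"
 have run:"t = run out_prog s3" unfolding t_def fold_step_prog_def s1_def s2_def s3_def by simp
 note l = run_load_prog[OF rep labs N(1,2) e N(3),folded s1_def]
 have f1:"reg s1 0 = reg s 0" "reg s1 3 = reg s 3" "reg s1 4 = N" unfolding s1_def by(simp_all add:frame_reg load_prog_def r4 del: run.simps(5))
 have f2:"reg s2 3 = reg s 3" "reg s2 4 = N" unfolding s2_def by(simp_all add:frame_reg f1)
 have wf:"lgraph_wf Z" and fin:"finite (lE Z)" and v:"v:lV Z" "reg s 0 = v" using rep by simp_all
 have xls:"x:set ls" if "(u,x,w):tri Z" for u x w using that labs by(auto elim!: triE)
 have inj:"inj_on idx {x. EX u w. (u,x,w):tri Z}"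
 proof (rule inj_onI)
 fix x y assume "x:{x. EX u w. (u,x,w):tri Z}" "y:{x. EX u w. (u,x,w):tri Z}" "idx x = idx y"
 hence "ls ! idx x = x" "ls ! idx y = y" "idx x = idx y" using idx(2)[OF xls] by blast+
 thus "x = y" by metis qed
 obtain L where L:"ALL j<N. ALL k<N. L j = L k<->lfc (tri Z) j k" "fold_cong (tri Z) L"
 "tabs s2 N (L ` (lV Z Un {u. EX x w. (u,x,w):tri Z} Un {w. EX u x. (u,x,w):tri Z}))
 {(L u,ls ! idx x,L w)|u x w. (u,x,w):tri Z&idx x < K}" "reg s2 0 = L (reg s1 0)"
 using run_quot_key[OF l(1) N(1) l(3) l(2) inj] unfolding s2_def f1 by blast
 have "lV Z Un {u. EX x w. (u,x,w):tri Z} Un {w. EX u x. (u,x,w):tri Z} = lV Z" using triD(1,2)[OF wf] by blast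
 moreover have "{(L u,ls ! idx x,L w)|u x w. (u,x,w):tri Z&idx x < K} = tmap L ` tri Z" by(rule decode) (rule xls)
 ultimately have tb:"tabs s2 N (L ` lV Z) (tmap L ` tri Z)" using L(3) by simp
 have v2:"reg s2 0 = L v" using L(4) f1 v by simp
 have sy:"symm (tmap L ` tri Z)" by(rule symm_quotient[OF symm_tri[OF wf]])
 have de:"det (tmap L ` tri Z)" by(rule det_quotient[OF L(2)])
 obtain V' T' where h:"(hair (L v))^** (L ` lV Z,tmap L ` tri Z) (V',T')" "tabs s3 N V' T'" "symm T'" "det T'"
 "!!Y. ~ hair (L v) (V',T') Y" "L v:V'"
 using run_hair_prog[OF tb sy de f2(2)] v(1) unfolding v2 s3_def[symmetric] by blast
 have f3:"reg s3 0 = L v" "reg s3 3 = reg s 3" "reg s3 4 = N" unfolding s3_def by(simp_all add:frame_reg v2 f2)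
 obtain Z' where G:"represents code t (Z',L v)" "lgraph_wf Z'" "folded Z'" "lV Z' = V'" "tri Z' = T'"
 using run_out_prog[OF h(2,4,3)] h(6) unfolding f3 run by blast
 have lc:"least_cong (tri Z) (lV Z) L" unfolding least_cong_def
 proof (intro conjI L(2) allI impI ballI)
 fix h :: "nat => nat" and u w assume "fold_cong (tri Z) h" "u:lV Z" "w:lV Z" "L u = L w"
 thus "h u = h w" using L(1) N(1) lfc_least[of "tri Z" u w h] by blast qed
 have "step2 (Z,v) (Z',L v)" by(rule step2I[OF wf fin v(1) lc h(1,5) G(2-5)])
 moreover have "tabs t N V' T'" unfolding run by(rule tabs_cong[OF h(2)]) (simp_all add:frame_reg frame_arr)
 moreover have "reg t 4 = N" unfolding run using f3 by(simp add:frame_reg)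
 ultimately show ?thesis using G by blast qed

lemma frugal_loop:"frugal loop_prog"
 by(auto simp:frugal_def loop_prog_def loop_copy_def loop_arcs_def loop_ends_def inv_code_def split:if_splits)

lemma frugal_out:"frugal out_prog"
 by(auto simp:frugal_def out_prog_def out_verts_def out_arcs_def out_bars_def out_arc_def out_next_def code_expr_def inv_expr_def split:if_splits)

lemma frugal_quot:"frugal quot_prog"
 by(auto simp:frugal_def quot_prog_def fold_prog_def fold_round_def search_def fold_probe_def table_prog_def table_entry_def key_def split:if_splits)

lemma frugal_fold_step:"frugal fold_step_prog"
proof -
 have "frugal hair_prog" by(auto simp:frugal_def hair_prog_def hair_test_def hair_cut_def cell_def split:if_splits)
 moreover have "frugal load_prog" by(auto simp:frugal_def load_prog_def idx_expr_def split:if_splits)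
 ultimately show ?thesis by(simp add:fold_step_prog_def frugal_quot frugal_out) qed

end

section \<open>The programs for the third and the fourth step\<close>

text \<open>The finite data on which the programs depend: the letters, the elements of the factors, the
 numbers \<open>sl i g\<close> of the elements in the names \<open>sl i g * N + v\<close> of the vertices of
 glued Cayley graphs, and the pairs of words for the fourth step, whose letters are numbered after the
 proper ones.\<close>
locale amalgam_progs = amalgam X R A \<phi>+letter_table ls W code
 for X :: "index => 'x set" and R :: "index => 'x word set" and A :: "'a monoid" and \<phi> :: "index => 'a => 'x word set"
 and ls :: "'x letter list" and W :: nat and code :: "'x letter => nat" +
 fixes el :: "index => 'x word set list" and sl :: "index => 'x word set => nat" and slots :: nat
 and prs :: "('x word \<times> 'x word) list"
 assumes ls:"set ls = letters XX" and el:"set (el i) = FC i" "distinct (el i)" and sl_one:"!!i. sl i \<one>[i] = 0"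
 and sl_pos:"!!i g. g:FC i==>g~=\<one>[i]==>sl i g > 0"
 and sl_inj:"!!i g i' g'. g:FC i==>g':carrier (factor i')==>sl i g > 0==>sl i g = sl i' g'
 ==>i = i'&g = g'" and sl_less:"!!i g. g:FC i==>sl i g < slots" and prs:"pair_list prs" and W_prs:"K+length prs<=W"
begin

definition wd :: "index => 'x word set => 'x word" where
 "wd i g = (SOME u. u:WX i&elt i u = g)"

lemma wd:"g:FC i==>wd i g:WX i" "g:FC i==>elt i (wd i g) = g"
proof -
 assume "g:FC i"
 hence "EX u. u:WX i&elt i u = g" by(auto simp:carrier_factor)
 from someI_ex[OF this] show "wd i g:WX i" "elt i (wd i g) = g" unfolding wd_def by blast+ qed

lemma xls:"x:LX i==>x:set ls" unfolding ls using letters_mono by blast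

lemma slots_pos:"0 < slots" using sl_less[OF one_cl[of One]] by simp

definition good :: "state => nat => (nat,nat,'x) lgraph => nat => bool" where
 "good s N Z v<->represents code s (Z,v)&folded Z&tabs s N (lV Z) (tri Z)&reg s 4 = N"

lemma goodD:
 assumes "good s N Z v"
 shows "represents code s (Z,v)" "folded Z" "tabs s N (lV Z) (tri Z)" "reg s 4 = N" "lgraph_wf Z" "finite (lE Z)"
 "v:lV Z" "reg s 0 = v" "lV Z<={..<N}" "finite (lV Z)" "v < N" "N<=reg s 3"
proof -
 show g:"represents code s (Z,v)" "folded Z" "tabs s N (lV Z) (tri Z)" "reg s 4 = N" using assms unfolding good_def by blast+
 from g(1) show w:"lgraph_wf Z" "finite (lE Z)" "v:lV Z" "reg s 0 = v" by simp_all
 show "lV Z<={..<N}" by(rule tabsD(1)[OF g(3)])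
 with w(3) show "finite (lV Z)" "v < N" using finite_subset by blast+
 show "N<=reg s 3" by(rule N_le[OF tabsD(2)[OF g(3)]]) qed

lemma good_agree:"good s N Z v==>agree 40 s t==>good t N Z v"
proof -
 assume g:"good s N Z v" and a:"agree 40 s t"
 hence e:"reg t 3 = reg s 3" "reg t 4 = reg s 4" "arr t = arr s" unfolding agree_def by simp_all
 from g have h:"represents code s (Z,v)" "folded Z" "tabs s N (lV Z) (tri Z)" "reg s 4 = N" unfolding good_def by blast+
 have "tabs t N (lV Z) (tri Z)" by(rule tabs_cong[OF h(3) e(1)]) (simp_all only: e(3))
 with h(2,4) e(2) represents_agree[OF h(1) a] show ?thesis unfolding good_def by simp qed

lemma has_ls:"has i T v<->(EX x:set ls. x:LX i&(EX w. (v,x,w):T))" unfolding has_def using xls by blast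

definition has_expr :: "index => expr => expr" where
 "has_expr i e = eSum (map (arc_expr e) (filter (%x. x:LX i) ls))"

definition vb_expr :: "expr => expr" where
 "vb_expr e = tAll [has_expr One e,has_expr Two e]"

lemma has_expr_uses:"eregs (has_expr i e)<=eregs e" "earrs (has_expr i e)<=insert 6 (earrs e)"
 using arc_expr_uses by(fastforce simp:has_expr_def)+

lemma vb_expr_uses:"eregs (vb_expr e)<=eregs e" "earrs (vb_expr e)<=insert 6 (earrs e)"
 using has_expr_uses[of One e] has_expr_uses[of Two e] by(simp_all add:vb_expr_def)

lemma ev_has_expr:
 assumes t:"tabs s N V T" and v:"ev e s < N" shows "ev (has_expr i e) s~=0<->has i T (ev e s)"
proof -
 have "ev (has_expr i e) s~=0<->(EX x:set ls. x:LX i&ev (arc_expr e x) s~=0)"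
 by(simp add:has_expr_def Bex_def del: split_paired_Ex split_paired_All)
 also have "\<dots><->(EX x:set ls. x:LX i&(EX w. (ev e s,x,w):T))" using ev_arc_expr(2)[OF t v] by blast
 finally show ?thesis unfolding has_ls . qed

lemma all_index:"(ALL i. P i)<->P One&P Two" by(metis index.exhaust)

lemma ev_vb_expr:
 assumes t:"tabs s N (lV H) (tri H)" and v:"ev e s < N" shows "ev (vb_expr e) s~=0<->ev e s:VB H"
proof -
 have "ev e s:lV H" if "has One (tri H) (ev e s)" using that tabsD(4)[OF t] unfolding has_def by blast
 thus ?thesis using ev_has_expr[OF t v] unfolding VB_has by(auto simp:vb_expr_def all_index split:if_splits) qed

lemma ev_walk_act:
 assumes t:"tabs s N V T" and b:"based T" and v:"ev e s < N" and h:"has i T (ev e s)" and p:"p:WX i"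
 shows "ev (walk e p) s = act i T (ev e s) (elt i p)" by(rule ev_walk[OF t v]) (use act_trav[OF b h p] in blast)

definition triples :: "state => nat => (expr \<times> expr \<times> nat \<times> expr) list => (nat \<times> nat \<times> nat) set" where
 "triples s N l = {(ev e (set_reg 6 v s),x,ev d (set_reg 6 v s))|v c e x d. v < N&(c,e,x,d):set l&ev c (set_reg 6 v s)~=0}"

lemma triples_append:"triples s N (l @ l') = triples s N l Un triples s N l'"
 unfolding triples_def by(simp only: set_append Un_iff) blast

definition arc_list :: "(expr \<times> expr \<times> nat \<times> expr) list" where
 "arc_list = map (%x. (arc_expr (Var 6) x,Var 6,idx x,Minus (arc_expr (Var 6) x) (Num 1))) ls"

lemma pure_6:"eregs e<={4,6}==>earrs e<={6}==>pure e" unfolding pure_def by auto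

lemma pure_arc_list:"pure_list arc_list"
proof -
 have "pure (arc_expr (Var 6) x)" "pure (Minus (arc_expr (Var 6) x) (Num 1))" "pure (Var 6)" for x
 using arc_expr_uses[of "Var 6" x] by(auto intro!: pure_6)
 thus ?thesis by(auto simp:pure_list_def arc_list_def) qed

lemma tabs_loop:"tabs s N V T==>tabs (set_reg 6 v s) N V T" by(erule tabs_cong) simp_all

lemma triples_arc_list:
 assumes t:"tabs s N V T" shows "triples s N arc_list = (%(u,x,w). (u,idx x,w)) ` T"
proof (intro equalityI subsetI)
 fix y assume "y:triples s N arc_list"
 then obtain v x where y:"v < N" "x:set ls" "ev (arc_expr (Var 6) x) (set_reg 6 v s)~=0"
 "y = (v,idx x,ev (arc_expr (Var 6) x) (set_reg 6 v s) - 1)" unfolding triples_def arc_list_def by auto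
 from y(3) obtain w where w:"ev (arc_expr (Var 6) x) (set_reg 6 v s) = Suc w" using not0_implies_Suc by blast
 hence "(v,x,w):T" using ev_arc_expr(1)[OF tabs_loop[OF t],of "Var 6" v x w] y(1,2) by simp
 thus "y:(%(u,x,w). (u,idx x,w)) ` T" using y(4) w by(intro image_eqI[of _ _ "(v,x,w)"]) simp_all
next
 fix y assume "y:(%(u,x,w). (u,idx x,w)) ` T"
 then obtain v x w where y:"y = (v,idx x,w)" "(v,x,w):T" by auto
 have v:"v < N" "x:set ls" using tabsD(4)[OF t y(2)] tabsD(1)[OF t] by blast+
 hence w:"ev (arc_expr (Var 6) x) (set_reg 6 v s) = Suc w" using ev_arc_expr(1)[OF tabs_loop[OF t],of "Var 6" v x w] y(2) by simp
 have "(arc_expr (Var 6) x,Var 6,idx x,Minus (arc_expr (Var 6) x) (Num 1)):set arc_list" using v(2) by(simp add:arc_list_def)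
 thus "y:triples s N arc_list" unfolding triples_def y(1) using v(1) w
 by(intro CollectI exI[of _ v] exI[of _ "arc_expr (Var 6) x"] exI[of _ "Var 6"] exI[of _ "idx x"] exI[of _ "Minus (arc_expr (Var 6) x) (Num 1)"]) simp
qed

lemma fold_okI:
 assumes "tset s<={..<N} \<times> {..<W} \<times> {..<N}" "reg s 5<=reg s 3" "W * N<=reg s 3" "0 < N"
 shows "fold_ok W N s"
proof -
 have "(arr s 7 e,arr s 8 e,arr s 9 e):{..<N} \<times> {..<W} \<times> {..<N}" if "e < reg s 5" for e
 using that assms(1) unfolding tset_def by blast
 thus ?thesis using assms len(2) unfolding fold_ok_def by simp qed

subsection \<open>Gluing the Cayley graphs\<close>

definition vid_expr :: "index => 'x word set => expr" where
 "vid_expr i g = Plus (eMul (sl i g) (Var 4)) (Var 6)"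

definition glue_list :: "(expr \<times> expr \<times> nat \<times> expr) list" where
 "glue_list = [(has_expr i (Var 6),vid_expr i g,idx x,vid_expr i (g \<odot>[i] elt i [x])).
 i \<leftarrow> [One,Two],g \<leftarrow> el i,x \<leftarrow> filter (%x. x:LX i) ls]"

definition glue_prog :: stmt where
 "glue_prog = build_prog (arc_list @ glue_list) ;; Assign 4 (eMul slots (Var 4)) ;; quot_prog ;; out_prog"

lemma glue_list:
 "p:set glue_list<->(EX i g x. g:FC i&x:LX i
 &p = (has_expr i (Var 6),vid_expr i g,idx x,vid_expr i (g \<odot>[i] elt i [x])))"
proof -
 have "p:set glue_list<->(EX i:{One,Two}. EX g:FC i. EX x:{x:set ls. x:LX i}.
 p = (has_expr i (Var 6),vid_expr i g,idx x,vid_expr i (g \<odot>[i] elt i [x])))"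
 unfolding glue_list_def by(simp add:el del: split_paired_Ex) blast
 also have "\<dots><->(EX i. EX g:FC i. EX x:{x:set ls. x:LX i}.
 p = (has_expr i (Var 6),vid_expr i g,idx x,vid_expr i (g \<odot>[i] elt i [x])))"
 proof -
 have "(UNIV :: index set) = {One,Two}" by(auto intro:index.exhaust)
 from this[symmetric] show ?thesis by(simp only: bex_UNIV) qed
 finally show ?thesis using xls by blast qed

lemma pure_append:"pure_list (l @ l')<->pure_list l&pure_list l'" unfolding pure_list_def set_append by(rule ball_Un)

lemma pure_glue_list:"pure_list glue_list"
proof -
 have "pure (has_expr i (Var 6))" "pure (vid_expr i g)" for i g
 using has_expr_uses[of i "Var 6"] by(auto intro!: pure_6 simp:vid_expr_def split:if_splits)
 thus ?thesis unfolding pure_list_def using glue_list by auto qed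

lemma triples_glue_list:
 assumes t:"tabs s N (lV Z) (tri Z)" and N:"reg s 4 = N"
 shows "triples s N (arc_list @ glue_list) = (%(u,x,w). (u,idx x,w)) ` glue_arcs Z N sl"
proof -
 have e:"ev (vid_expr i g) (set_reg 6 v s) = vid N sl v i g" for i g v by(simp add:vid_expr_def vid_def N)
 have h:"ev (has_expr i (Var 6)) (set_reg 6 v s)~=0<->has i (tri Z) v" if "v < N" for v i
 using ev_has_expr[OF tabs_loop[OF t],of "Var 6" v i] that by simp
 have hN:"v < N" if "has i (tri Z) v" for v i using that tabsD(1,4)[OF t] unfolding has_def by blast
 have "triples s N glue_list = {(vid N sl v i g,idx x,vid N sl v i (g \<odot>[i] elt i [x]))|v i g x.
 has i (tri Z) v&g:FC i&x:LX i}" (is "_ = ?R")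
 proof (intro equalityI subsetI)
 fix y assume "y:triples s N glue_list"
 then obtain v i g x where "v < N" "g:FC i" "x:LX i" "ev (has_expr i (Var 6)) (set_reg 6 v s)~=0"
 "y = (ev (vid_expr i g) (set_reg 6 v s),idx x,ev (vid_expr i (g \<odot>[i] elt i [x])) (set_reg 6 v s))"
 unfolding triples_def glue_list by blast
 thus "y:?R" unfolding e using h by blast
 next
 fix y assume "y:?R"
 then obtain v i g x where "y = (vid N sl v i g,idx x,vid N sl v i (g \<odot>[i] elt i [x]))"
 "has i (tri Z) v" "g:FC i" "x:LX i" by blast
 thus "y:triples s N glue_list" unfolding triples_def glue_list using h[OF hN] hN e[symmetric] by blast qed
 moreover have "(%(u,x,w). (u,idx x,w)) ` glue_arcs Z N sl = (%(u,x,w). (u,idx x,w)) ` tri Z Un ?R"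
 proof -
 have im:"(%(u,x,w). (u,idx x,w)) ` {(f v i g,x,h v i g x)|v i g x. P v i g x} = {(f v i g,idx x,h v i g x)|v i g x. P v i g x}"
 for f h and P :: "nat => index => 'x word set => 'x letter => bool"
 proof (intro equalityI subsetI)
 fix y assume "y:(%(u,x,w). (u,idx x,w)) ` {(f v i g,x,h v i g x)|v i g x. P v i g x}"
 then obtain v i g x where "y = (f v i g,idx x,h v i g x)" "P v i g x" by auto
 thus "y:{(f v i g,idx x,h v i g x)|v i g x. P v i g x}" by blast
 next
 fix y assume "y:{(f v i g,idx x,h v i g x)|v i g x. P v i g x}"
 then obtain v i g x where "y = (f v i g,idx x,h v i g x)" "P v i g x" by blast
 thus "y:(%(u,x,w). (u,idx x,w)) ` {(f v i g,x,h v i g x)|v i g x. P v i g x}"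
 by(intro image_eqI[of _ _ "(f v i g,x,h v i g x)"]) (simp,blast) qed
 show ?thesis unfolding glue_arcs_def image_Un im .. qed
 ultimately show ?thesis unfolding triples_append triples_arc_list[OF t] by simp qed

lemma inv_letter_elt:"g:FC i==>x:LX i
 ==>g \<odot>[i] elt i [x] \<odot>[i] elt i [inv_letter x] = g"
 by(simp add:elt_inv_letter group.inv_solve_right'[OF grp] m_cl)

lemma symm_glue:"lgraph_wf Z==>symm (glue_arcs Z N sl)" unfolding symm_def
proof (intro allI impI)
 fix u x w assume wf:"lgraph_wf Z" and a:"(u,x,w):glue_arcs Z N sl"
 show "(w,inv_letter x,u):glue_arcs Z N sl"
 proof (cases "(u,x,w):tri Z")
 case True
 thus ?thesis unfolding glue_arcs_def by(intro UnI1 triD(3)[OF wf])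
 next
 case False
 with a obtain v i g where v:"u = vid N sl v i g" "w = vid N sl v i (g \<odot>[i] elt i [x])" "has i (tri Z) v"
 "g:FC i" "x:LX i" unfolding glue_arcs_def by blast
 have "inv_letter x:LX i" using v(5) by simp
 moreover have "g \<odot>[i] elt i [x]:FC i" using v(4,5) by(simp add:m_cl)
 ultimately have "(vid N sl v i (g \<odot>[i] elt i [x]),inv_letter x,vid N sl v i (g \<odot>[i] elt i [x] \<odot>[i] elt i [inv_letter x]))
 :glue_arcs Z N sl" using v(3) unfolding glue_arcs_def by blast
 thus ?thesis unfolding inv_letter_elt[OF v(4,5)] v(1,2) . qed qed

lemma inj_idx:"inj_on idx (set ls)" by(rule inj_onI) (metis idx(2))

theorem run_glue_prog:
 assumes g:"good s N Z v" and B:"W * (slots * N)<=reg s 3" "N * length (arc_list @ glue_list)<=reg s 3"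
 defines "t == run glue_prog s" shows "EX Z' v'. good t (slots * N) Z' v'&step3 (Z,v) (Z',v')&based (tri Z')"
proof -
 note D = goodD[OF g]
 let ?N = "slots * N"
 define s1 where "s1 = run (build_prog (arc_list @ glue_list)) s"
 define s2 where "s2 = set_reg 4 ?N s1"
 define s3 where "s3 = run quot_prog s2"
 let ?E = "glue_arcs Z N sl" and ?V = "glue_verts Z N sl"
 have fr:"reg s1 r = reg s r" if "r ~: {5,6,20}" for r unfolding s1_def
 using build_frame(1)[of "arc_list @ glue_list"] that by(intro frame_reg) blast
 have fa:"arr s1 b = arr s b" if "b ~: {7,8,9}" for b unfolding s1_def
 using build_frame(2)[of "arc_list @ glue_list"] that by(intro frame_arr) blast
 have f1:"reg s1 0 = v" "reg s1 3 = reg s 3" "reg s1 4 = N" "arr s1 5 = arr s 5" using fr[of 0] fr[of 3] fr[of 4] fa[of 5] D(4,8) by simp_all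
 have run:"t = run out_prog s3" unfolding t_def glue_prog_def s3_def s2_def s1_def using f1(3) by(simp add:s1_def)
 have pl:"pure_list (arc_list @ glue_list)" using pure_arc_list pure_glue_list by(simp add:pure_append)
 have ts1:"tset s1 = (%(u,x,w). (u,idx x,w)) ` ?E" "reg s1 5<=reg s 3"
 using run_build_prog[OF pl D(4,12)] triples_glue_list[OF D(3,4)] B(2) unfolding s1_def triples_def by simp_all
 have ts:"tset s2 = (%(u,x,w). (u,idx x,w)) ` ?E" unfolding s2_def ts1(1)[symmetric] by(simp add:tset_def)
 have N0:"0 < ?N" "N<=?N" using slots_pos D(11) by simp_all
 have NN:"{..<N}<={..<?N}" using N0(2) by(simp only: lessThan_subset_iff)
 have vidN:"vid N sl u i h < ?N" if "h:FC i" "u < N" for u i h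
 using key_less[OF sl_less[OF that(1)] that(2),where B = "N * slots"] by(simp add:vid_def mult.commute)
 have hN:"u < N" if "has i (tri Z) u" for u i using that D(9) triD(1)[OF D(5)] unfolding has_def by blast
 have VN:"?V<={..<?N}"
 proof
 fix u assume "u:?V"
 then consider "u:lV Z"|z i h where "u = vid N sl z i h" "has i (tri Z) z" "h:FC i" unfolding glue_verts_def by blast
 thus "u:{..<?N}"
 proof cases
 case 1
 show ?thesis by(rule subsetD[OF order_trans[OF D(9) NN] 1])
 next
 case 2
 thus ?thesis using vidN[OF 2(3) hN[OF 2(2)]] by simp qed qed
 have labs:"x:letters XX" if "(u,x,w):tri Z" for u x w using tabsD(4)[OF D(3) that] ls by simp
 note sls = sl_one sl_pos sl_inj
 note ctx = D(5,6,9) labs sls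
 have Ev:"u:?V&w:?V" if "(u,x,w):?E" for u x w by(rule glue_arcs_verts[OF D(5,6,9) labs sls that])
 have El:"x:set ls" if "(u,x,w):?E" for u x w using that labs ls xls unfolding glue_arcs_def by blast
 have ok:"fold_ok W ?N s2"
 proof (rule fold_okI)
 show "tset s2<={..<?N} \<times> {..<W} \<times> {..<?N}"
 proof
 fix y assume "y:tset s2"
 then obtain u x w where y:"y = (u,idx x,w)" "(u,x,w):?E" unfolding ts by auto
 have "u < ?N" "w < ?N" using Ev[OF y(2)] VN by blast+
 moreover have "idx x < W" using idx(1)[OF El[OF y(2)]] len(1) by simp
 ultimately show "y:{..<?N} \<times> {..<W} \<times> {..<?N}" unfolding y(1) by simp qed
 qed (use ts1(2) B(1) N0 f1 in "simp_all add:s2_def")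
 have V0:"lV Z<={..<?N}" using D(9) NN by(rule order_trans)
 have al:"arr s2 5 j~=0<->j:lV Z" if "j < reg s2 3" for j
 using tabsD(3)[OF D(3),of j] that unfolding s2_def by(simp add:f1)
 have inj:"inj_on idx {x. EX u w. (u,x,w):?E}" by(rule inj_on_subset[OF inj_idx]) (use El in blast)
 obtain L where L:"ALL j<?N. ALL k<?N. L j = L k<->lfc ?E j k" "fold_cong ?E L"
 "tabs s3 ?N (L ` (lV Z Un {u. EX x w. (u,x,w):?E} Un {w. EX u x. (u,x,w):?E}))
 {(L u,ls ! idx x,L w)|u x w. (u,x,w):?E&idx x < K}" "reg s3 0 = L (reg s2 0)"
 using run_quot_key[OF ok V0 al ts inj] unfolding s3_def by blast
 have "lV Z Un {u. EX x w. (u,x,w):?E} Un {w. EX u x. (u,x,w):?E} = ?V"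
 proof (intro equalityI subsetI)
 fix u assume "u:lV Z Un {u. EX x w. (u,x,w):?E} Un {w. EX u x. (u,x,w):?E}"
 thus "u:?V" using Ev unfolding glue_verts_def by blast
 next
 fix u assume "u:?V"
 then consider "u:lV Z"|z i h where "u = vid N sl z i h" "has i (tri Z) z" "h:FC i" unfolding glue_verts_def by blast
 thus "u:lV Z Un {u. EX x w. (u,x,w):?E} Un {w. EX u x. (u,x,w):?E}"
 proof cases
 case 2
 from 2(2) obtain x where "x:LX i" unfolding has_def by blast
 with 2 show ?thesis unfolding glue_arcs_def by blast qed blast qed
 with L(3) decode[OF El,where L = L] have tb:"tabs s3 ?N (L ` ?V) (tmap L ` ?E)" by simp
 have v3:"reg s3 0 = L v" "v:?V" using L(4) f1(1) D(7) by(simp_all add:s2_def glue_verts_def)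
 obtain Z' where G:"represents code t (Z',L v)" "lgraph_wf Z'" "folded Z'" "lV Z' = L ` ?V" "tri Z' = tmap L ` ?E"
 using run_out_prog[OF tb det_quotient[OF L(2)] symm_quotient[OF symm_glue[OF D(5)]]] imageI[OF v3(2),of L] unfolding v3(1) run by blast
 have Lc:"L u = L w<->lfc ?E u w" if "u:?V" "w:?V" for u w using L(1) VN that by blast
 have "step3 (Z,v) (Z',L v)" by(rule step3_glue[OF ctx Lc G(2-5) D(7)])
 moreover have "based (tri Z')" by(rule glue_based[OF ctx Lc G(2-5)])
 moreover have "tabs t ?N (lV Z') (tri Z')" unfolding G(4,5) run by(rule tabs_cong[OF tb]) (simp_all add:frame_reg frame_arr)
 moreover have "reg t 4 = ?N" unfolding run s3_def by(simp add:frame_reg s2_def)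
 ultimately show ?thesis using G unfolding good_def by blast qed

subsection \<open>Identifying the ends of equal walks\<close>

definition pair_arcs :: "(expr \<times> expr \<times> nat \<times> expr) list" where
 "pair_arcs = concat (map (%k. [(vb_expr (Var 6),Var 6,K+k,walk (Var 6) (fst (prs ! k))),
 (vb_expr (Var 6),Var 6,K+k,walk (Var 6) (snd (prs ! k)))]) [0..<length prs])"

definition pair_prog :: stmt where
 "pair_prog = build_prog (arc_list @ pair_arcs) ;; quot_prog ;; out_prog"

definition pair_key :: "'x letter+nat => nat" where
 "pair_key = case_sum idx (%k. K+k)"

lemma pure_pair_arcs:"pure_list pair_arcs"
proof -
 have "pure (vb_expr (Var 6))" "pure (walk (Var 6) p)" "pure (Var 6)" for p
 using vb_expr_uses[of "Var 6"] walk_uses[of "Var 6" p] by(auto intro!: pure_6)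
 thus ?thesis unfolding pure_list_def pair_arcs_def by auto qed

lemma triples_pair_arcs:
 assumes t:"tabs s N (lV Z) (tri Z)" and b:"based (tri Z)"
 shows "triples s N (arc_list @ pair_arcs) = (%(u,x,w). (u,pair_key x,w)) ` amalgam_arcs prs Z"
proof -
 have vb:"ev (vb_expr (Var 6)) (set_reg 6 v s)~=0<->v:VB Z" if "v < N" for v
 using ev_vb_expr[OF tabs_loop[OF t],of "Var 6" v] that by simp
 have vN:"v < N" if "v:VB Z" for v using that tabsD(1)[OF t] unfolding VB_def by blast
 have w1:"ev (walk (Var 6) (fst (prs ! k))) (set_reg 6 v s) = act One (tri Z) v (elt One (fst (prs ! k)))"
 "ev (walk (Var 6) (snd (prs ! k))) (set_reg 6 v s) = act Two (tri Z) v (elt Two (snd (prs ! k)))"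
 if "v:VB Z" "k < length prs" for v k
 using ev_walk_act[OF tabs_loop[OF t] b,of "Var 6" v] vN[OF that(1)] that(1) A_wd[OF pair_listD(1)[OF prs that(2)]]
 A_wd[OF pair_listD(2)[OF prs that(2)]] unfolding VB_has by simp_all
 have p:"p:set pair_arcs<->(EX k<length prs. p = (vb_expr (Var 6),Var 6,K+k,walk (Var 6) (fst (prs ! k)))
 |p = (vb_expr (Var 6),Var 6,K+k,walk (Var 6) (snd (prs ! k))))" for p unfolding pair_arcs_def by auto
 have "triples s N pair_arcs = {(v,K+k,act One (tri Z) v (elt One (fst (prs ! k))))|v k. v:VB Z&k < length prs}
 Un {(v,K+k,act Two (tri Z) v (elt Two (snd (prs ! k))))|v k. v:VB Z&k < length prs}" (is "_ = ?R1 Un ?R2")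
 proof (intro equalityI subsetI)
 fix y assume "y:triples s N pair_arcs"
 then obtain v c e x d where y:"v < N" "(c,e,x,d):set pair_arcs" "ev c (set_reg 6 v s)~=0" "y = (ev e (set_reg 6 v s),x,ev d (set_reg 6 v s))"
 unfolding triples_def by blast
 from y(2)[unfolded p] obtain k where k:"k < length prs" "c = vb_expr (Var 6)" "e = Var 6" "x = K+k"
 "d = walk (Var 6) (fst (prs ! k))|d = walk (Var 6) (snd (prs ! k))" by auto
 hence v:"v:VB Z" using vb y(1,3) by blast
 have "y = (v,K+k,ev d (set_reg 6 v s))" using y(4) k(3,4) by simp
 with k(5) w1[OF v k(1)] v k(1) show "y:?R1 Un ?R2" by blast
 next
 fix y assume "y:?R1 Un ?R2"
 then obtain v k d where k:"v:VB Z" "k < length prs" "d = walk (Var 6) (fst (prs ! k))|d = walk (Var 6) (snd (prs ! k))"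
 "y = (v,K+k,ev d (set_reg 6 v s))"
 proof (elim UnE)
 assume "y:?R1"
 then obtain v k where "v:VB Z" "k < length prs" "y = (v,K+k,act One (tri Z) v (elt One (fst (prs ! k))))" by blast
 with w1(1)[OF this(1,2)] show thesis by(intro that[of v k "walk (Var 6) (fst (prs ! k))"]) simp_all
 next
 assume "y:?R2"
 then obtain v k where "v:VB Z" "k < length prs" "y = (v,K+k,act Two (tri Z) v (elt Two (snd (prs ! k))))" by blast
 with w1(2)[OF this(1,2)] show thesis by(intro that[of v k "walk (Var 6) (snd (prs ! k))"]) simp_all qed
 have "(vb_expr (Var 6),Var 6,K+k,d):set pair_arcs" unfolding p using k(2,3) by blast
 thus "y:triples s N pair_arcs" unfolding triples_def using vN[OF k(1)] vb k(1,4)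
 by(intro CollectI exI[of _ v] exI[of _ "vb_expr (Var 6)"] exI[of _ "Var 6"] exI[of _ "K+k"] exI[of _ d]) simp qed
 moreover have "(%(u,x,w). (u,pair_key x,w)) ` amalgam_arcs prs Z = (%(u,x,w). (u,idx x,w)) ` tri Z Un (?R1 Un ?R2)"
 unfolding amalgam_arcs_def image_Un Un_assoc by(intro arg_cong2[of _ _ _ _ "(Un)"]) (force simp:pair_key_def)+
 ultimately show ?thesis unfolding triples_append triples_arc_list[OF t] by simp qed

theorem run_pair_prog:
 assumes g:"good s N Z v" and b:"based (tri Z)" and B:"N * length (arc_list @ pair_arcs)<=reg s 3"
 defines "t == run pair_prog s" shows "EX Z' v'. good t N Z' v'&step4 (Z,v) (Z',v')&based (tri Z')"
proof -
 note D = goodD[OF g]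
 define s1 where "s1 = run (build_prog (arc_list @ pair_arcs)) s"
 define s3 where "s3 = run quot_prog s1"
 let ?E = "amalgam_arcs prs Z" and ?V = "lV Z"
 have fr:"reg s1 r = reg s r" if "r ~: {5,6,20}" for r unfolding s1_def
 using build_frame(1)[of "arc_list @ pair_arcs"] that by(intro frame_reg) blast
 have fa:"arr s1 b = arr s b" if "b ~: {7,8,9}" for b unfolding s1_def
 using build_frame(2)[of "arc_list @ pair_arcs"] that by(intro frame_arr) blast
 have f1:"reg s1 0 = v" "reg s1 3 = reg s 3" "reg s1 4 = N" "arr s1 5 = arr s 5" using fr[of 0] fr[of 3] fr[of 4] fa[of 5] D(4,8) by simp_all
 have run:"t = run out_prog s3" unfolding t_def pair_prog_def s3_def s1_def by simp
 have pl:"pure_list (arc_list @ pair_arcs)" using pure_arc_list pure_pair_arcs by(simp add:pure_append)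
 have ts:"tset s1 = (%(u,x,w). (u,pair_key x,w)) ` ?E" "reg s1 5<=reg s 3"
 using run_build_prog[OF pl D(4,12)] triples_pair_arcs[OF D(3) b] B unfolding s1_def triples_def by simp_all
 have labs:"x:set ls" if "(u,x,w):tri Z" for u x w using tabsD(4)[OF D(3) that] by simp
 have cases:"(u:?V&w:?V)&((EX y:set ls. x = Inl y&(u,y,w):tri Z)|(EX k<length prs. x = Inr k))" if "(u,x,w):?E" for u x w
 proof -
 from that consider y where "x = Inl y" "(u,y,w):tri Z"
 |k where "x = Inr k" "u:VB Z" "k < length prs" "w = act One (tri Z) u (elt One (fst (prs ! k)))"
 |k where "x = Inr k" "u:VB Z" "k < length prs" "w = act Two (tri Z) u (elt Two (snd (prs ! k)))"
 unfolding amalgam_arcs_def by blast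
 thus ?thesis
 proof cases
 case 1
 thus ?thesis using triD(1,2)[OF D(5)] labs by blast
 next
 case 2
 have h:"u:?V" "has One (tri Z) u" using 2(2) by(simp_all add:VB_has)
 have "w:?V" unfolding 2(4) by(rule act_V[OF D(5) b h(2) elt_closed[OF A_wd[OF pair_listD(1)[OF prs 2(3)]]]])
 with 2 h show ?thesis by blast
 next
 case 3
 have h:"u:?V" "has Two (tri Z) u" using 3(2) by(simp_all add:VB_has)
 have "w:?V" unfolding 3(4) by(rule act_V[OF D(5) b h(2) elt_closed[OF A_wd[OF pair_listD(2)[OF prs 3(3)]]]])
 with 3 h show ?thesis by blast qed qed
 have key:"pair_key (Inl x) = idx x" "pair_key (Inr k) = K+k" for x k by(simp_all add:pair_key_def)
 have ok:"fold_ok W N s1"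
 proof (rule fold_okI)
 show "tset s1<={..<N} \<times> {..<W} \<times> {..<N}"
 proof
 fix y assume "y:tset s1"
 then obtain u x w where y:"y = (u,pair_key x,w)" "(u,x,w):?E" unfolding ts by auto
 have "u < N" "w < N" using cases[OF y(2)] D(9) by blast+
 moreover have "pair_key x < W" using cases[OF y(2)] idx(1) len(1) W_prs by(fastforce simp:key)
 ultimately show "y:{..<N} \<times> {..<W} \<times> {..<N}" unfolding y(1) by simp qed
 qed (use ts(2) tabsD(2)[OF D(3)] D(11) f1 in simp_all)
 have al:"arr s1 5 j~=0<->j:?V" if "j < reg s1 3" for j using tabsD(3)[OF D(3),of j] that by(simp add:f1)
 have inj:"inj_on pair_key {x. EX u w. (u,x,w):?E}"
 proof (rule inj_onI)
 fix x y assume xy:"x:{x. EX u w. (u,x,w):?E}" "y:{x. EX u w. (u,x,w):?E}" "pair_key x = pair_key y"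
 have c:"(EX z:set ls. x' = Inl z)|(EX k. x' = Inr k)" if "x':{x. EX u w. (u,x,w):?E}" for x' using that cases by blast
 from c[OF xy(1)] c[OF xy(2)] xy(3) idx(1) inj_onD[OF inj_idx] show "x = y" by(auto simp:key) (metis not_add_less1)+
 qed
 obtain L where L:"ALL j<N. ALL k<N. L j = L k<->lfc ?E j k" "fold_cong ?E L"
 "tabs s3 N (L ` (?V Un {u. EX x w. (u,x,w):?E} Un {w. EX u x. (u,x,w):?E}))
 {(L u,ls ! pair_key x,L w)|u x w. (u,x,w):?E&pair_key x < K}" "reg s3 0 = L (reg s1 0)"
 using run_quot_key[OF ok D(9) al ts(1) inj] unfolding s3_def by blast
 have "?V Un {u. EX x w. (u,x,w):?E} Un {w. EX u x. (u,x,w):?E} = ?V" using cases by blast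
 moreover have "{(L u,ls ! pair_key x,L w)|u x w. (u,x,w):?E&pair_key x < K}
 = {(L u,ls ! idx x,L w)|u x w. (u,x,w):tri Z&idx x < K}" (is "?P = ?Q")
 proof (intro equalityI subsetI)
 fix y assume "y:?P"
 then obtain u x w where y:"y = (L u,ls ! pair_key x,L w)" "(u,x,w):?E" "pair_key x < K" by blast
 from cases[OF y(2)] y(3) obtain z where "x = Inl z" "(u,z,w):tri Z" by(auto simp:key)
 moreover from this have "y = (L u,ls ! idx z,L w)" "idx z < K" using y(1,3) by(simp_all add:key)
 ultimately show "y:?Q" by blast
 next
 fix y assume "y:?Q"
 then obtain u x w where y:"y = (L u,ls ! idx x,L w)" "(u,x,w):tri Z" "idx x < K" by blast
 hence "(u,Inl x,w):?E" unfolding amalgam_arcs_def by blast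
 with y(1,3) show "y:?P" unfolding key(1)[symmetric] by blast qed
 ultimately have tb:"tabs s3 N (L ` ?V) (tmap L ` tri Z)" using L(3) decode[OF labs,where L = L] by simp
 have fc:"fold_cong (tri Z) L"
 proof (rule fold_congI)
 fix u x w u' w' assume "(u,x,w):tri Z" "(u',x,w'):tri Z" "L u = L u'"
 moreover from this have "(u,Inl x,w):?E" "(u',Inl x,w'):?E" unfolding amalgam_arcs_def by blast+
 ultimately show "L w = L w'" using fold_congD[OF L(2)] by blast qed
 have v3:"reg s3 0 = L v" using L(4) f1(1) by simp
 obtain Z' where G:"represents code t (Z',L v)" "lgraph_wf Z'" "folded Z'" "lV Z' = L ` ?V" "tri Z' = tmap L ` tri Z"
 using run_out_prog[OF tb det_quotient[OF fc] symm_quotient[OF symm_tri[OF D(5)]]] imageI[OF D(7),of L] unfolding v3 run by blast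
 have Lc:"L u = L w<->lfc ?E u w" if "u:?V" "w:?V" for u w using L(1) D(9) that by blast
 have "step4 (Z,v) (Z',L v)" by(rule step4_amalgam(1)[OF D(5,6,10) b prs Lc G(2-5) D(7)])
 moreover have "based (tri Z')" by(rule step4_amalgam(2)[OF D(5,6,10) b prs Lc G(2-5) D(7)])
 moreover have "tabs t N (lV Z') (tri Z')" unfolding G(4,5) run by(rule tabs_cong[OF tb]) (simp_all add:frame_reg frame_arr)
 moreover have "reg t 4 = N" unfolding run s3_def using f1 by(simp add:frame_reg)
 ultimately show ?thesis using G unfolding good_def by blast qed

lemma frugal_build:
 assumes "!!c e x d. (c,e,x,d):set l==>eregs c<={4,6}&eregs e<={4,6}&eregs d<={4,6}" shows "frugal (build_prog l)"
proof -
 have *: "uregs (app_triple p)<={..<40}&depth (app_triple p) = 0" if p:"p:set l" for p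
 proof -
 obtain c e x d where "p = (c,e,x,d)" by(rule prod_cases4)
 with assms[of c e x d] p show ?thesis by(auto simp:app_triple_def) qed
 have "(\<Union>p\<in>set l. uregs (app_triple p))<={..<40}" using * by blast
 moreover have "depth (seqs (map app_triple l))<=0" by(rule seqs_depth) (use * in auto)
 ultimately show ?thesis by(auto simp:frugal_def build_prog_def) qed

lemma frugal_glue:"frugal glue_prog" and frugal_pair:"frugal pair_prog"
proof -
 have a:"eregs (arc_expr (Var 6) x)<={4,6}" "eregs (has_expr i (Var 6))<={4,6}" "eregs (vb_expr (Var 6))<={4,6}" "eregs (walk (Var 6) p)<={4,6}"
 "eregs (vid_expr i h)<={4,6}" for x i p h
 using arc_expr_uses(1)[of "Var 6" x] has_expr_uses(1)[of i "Var 6"] vb_expr_uses(1)[of "Var 6"] walk_uses(1)[of "Var 6" p]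
 by(auto simp:vid_expr_def split:if_splits)
 have l:"eregs c<={4,6}&eregs e<={4,6}&eregs d<={4,6}"
 if "(c,e,x,d):set arc_list|(c,e,x,d):set glue_list|(c,e,x,d):set pair_arcs" for c e x d using that
 proof (elim disjE)
 assume "(c,e,x,d):set arc_list"
 then obtain y where "c = arc_expr (Var 6) y" "e = Var 6" "d = Minus (arc_expr (Var 6) y) (Num 1)" by(auto simp:arc_list_def)
 thus ?thesis using a(1)[of y] by simp
 next
 assume "(c,e,x,d):set glue_list"
 then obtain i g g' where "c = has_expr i (Var 6)" "e = vid_expr i g" "d = vid_expr i g'" unfolding glue_list by blast
 thus ?thesis using a(2,5) by simp
 next
 assume "(c,e,x,d):set pair_arcs"
 then obtain p where "c = vb_expr (Var 6)" "e = Var 6" "d = walk (Var 6) p" by(auto simp:pair_arcs_def)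
 thus ?thesis using a(3) a(4)[of p] by simp qed
 have "frugal (build_prog (arc_list @ glue_list))" by(rule frugal_build) (use l in "simp only: set_append Un_iff,blast")
 moreover have "frugal (build_prog (arc_list @ pair_arcs))" by(rule frugal_build) (use l in "simp only: set_append Un_iff,blast")
 moreover have "frugal (Assign 4 (eMul slots (Var 4)))" by(simp add:frugal_def)
 ultimately show "frugal glue_prog" "frugal pair_prog" by(simp_all add:glue_prog_def pair_prog_def frugal_quot frugal_out)
qed

end

section \<open>The program for the fifth step\<close>

definition put :: "nat => nat => nat => (nat => expr) => stmt" where
 "put b r n E = seqs (map (%k. Write b (Plus (Var r) (Num k)) (E k)) [0..<n])"

lemma run_seqs:"run (seqs cs) s = set_reg 20 0 (fold run cs s)" by(induction cs arbitrary: s) simp_all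

lemma put_frame [simp]:"wregs (put b r n E) = {20}" "warrs (put b r n E)<={b}" by(auto simp:put_def)

lemma run_put:
 assumes "!!k. k < n==>b ~: earrs (E k)" "r~=20"
 shows "arr (run (put b r n E) s) b q = (if reg s r<=q&q < reg s r+n then ev (E (q - reg s r)) s else arr s b q)"
 "c~=b==>arr (run (put b r n E) s) c = arr s c" "j~=20==>reg (run (put b r n E) s) j = reg s j"
proof -
 let ?f = "%m. fold run (map (%k. Write b (Plus (Var r) (Num k)) (E k)) [0..<m]) s"
 have *: "m<=n==>reg (?f m) = reg s&(ALL c. c~=b-->arr (?f m) c = arr s c)
 &(ALL q. arr (?f m) b q = (if reg s r<=q&q < reg s r+m then ev (E (q - reg s r)) s else arr s b q))" for m
 proof (induction m)
 case (Suc m)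
 hence IH:"reg (?f m) = reg s" "!!c. c~=b==>arr (?f m) c = arr s c"
 "!!q. arr (?f m) b q = (if reg s r<=q&q < reg s r+m then ev (E (q - reg s r)) s else arr s b q)" by simp_all
 have "ev (E m) (?f m) = ev (E m) s"
 proof (rule ev_cong)
 fix c assume "c:earrs (E m)"
 hence "c~=b" using assms(1)[of m] Suc.prems by auto
 thus "arr (?f m) c = arr s c" by(rule IH(2)) qed (simp add:IH(1))
 thus ?case using IH by(auto simp:less_Suc_eq) qed simp
 have r:"run (put b r n E) s = set_reg 20 0 (?f n)" unfolding put_def by(rule run_seqs)
 show "arr (run (put b r n E) s) b q = (if reg s r<=q&q < reg s r+n then ev (E (q - reg s r)) s else arr s b q)"
 "c~=b==>arr (run (put b r n E) s) c = arr s c" "j~=20==>reg (run (put b r n E) s) j = reg s j"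
 using *[OF order_refl] unfolding r by simp_all qed

definition clear :: "nat => (expr \<times> expr) list => stmt" where
 "clear b l = seqs (map (%(c,a). Cond c (Write b a (Num 0)) skip) l)"

lemma run_clear:
 assumes "!!c a. (c,a):set l==>b ~: earrs c Un earrs a&20 ~: eregs c Un eregs a"
 shows "arr (run (clear b l) s) b q = (if EX (c,a):set l. ev c s~=0&ev a s = q then 0 else arr s b q)"
 "d~=b==>arr (run (clear b l) s) d = arr s d" "j~=20==>reg (run (clear b l) s) j = reg s j"
proof -
 have "arr (run (clear b l) s) b q = (if EX (c,a):set l. ev c s~=0&ev a s = q then 0 else arr s b q)
 &(ALL d. d~=b-->arr (run (clear b l) s) d = arr s d)&(ALL j. j~=20-->reg (run (clear b l) s) j = reg s j)"
 using assms
 proof (induction l arbitrary: s)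
 case (Cons p l)
 obtain c a where p:"p = (c,a)" by(cases p)
 let ?s = "run (Cond c (Write b a (Num 0)) skip) s"
 have fr:"!!d. d~=b==>arr ?s d = arr s d" "!!j. j~=20==>reg ?s j = reg s j" by auto
 have same:"ev c' ?s = ev c' s&ev a' ?s = ev a' s" if "(c',a'):set l" for c' a'
 proof -
 have "b ~: earrs c' Un earrs a'&20 ~: eregs c' Un eregs a'" by(rule Cons.prems) (simp add:that)
 thus ?thesis by(intro conjI ev_cong fr) auto qed
 let ?Q = "EX (c,a):set l. ev c s~=0&ev a s = q"
 have e1:"(EX (c,a):set l. ev c ?s~=0&ev a ?s = q)<->?Q" by(rule bex_cong[OF HOL.refl]) (use same in auto)
 have e2:"run (clear b (p # l)) s = run (clear b l) ?s" by(simp add:clear_def p)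
 have e3:"(EX (c,a):set (p # l). ev c s~=0&ev a s = q)<->(ev c s~=0&ev a s = q)|?Q" by(simp add:p)
 have e4:"arr ?s b q = (if ev c s~=0&ev a s = q then 0 else arr s b q)" by auto
 have IH:"arr (run (clear b l) ?s) b q = (if ?Q then 0 else (if ev c s~=0&ev a s = q then 0 else arr s b q))"
 "ALL d. d~=b-->arr (run (clear b l) ?s) d = arr ?s d" "ALL j. j~=20-->reg (run (clear b l) ?s) j = reg ?s j"
 using Cons.IH[of ?s,OF Cons.prems[OF list.set_intros(2)]] unfolding e1 e4 by blast+
 show ?case unfolding e2 e3
 proof (intro conjI allI impI)
 show "arr (run (clear b l) ?s) b q = (if (ev c s~=0&ev a s = q)|?Q then 0 else arr s b q)"
 unfolding IH(1) by(cases "ev c s~=0&ev a s = q") (simp_all only: if_cancel if_True if_False simp_thms)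
 next
 fix d assume d:"d~=b"
 hence "arr (run (clear b l) ?s) d = arr ?s d" using IH(2) by blast
 also have "\<dots> = arr s d" by(rule fr(1)[OF d])
 finally show "arr (run (clear b l) ?s) d = arr s d" .
 next
 fix j :: nat assume j:"j~=20"
 hence "reg (run (clear b l) ?s) j = reg ?s j" using IH(3) by blast
 also have "\<dots> = reg s j" by(rule fr(2)[OF j])
 finally show "reg (run (clear b l) ?s) j = reg s j" . qed qed (simp add:clear_def)
 thus "arr (run (clear b l) s) b q = (if EX (c,a):set l. ev c s~=0&ev a s = q then 0 else arr s b q)"
 "d~=b==>arr (run (clear b l) s) d = arr s d" "j~=20==>reg (run (clear b l) s) j = reg s j" by blast+ qed

context amalgam_progs
begin

abbreviation wk :: "index => 'x word set => expr => expr" where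
 "wk i g e == walk e (wd i g)"

lemma ev_wk:
 assumes "tabs s N V T" "based T" "ev e s < N" "has i T (ev e s)" "g:FC i"
 shows "ev (wk i g e) s = act i T (ev e s) g"
 using ev_walk_act[OF assms(1-4) wd(1)[OF assms(5)]] wd(2)[OF assms(5)] by simp

definition free_expr :: "index => 'x word set set => expr => expr" where
 "free_expr i S e = tAll (map (%g. tNot (tEq (wk i g e) e)) (filter (%g. g:S) (el i)))"

lemma ev_free_expr:
 assumes t:"tabs s N V T" and b:"based T" and v:"ev e s < N" and h:"has i T (ev e s)"
 shows "ev (free_expr i S e) s~=0<->stab T i (ev e s) Int S = {}"
proof -
 have w:"ev (wk i g e) s = act i T (ev e s) g" if "g:FC i" for g using ev_wk[OF t b v h that] .
 have "ev (free_expr i S e) s~=0<->(ALL g:set (el i). g:S-->ev (wk i g e) s~=ev e s)" by(auto simp:free_expr_def)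
 thus ?thesis unfolding el stab_def[OF b] using w by auto qed

text \<open>A basepoint in the component has edges of colour \<open>i\<close>, so it belongs to \<open>VM
 i\<close> unless it is bichromatic.\<close>
definition rem_expr :: "index => expr" where
 "rem_expr i = tAll [tLess (Var 7) (Var 4),vb_expr (Var 7),free_expr i (- (\<phi> i ` carrier A)) (Var 7),
 tEq (eSum (map (%g. vb_expr (wk i g (Var 7))) (el i))) (Num (card (carrier A))),
 Plus (tAll (map (%g. tNot (tEq (wk i g (Var 7)) (Var 0))) (el i)))
 (tAll [free_expr i (- {\<one>[i]}) (Var 7),vb_expr (Var 0)])]"

lemma vb_expr_01:"ev (vb_expr e) s = (if ev (vb_expr e) s~=0 then 1 else 0)" by(simp add:vb_expr_def)

lemma ev_removal_expr:
 assumes t:"tabs s N (lV H) (tri H)" and wf:"lgraph_wf H" and b:"based (tri H)" and v0:"reg s 0 = v0" "v0:lV H"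
 and r:"reg s 4 = N" "reg s 7 = p0" shows "ev (rem_expr i) s~=0<->rem_cond H v0 i p0"
proof (cases "p0:VB H")
 case False
 have "~ (p0 < N&ev (vb_expr (Var 7)) s~=0)" using ev_vb_expr[OF t,of "Var 7"] False r by auto
 hence "ev (rem_expr i) s = 0" using r by(auto simp:rem_expr_def)
 with False show ?thesis by(simp add:rem_cond_def)
next
 case True
 hence p0: "p0 < N" "has i (tri H) p0" using tabsD(1)[OF t] unfolding VB_has by auto
 let ?C = "FC i" and ?a = "act i (tri H) p0" and ?S = "stab (tri H) i p0"
 have aN:"?a g < N" if "g:?C" for g using act_V[OF wf b p0(2) that] tabsD(1)[OF t] by auto
 have w:"ev (wk i g (Var 7)) s = ?a g" if "g:?C" for g using ev_wk[OF t b,of "Var 7" i g] p0 that r by simp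
 have 1:"ev (vb_expr (Var 7)) s~=0" using ev_vb_expr[OF t,of "Var 7"] True r p0 by simp
 have 2:"ev (free_expr i S (Var 7)) s~=0<->?S Int S = {}" for S using ev_free_expr[OF t b,of "Var 7" i S] p0 r by simp
 have "(\<Sum>g\<leftarrow>el i. ev (vb_expr (wk i g (Var 7))) s) = (\<Sum>g\<in>?C. if ?a g:VB H then 1 else 0)"
 proof -
 have "ev (vb_expr (wk i g (Var 7))) s = (if ?a g:VB H then 1 else 0)" if "g:?C" for g
 using ev_vb_expr[OF t,of "wk i g (Var 7)"] w[OF that] aN[OF that] vb_expr_01[of "wk i g (Var 7)" s] by(cases "?a g:VB H") simp_all
 moreover have "(\<Sum>g\<leftarrow>el i. ev (vb_expr (wk i g (Var 7))) s) = (\<Sum>g\<in>?C. ev (vb_expr (wk i g (Var 7))) s)"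
 using sum_list_distinct_conv_sum_set[OF el(2)] el(1) by metis
 ultimately show ?thesis by simp qed
 also have "\<dots> = card {g:?C. ?a g:VB H}"
 using sum.inter_filter[OF fin_car[of i],of "%_. 1 :: nat" "%g. ?a g:VB H"] by simp
 finally have 3:"ev (eSum (map (%g. vb_expr (wk i g (Var 7))) (el i))) s = card {g:?C. ?a g:VB H}" by(simp add:o_def)
 have comp:"comp_V i H p0 = ?a ` ?C" by(rule comp_V_act[OF wf b p0(2)])
 have 4:"(ALL g:set (el i). ev (tNot (tEq (wk i g (Var 7)) (Var 0))) s~=0)<->v0 ~: comp_V i H p0"
 proof -
 have "(ALL g:set (el i). ev (tNot (tEq (wk i g (Var 7)) (Var 0))) s~=0)<->(ALL g:?C. ?a g~=v0)"
 unfolding el by(rule ball_cong[OF HOL.refl]) (use w v0 in simp)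
 thus ?thesis unfolding comp by blast qed
 have 5:"ev (vb_expr (Var 0)) s~=0<->v0:VB H" using ev_vb_expr[OF t,of "Var 0"] v0 tabsD(1)[OF t] by auto
 have triv:"?S Int - {\<one>[i]} = {}<->?S = {\<one>[i]}"
 using subgroup.one_closed[OF stab_subgroup[OF b p0(2)]] by blast
 have vm:"v0:VM i H<->v0 ~: VB H" if "v0:comp_V i H p0"
 proof -
 have h:"has i (tri H) v0" using that has_act[OF b _ p0(2)] unfolding comp by blast
 obtain j where j:"j~=i" by(metis index.distinct(1))
 have "k = i|k = j" for k using other_index[of k i j] j by blast
 hence "(ALL k. k~=i-->~ has k (tri H) v0)<->~ has j (tri H) v0" "(ALL k. has k (tri H) v0)<->has j (tri H) v0"
 using h j by metis+
 thus ?thesis unfolding VM_has[OF b] VB_has using h v0(2) by simp qed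
 have "ev (rem_expr i) s~=0<->?S Int - (\<phi> i ` carrier A) = {}&card {g:?C. ?a g:VB H} = card (carrier A)
 &(v0 ~: comp_V i H p0|(?S = {\<one>[i]}&v0:VB H))"
 proof -
 have "ev (rem_expr i) s~=0<->ev (free_expr i (- (\<phi> i ` carrier A)) (Var 7)) s~=0
 &ev (eSum (map (%g. vb_expr (wk i g (Var 7))) (el i))) s = card (carrier A)
 &((ALL g:set (el i). ev (tNot (tEq (wk i g (Var 7)) (Var 0))) s~=0)
 |ev (free_expr i (- {\<one>[i]}) (Var 7)) s~=0&ev (vb_expr (Var 0)) s~=0)"
 using 1 p0(1) r by(auto simp:rem_expr_def simp del: tests(1) eSum_simps(1))
 thus ?thesis unfolding 2 3 4 5 triv . qed
 also have "\<dots><->rem_cond H v0 i p0" unfolding rem_cond_def using True vm by(cases "?S = {\<one>[i]}") auto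
 finally show ?thesis . qed

text \<open>The orbit is first stored in array 17, because the walks read the table that is going to be
 cleared.\<close>
definition rem_stmt :: "index => stmt" where
 "rem_stmt i = Assign 9 (Num 0) ;; put 17 9 (length (el i)) (%k. wk i (el i ! k) (Var 7)) ;;
 clear 5 (map (%k. (tNot (vb_expr (Cell 17 (Num k))),Cell 17 (Num k))) [0..<length (el i)]) ;;
 clear 6 (concat (map (%k. map (%x. (Num 1,Plus (eMul W (Cell 17 (Num k))) (Num (idx x)))) (filter (%x. x:LX i) ls)) [0..<length (el i)]))"

lemma walk_17:"17 ~: earrs (wk i g (Var 7))" "5 ~: earrs (vb_expr (Cell 17 (Num k)))" "20 ~: eregs (vb_expr (Cell 17 (Num k)))"
 using walk_uses(2)[of "Var 7" "wd i g"] vb_expr_uses[of "Cell 17 (Num k)"] by auto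

lemma run_remove_stmt:
 assumes t:"tabs s N (lV H) (tri H)" and wf:"lgraph_wf H" and fo:"folded H" and b:"based (tri H)" and v0:"v0:lV H"
 and r:"reg s 7 = p0" and c:"rem_cond H v0 i p0"
 shows "tabs (run (rem_stmt i) s) N (lV (removed H i p0)) (tri (removed H i p0))"
proof -
 let ?n = "length (el i)" and ?R = "removed H i p0" and ?V = "comp_V i H p0"
 define s1 where "s1 = run (put 17 9 ?n (%k. wk i (el i ! k) (Var 7))) (set_reg 9 0 s)"
 define l5 where "l5 = map (%k. (tNot (vb_expr (Cell 17 (Num k))),Cell 17 (Num k))) [0..<?n]"
 define s2 where "s2 = run (clear 5 l5) s1"
 define l6 where "l6 = concat (map (%k. map (%x. (Num 1,Plus (eMul W (Cell 17 (Num k))) (Num (idx x)))) (filter (%x. x:LX i) ls)) [0..<?n])"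
 define s3 where "s3 = run (clear 6 l6) s2"
 have run:"run (rem_stmt i) s = s3" by(simp add:rem_stmt_def s3_def s2_def s1_def l6_def l5_def)
 have vb:"p0:VB H" using c by(simp add:rem_cond_def)
 hence p0: "p0 < N" "has i (tri H) p0" using tabsD(1)[OF t] unfolding VB_has by auto
 let ?a = "act i (tri H) p0"
 have elk:"el i ! k:FC i" if "k < ?n" for k using nth_mem[OF that] el(1) by blast
 have P:"arr s1 d = arr s d" if "d~=17" for d using that unfolding s1_def by(simp add:run_put walk_17)
 have P3:"reg s1 3 = reg s 3" unfolding s1_def by(simp add:run_put walk_17)
 have a17:"arr s1 17 k = ?a (el i ! k)" if "k < ?n" for k
 proof -
 have t': "tabs (set_reg 9 0 s) N (lV H) (tri H)" by(rule tabs_cong[OF t]) simp_all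
 have "arr s1 17 k = ev (wk i (el i ! k) (Var 7)) (set_reg 9 0 s)"
 using that unfolding s1_def by(subst run_put(1)) (simp_all add:walk_17)
 also have "\<dots> = ?a (el i ! k)" using ev_wk[OF t' b,of "Var 7" i "el i ! k"] elk[OF that] p0 r by simp
 finally show ?thesis . qed
 have V:"?V = {arr s1 17 k|k. k < ?n}"
 proof -
 have "?V = ?a ` set (el i)" unfolding el by(rule comp_V_act[OF wf b p0(2)])
 also have "\<dots> = {arr s1 17 k|k. k < ?n}" unfolding set_conv_nth using a17 by force
 finally show ?thesis . qed
 have aN:"arr s1 17 k < N" if "k < ?n" for k
 using act_V[OF wf b p0(2) elk[OF that]] tabsD(1)[OF t] a17[OF that] by auto
 have t1:"tabs s1 N (lV H) (tri H)" by(rule tabs_cong[OF t]) (simp_all add:P P3)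
 have vbk:"ev (vb_expr (Cell 17 (Num k))) s1~=0<->arr s1 17 k:VB H" if "k < ?n" for k
 using ev_vb_expr[OF t1,of "Cell 17 (Num k)"] aN[OF that] by simp
 have a5:"arr s2 5 u = (if u:?V - VB H then 0 else arr s 5 u)" "d~=5==>arr s2 d = arr s1 d" "reg s2 3 = reg s 3" for u d
 proof -
 have pre:"5 ~: earrs c Un earrs a&20 ~: eregs c Un eregs a"
 if "(c,a):set l5" for c a using that walk_17 unfolding l5_def by auto
 show "d~=5==>arr s2 d = arr s1 d" "reg s2 3 = reg s 3" unfolding s2_def using run_clear(2,3)[of l5 5,OF pre] P3 by simp_all
 have "(EX (c,a):set l5. ev c s1~=0&ev a s1 = u)<->(EX k<?n. ~ ev (vb_expr (Cell 17 (Num k))) s1~=0&arr s1 17 k = u)"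
 unfolding l5_def by(auto split:if_splits)
 also have "\<dots><->(EX k<?n. arr s1 17 k ~: VB H&arr s1 17 k = u)" using vbk by blast
 also have "\<dots><->u:?V - VB H" unfolding V by blast
 finally have e:"(EX (c,a):set l5. ev c s1~=0&ev a s1 = u)<->u:?V - VB H" .
 have "arr s2 5 u = (if EX (c,a):set l5. ev c s1~=0&ev a s1 = u then 0 else arr s1 5 u)"
 unfolding s2_def by(rule run_clear(1)) (rule pre)
 thus "arr s2 5 u = (if u:?V - VB H then 0 else arr s 5 u)" unfolding e using P[of 5] by simp qed
 have a6:"arr s3 6 q = (if EX u x. u:?V&x:LX i&q = W * u+idx x then 0 else arr s 6 q)" "d~=6==>arr s3 d = arr s2 d"
 "reg s3 3 = reg s 3" for q d
 proof -
 have l6:"p:set l6<->(EX k<?n. EX x:LX i. p = (Num 1,Plus (eMul W (Cell 17 (Num k))) (Num (idx x))))" for p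
 proof -
 have f:"set (filter (%x. x:LX i) ls) = LX i" using xls by auto
 have "p:set l6<->(EX k:{..<?n}. p:(%x. (Num 1,Plus (eMul W (Cell 17 (Num k))) (Num (idx x)))) ` set (filter (%x. x:LX i) ls))"
 unfolding l6_def by(simp add:atLeast0LessThan)
 thus ?thesis unfolding f Bex_def lessThan_iff by blast qed
 have pre:"6 ~: earrs c Un earrs a&20 ~: eregs c Un eregs a" if "(c,a):set l6" for c a using that unfolding l6 by(auto split:if_splits)
 show "d~=6==>arr s3 d = arr s2 d" "reg s3 3 = reg s 3" unfolding s3_def using run_clear(2,3)[of l6 6,OF pre] a5(3) by simp_all
 have s17:"arr s2 17 = arr s1 17" by(rule a5(2)) simp
 have "(EX (c,a):set l6. ev c s2~=0&ev a s2 = q)<->(EX k<?n. EX x:LX i. W * arr s1 17 k+idx x = q)"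
 proof
 assume "EX (c,a):set l6. ev c s2~=0&ev a s2 = q"
 then obtain c a where ca:"(c,a):set l6" "ev a s2 = q" by blast
 from ca(1)[unfolded l6] obtain k x where "k < ?n" "x:LX i" "a = Plus (eMul W (Cell 17 (Num k))) (Num (idx x))" by blast
 with ca(2) s17 show "EX k<?n. EX x:LX i. W * arr s1 17 k+idx x = q" by auto
 next
 assume "EX k<?n. EX x:LX i. W * arr s1 17 k+idx x = q"
 then obtain k x where k:"k < ?n" "x:LX i" "W * arr s1 17 k+idx x = q" by blast
 hence "(Num 1,Plus (eMul W (Cell 17 (Num k))) (Num (idx x))):set l6" unfolding l6 by blast
 thus "EX (c,a):set l6. ev c s2~=0&ev a s2 = q" by(rule bexI[rotated]) (use k(3) s17 in simp) qed
 also have "\<dots><->(EX u x. u:?V&x:LX i&q = W * u+idx x)" unfolding V by blast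
 finally have e:"(EX (c,a):set l6. ev c s2~=0&ev a s2 = q)<->(EX u x. u:?V&x:LX i&q = W * u+idx x)" .
 have "arr s3 6 q = (if EX (c,a):set l6. ev c s2~=0&ev a s2 = q then 0 else arr s2 6 q)"
 unfolding s3_def by(rule run_clear(1)) (rule pre)
 note e7 = this
 have e6:"arr s2 6 q = arr s 6 q" using a5(2)[of 6] P[of 6] by simp
 show "arr s3 6 q = (if EX u x. u:?V&x:LX i&q = W * u+idx x then 0 else arr s 6 q)" using e7 unfolding e e6 . qed
 note RP = removed_props[OF wf fo b v0 c]
 have Rv:"lV ?R = lV H - (?V - VB H)" by(simp add:removed_def)
 have T:"(u,x,w):tri ?R<->(u,x,w):tri H&~ (u:?V&x:LX i)" for u x w unfolding tri_removed by blast
 show ?thesis unfolding run tabs_def a6(3)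
 proof (intro conjI allI impI)
 show "lV ?R<={..<N}" using RP(6) tabsD(1)[OF t] by blast
 show "W * N<=reg s 3" by(rule tabsD(2)[OF t])
 next
 fix u assume u:"u < reg s 3"
 have "arr s3 5 u = (if u:?V - VB H then 0 else arr s 5 u)" using a6(2)[of 5] a5(1) by simp
 thus "arr s3 5 u~=0<->u:lV ?R" using tabsD(3)[OF t u] unfolding Rv by auto
 next
 fix u x w assume a:"(u,x,w):tri ?R"
 show "u:lV ?R" "w:lV ?R" by(rule triD(1,2)[OF RP(1) a])+
 show "x:set ls" using a tabsD(4)[OF t] unfolding T by blast
 next
 fix q w assume q:"q < reg s 3"
 show "arr s3 6 q = Suc w<->(EX v k. k < K&q = W * v+k&(v,ls ! k,w):tri ?R)"
 proof (cases "EX u x. u:?V&x:LX i&q = W * u+idx x")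
 case True
 then obtain u x where u:"u:?V" "x:LX i" "q = W * u+idx x" by blast
 have x:"idx x < W" "ls ! idx x = x" using idx[OF xls[OF u(2)]] len(1) by simp_all
 have "~ (EX v k. k < K&q = W * v+k&(v,ls ! k,w):tri ?R)"
 proof
 assume "EX v k. k < K&q = W * v+k&(v,ls ! k,w):tri ?R"
 then obtain v k where k:"k < K" "q = W * v+k" "(v,ls ! k,w):tri ?R" by blast
 have "W * v+k = W * u+idx x" using k(2) u(3) by simp
 from key_inj[OF this _ x(1)] k(1) len(1) have "v = u" "k = idx x" by auto
 with k(3) x(2) u show False unfolding T by simp qed
 moreover have "arr s3 6 q = 0" unfolding a6(1) if_P[OF True] ..
 ultimately show ?thesis by simp
 next
 case False
 have "(v,ls ! k,w):tri H<->(v,ls ! k,w):tri ?R" if k:"k < K" "q = W * v+k" for v k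
 proof -
 have "~ (v:?V&ls ! k:LX i)"
 proof
 assume "v:?V&ls ! k:LX i"
 moreover have "q = W * v+idx (ls ! k)" using k idx_nth by simp
 ultimately show False using False by blast qed
 thus ?thesis unfolding T by blast qed
 moreover have "arr s3 6 q = arr s 6 q" unfolding a6(1) if_not_P[OF False] ..
 ultimately show ?thesis using tabsD(5)[OF t q,of w] by auto qed qed qed

definition rem_test :: "index => stmt" where
 "rem_test i = Cond (rem_expr i) (rem_stmt i) skip"

definition rem_prog :: stmt where
 "rem_prog = For 6 (For 7 (rem_test One ;; rem_test Two))"

lemma clear_frame [simp]:"wregs (clear b l) = {20}" "warrs (clear b l)<={b}" by(auto simp:clear_def)

lemma remove_frame:
 "wregs (rem_test i)<={9,20}" "warrs (rem_test i)<={5,6,17}" "wregs rem_prog<={6,7,9,20}" "warrs rem_prog<={5,6,17}"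
proof -
 have w:"wregs (rem_stmt i)<={9,20}" "warrs (rem_stmt i)<={5,6,17}" for i
 unfolding rem_stmt_def by(auto dest!: subsetD[OF clear_frame(2)] subsetD[OF put_frame(2)])
 thus "wregs (rem_test i)<={9,20}" "warrs (rem_test i)<={5,6,17}" "wregs rem_prog<={6,7,9,20}" "warrs rem_prog<={5,6,17}"
 unfolding rem_test_def rem_prog_def wregs.simps warrs.simps skip_simps by blast+ qed

definition reduct :: "(nat,nat,'x) lgraph => nat => nat => state => (nat,nat,'x) lgraph => bool" where
 "reduct Z v0 N s H<->remove_component^** (Z,v0) (H,v0)&lgraph_wf H&folded H&based (tri H)&v0:lV H
 &tabs s N (lV H) (tri H)&reg s 0 = v0&reg s 4 = N&finite (lE H)&lE H<=lE Z"

lemma run_remove_test: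
 assumes I:"reduct Z v0 N s H" and r:"reg s 7 = p0"
 shows "reg (run (rem_test i) s) 7 = p0&(EX H'. reduct Z v0 N (run (rem_test i) s) H' &
 (lE H' \<subset> lE H&rem_cond H v0 i p0|H' = H&~ rem_cond H v0 i p0))"
proof -
 let ?s = "run (rem_test i) s"
 have n:"j ~: wregs (rem_test i)" if "j ~: {9,20}" for j using remove_frame(1)[of i] that by blast
 have f:"reg ?s 7 = p0" "reg ?s 0 = reg s 0" "reg ?s 4 = reg s 4"
 using frame_reg[OF n[of 7],of s] frame_reg[OF n[of 0],of s] frame_reg[OF n[of 4],of s] r by simp_all
 note D = I[unfolded reduct_def]
 have c:"ev (rem_expr i) s~=0<->rem_cond H v0 i p0" using ev_removal_expr[of s N H v0 p0 i] D r by blast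
 show ?thesis
 proof (cases "rem_cond H v0 i p0")
 case True
 hence e:"?s = run (rem_stmt i) s" using c by(simp add:rem_test_def)
 have tb:"tabs ?s N (lV (removed H i p0)) (tri (removed H i p0))" unfolding e
 by(rule run_remove_stmt) (use D r True in blast)+
 have P:"lgraph_wf (removed H i p0)" "folded (removed H i p0)" "based (tri (removed H i p0))"
 "v0:lV (removed H i p0)" "lE (removed H i p0) \<subset> lE H" by(rule removed_props; use D True in blast)+
 have st:"remove_component (H,v0) (removed H i p0,v0)" by(rule removed_step) (use D True in blast)+
 have "reduct Z v0 N ?s (removed H i p0)" unfolding reduct_def
 proof (intro conjI P tb)
 show "remove_component^** (Z,v0) (removed H i p0,v0)" using D st by(meson rtranclp.rtrancl_into_rtrancl)
 show "finite (lE (removed H i p0))" using D P(5) finite_subset by blast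
 show "lE (removed H i p0)<=lE Z" using D P(5) by blast qed (use D f in simp_all)
 with P(5) True f(1) show ?thesis by blast
 next
 case False
 hence e:"?s = set_reg 20 0 s" using c by(simp add:rem_test_def)
 have "tabs ?s N (lV H) (tri H)" unfolding e by(rule tabs_cong[of s]) (use D in simp_all)
 hence "reduct Z v0 N ?s H" unfolding reduct_def using D f by simp
 with False f(1) show ?thesis by blast qed qed

definition closed :: "(nat,nat,'x) lgraph => nat => bool" where
 "closed H v0<->(ALL i p0. ~ rem_cond H v0 i p0)"

lemma run_remove_round:
 assumes I:"reduct Z v0 N s H"
 shows "EX H'. reduct Z v0 N (run (For 7 (rem_test One ;; rem_test Two)) s) H'&(lE H' \<subset> lE H&~ closed H v0|H' = H&closed H v0)"
proof -
 define J where "J m t<->(EX H'. reduct Z v0 N t H'&(lE H' \<subset> lE H&~ closed H v0|H' = H&(ALL i. ALL p0<m. ~ rem_cond H v0 i p0)))" for m t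
 have "J (reg s 3) (run (For 7 (rem_test One ;; rem_test Two)) s)"
 proof (rule run_For_rule)
 show "J 0 s" unfolding J_def using I by blast
 next
 fix m t assume "J m t"
 then obtain H' where H': "reduct Z v0 N t H'" "lE H' \<subset> lE H&~ closed H v0|H' = H&(ALL i. ALL p0<m. ~ rem_cond H v0 i p0)"
 unfolding J_def by blast
 let ?t = "set_reg 7 m t"
 have "tabs ?t N (lV H') (tri H')" by(rule tabs_cong[of t]) (use H'(1) in "simp_all add:reduct_def")
 hence 0:"reduct Z v0 N ?t H'" "reg ?t 7 = m" using H'(1) unfolding reduct_def by simp_all
 from run_remove_test[OF 0,of One] obtain H1 where H1:"reg (run (rem_test One) ?t) 7 = m" "reduct Z v0 N (run (rem_test One) ?t) H1"
 "lE H1 \<subset> lE H'&rem_cond H' v0 One m|H1 = H'&~ rem_cond H' v0 One m" by blast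
 from run_remove_test[OF H1(2,1),of Two] obtain H2 where H2:"reduct Z v0 N (run (rem_test Two) (run (rem_test One) ?t)) H2"
 "lE H2 \<subset> lE H1&rem_cond H1 v0 Two m|H2 = H1&~ rem_cond H1 v0 Two m" by blast
 have "lE H2 \<subset> lE H&~ closed H v0|H2 = H&(ALL i. ALL p0<Suc m. ~ rem_cond H v0 i p0)"
 proof (cases "H' = H&(ALL i. ALL p0<m. ~ rem_cond H v0 i p0)")
 case True
 show ?thesis
 proof (cases "rem_cond H v0 One m|rem_cond H v0 Two m")
 case c: True
 hence "~ closed H v0" unfolding closed_def by blast
 moreover have "lE H2 \<subset> lE H" using c H1(3) H2(2) True by auto
 ultimately show ?thesis by blast
 next
 case c: False
 hence "H2 = H" using H1(3) H2(2) True by blast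
 moreover have "~ rem_cond H v0 i m" for i using c by(cases i) simp_all
 ultimately show ?thesis using True unfolding less_Suc_eq by blast qed
 next
 case False
 hence "lE H' \<subset> lE H&~ closed H v0" using H'(2) by blast
 moreover have "lE H2<=lE H'" using H1(3) H2(2) by blast
 ultimately show ?thesis by blast qed
 with H2(1) show "J (Suc m) (run (rem_test One ;; rem_test Two) ?t)" unfolding J_def by auto qed
 then obtain H' where H': "reduct Z v0 N (run (For 7 (rem_test One ;; rem_test Two)) s) H'"
 "lE H' \<subset> lE H&~ closed H v0|H' = H&(ALL i. ALL p0<reg s 3. ~ rem_cond H v0 i p0)" unfolding J_def by blast
 have "closed H v0" if "ALL i. ALL p0<reg s 3. ~ rem_cond H v0 i p0" unfolding closed_def
 proof (intro allI notI)
 fix i p0 assume c:"rem_cond H v0 i p0"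
 have t:"tabs s N (lV H) (tri H)" using I unfolding reduct_def by blast
 have "p0:lV H" using c unfolding rem_cond_def VB_has by blast
 hence "p0 < reg s 3" using tabsD(1)[OF t] N_le[OF tabsD(2)[OF t]] by auto
 with that c show False by blast qed
 with H' show ?thesis by blast qed

lemma card_larcs:
 assumes wf:"lgraph_wf H" and fo:"folded H" and t:"tabs s N (lV H) (tri H)" shows "card (lE H)<=reg s 3"
proof -
 have "inj_on (%e. (ltail H e,lab H e)) (lE H)" by(rule inj_onI) (use fo in "auto simp:folded_def")
 moreover have "(%e. (ltail H e,lab H e)) ` lE H<={..<N} \<times> set ls"
 proof
 fix y assume "y:(%e. (ltail H e,lab H e)) ` lE H"
 then obtain e where e:"e:lE H" "y = (ltail H e,lab H e)" by blast
 from tabsD(4)[OF t triI[OF e(1)]] tabsD(1)[OF t] show "y:{..<N} \<times> set ls" unfolding e(2) by blast qed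
 ultimately have "card (lE H)<=card ({..<N} \<times> set ls)" by(rule card_inj_on_le) simp
 also have "\<dots> = N * K" using distinct_card[OF dist] by(simp add:card_cartesian_product)
 also have "\<dots><=W * N" using len(1) by(simp add:mult.commute)
 finally show ?thesis using tabsD(2)[OF t] by simp qed

text \<open>Each scan that removes anything deletes edges, and there are at most \<open>reg s 3\<close>
 edges.\<close>
lemma run_remove_prog:
 assumes I:"reduct Z v0 N s Z" shows "EX H. reduct Z v0 N (run rem_prog s) H&closed H v0"
proof -
 let ?b = "For 7 (rem_test One ;; rem_test Two)"
 define J where "J m t<->(EX H. reduct Z v0 N t H&(closed H v0|card (lE H)+m<=card (lE Z)))" for m t
 have "J (reg s 3) (run rem_prog s)" unfolding rem_prog_def
 proof (rule run_For_rule)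
 show "J 0 s" unfolding J_def using I by auto
 next
 fix m t assume "J m t"
 then obtain H where H:"reduct Z v0 N t H" "closed H v0|card (lE H)+m<=card (lE Z)" unfolding J_def by blast
 let ?t = "set_reg 6 m t"
 have "tabs ?t N (lV H) (tri H)" by(rule tabs_cong[of t]) (use H(1) in "simp_all add:reduct_def")
 hence "reduct Z v0 N ?t H" using H(1) unfolding reduct_def by simp
 from run_remove_round[OF this] obtain H' where H': "reduct Z v0 N (run ?b ?t) H'"
 "lE H' \<subset> lE H&~ closed H v0|H' = H&closed H v0" by blast
 have "closed H' v0|card (lE H')+Suc m<=card (lE Z)"
 proof (cases "H' = H&closed H v0")
 case True
 thus ?thesis by simp
 next
 case False
 hence l:"lE H' \<subset> lE H" "~ closed H v0" using H'(2) by blast+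
 have "finite (lE H)" using H(1) unfolding reduct_def by blast
 from psubset_card_mono[OF this l(1)] H(2) l(2) show ?thesis by simp qed
 with H'(1) show "J (Suc m) (run ?b ?t)" unfolding J_def by blast qed
 then obtain H where H:"reduct Z v0 N (run rem_prog s) H" "closed H v0|card (lE H)+reg s 3<=card (lE Z)" unfolding J_def by blast
 have "closed H v0"
 proof (rule ccontr)
 assume "~ closed H v0"
 moreover have "card (lE Z)<=reg s 3" using card_larcs[of Z s N] I unfolding reduct_def by blast
 ultimately have "card (lE H) = 0" using H(2) by simp
 moreover have "finite (lE H)" using H(1) unfolding reduct_def by blast
 ultimately have "tri H = {}" by(simp add:tri_def)
 hence "VB H = {}" unfolding VB_has has_def by auto
 thus False using `~ closed H v0` unfolding closed_def rem_cond_def by blast qed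
 with H(1) show ?thesis by blast qed

subsection \<open>A single Cayley graph\<close>

lemma bex_index:"(EX i:{One,Two}. P i)<->(EX i. P i)"
proof -
 have "(UNIV :: index set) = {One,Two}" by(auto intro:index.exhaust)
 from this[symmetric] show ?thesis by(simp only: bex_UNIV) qed

definition count_prog :: stmt where
 "count_prog = Assign 9 (Num 0) ;; Assign 10 (Num 0) ;;
 For 6 (Cond (Cell 5 (Var 6)) (Assign 9 (Plus (Var 9) (Num 1))) skip ;;
 Cond (tAll [tLess (Var 6) (Var 4),vb_expr (Var 6)]) (Assign 10 (Num 1)) skip)"

definition cay_expr :: expr where
 "cay_expr = tAll [tNot (Var 10),eSum (map (%i. tAll [has_expr i (Var 0),tEq (Var 9) (Num (card (FC i))),
 free_expr i (- {\<one>[i]}) (Var 0)]) [One,Two])]"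

definition reduce_stmt :: stmt where
 "reduce_stmt = For 6 (Write 5 (Var 6) (Num 0)) ;; For 6 (Write 6 (Var 6) (Num 0)) ;; Write 5 (Var 0) (Num 1)"

definition cay_prog :: stmt where
 "cay_prog = count_prog ;; Cond cay_expr reduce_stmt skip"

lemma count_frame [simp]:"wregs count_prog = {6,9,10,20}" "warrs count_prog = {}"
 "wregs cay_prog = {6,9,10,20}" "warrs cay_prog = {5,6}" by(auto simp:count_prog_def cay_prog_def reduce_stmt_def)

lemma run_count_prog:
 assumes t:"tabs s N (lV H) (tri H)" and r:"reg s 4 = N"
 shows "reg (run count_prog s) 9 = card (lV H)" "reg (run count_prog s) 10 = 0<->VB H = {}"
proof -
 let ?b = "Cond (Cell 5 (Var 6)) (Assign 9 (Plus (Var 9) (Num 1))) skip ;;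
 Cond (tAll [tLess (Var 6) (Var 4),vb_expr (Var 6)]) (Assign 10 (Num 1)) skip"
 let ?s = "set_reg 10 0 (set_reg 9 0 s)"
 define I where "I m t<->reg t 9 = card {u:lV H. u < m}&(reg t 10 = 0<->(ALL u:VB H. ~ u < m))" for m and t :: state
 have fV:"finite (lV H)" using tabsD(1)[OF t] finite_subset by blast
 have "I (reg ?s 3) (run (For 6 ?b) ?s)"
 proof (rule For_rule)
 show "I 0 ?s" unfolding I_def by simp
 next
 fix m and t' :: state
 assume m:"m < reg ?s 3" and It:"I m t'" and fr:"!!r. r ~: wregs (For 6 ?b)==>reg t' r = reg ?s r"
 and fa:"!!b. b ~: warrs ?b==>arr t' b = arr ?s b"
 define u where "u = run (Cond (Cell 5 (Var 6)) (Assign 9 (Plus (Var 9) (Num 1))) skip) (set_reg 6 m t')"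
 have f:"reg t' 4 = N" "reg t' 3 = reg s 3" "arr t' = arr s" using fr[of 4] fr[of 3] fa r by(simp_all add:fun_eq_iff)
 have al:"arr t' 5 m~=0<->m:lV H" using tabsD(3)[OF t,of m] m f by simp
 have u:"reg u 9 = (if m:lV H then Suc (reg t' 9) else reg t' 9)" "reg u 10 = reg t' 10" "reg u 6 = m" "reg u 4 = N" "arr u = arr s" "reg u 3 = reg s 3"
 using al f unfolding u_def by auto
 have tu:"tabs u N (lV H) (tri H)" by(rule tabs_cong[OF t u(6)]) (simp_all add:u(5))
 have "m < N&ev (vb_expr (Var 6)) u~=0<->m:VB H"
 using ev_vb_expr[OF tu,of "Var 6"] u(3) tabsD(1)[OF t] unfolding VB_def by auto
 hence w:"run ?b (set_reg 6 m t') = (if m:VB H then set_reg 10 1 u else set_reg 20 0 u)"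
 unfolding run.simps(3) u_def[symmetric] using u by auto
 have c:"card {u:lV H. u < Suc m} = (if m:lV H then Suc (card {u:lV H. u < m}) else card {u:lV H. u < m})"
 proof -
 have "{u:lV H. u < Suc m} = (if m:lV H then insert m {u:lV H. u < m} else {u:lV H. u < m})" by(auto simp:less_Suc_eq)
 thus ?thesis using fV by simp qed
 have It': "reg t' 9 = card {u:lV H. u < m}" "reg t' 10 = 0<->(ALL u:VB H. ~ u < m)" using It unfolding I_def by blast+
 show "I (Suc m) (run ?b (set_reg 6 m t'))" unfolding w I_def c using u It' by(auto simp:less_Suc_eq) qed
 hence I:"I (reg s 3) (run count_prog s)" unfolding count_prog_def by(simp del: run.simps(5) add:run.simps(1-3))
 have lt:"u < reg s 3" if "u:lV H" for u using that tabsD(1)[OF t] N_le[OF tabsD(2)[OF t]] by auto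
 hence "{u:lV H. u < reg s 3} = lV H" by blast
 thus "reg (run count_prog s) 9 = card (lV H)" using I unfolding I_def by simp
 show "reg (run count_prog s) 10 = 0<->VB H = {}" using I lt unfolding I_def VB_def by blast qed

lemma run_cay_prog:
 assumes t:"tabs s N (lV H) (tri H)" and b:"based (tri H)" and r:"reg s 4 = N" "reg s 0 = v0" "v0:lV H"
 shows "cay_cond H v0==>tabs (run cay_prog s) N {v0} {}" "~ cay_cond H v0==>tabs (run cay_prog s) N (lV H) (tri H)"
proof -
 define u where "u = run count_prog s"
 have f:"reg u 3 = reg s 3" "reg u 0 = v0" "arr u = arr s" unfolding u_def using r by(simp_all add:frame_reg frame_arr fun_eq_iff)
 have tu:"tabs u N (lV H) (tri H)" by(rule tabs_cong[OF t f(1)]) (simp_all add:f(3))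
 note c = run_count_prog[OF t r(1),folded u_def]
 have v0N:"v0 < N" "v0 < reg s 3" using tabsD(1)[OF t] N_le[OF tabsD(2)[OF t]] r(3) by auto
 have i:"ev (tAll [has_expr i (Var 0),tEq (Var 9) (Num (card (FC i))),free_expr i (- {\<one>[i]}) (Var 0)]) u~=0
 <->has i (tri H) v0&stab (tri H) i v0 = {\<one>[i]}&card (lV H) = card (FC i)" for i
 proof (cases "has i (tri H) v0")
 case True
 have "stab (tri H) i v0 Int - {\<one>[i]} = {}<->stab (tri H) i v0 = {\<one>[i]}"
 using subgroup.one_closed[OF stab_subgroup[OF b True]] by blast
 thus ?thesis using ev_has_expr[OF tu,of "Var 0" i] ev_free_expr[OF tu b,of "Var 0" i "- {\<one>[i]}"] True v0N f c by simp
 next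
 case False
 thus ?thesis using ev_has_expr[OF tu,of "Var 0" i] v0N f by simp qed
 have "ev cay_expr u~=0<->VB H = {}&(EX i:{One,Two}. ev (tAll [has_expr i (Var 0),tEq (Var 9) (Num (card (FC i))),free_expr i (- {\<one>[i]}) (Var 0)]) u~=0)"
 using c(2) unfolding cay_expr_def by(simp del: tAll_simps(1) add:tAll_simps(1)[of "[_,_]"])
 also have "\<dots><->cay_cond H v0" unfolding i cay_cond_def bex_index ..
 finally have e:"ev cay_expr u~=0<->cay_cond H v0" .
 have run:"run cay_prog s = (if cay_cond H v0 then run reduce_stmt u else set_reg 20 0 u)"
 unfolding cay_prog_def run.simps(3) u_def[symmetric] using e by simp
 { assume "cay_cond H v0"
 hence rs:"run cay_prog s = run reduce_stmt u" using run by simp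
 define u1 where "u1 = run (For 6 (Write 5 (Var 6) (Num 0))) u"
 define u2 where "u2 = run (For 6 (Write 6 (Var 6) (Num 0))) u1"
 have g:"reg u1 3 = reg s 3" "reg u2 3 = reg s 3" "reg u2 0 = v0" "arr u2 5 = arr u1 5" unfolding u2_def u1_def using f
 by(simp_all add:frame_reg frame_arr del: run.simps)
 have A5:"arr u1 5 = (%j. if j < reg u 3 then 0 else arr u 5 j)" unfolding u1_def by(rule For_array_rule) auto
 have A6:"arr u2 6 = (%j. if j < reg u1 3 then 0 else arr u1 6 j)" unfolding u2_def by(rule For_array_rule) auto
 have rr:"run cay_prog s = set_arr 5 v0 1 u2" unfolding rs reduce_stmt_def run.simps(3) u1_def[symmetric] u2_def[symmetric] using g by simp
 show "tabs (run cay_prog s) N {v0} {}" unfolding rr tabs_def using v0N tabsD(2)[OF t] g A5 A6 f by auto }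
 { assume "~ cay_cond H v0"
 hence "run cay_prog s = set_reg 20 0 u" using run by simp
 thus "tabs (run cay_prog s) N (lV H) (tri H)" using tabs_cong[OF tu,of "set_reg 20 0 u"] by simp } qed

definition prune_prog :: stmt where
 "prune_prog = rem_prog ;; cay_prog ;; out_prog"

theorem run_prune_prog:
 assumes g:"good s N Z v" and b:"based (tri Z)"
 defines "t == run prune_prog s" shows "EX Z'. good t N Z' v&step5 (Z,v) (Z',v)&based (tri Z')"
proof -
 note D = goodD[OF g]
 define s1 where "s1 = run rem_prog s"
 define s2 where "s2 = run cay_prog s1"
 have run:"t = run out_prog s2" unfolding t_def prune_prog_def s1_def s2_def by simp
 have "reduct Z v N s Z" unfolding reduct_def using D b by simp
 from run_remove_prog[OF this] obtain H where R:"reduct Z v N s1 H" "closed H v" unfolding s1_def by blast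
 hence H:"remove_component^** (Z,v) (H,v)" "lgraph_wf H" "folded H" "based (tri H)" "v:lV H"
 "tabs s1 N (lV H) (tri H)" "reg s1 0 = v" "reg s1 4 = N" unfolding reduct_def by blast+
 have f2:"reg s2 0 = v" "reg s2 4 = N" unfolding s2_def using H by(simp_all add:frame_reg)
 define V where "V = (if cay_cond H v then {v} else lV H)"
 define T where "T = (if cay_cond H v then {} else tri H)"
 have tb:"tabs s2 N V T" using run_cay_prog[OF H(6,4,8,7,5),folded s2_def] unfolding V_def T_def by(cases "cay_cond H v") simp_all
 have e:"det T" "symm T" "based T" "v:V"
 unfolding V_def T_def using basedD(1,2)[OF H(4)] H(4,5) by(auto simp:det_def symm_def based_def has_def)
 obtain Z' where G:"represents code t (Z',v)" "lgraph_wf Z'" "folded Z'" "lV Z' = V" "tri Z' = T"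
 using run_out_prog[OF tb e(1,2)] e(4) unfolding f2(1) run by blast
 have fV:"finite (lV H)" using tabsD(1)[OF H(6)] finite_subset by blast
 have "step5 (Z,v) (Z',v)"
 by(rule step5I[OF H(1-4) fV H(5) _ G(2,3)]) (use R(2) G(4,5) in "simp_all add:closed_def V_def T_def")
 moreover have "tabs t N V T" unfolding run by(rule tabs_cong[OF tb]) (simp_all add:frame_reg frame_arr)
 moreover have "reg t 4 = N" unfolding run using f2 by(simp add:frame_reg)
 ultimately show ?thesis using G e(3) unfolding good_def by auto qed

lemma free_regs:"eregs (free_expr i S e)<=eregs e" using walk_uses(1)[of e] by(auto simp:free_expr_def)

lemma frugal_prune:"frugal prune_prog"
proof -
 have r:"eregs (rem_expr i)<={0,4,7}" for i
 proof -
 have "eregs (vb_expr (wk i g (Var 7)))<={7}" "eregs (wk i g (Var 7))<={7}" "eregs (vb_expr (Var v))<={v}" "eregs (free_expr i S (Var 7))<={7}" for g v S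
 using vb_expr_uses(1)[of "wk i g (Var 7)"] walk_uses(1)[of "Var 7" "wd i g"] vb_expr_uses(1)[of "Var v"] free_regs[of i S "Var 7"] by auto
 thus ?thesis unfolding rem_expr_def by(simp add:UN_subset_iff) blast qed
 have s:"uregs (rem_stmt i)<={7,9,20}&depth (rem_stmt i) = 0" for i
 proof -
 have p:"uregs (put 17 9 n (%k. wk i (f k) (Var 7)))<={7,9,20}" for n f
 using walk_uses(1)[of "Var 7"] unfolding put_def seqs_simps by fastforce
 have c5:"uregs (clear 5 (map (%k. (tNot (vb_expr (Cell 17 (Num k))),Cell 17 (Num k))) ks))<={20}" for ks
 using vb_expr_uses(1)[of "Cell 17 (Num _)"] unfolding clear_def seqs_simps by fastforce
 have c6:"uregs (clear 6 (concat (map (%k. map (%x. (Num 1,Plus (eMul W (Cell 17 (Num k))) (Num (idx x)))) xs) ks)))<={20}" for xs ks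
 unfolding clear_def seqs_simps by(auto split:if_splits)
 have "depth (put b r n E)<=0" for b r n E unfolding put_def by(rule seqs_depth) auto
 moreover have "depth (clear b l)<=0" for b l unfolding clear_def by(rule seqs_depth) auto
 ultimately show ?thesis unfolding rem_stmt_def by(auto dest!: subsetD[OF p] subsetD[OF c5] subsetD[OF c6[unfolded One_nat_def]])
 qed
 have "frugal rem_prog" unfolding frugal_def
 proof (intro conjI)
 show "3 ~: wregs rem_prog" using remove_frame(3) by auto
 show "uregs rem_prog<={..<40}" using r s by(fastforce simp:rem_prog_def rem_test_def)
 show "depth rem_prog<=2" using s by(simp add:rem_prog_def rem_test_def) qed
 moreover have "frugal cay_prog"
 proof -
 have "eregs cay_expr<={0,9,10}" using has_expr_uses(1)[of _ "Var 0"] free_regs[of _ _ "Var 0"] unfolding cay_expr_def by fastforce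
 moreover have "eregs (vb_expr (Var 6))<={6}" using vb_expr_uses(1)[of "Var 6"] by simp
 ultimately show ?thesis by(auto simp:frugal_def cay_prog_def count_prog_def reduce_stmt_def) qed
 ultimately show ?thesis by(simp add:prune_prog_def frugal_out) qed

end

section \<open>The program for the sixth step\<close>

definition pos :: "'b list => 'b => nat" where
 "pos xs x = (SOME k. k < length xs&xs ! k = x)"

lemma pos:"x:set xs==>pos xs x < length xs" "x:set xs==>xs ! pos xs x = x"
 using someI_ex[of "%k. k < length xs&xs ! k = x"] by(auto simp:pos_def in_set_conv_nth)

lemma pos_nth:"distinct xs==>k < length xs==>pos xs (xs ! k) = k"
 using pos[of "xs ! k" xs] nth_eq_iff_index_eq by fastforce

definition listing :: "'b set => 'b list" where
 "listing S = (SOME xs. distinct xs&set xs = S)"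

lemma listing:"finite S==>distinct (listing S)" "finite S==>set (listing S) = S"
 using someI_ex[of "%xs. distinct xs&set xs = S"] finite_distinct_list[of S] unfolding listing_def by blast+

definition branch :: "(expr \<times> stmt) list => stmt" where
 "branch l = foldr (%(c,d) r. Cond c d r) l skip"

lemma run_branch:
 "(!!c d. (c,d):set l==>ev c s = 0)==>run (branch l) s = set_reg 20 0 s"
 "(c,d):set l==>ev c s~=0==>EX c d. (c,d):set l&ev c s~=0&run (branch l) s = run d s"
proof -
 show "(!!c d. (c,d):set l==>ev c s = 0)==>run (branch l) s = set_reg 20 0 s"
 proof (induction l)
 case Nil
 show ?case by(simp add:branch_def)
 next
 case (Cons p l)
 obtain c d where p:"p = (c,d)" by(cases p)
 have "ev c s = 0" by(rule Cons.prems[of c d]) (simp add:p)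
 hence "run (branch (p # l)) s = run (branch l) s" by(simp add:branch_def p)
 also have "\<dots> = set_reg 20 0 s" using Cons.IH Cons.prems by auto 
 finally show ?case . qed
 assume "(c,d):set l" "ev c s~=0"
 thus "EX c d. (c,d):set l&ev c s~=0&run (branch l) s = run d s"
 proof (induction l)
 case (Cons p l)
 obtain c' d' where p:"p = (c',d')" by(cases p)
 show ?case using Cons by(fastforce simp:branch_def p)  qed simp qed

lemma coset_eq_iff:
 assumes "group G" "subgroup S G" "x:carrier G" "y:carrier G"
 shows "S #>\<^bsub>G\<^esub> x = S #>\<^bsub>G\<^esub> y<->x \<otimes>\<^bsub>G\<^esub> inv\<^bsub>G\<^esub> y:S"
 using group.repr_independence[OF assms(1) _ assms(4,2),of x] group.repr_independenceD[OF assms(1,2,3),of y]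
 subgroup.rcos_module[OF assms(2,1,4,3)] by metis

context amalgam_progs
begin

definition new_cosets :: "index => 'a set => 'x word set set list" where
 "new_cosets j L = listing {c:rcosets[j] (\<phi> j ` L). ALL a:carrier A. c~=\<phi> j ` L #>[j] \<phi> j a}"

definition new_arcs :: "index => 'a set => ('x word set set \<times> 'x letter) list" where
 "new_arcs j L = listing (lE (cayley j (\<phi> j ` L)))"

text \<open>Cosets of elements of \<open>A\<close> are vertices that can be reached from the basepoint. The
 others get names from the content of register 3 on, which is larger than all names in use.\<close>
definition cos_expr :: "index => index => 'a set => 'x word set set => expr" where
 "cos_expr i j L c = (if EX a:carrier A. c = \<phi> j ` L #>[j] \<phi> j a
 then wk i (\<phi> i (SOME a. a:carrier A&c = \<phi> j ` L #>[j] \<phi> j a)) (Var 0)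
 else Plus (Var 3) (Num (pos (new_cosets j L) c)))"

definition attach_stmt :: "index => index => 'a set => stmt" where
 "attach_stmt i j L = (let C = cayley j (\<phi> j ` L); ds = new_arcs j L; n = length ds in
 put 0 1 (length (new_cosets j L)) (%k. Plus (Var 3) (Num k)) ;; Assign 1 (Plus (Var 1) (Num (length (new_cosets j L)))) ;;
 put 1 2 n (%k. cos_expr i j L (ltail C (ds ! k))) ;; put 2 2 n (%k. cos_expr i j L (lhead C (ds ! k))) ;;
 put 3 2 n (%k. Plus (Var 2) (Num (pos ds (bar C (ds ! k))))) ;; put 4 2 n (%k. Num (code (lab C (ds ! k)))) ;;
 Assign 2 (Plus (Var 2) (Num n)))"

lemma finite_rcosets:"subgroup S (factor j)==>finite (rcosets[j] S)" using fin_car[of j] by(simp add:rcosets_eq)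

lemma new_lists:
 assumes "subgroup (\<phi> j ` L) (factor j)"
 shows "distinct (new_cosets j L)" "set (new_cosets j L) = {c:rcosets[j] (\<phi> j ` L). ALL a:carrier A. c~=\<phi> j ` L #>[j] \<phi> j a}"
 "distinct (new_arcs j L)" "set (new_arcs j L) = lE (cayley j (\<phi> j ` L))"
proof -
 have f:"finite {c:rcosets[j] (\<phi> j ` L). ALL a:carrier A. c~=\<phi> j ` L #>[j] \<phi> j a}" using finite_rcosets[OF assms] by simp
 have g:"finite (lE (cayley j (\<phi> j ` L)))" using finite_rcosets[OF assms] finite_letters by simp
 show "distinct (new_cosets j L)" "set (new_cosets j L) = {c:rcosets[j] (\<phi> j ` L). ALL a:carrier A. c~=\<phi> j ` L #>[j] \<phi> j a}"
 unfolding new_cosets_def by(rule listing[OF f])+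
 show "distinct (new_arcs j L)" "set (new_arcs j L) = lE (cayley j (\<phi> j ` L))" unfolding new_arcs_def by(rule listing[OF g])+
qed

lemma cos_expr_uses:"eregs (cos_expr i j L c)<={0,3}" "earrs (cos_expr i j L c)<={6}"
proof -
 have w:"eregs (wk i g (Var 0))<={0}" "earrs (wk i g (Var 0))<={6}" for g
 using walk_uses(1)[of "Var 0" "wd i g"] walk_uses(2)[of "Var 0" "wd i g"] by simp_all
 show "eregs (cos_expr i j L c)<={0,3}" "earrs (cos_expr i j L c)<={6}"
 unfolding cos_expr_def using w by(auto split:if_splits) qed

lemma run_attach_stmt:
 fixes i :: index and s :: state
 assumes S:"subgroup (\<phi> j ` L) (factor j)"
 defines "C == cayley j (\<phi> j ` L)" and "ds == new_arcs j L" and "nc == new_cosets j L" and "t == run (attach_stmt i j L) s"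
 shows "reg t 0 = reg s 0" "reg t 1 = reg s 1+length nc" "reg t 2 = reg s 2+length ds"
 "arr t 0 q = (if reg s 1<=q&q < reg s 1+length nc then reg s 3+(q - reg s 1) else arr s 0 q)"
 "arr t 1 q = (if reg s 2<=q&q < reg s 2+length ds then ev (cos_expr i j L (ltail C (ds ! (q - reg s 2)))) s else arr s 1 q)"
 "arr t 2 q = (if reg s 2<=q&q < reg s 2+length ds then ev (cos_expr i j L (lhead C (ds ! (q - reg s 2)))) s else arr s 2 q)"
 "arr t 3 q = (if reg s 2<=q&q < reg s 2+length ds then reg s 2+pos ds (bar C (ds ! (q - reg s 2))) else arr s 3 q)"
 "arr t 4 q = (if reg s 2<=q&q < reg s 2+length ds then code (lab C (ds ! (q - reg s 2))) else arr s 4 q)"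
proof -
 let ?n = "length ds"
 define s1 where "s1 = run (put 0 1 (length nc) (%k. Plus (Var 3) (Num k))) s"
 define s2 where "s2 = set_reg 1 (reg s 1+length nc) s1"
 define s3 where "s3 = run (put 1 2 ?n (%k. cos_expr i j L (ltail C (ds ! k)))) s2"
 define s4 where "s4 = run (put 2 2 ?n (%k. cos_expr i j L (lhead C (ds ! k)))) s3"
 define s5 where "s5 = run (put 3 2 ?n (%k. Plus (Var 2) (Num (pos ds (bar C (ds ! k)))))) s4"
 define s6 where "s6 = run (put 4 2 ?n (%k. Num (code (lab C (ds ! k))))) s5"
 have ce:"b ~: earrs (cos_expr i j L c)" if "b~=6" for b c using cos_expr_uses(2)[of i j L c] that by blast
 have p1:"reg s1 r = reg s r" "b~=0==>arr s1 b = arr s b" if "r~=20" for r b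
 unfolding s1_def using that by(auto intro!: run_put(2,3))
 have p2:"reg s2 r = (if r = 1 then reg s 1+length nc else reg s r)" "b~=0==>arr s2 b = arr s b" if "r~=20" for r b
 unfolding s2_def using that p1 by simp_all
 have p3:"reg s3 r = reg s2 r" "b~=1==>arr s3 b = arr s2 b" if "r~=20" for r b
 unfolding s3_def using that by(auto intro!: run_put(2,3) ce)
 have p4:"reg s4 r = reg s3 r" "b~=2==>arr s4 b = arr s3 b" if "r~=20" for r b
 unfolding s4_def using that by(auto intro!: run_put(2,3) ce)
 have p5:"reg s5 r = reg s4 r" "b~=3==>arr s5 b = arr s4 b" if "r~=20" for r b
 unfolding s5_def using that by(auto intro!: run_put(2,3))
 have p6:"reg s6 r = reg s5 r" "b~=4==>arr s6 b = arr s5 b" if "r~=20" for r b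
 unfolding s6_def using that by(auto intro!: run_put(2,3))
 have r1:"reg s1 1 = reg s 1" by(rule p1(1)) simp
 have t:"t = set_reg 2 (reg s6 2+?n) s6"
 unfolding t_def attach_stmt_def Let_def C_def[symmetric] ds_def[symmetric] nc_def[symmetric] run.simps(3)
 by(simp add:s1_def s2_def s3_def s4_def s5_def s6_def r1[unfolded s1_def,simplified] del: run.simps(2,4,5))
 have r2:"reg s2 2 = reg s 2" "reg s3 2 = reg s 2" "reg s4 2 = reg s 2" "reg s5 2 = reg s 2" "reg s6 2 = reg s 2"
 using p2(1)[of 2] p3(1)[of 2] p4(1)[of 2] p5(1)[of 2] p6(1)[of 2] by simp_all
 have same:"ev (cos_expr i j L c) u = ev (cos_expr i j L c) s" if "reg u 0 = reg s 0" "reg u 3 = reg s 3" "arr u 6 = arr s 6" for u c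
 using cos_expr_uses[of i j L c] that by(intro ev_cong) auto
 have e2:"ev (cos_expr i j L c) s2 = ev (cos_expr i j L c) s" for c by(rule same) (use p2(1)[of 0] p2(1)[of 3] p2(2)[of 0 6] in simp_all)
 have e3:"ev (cos_expr i j L c) s3 = ev (cos_expr i j L c) s" for c by(rule same) (use p3(1)[of 0] p3(1)[of 3] p3(2)[of 0 6] p2(1)[of 0] p2(1)[of 3] p2(2)[of 0 6] in simp_all)
 show "reg t 0 = reg s 0" "reg t 1 = reg s 1+length nc" "reg t 2 = reg s 2+length ds"
 unfolding t using r2 p2(1)[of 0] p3(1)[of 0] p4(1)[of 0] p5(1)[of 0] p6(1)[of 0] p2(1)[of 1] p3(1)[of 1] p4(1)[of 1] p5(1)[of 1] p6(1)[of 1] by simp_all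
 have "arr t 0 q = arr s1 0 q" unfolding t using p6(2)[of 0 0] p5(2)[of 0 0] p4(2)[of 0 0] p3(2)[of 0 0] by(simp add:s2_def)
 thus "arr t 0 q = (if reg s 1<=q&q < reg s 1+length nc then reg s 3+(q - reg s 1) else arr s 0 q)"
 unfolding s1_def by(subst (asm) run_put(1)) simp_all
 have "arr t 1 q = arr s3 1 q" unfolding t using p6(2)[of 0 1] p5(2)[of 0 1] p4(2)[of 0 1] by simp
 thus "arr t 1 q = (if reg s 2<=q&q < reg s 2+length ds then ev (cos_expr i j L (ltail C (ds ! (q - reg s 2)))) s else arr s 1 q)"
 unfolding s3_def using p2(2)[of 0 1] by(subst (asm) run_put(1)) (simp_all add:ce r2 e2)
 have "arr t 2 q = arr s4 2 q" unfolding t using p6(2)[of 0 2] p5(2)[of 0 2] by simp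
 thus "arr t 2 q = (if reg s 2<=q&q < reg s 2+length ds then ev (cos_expr i j L (lhead C (ds ! (q - reg s 2)))) s else arr s 2 q)"
 unfolding s4_def using p2(2)[of 0 2] p3(2)[of 0 2] by(subst (asm) run_put(1)) (simp_all add:ce r2 e3)
 have "arr t 3 q = arr s5 3 q" unfolding t using p6(2)[of 0 3] by simp
 thus "arr t 3 q = (if reg s 2<=q&q < reg s 2+length ds then reg s 2+pos ds (bar C (ds ! (q - reg s 2))) else arr s 3 q)"
 unfolding s5_def using p2(2)[of 0 3] p3(2)[of 0 3] p4(2)[of 0 3] by(subst (asm) run_put(1)) (simp_all add:r2)
 have "arr t 4 q = arr s6 4 q" unfolding t by simp
 thus "arr t 4 q = (if reg s 2<=q&q < reg s 2+length ds then code (lab C (ds ! (q - reg s 2))) else arr s 4 q)"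
 unfolding s6_def using p2(2)[of 0 4] p3(2)[of 0 4] p4(2)[of 0 4] p5(2)[of 0 4] by(subst (asm) run_put(1)) (simp_all add:r2)
qed

theorem run_attach_step:
 assumes g:"good s N H v" and b:"based (tri H)" and v:"v:VM i H" and ij:"i~=j"
 and L:"L = {a:carrier A. \<phi> i a:stab (tri H) i v}" "L~={oneA}"
 shows "EX Z'. represents code (run (attach_stmt i j L) s) (Z',v)&step6 (H,v) (Z',v)"
proof -
 note D = goodD[OF g]
 let ?S = "\<phi> j ` L" and ?T = "tri H"
 let ?C = "cayley j ?S" and ?ds = "new_arcs j L" and ?nc = "new_cosets j L" and ?t = "run (attach_stmt i j L) s"
 let ?ne = "reg s 2" and ?nv = "reg s 1" and ?B = "reg s 3"
 have h:"has i ?T v" using v VM_has[OF b,of v i] by blast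
 have LA:"subgroup L A" unfolding L(1) by(rule preimage_subgroup[OF stab_subgroup[OF b h]])
 have S:"subgroup ?S (factor j)" by(rule \<phi>_subgroup[OF LA])
 note nl = new_lists[OF S] and rt = run_attach_stmt[OF S,where i = i and s = s]
 have wfC:"lgraph_wf ?C" by(rule cayley_wf[OF S])
 define nu where "nu c = ev (cos_expr i j L c) s" for c
 define ep where "ep d = ?ne+pos ?ds d" for d
 have coset:"?S #>[j] \<phi> j a = ?S #>[j] \<phi> j a'<->act i ?T v (\<phi> i a) = act i ?T v (\<phi> i a')"
 if a:"a:carrier A" "a':carrier A" for a a'
 proof -
 have d:"\<phi> k (a \<otimes>\<^bsub>A\<^esub> inv\<^bsub>A\<^esub> a') = \<phi> k a \<odot>[k] inv[k] \<phi> k a'" for k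
 using a group.inv_closed[OF group_A a(2)] by(simp add:\<phi>_mult group_hom.hom_inv[OF \<phi>_group_hom])
 have c:"a \<otimes>\<^bsub>A\<^esub> inv\<^bsub>A\<^esub> a':carrier A" using a group_A by(meson group.inv_closed group.is_monoid monoid.m_closed)
 have "?S #>[j] \<phi> j a = ?S #>[j] \<phi> j a'<->\<phi> j (a \<otimes>\<^bsub>A\<^esub> inv\<^bsub>A\<^esub> a'):?S"
 using coset_eq_iff[OF grp S] a d[of j] by simp
 also have "\<dots><->a \<otimes>\<^bsub>A\<^esub> inv\<^bsub>A\<^esub> a':L" by(rule inj_on_image_mem_iff[OF \<phi>_inj c subgroup.subset[OF LA]])
 also have "\<dots><->\<phi> i (a \<otimes>\<^bsub>A\<^esub> inv\<^bsub>A\<^esub> a'):stab ?T i v" unfolding L(1) using c by simp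
 also have "\<dots><->act i ?T v (\<phi> i a) = act i ?T v (\<phi> i a')" using act_eq_iff[OF b _ _ h] a d[of i] by simp
 finally show ?thesis . qed
 have nuA:"nu (?S #>[j] \<phi> j a) = act i ?T v (\<phi> i a)" if a:"a:carrier A" for a
 proof -
 let ?c = "?S #>[j] \<phi> j a"
 define a' where "a' = (SOME a'. a':carrier A&?c = ?S #>[j] \<phi> j a')"
 have a': "a':carrier A" "?c = ?S #>[j] \<phi> j a'"
 using someI[of "%a'. a':carrier A&?c = ?S #>[j] \<phi> j a'" a] a unfolding a'_def by blast+
 have "cos_expr i j L ?c = wk i (\<phi> i a') (Var 0)" unfolding cos_expr_def a'_def by(rule if_P) (use a in blast)
 hence "nu ?c = act i ?T v (\<phi> i a')" unfolding nu_def using ev_wk[OF D(3) b,of "Var 0" i "\<phi> i a'"] a'(1) h D(8,11) by simp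
 thus ?thesis using coset[OF a a'(1)] a'(2) by simp qed
 have nuN:"nu c = ?B+pos ?nc c" "c:set ?nc" if c:"c:rcosets[j] ?S" "!!a. a:carrier A==>c~=?S #>[j] \<phi> j a" for c
 proof -
 have "cos_expr i j L c = Plus (Var 3) (Num (pos ?nc c))" unfolding cos_expr_def by(rule if_not_P) (use c(2) in blast)
 thus "nu c = ?B+pos ?nc c" unfolding nu_def by simp
 show "c:set ?nc" unfolding nl(2) using c by blast qed
 have actV:"act i ?T v (\<phi> i a):lV H" if "a:carrier A" for a by(rule act_V[OF D(5) b h]) (use that in simp)
 have lt:"u < ?B" if "u:lV H" for u using that D(9,12) by auto
 have acos:"?S #>[j] \<phi> j a:rcosets[j] ?S" if "a:carrier A" for a unfolding rcosets_eq[OF S] using that by simp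
 have nuimg:"lV H Un {?B..<?B+length ?nc} = lV H Un nu ` (rcosets[j] ?S)"
 proof (intro equalityI subsetI)
 fix u assume "u:lV H Un {?B..<?B+length ?nc}"
 then consider "u:lV H"|"?B<=u" "u < ?B+length ?nc" by auto
 thus "u:lV H Un nu ` (rcosets[j] ?S)"
 proof cases
 case 2
 let ?c = "?nc ! (u - ?B)"
 have l:"u - ?B < length ?nc" using 2 by simp
 have c:"?c:rcosets[j] ?S" "!!a. a:carrier A==>?c~=?S #>[j] \<phi> j a" using nth_mem[OF l] unfolding nl(2) by blast+
 have u:"u = nu ?c" using nuN(1)[OF c] pos_nth[OF nl(1) l] 2(1) by simp
 show ?thesis by(rule UnI2) (rule image_eqI[of u nu ?c,OF u c(1)]) qed blast
 next
 fix u assume "u:lV H Un nu ` (rcosets[j] ?S)"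
 then consider "u:lV H"|c where "u = nu c" "c:rcosets[j] ?S" by blast
 thus "u:lV H Un {?B..<?B+length ?nc}"
 proof cases
 case 2
 show ?thesis
 proof (cases "EX a:carrier A. c = ?S #>[j] \<phi> j a")
 case True
 thus ?thesis using 2(1) nuA actV by auto
 next
 case False
 hence "nu c = ?B+pos ?nc c" "c:set ?nc" using nuN[OF 2(2)] by blast+
 thus ?thesis using pos(1)[of c ?nc] 2(1) by simp qed qed blast qed
 have nunew:"nu c ~: lV H" if "c:rcosets[j] ?S" "!!a. a:carrier A==>c~=?S #>[j] \<phi> j a" for c
 using nuN(1)[OF that] lt[of "nu c"] by auto
 have nuinj:"inj_on nu (rcosets[j] ?S)"
 proof (rule inj_onI)
 fix c d assume cd:"c:rcosets[j] ?S" "d:rcosets[j] ?S" "nu c = nu d"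
 have o:"(EX a:carrier A. c = ?S #>[j] \<phi> j a&nu c = act i ?T v (\<phi> i a)&nu c < ?B)|(nu c = ?B+pos ?nc c&c:set ?nc)"
 if "c:rcosets[j] ?S" for c using nuA lt actV nuN[OF that] by auto 
 from o[OF cd(1)] o[OF cd(2)] cd(3) consider
 a a' where "a:carrier A" "a':carrier A" "c = ?S #>[j] \<phi> j a" "d = ?S #>[j] \<phi> j a'" "act i ?T v (\<phi> i a) = act i ?T v (\<phi> i a')"
 |"pos ?nc c = pos ?nc d" "c:set ?nc" "d:set ?nc" by auto
 thus "c = d" by(metis coset pos(2))  qed
 have pd:"pos ?ds d < length ?ds" "?ds ! pos ?ds d = d" if "d:lE ?C" for d using pos[of d ?ds] that nl(4) by blast+
 have epinj:"inj_on ep (lE ?C)" by(rule inj_onI) (metis ep_def add_left_cancel pd(2))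
 have rp:"bij_betw (arr s 0) {..<?nv} (lV H)" "lE H = {..<?ne}"
 "!!e. e < ?ne==>arr s 1 e = ltail H e&arr s 2 e = lhead H e&arr s 3 e = bar H e&arr s 4 e = code (lab H e)" using D(1) by simp_all
 have epnew:"ep ` lE ?C Int lE H = {}" unfolding rp(2) ep_def by auto
 have epimg:"ep ` lE ?C = {?ne..<?ne+length ?ds}"
 proof (intro equalityI subsetI)
 fix e assume "e:ep ` lE ?C"
 thus "e:{?ne..<?ne+length ?ds}" using pd(1) unfolding ep_def by auto
 next
 fix e assume "e:{?ne..<?ne+length ?ds}"
 hence l:"e - ?ne < length ?ds" "?ne<=e" by auto
 have u:"e = ep (?ds ! (e - ?ne))" unfolding ep_def using pos_nth[OF nl(3) l(1)] l(2) by simp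
 have "?ds ! (e - ?ne):lE ?C" using nth_mem[OF l(1)] nl(4) by blast
 thus "e:ep ` lE ?C" by(rule image_eqI[of e ep "?ds ! (e - ?ne)",OF u]) qed
 define Z' :: "(nat,nat,'x) lgraph" where
 "Z' = \<lparr>dig = \<lparr>verts = lV H Un {?B..<?B+length ?nc},arcs = {..<?ne+length ?ds},tail = arr ?t 1,head = arr ?t 2\<rparr>,
 bar = (%e. if e < ?ne+length ?ds then arr ?t 3 e else e),
 lab = (%e. if e < ?ne then lab H e else lab ?C (?ds ! (e - ?ne)))\<rparr>"
 have old:"ltail Z' e = ltail H e&lhead Z' e = lhead H e&bar Z' e = bar H e&lab Z' e = lab H e" if "e:lE H" for e
 proof -
 have "e < ?ne" using that rp(2) by simp
 thus ?thesis using rp(3)[of e] rt(5-7)[of e] by(simp add:Z'_def) qed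
 have new:"ltail Z' (ep d) = nu (ltail ?C d)&lhead Z' (ep d) = nu (lhead ?C d)&bar Z' (ep d) = ep (bar ?C d)&lab Z' (ep d) = lab ?C d"
 if d:"d:lE ?C" for d
 proof -
 have e:"?ne<=ep d" "ep d < ?ne+length ?ds" "ep d - ?ne = pos ?ds d" using pd(1)[OF d] by(simp_all add:ep_def)
 have "arr ?t 1 (ep d) = nu (ltail ?C d)" "arr ?t 2 (ep d) = nu (lhead ?C d)" "arr ?t 3 (ep d) = ep (bar ?C d)"
 unfolding rt(5-7) e(3) pd(2)[OF d] using e(1,2) by(simp_all add:nu_def ep_def)
 thus ?thesis using e pd(2)[OF d] by(simp add:Z'_def) qed
 have E6:"lE Z' = lE H Un ep ` lE ?C" unfolding epimg rp(2) by(auto simp:Z'_def)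
 have V6:"lV Z' = lV H Un nu ` (rcosets[j] ?S)" unfolding nuimg[symmetric] by(simp add:Z'_def)
 have out:"bar Z' e = e" if "e ~: lE Z'" for e using that by(simp add:Z'_def)
 note G = step6_glue[OF D(5,2) b v ij L nuA nunew nuinj epinj epnew V6 E6 old new out]
 have wf6:"lgraph_wf Z'" by(rule G(2))
 have bij:"bij_betw (arr ?t 0) {..<?nv+length ?nc} (lV Z')"
 proof -
 have "bij_betw (arr ?t 0) {..<?nv} (lV H)" using rp(1) by(subst bij_betw_cong[of _ _ "arr s 0"]) (simp_all add:rt(4))
 moreover have "bij_betw (arr ?t 0) {?nv..<?nv+length ?nc} {?B..<?B+length ?nc}"
 proof (rule bij_betw_byWitness[where f' = "%u. ?nv+(u - ?B)"]) qed (auto simp:rt(4))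
 moreover have "lV H Int {?B..<?B+length ?nc} = {}" using lt by fastforce
 ultimately have "bij_betw (arr ?t 0) ({..<?nv} Un {?nv..<?nv+length ?nc}) (lV H Un {?B..<?B+length ?nc})" by(rule bij_betw_combine)
 moreover have "{..<?nv} Un {?nv..<?nv+length ?nc} = {..<?nv+length ?nc}" by auto
 ultimately show ?thesis by(simp add:Z'_def) qed
 have "represents code ?t (Z',v)" unfolding represents.simps rt(1-3)
 using wf6 bij D(8) D(7) rp(3) by(simp add:Z'_def rt) 
 with G(1) show ?thesis by blast qed

definition opposite :: "index => index" where
 "opposite i = (if i = One then Two else One)"

definition attach_cond :: "index => 'a set => expr" where
 "attach_cond i L = tAll [has_expr i (Var 0),tNot (vb_expr (Var 0)),tAll (map (%a. if a:L then tEq (wk i (\<phi> i a) (Var 0)) (Var 0)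
 else tNot (tEq (wk i (\<phi> i a) (Var 0)) (Var 0))) (listing (carrier A)))]"

definition attach_cases :: "(expr \<times> stmt) list" where
 "attach_cases = concat (map (%i. map (%L. (attach_cond i L,attach_stmt i (opposite i) L)) (listing (Pow (carrier A) - {{oneA}}))) [One,Two])"

text \<open>At most one case applies, since \<open>i\<close> is the colour of the basepoint and
 \<open>L\<close> is determined by its stabilizer.\<close>
definition attach_prog :: stmt where
 "attach_prog = branch attach_cases"

lemma attach_cases:"(c,d):set attach_cases<->(EX i L. L<=carrier A&L~={oneA}&c = attach_cond i L&d = attach_stmt i (opposite i) L)"
proof -
 have f:"finite (Pow (carrier A) - {{oneA}})" using finite_A by simp
 have "(c,d):set attach_cases<->(EX i:{One,Two}. EX L:Pow (carrier A) - {{oneA}}. c = attach_cond i L&d = attach_stmt i (opposite i) L)"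
 unfolding attach_cases_def by(auto simp:listing(2)[OF f])
 thus ?thesis unfolding bex_index by blast qed

lemma ev_attach_cond:
 assumes g:"good s N H v" and b:"based (tri H)" and L:"L<=carrier A"
 shows "ev (attach_cond i L) s~=0<->v:VM i H&L = {a:carrier A. \<phi> i a:stab (tri H) i v}"
proof (cases "has i (tri H) v")
 case False
 hence "ev (has_expr i (Var 0)) s = 0" using ev_has_expr[OF goodD(3)[OF g],of "Var 0" i] goodD(8,11)[OF g] by simp
 hence "ev (attach_cond i L) s = 0" by(simp add:attach_cond_def)
 moreover have "v ~: VM i H" using False unfolding VM_has[OF b] by blast
 ultimately show ?thesis by simp
next
 case True
 note D = goodD[OF g]
 let ?x = "%a. if a:L then tEq (wk i (\<phi> i a) (Var 0)) (Var 0) else tNot (tEq (wk i (\<phi> i a) (Var 0)) (Var 0))"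
 have w:"ev (wk i (\<phi> i a) (Var 0)) s = act i (tri H) v (\<phi> i a)" if "a:carrier A" for a
 using ev_wk[OF D(3) b,of "Var 0" i "\<phi> i a"] True D(8,11) that by simp
 have "(ALL a:carrier A. ev (?x a) s~=0)<->(ALL a:carrier A. a:L<->\<phi> i a:stab (tri H) i v)"
 by(rule ball_cong[OF HOL.refl]) (use w D(8) in "simp add:stab_def[OF b]")
 also have "\<dots><->L = {a:carrier A. \<phi> i a:stab (tri H) i v}" using L by blast
 finally have 1:"(ALL a:carrier A. ev (?x a) s~=0)<->L = {a:carrier A. \<phi> i a:stab (tri H) i v}" .
 have 2:"ev (has_expr i (Var 0)) s~=0" using ev_has_expr[OF D(3),of "Var 0" i] D(8,11) True by simp
 have 3:"ev (vb_expr (Var 0)) s~=0<->v:VB H" using ev_vb_expr[OF D(3),of "Var 0"] D(8,11) by simp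
 obtain j where j:"j~=i" by(metis index.distinct(1))
 have "k = i|k = j" for k using other_index[of k i j] j by blast
 hence "(ALL k. k~=i-->~ has k (tri H) v)<->~ has j (tri H) v" "(ALL k. has k (tri H) v)<->has j (tri H) v"
 using True j by metis+
 hence 4:"v:VM i H<->v ~: VB H" unfolding VM_has[OF b] VB_has using True D(7) by simp
 have "ev (attach_cond i L) s~=0<->ev (has_expr i (Var 0)) s~=0&~ ev (vb_expr (Var 0)) s~=0
 &(ALL a:carrier A. ev (?x a) s~=0)"
 proof -
 have n:"(if P then 1 else 0 :: nat)~=0<->P" for P by simp
 have o:"ev (tAll [x,y,z]) s~=0<->ev x s~=0&ev y s~=0&ev z s~=0" "ev (tNot x) s~=0<->~ ev x s~=0" for x y z by simp_all
 have l:"ev (tAll (map ?x (listing (carrier A)))) s~=0<->(ALL a:carrier A. ev (?x a) s~=0)"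
 unfolding tAll_simps(1) set_map listing(2)[OF finite_A] n by blast
 show ?thesis unfolding attach_cond_def o(1) l unfolding o(2) .. qed
 thus ?thesis unfolding 1 3 4 using 2 by simp qed

theorem run_attach_prog:
 assumes g:"good s N Z v" and b:"based (tri Z)"
 shows "EX Z'. represents code (run attach_prog s) (Z',v)&step6 (Z,v) (Z',v)"
proof (cases "EX c d. (c,d):set attach_cases&ev c s~=0")
 case True
 then obtain c d where "(c,d):set attach_cases" "ev c s~=0" by blast
 from run_branch(2)[OF this] obtain c d where cd:"(c,d):set attach_cases" "ev c s~=0" "run attach_prog s = run d s"
 unfolding attach_prog_def by blast
 from cd(1)[unfolded attach_cases] obtain i L where i:"L<=carrier A" "L~={oneA}" "c = attach_cond i L" "d = attach_stmt i (opposite i) L" by blast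
 have v:"v:VM i Z" "L = {a:carrier A. \<phi> i a:stab (tri Z) i v}" using ev_attach_cond[OF g b i(1),of i] cd(2) i(3) by blast+
 have "i~=opposite i" by(cases i) (simp_all add:opposite_def)
 from run_attach_step[OF g b v(1) this v(2) i(2)] show ?thesis unfolding cd(3) i(4) .
next
 case False
 note D = goodD[OF g]
 have r:"run attach_prog s = set_reg 20 0 s" unfolding attach_prog_def by(rule run_branch(1)) (use False in blast)
 have "step6 (Z,v) (Z,v)"
 proof (rule step6_skip[OF D(5,2) b D(7)])
 fix i assume v:"v:VM i Z"
 let ?L = "{a:carrier A. \<phi> i a:stab (tri Z) i v}"
 show "?L = {oneA}"
 proof (rule ccontr)
 assume ne:"?L~={oneA}"
 have "(attach_cond i ?L,attach_stmt i (opposite i) ?L):set attach_cases"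
 unfolding attach_cases by(intro exI[of _ i] exI[of _ ?L] conjI HOL.refl ne) blast
 moreover have "ev (attach_cond i ?L) s~=0" using ev_attach_cond[OF g b,of ?L i] v by blast
 ultimately show False using False by blast qed qed
 moreover have "represents code (set_reg 20 0 s) (Z,v)" using D(1) by simp
 ultimately show ?thesis unfolding r by blast qed

lemma frugal_attach:"frugal attach_prog"
proof -
 have br:"frugal (branch l)" if "!!c d. (c,d):set l==>eregs c<={..<40}&frugal d" for l using that
 proof (induction l)
 case Nil
 thus ?case by(simp add:branch_def frugal_def)
 next
 case (Cons p l)
 obtain c d where p:"p = (c,d)" by(cases p)
 have "eregs c<={..<40}" "frugal d" using Cons.prems[of c d] p by simp_all
 moreover have "frugal (branch l)" by(rule Cons.IH) (rule Cons.prems,simp)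
 ultimately show ?case by(simp add:branch_def p frugal_def) qed
 have pt:"frugal (put b r n E)" if "r < 40" "!!k. k < n==>eregs (E k)<={..<40}" for b r n E
 proof -
 have "depth (put b r n E)<=0" unfolding put_def by(rule seqs_depth) auto
 moreover have "uregs (put b r n E)<={..<40}" unfolding put_def seqs_simps using that by fastforce
 ultimately show ?thesis by(simp add:frugal_def) qed
 have ce:"eregs (cos_expr i j L c)<={..<40}" for i j L c using cos_expr_uses(1)[of i j L c] by auto
 have "frugal (attach_stmt i j L)" for i j L
 unfolding attach_stmt_def Let_def frugal_then by(intro conjI pt ce) (auto simp:frugal_def)
 moreover have "eregs (attach_cond i L)<={..<40}" for i L
 proof -
 have "eregs (wk i g (Var 0))<={0}" for g using walk_uses(1)[of "Var 0"] by simp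
 hence "eregs (attach_cond i L)<={0}" using has_expr_uses(1)[of i "Var 0"] vb_expr_uses(1)[of "Var 0"]
 unfolding attach_cond_def by(fastforce split:if_splits)
 thus ?thesis by auto qed
 ultimately have "eregs c<={..<40}&frugal d" if "(c,d):set attach_cases" for c d
 using that unfolding attach_cases by blast
 thus ?thesis unfolding attach_prog_def by(rule br) qed

section \<open>The whole algorithm\<close>

text \<open>The number of rounds must reach the size of the table of edges and the lengths of the lists of
 triples in all steps.\<close>
definition space :: nat where
 "space = W * slots+2+length (arc_list @ glue_list)+slots * length (arc_list @ pair_arcs)"

definition init_prog :: com where
 "init_prog = Seq (comp 40 (Assign 39 (eMul space (Plus (Var 0) (Num 1))))) (Seq (Const 40 0) (Add 3 39 40))"

definition program :: "nat => com" where
 "program k = (if k = 1 then Seq init_prog (comp 40 loop_prog) else if k = 2 then comp 40 fold_step_prog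
 else if k = 3 then comp 40 glue_prog else if k = 4 then comp 40 pair_prog else if k = 5 then comp 40 prune_prog
 else comp 40 attach_prog)"

definition total_cost :: nat where
 "total_cost = cost loop_prog+cost fold_step_prog+cost glue_prog+cost pair_prog+cost prune_prog+cost attach_prog"

definition run_time :: "nat => nat" where
 "run_time m = total_cost * Suc (space * (m+1)) ^ 2+(cost (Assign 39 (eMul space (Plus (Var 0) (Num 1))))+2)"

lemma run_time_bigo:"(%m. real (run_time m)):O(%m. real m ^ 2)"
proof -
 define D where "D = cost (Assign 39 (eMul space (Plus (Var 0) (Num 1))))+2"
 let ?c = "total_cost * (2 * space+1) ^ 2+D"
 have "run_time m<=?c * m ^ 2" if m:"1<=m" for m
 proof -
 have "space<=space * m" using mult_le_mono2[OF m,of space] by simp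
 hence "Suc (space * m+space)<=2 * (space * m)+m" using m by linarith
 hence "Suc (space * (m+1))<=(2 * space+1) * m" by(simp add:algebra_simps)
 hence "Suc (space * (m+1)) ^ 2<=((2 * space+1) * m) ^ 2" by(rule power_mono) simp
 hence "Suc (space * (m+1)) ^ 2<=(2 * space+1) ^ 2 * m ^ 2" by(simp only: power_mult_distrib)
 from mult_le_mono2[OF this,of total_cost]
 have 1:"total_cost * Suc (space * (m+1)) ^ 2<=total_cost * (2 * space+1) ^ 2 * m ^ 2" by(simp only: mult.assoc)
 have "D * 1<=D * m ^ 2" by(rule mult_le_mono2) (use m in "simp add:one_le_power")
 with 1 show ?thesis unfolding run_time_def D_def[symmetric] by(simp only: add_mult_distrib mult_1_right add_mono) qed
 hence "real (run_time m)<=real ?c * real m ^ 2" if "1<=m" for m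
 using that by(metis of_nat_le_iff of_nat_mult of_nat_power)
 hence "\<forall>\<^sub>F m in sequentially. norm (real (run_time m))<=real ?c * norm (real m ^ 2)"
 by(intro eventually_sequentiallyI[of 1]) simp
 thus ?thesis by(rule bigoI) qed

lemma frugal_exec:
 assumes "frugal c"
 shows "EX t s'. exec (comp 40 c) s t s'&agree 40 (run c s) s'&reg s' 3 = reg s 3&t<=cost c * Suc (reg s 3) ^ 2"
proof -
 obtain t s' where e:"exec (comp 40 c) s t s'" "agree 40 (run c s) s'" "t<=cost c * Suc (reg s 3) ^ 2" using frugal_run[OF assms] by blast
 have "reg (run c s) 3 = reg s 3" by(rule frame_reg) (use assms in "simp add:frugal_def")
 hence "reg s' 3 = reg s 3" using e(2) by(simp add:agree_def)
 with e show ?thesis by blast qed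

lemma exec_init_prog:
 "EX t s'. exec init_prog s t s'&t<=cost (Assign 39 (eMul space (Plus (Var 0) (Num 1))))+2&arr s' = arr s&reg s' 0 = reg s 0
 &reg s' 3 = space * (reg s 0+1)"
proof -
 let ?c = "Assign 39 (eMul space (Plus (Var 0) (Num 1)))"
 have a:"agree 40 s s" by(simp add:agree_def)
 have u:"uregs ?c<={..<40}" "3 ~: wregs ?c" by(auto split:if_splits)
 have "EX t s1. exec (comp 40 ?c) s t s1&agree 40 (run ?c s) s1&(ALL r. 40<=r-->r < 40-->reg s1 r = reg s r)
 &t<=cost ?c * Suc (reg s 3) ^ depth ?c" by(rule exec_comp[OF u _ _ a]) simp_all
 then obtain t s1 where
 e:"exec (comp 40 ?c) s t s1" "agree 40 (run ?c s) s1" "t<=cost ?c * Suc (reg s 3) ^ depth ?c" by blast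
 have r:"reg s1 39 = space * (reg s 0+1)" "reg s1 0 = reg s 0" "arr s1 = arr s" using e(2) by(simp_all add:agree_def)
 let ?s2 = "set_reg 40 0 s1"
 let ?s3 = "set_reg 3 (reg ?s2 39+reg ?s2 40) ?s2"
 have "exec init_prog s (t+(1+1)) ?s3" unfolding init_prog_def by(rule exec.Seq[OF e(1) exec.Seq[OF exec.Const exec.Add]])
 moreover have "t+(1+1)<=cost ?c+2" using e(3) by simp
 ultimately show ?thesis using r by(intro exI[of _ "t+(1+1)"] exI[of _ ?s3]) simp qed

theorem quadratic_run:
 assumes gs:"set gs<=words XX" shows "EX (Z :: nat => (nat,nat,'x) pgraph) (s :: nat => state) (t :: nat => nat).
 s 0 = input_state code gs&(ALL k:{1..6}. exec (program k) (s (k - 1)) (t k) (s k)&represents code (s k) (Z k))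
 &stallings_run gs Z&(\<Sum>k = 1..6. t k)<=run_time (\<Sum>g\<leftarrow>gs. length g)"
proof -
 define m where "m = length (concat gs)"
 have m:"(\<Sum>g\<leftarrow>gs. length g) = m" unfolding m_def by(simp add:length_concat)
 let ?B = "space * (m+1)"
 let ?s0 = "input_state code gs"
 have ls0:"set (concat gs)<=set ls"
 proof
 fix x assume "x:set (concat gs)"
 then obtain g where "g:set gs" "x:set g" by auto
 thus "x:set ls" using gs unfolding ls lists_eq_set by blast qed
 have i0:"reg ?s0 0 = m" "!!i. i < m==>arr ?s0 0 i = code (concat gs ! i)" "!!i. i < m==>arr ?s0 1 i = flags gs ! i"
 proof -
 have "input_state code gs = \<lparr>reg = (%_. 0)(0 := length (map code (concat gs))),
 arr = (%_ _. 0)(0 := %p. if p < length (map code (concat gs)) then map code (concat gs) ! p else 0,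
 1 := %p. if p < length (flags gs) then flags gs ! p else 0)\<rparr>" unfolding input_state_def Let_def flags_def ..
 thus "reg ?s0 0 = m" "!!i. i < m==>arr ?s0 0 i = code (concat gs ! i)" "!!i. i < m==>arr ?s0 1 i = flags gs ! i"
 using flags(1)[of gs] by(simp_all add:m_def del: map_concat length_concat) qed
 obtain ti si where init:"exec init_prog ?s0 ti si" "ti<=cost (Assign 39 (eMul space (Plus (Var 0) (Num 1))))+2"
 "arr si = arr ?s0" "reg si 0 = m" "reg si 3 = ?B" using exec_init_prog[of ?s0] i0(1) by auto
 have sp:"W * (slots * (m+1))<=?B" "2 * m<=?B" "(m+1) * length (arc_list @ glue_list)<=?B" "slots * (m+1) * length (arc_list @ pair_arcs)<=?B"
 "W * (m+1)<=?B" "m<=?B"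
 proof -
 have le:"c * (m+1)<=?B" if "c<=space" for c using that by(rule mult_le_mono1)
 have "W * slots<=space" "2<=space" "length (arc_list @ glue_list)<=space" "slots * length (arc_list @ pair_arcs)<=space"
 unfolding space_def by simp_all
 from this[THEN le] show "W * (slots * (m+1))<=?B" "2 * m<=?B" "(m+1) * length (arc_list @ glue_list)<=?B"
 "slots * (m+1) * length (arc_list @ pair_arcs)<=?B" "m<=?B" by(simp_all add:algebra_simps)
 have "W * 1<=W * slots" by(rule mult_le_mono2) (use slots_pos in simp)
 hence "W<=W * slots" by(simp only: mult_1_right)
 hence "W<=space" unfolding space_def by linarith
 thus "W * (m+1)<=?B" by(rule le) qed
 obtain t1 s1 where e1:"exec (comp 40 loop_prog) si t1 s1" "agree 40 (run loop_prog si) s1" "reg s1 3 = ?B" "t1<=cost loop_prog * Suc ?B ^ 2"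
 using frugal_exec[OF frugal_loop,of si] init(5) by auto
 have "EX Z. represents code (run loop_prog si) (Z,0)&pgraph_iso (bouquet gs) (Z,0)&lV Z<={..<m+1}&reg (run loop_prog si) 2 = 2 * m
 &reg (run loop_prog si) 4 = m+1&lab Z ` lE Z<=set ls"
 by(rule run_loop_prog[OF ls0 m_def init(4)]) (use init sp(6) i0(2,3) in simp_all)
 then obtain Z1 where G1:"represents code (run loop_prog si) (Z1,0)" "pgraph_iso (bouquet gs) (Z1,0)" "lV Z1<={..<m+1}"
 "reg (run loop_prog si) 2 = 2 * m" "reg (run loop_prog si) 4 = m+1" "lab Z1 ` lE Z1<=set ls" by blast
 have r1:"represents code s1 (Z1,0)" by(rule represents_agree[OF G1(1) e1(2)])
 have f1:"reg s1 2 = 2 * m" "reg s1 4 = m+1" using e1(2) G1(4,5) by(simp_all add:agree_def)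
 obtain t2 s2 where e2:"exec (comp 40 fold_step_prog) s1 t2 s2" "agree 40 (run fold_step_prog s1) s2" "reg s2 3 = ?B" "t2<=cost fold_step_prog * Suc ?B ^ 2"
 using frugal_exec[OF frugal_fold_step,of s1] e1(3) by auto
 obtain Z2 v2 where G2:"represents code (run fold_step_prog s1) (Z2,v2)" "step2 (Z1,0) (Z2,v2)" "folded Z2"
 "tabs (run fold_step_prog s1) (m+1) (lV Z2) (tri Z2)" "reg (run fold_step_prog s1) 4 = m+1"
 using run_fold_step_prog[OF r1 G1(6,3),unfolded e1(3) f1,OF sp(5) _ sp(2) HOL.refl] by auto
 have g2:"good s2 (m+1) Z2 v2" by(rule good_agree[OF _ e2(2)]) (use G2 in "simp only: good_def simp_thms")
 obtain t3 s3 where e3:"exec (comp 40 glue_prog) s2 t3 s3" "agree 40 (run glue_prog s2) s3" "reg s3 3 = ?B" "t3<=cost glue_prog * Suc ?B ^ 2"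
 using frugal_exec[OF frugal_glue,of s2] e2(3) by auto
 obtain Z3 v3 where G3:"good (run glue_prog s2) (slots * (m+1)) Z3 v3" "step3 (Z2,v2) (Z3,v3)" "based (tri Z3)"
 using run_glue_prog[OF g2,unfolded e2(3),OF sp(1,3)] by blast
 note g3 = good_agree[OF G3(1) e3(2)]
 obtain t4 s4 where e4:"exec (comp 40 pair_prog) s3 t4 s4" "agree 40 (run pair_prog s3) s4" "reg s4 3 = ?B" "t4<=cost pair_prog * Suc ?B ^ 2"
 using frugal_exec[OF frugal_pair,of s3] e3(3) by auto
 obtain Z4 v4 where G4:"good (run pair_prog s3) (slots * (m+1)) Z4 v4" "step4 (Z3,v3) (Z4,v4)" "based (tri Z4)"
 using run_pair_prog[OF g3 G3(3),unfolded e3(3),OF sp(4)] by blast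
 note g4 = good_agree[OF G4(1) e4(2)]
 obtain t5 s5 where e5:"exec (comp 40 prune_prog) s4 t5 s5" "agree 40 (run prune_prog s4) s5" "reg s5 3 = ?B" "t5<=cost prune_prog * Suc ?B ^ 2"
 using frugal_exec[OF frugal_prune,of s4] e4(3) by auto
 obtain Z5 where G5:"good (run prune_prog s4) (slots * (m+1)) Z5 v4" "step5 (Z4,v4) (Z5,v4)" "based (tri Z5)"
 using run_prune_prog[OF g4 G4(3)] by blast
 note g5 = good_agree[OF G5(1) e5(2)]
 obtain t6 s6 where e6:"exec (comp 40 attach_prog) s5 t6 s6" "agree 40 (run attach_prog s5) s6" "t6<=cost attach_prog * Suc ?B ^ 2"
 using frugal_exec[OF frugal_attach,of s5] e5(3) by auto
 obtain Z6 where G6:"represents code (run attach_prog s5) (Z6,v4)" "step6 (Z5,v4) (Z6,v4)" using run_attach_prog[OF g5 G5(3)] by blast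
 note r6 = represents_agree[OF G6(1) e6(2)]
 define Z where "Z = ((!) [(Z1,0),(Z1,0),(Z2,v2),(Z3,v3),(Z4,v4),(Z5,v4),(Z6,v4)])"
 define s where "s = ((!) [?s0,s1,s2,s3,s4,s5,s6])"
 define t where "t = ((!) [0,ti+t1,t2,t3,t4,t5,t6])"
 have all:"{1..6 :: nat} = {1,2,3,4,5,6}" by auto
 have num:"(3 :: nat) = Suc (Suc (Suc 0))" "(4 :: nat) = Suc (Suc (Suc (Suc 0)))" "(5 :: nat) = Suc (Suc (Suc (Suc (Suc 0))))"
 "(6 :: nat) = Suc (Suc (Suc (Suc (Suc (Suc 0)))))" by simp_all
 have S:"s 0 = ?s0" "s 1 = s1" "s 2 = s2" "s 3 = s3" "s 4 = s4" "s 5 = s5" "s 6 = s6" unfolding s_def num by simp_all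
 have T:"t 1 = ti+t1" "t 2 = t2" "t 3 = t3" "t 4 = t4" "t 5 = t5" "t 6 = t6" unfolding t_def num by simp_all
 have G:"Z 1 = (Z1,0)" "Z 2 = (Z2,v2)" "Z 3 = (Z3,v3)" "Z 4 = (Z4,v4)" "Z 5 = (Z5,v4)" "Z 6 = (Z6,v4)"
 unfolding Z_def num by simp_all
 have P:"program 1 = Seq init_prog (comp 40 loop_prog)" "program 2 = comp 40 fold_step_prog" "program 3 = comp 40 glue_prog"
 "program 4 = comp 40 pair_prog" "program 5 = comp 40 prune_prog" "program 6 = comp 40 attach_prog" by(simp_all add:program_def)
 have ex:"exec (program k) (s (k - 1)) (t k) (s k)&represents code (s k) (Z k)" if "k:{1..6}" for k
 proof -
 have d:"(1 :: nat) - 1 = 0" "(2 :: nat) - 1 = 1" "(3 :: nat) - 1 = 2" "(4 :: nat) - 1 = 3" "(5 :: nat) - 1 = 4" "(6 :: nat) - 1 = 5" by simp_all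
 from that consider "k = 1"|"k = 2"|"k = 3"|"k = 4"|"k = 5"|"k = 6" unfolding all by blast
 thus ?thesis
 proof cases
 case 1
 show ?thesis unfolding 1 d S T G P using exec.Seq[OF init(1) e1(1)] r1 by blast
 next
 case 2
 show ?thesis unfolding 2 d S T G P using e2(1) goodD(1)[OF g2] by blast
 next
 case 3
 show ?thesis unfolding 3 d S T G P using e3(1) goodD(1)[OF g3] by blast
 next
 case 4
 show ?thesis unfolding 4 d S T G P using e4(1) goodD(1)[OF g4] by blast
 next
 case 5
 show ?thesis unfolding 5 d S T G P using e5(1) goodD(1)[OF g5] by blast
 next
 case 6
 show ?thesis unfolding 6 d S T G P using e6(1) r6 by blast qed qed
 have "stallings_run gs Z" unfolding stallings_run_def G step1_def using G1(2) G2(2) G3(2) G4(2) G5(2) G6(2) by blast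
 moreover have "(\<Sum>k = 1..6. t k)<=run_time (\<Sum>g\<leftarrow>gs. length g)"
 proof -
 have "(\<Sum>k = 1..6. t k) = t 1+t 2+t 3+t 4+t 5+t 6" unfolding all by simp
 also have "\<dots><=run_time m" unfolding T run_time_def total_cost_def add_mult_distrib
 using init(2) e1(4) e2(4) e3(4) e4(4) e5(4) e6(3) by linarith
 finally show ?thesis unfolding m . qed
 ultimately show ?thesis using ex S(1) by blast qed

end

lemma amalgam_progs_exist:
 assumes a:"amalgam X R A \<phi>" and c:"inj_on code (letters (X One Un X Two))"
 shows "EX ls W el sl slots prs. amalgam_progs X R A \<phi> ls W code el sl slots prs"
proof -
 interpret amalgam X R A \<phi> by(rule a)
 have fl:"finite (letters XX)" unfolding letters_XX using finite_letters by simp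
 define ls where "ls = listing (letters XX)"
 note l = listing[OF fl,folded ls_def]
 obtain prs where prs:"pair_list prs" using pair_list_exists by blast
 define W where "W = length ls+length prs+1"
 define S where "S = {(i,g)|i g. g:FC i&g~=\<one>[i]}"
 have "S<={One,Two} \<times> (carrier (factor One) Un carrier (factor Two))"
 proof
 fix p assume "p:S"
 then obtain i g where "p = (i,g)" "g:FC i" unfolding S_def by blast
 thus "p:{One,Two} \<times> (carrier (factor One) Un carrier (factor Two))" by(cases i) simp_all qed
 hence fS:"finite S" using fin_car by(meson finite.emptyI finite.insertI finite_SigmaI finite_UnI finite_subset)
 define zs where "zs = listing S"
 note z = listing[OF fS,folded zs_def]
 define sl where "sl i g = (if (i,g):S then Suc (pos zs (i,g)) else 0)" for i g
 have p:"pos zs x < length zs" "zs ! pos zs x = x" if "x:S" for x using pos[of x zs] that z(2) by blast+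
 have "amalgam_progs X R A \<phi> ls W code (%i. listing (FC i)) sl (Suc (length zs)) prs"
 proof (intro amalgam_progs.intro a letter_table.intro amalgam_progs_axioms.intro)
 show "distinct ls" "length ls<=W" "0 < W" "length ls+length prs<=W" "set ls = letters XX" using l by(simp_all add:W_def)
 show "inj_on code (set ls)" using c unfolding l(2) .
 show "inv_letter x:set ls" if "x:set ls" for x using that unfolding l(2) by(cases x) (simp add:letters_def)
 show "set (listing (FC i)) = FC i" "distinct (listing (FC i))" for i by(rule listing[OF fin_car])+
 show "sl i \<one>[i] = 0" for i by(simp add:sl_def S_def)
 show "sl i g > 0" if "g:FC i" "g~=\<one>[i]" for i g using that by(simp add:sl_def S_def)
 show "sl i g < Suc (length zs)" for i g using p(1)[of "(i,g)"] by(simp add:sl_def)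
 show "i = i'&g = g'" if "sl i g > 0" "sl i g = sl i' g'" for i g i' g'
 proof -
 have "(i,g):S" "(i',g'):S" "pos zs (i,g) = pos zs (i',g')" using that unfolding sl_def by(auto split:if_splits)
 thus ?thesis using p(2) by(metis prod.inject) qed
 show "pair_list prs" by(rule prs) qed
 thus ?thesis by blast qed

theorem lemma8p7:
  fixes X :: "index \<Rightarrow> 'x set" and R :: "index \<Rightarrow> 'x word set"
    and A :: "'a monoid" and \<phi> :: "index \<Rightarrow> 'a \<Rightarrow> 'x word set"
    and code :: "'x letter \<Rightarrow> nat"
  assumes "amalgam X R A \<phi>"
    and "inj_on code (letters (X One \<union> X Two))"
  shows "\<exists>(P :: nat \<Rightarrow> com) (T :: nat \<Rightarrow> nat).
    (\<lambda>m. real (T m)) \<in> O(\<lambda>m. real m ^ 2) \<and>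
    (\<forall>gs. set gs \<subseteq> words (X One \<union> X Two) \<longrightarrow>
      (\<exists>(\<Gamma> :: nat \<Rightarrow> (nat, nat, 'x) pgraph) (s :: nat \<Rightarrow> state) (t :: nat \<Rightarrow> nat).
         s 0 = input_state code gs \<and>
         (\<forall>k\<in>{1..6}. exec (P k) (s (k - 1)) (t k) (s k) \<and> represents code (s k) (\<Gamma> k)) \<and>
         amalgam.stallings_run X R A \<phi> gs \<Gamma> \<and>
         (\<Sum>k = 1..6. t k) \<le> T (\<Sum>g\<leftarrow>gs. length g)))"
proof -
 obtain ls W el sl slots prs where "amalgam_progs X R A \<phi> ls W code el sl slots prs"
 using amalgam_progs_exist[OF assms] by blast
 then interpret amalgam_progs X R A \<phi> ls W code el sl slots prs .
 show ?thesis by(intro exI[of _ program] exI[of _ run_time] conjI allI impI run_time_bigo quadratic_run) qed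

end
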